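(* Let $n\in\mathbb N$. For any set $S$ of $\Sigma_{n+3}$ sentences that is consistent with $\mathrm{PA}$ and any $S$-provably total unary function $H$ with a $\Sigma_{n+1}$-definable graph, \[S+\{\Sigma_k\text{-}\mathrm{PHP}({<}\infty,\mathsf{num}):k\in\mathbb N\}\nvdash\Sigma_{n+1}\text{-}\mathrm{PHP}(H(\mathsf{num}),\mathsf{num}).\]
   Context: Language of first-order arithmetic. Numbers $x$ are identified with $\{v:v<x\}$. For a class of formulas $\Gamma$, $\Gamma\colon x\to(2)^1_y$ means there is no injection from $x$ into $y$ whose graph is defined by a $\Gamma$ formula with parameters. $\Sigma_k\text{-}\mathrm{PHP}({<}\infty,\mathsf{num})$ is the sentence(-scheme) $\forall a\,\exists b\,(\Sigma_k\colon b\to(2)^1_a)$. $\Sigma_{n+1}\text{-}\mathrm{PHP}(H(\mathsf{num}),\mathsf{num})$ is $\forall a\,(\Sigma_{n+1}\colon H(a)\to(2)^1_a)$. $H$ being $S$-provably total with $\Sigma_{n+1}$-definable graph means there is a $\Sigma_{n+1}$ formula $\varphi(x,y)$ defining the graph of $H$ such that $S\vdash\forall x\exists! y\,\varphi(x,y)$. *)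

theory Defs
  imports Main
begin

datatype tm = Var nat | Zero | Sc tm | Pl tm tm | Tm tm tm

datatype fm = Fls | Eq tm tm | Lt tm tm | Imp fm fm | All fm

definition Neg :: "fm \<Rightarrow> fm" where "Neg p = Imp p Fls"
definition And :: "fm \<Rightarrow> fm \<Rightarrow> fm" where "And p q = Neg (Imp p (Neg q))"
definition Iff :: "fm \<Rightarrow> fm \<Rightarrow> fm" where "Iff p q = And (Imp p q) (Imp q p)"
definition Ex :: "fm \<Rightarrow> fm" where "Ex p = Neg (All (Neg p))"

definition Alls :: "nat \<Rightarrow> fm \<Rightarrow> fm" where "Alls n p = (All ^^ n) p"

primrec tsubst :: "(nat \<Rightarrow> tm) \<Rightarrow> tm \<Rightarrow> tm" where
  "tsubst s (Var i) = s i"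
| "tsubst s Zero = Zero"
| "tsubst s (Sc t) = Sc (tsubst s t)"
| "tsubst s (Pl t u) = Pl (tsubst s t) (tsubst s u)"
| "tsubst s (Tm t u) = Tm (tsubst s t) (tsubst s u)"

definition tlift :: "tm \<Rightarrow> tm" where "tlift t = tsubst (\<lambda>i. Var (Suc i)) t"

definition up :: "(nat \<Rightarrow> tm) \<Rightarrow> nat \<Rightarrow> tm" where
  "up s i = (case i of 0 \<Rightarrow> Var 0 | Suc j \<Rightarrow> tlift (s j))"

primrec fsubst :: "(nat \<Rightarrow> tm) \<Rightarrow> fm \<Rightarrow> fm" where
  "fsubst s Fls = Fls"
| "fsubst s (Eq t u) = Eq (tsubst s t) (tsubst s u)"
| "fsubst s (Lt t u) = Lt (tsubst s t) (tsubst s u)"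
| "fsubst s (Imp p q) = Imp (fsubst s p) (fsubst s q)"
| "fsubst s (All p) = All (fsubst (up s) p)"

definition flift :: "fm \<Rightarrow> fm" where "flift p = fsubst (\<lambda>i. Var (Suc i)) p"
definition inst0 :: "tm \<Rightarrow> fm \<Rightarrow> fm" where
  "inst0 t p = fsubst (\<lambda>i. if i = 0 then t else Var (i - 1)) p"

primrec tclosed :: "nat \<Rightarrow> tm \<Rightarrow> bool" where
  "tclosed k (Var i) = (i < k)"
| "tclosed k Zero = True"
| "tclosed k (Sc t) = tclosed k t"
| "tclosed k (Pl t u) = (tclosed k t \<and> tclosed k u)"
| "tclosed k (Tm t u) = (tclosed k t \<and> tclosed k u)"

primrec fclosed :: "nat \<Rightarrow> fm \<Rightarrow> bool" where
  "fclosed k Fls = True"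
| "fclosed k (Eq t u) = (tclosed k t \<and> tclosed k u)"
| "fclosed k (Lt t u) = (tclosed k t \<and> tclosed k u)"
| "fclosed k (Imp p q) = (fclosed k p \<and> fclosed k q)"
| "fclosed k (All p) = fclosed (Suc k) p"

definition sentence :: "fm \<Rightarrow> bool" where "sentence p = fclosed 0 p"

primrec tvars :: "tm \<Rightarrow> nat set" where
  "tvars (Var i) = {i}"
| "tvars Zero = {}"
| "tvars (Sc t) = tvars t"
| "tvars (Pl t u) = tvars t \<union> tvars u"
| "tvars (Tm t u) = tvars t \<union> tvars u"

text \<open>Bounded (Delta_0) formulas: all quantifiers of the form \<open>\<forall>x<t\<close> with x not in t
  (bounded existential quantifiers are obtained via negation).\<close>
inductive bounded :: "fm \<Rightarrow> bool" where
  "bounded Fls"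
| "bounded (Eq t u)"
| "bounded (Lt t u)"
| "bounded p \<Longrightarrow> bounded q \<Longrightarrow> bounded (Imp p q)"
| "0 \<notin> tvars t \<Longrightarrow> bounded p \<Longrightarrow> bounded (All (Imp (Lt (Var 0) t) p))"

inductive sigma :: "nat \<Rightarrow> fm \<Rightarrow> bool" and pi :: "nat \<Rightarrow> fm \<Rightarrow> bool" where
  "bounded p \<Longrightarrow> sigma 0 p"
| "bounded p \<Longrightarrow> pi 0 p"
| "pi k p \<Longrightarrow> sigma (Suc k) p"
| "sigma k p \<Longrightarrow> pi (Suc k) p"
| "sigma (Suc k) p \<Longrightarrow> sigma (Suc k) (Ex p)"
| "pi (Suc k) p \<Longrightarrow> pi (Suc k) (All p)"

inductive prv :: "fm set \<Rightarrow> fm \<Rightarrow> bool" for T :: "fm set" where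
  hyp: "p \<in> T \<Longrightarrow> prv T p"
| ax1: "prv T (Imp p (Imp q p))"
| ax2: "prv T (Imp (Imp p (Imp q r)) (Imp (Imp p q) (Imp p r)))"
| ax3: "prv T (Imp (Neg (Neg p)) p)"
| ax_inst: "prv T (Imp (All p) (inst0 t p))"
| ax_allimp: "prv T (Imp (All (Imp (flift p) q)) (Imp p (All q)))"
| ax_refl: "prv T (Eq t t)"
| ax_subst: "prv T (Imp (Eq s t) (Imp (inst0 s p) (inst0 t p)))"
| mp: "prv T (Imp p q) \<Longrightarrow> prv T p \<Longrightarrow> prv T q"
| gen: "prv T p \<Longrightarrow> prv T (All p)"

definition consistent :: "fm set \<Rightarrow> bool" where "consistent T = (\<not> prv T Fls)"

definition ind :: "fm \<Rightarrow> fm" where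
  "ind p = Imp (inst0 Zero p)
             (Imp (All (Imp p (fsubst (\<lambda>i. if i = 0 then Sc (Var 0) else Var i) p))) (All p))"

definition Q_axioms :: "fm set" where
  "Q_axioms = {
     All (Neg (Eq (Sc (Var 0)) Zero)),
     All (All (Imp (Eq (Sc (Var 1)) (Sc (Var 0))) (Eq (Var 1) (Var 0)))),
     All (Eq (Pl (Var 0) Zero) (Var 0)),
     All (All (Eq (Pl (Var 1) (Sc (Var 0))) (Sc (Pl (Var 1) (Var 0))))),
     All (Eq (Tm (Var 0) Zero) Zero),
     All (All (Eq (Tm (Var 1) (Sc (Var 0))) (Pl (Tm (Var 1) (Var 0)) (Var 1)))),
     All (All (Iff (Lt (Var 1) (Var 0)) (Ex (Eq (Pl (Var 2) (Sc (Var 0))) (Var 1)))))}"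

definition PA :: "fm set" where
  "PA = Q_axioms \<union> {Alls n (ind p) | p n. fclosed (Suc n) p}"

text \<open>Convention for a formula \<open>\<psi>\<close> defining a (partial) map: Var 0 is the output v,
  Var 1 is the input u, Var (j+2) is the j-th parameter.
  \<open>pinst n \<psi> v u\<close> instantiates \<psi> under n binders (n \<ge> 2), keeping the parameters.\<close>
definition pinst :: "nat \<Rightarrow> fm \<Rightarrow> tm \<Rightarrow> tm \<Rightarrow> fm" where
  "pinst n p v u = fsubst (\<lambda>i. if i = 0 then v else if i = 1 then u else Var (i + n - 2)) p"

text \<open>\<open>graph_inj \<psi> b a\<close>: in a context where the parameters are Var 0, Var 1, ... and b, a
  are the variables with indices b, a, the formula \<psi>(u,v) defines the graph of an
  injection from b = {u. u<b} into a = {v. v<a}.\<close>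
definition graph_inj :: "fm \<Rightarrow> nat \<Rightarrow> nat \<Rightarrow> fm" where
  "graph_inj p b a =
     And (All (All (Imp (pinst 2 p (Var 0) (Var 1))
                         (And (Lt (Var 1) (Var (b + 2))) (Lt (Var 0) (Var (a + 2)))))))
    (And (All (Imp (Lt (Var 0) (Var (b + 1))) (Ex (pinst 2 p (Var 0) (Var 1)))))
    (And (All (All (All (Imp (And (pinst 3 p (Var 1) (Var 2)) (pinst 3 p (Var 0) (Var 2)))
                              (Eq (Var 1) (Var 0))))))
         (All (All (All (Imp (And (pinst 3 p (Var 0) (Var 2)) (pinst 3 p (Var 0) (Var 1)))
                              (Eq (Var 2) (Var 1))))))))"

text \<open>Instance of \<open>\<forall>a \<exists>b (\<Gamma> : b \<rightarrow> (2)^1_a)\<close> for the formula \<psi> with m parameters: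
  \<open>\<forall>a \<exists>b \<forall>z1..zm \<not> graph_inj\<close>.\<close>
definition php_fin :: "fm \<Rightarrow> nat \<Rightarrow> fm" where
  "php_fin p m = All (Ex (Alls m (Neg (graph_inj p m (Suc m)))))"

definition PHP_fin_all :: "fm set" where
  "PHP_fin_all = {php_fin p m | p m k. sigma k p \<and> fclosed (m + 2) p}"

text \<open>Convention for the formula \<open>\<phi>\<close> defining the graph of H: Var 0 is the output y,
  Var 1 is the input x.  \<open>total_fn \<phi>\<close> is \<open>\<forall>x \<exists>!y \<phi>(x,y)\<close>.\<close>
definition total_fn :: "fm \<Rightarrow> fm" where
  "total_fn f = All (Ex (And f
        (All (Imp (fsubst (\<lambda>i. if i = 0 then Var 0 else if i = 1 then Var 2 else Var (Suc i)) f)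
                  (Eq (Var 0) (Var 1))))))"

text \<open>Instance of \<open>\<forall>a (\<Gamma> : H(a) \<rightarrow> (2)^1_a)\<close> for \<psi> with m parameters, where H is given
  by \<phi>: \<open>\<forall>a \<forall>h (\<phi>(a,h) \<longrightarrow> \<forall>z1..zm \<not> graph_inj)\<close>.\<close>
definition php_H :: "fm \<Rightarrow> fm \<Rightarrow> nat \<Rightarrow> fm" where
  "php_H f p m = All (All (Imp f (Alls m (Neg (graph_inj p m (Suc m))))))"

end

theory Submission
  imports Defs "HOL-Library.Countable"
begin

text \<open>Let M be a nonstandard model of PA + S. The finitely many axioms from S in use hold in every
  submodel of M that contains certain elements and is closed under Skolem functions for finitely many total
  \<open>\<Pi>\<^sub>n\<close> relations. Such a submodel K is generated by a chain
  of states, each of which bounds the Skolem functions below the previous one and codes the \<open>\<Pi>\<^sub>n\<close> truth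
  below its bound, together with nonstandardly long sequences of indiscernibles between consecutive
  states. On the one hand, an element below the initial state is defined inside K by a standard
  formula from one of the standardly many states, and the chain is \<open>\<Delta>\<^sub>n\<^sub>+\<^sub>1\<close>, so that sending an element
  to its first definition is a \<open>\<Sigma>\<^sub>n\<^sub>+\<^sub>1\<close> injection from \<open>H(a)\<close> into any nonstandard \<open>a\<close>. On the other hand,
  shifting one galaxy of indiscernibles is an automorphism of K that fixes the part of K below a state
  and any given finite set of parameters but moves an element below the next state, so that no definable
  injection maps the latter into the former.\<close>

section \<open>Satisfaction\<close>

text \<open>Two demands on the submodel pull against each other: everything below the initial state
  has to be rigid, so that standard codes can enumerate it, while between any two consecutive states
  something has to move. So a definition of a small element must be freed of the indiscernibles that
  it mentions. Replacing the largest of them by a definable stand-in, the last member of a longer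
  sequence, brings in a later state, and the next replacement then needs homogeneity for truth at
  that later state. One thinning is therefore not enough: each level is thinned \<open>a0\<close>
  times, round \<open>t\<close> taking care of one further state, and as \<open>a0\<close> is
  nonstandard any standard number of replacements is covered. Only the largest element is ever
  replaced, so end-homogeneity suffices and iterated pigeonholes do the work of Ramsey's theorem.
  The level n + 3 comes from absoluteness: witnesses of the outer existential quantifiers are put
  into the submodel, universal quantifiers are inherited, and a Sigma_(n+1) statement true at all
  arguments has a total Pi_n Skolem relation.\<close>

class arith = zero + one + plus + times + ord

definition scons :: "'a \<Rightarrow> (nat \<Rightarrow> 'a) \<Rightarrow> nat \<Rightarrow> 'a" (infixr \<open>##\<close> 65) where
  "(x ## e) i = (case i of 0 \<Rightarrow> x | Suc j \<Rightarrow> e j)"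

lemma scons_0 [simp]: "(x ## e) 0 = x"
  and scons_Suc [simp]: "(x ## e) (Suc j) = e j"
  and scons_1 [simp]: "(x ## e) 1 = e 0"
  by (simp_all add: scons_def)

lemma scons_o_Suc [simp]: "(\<lambda>i. (x ## e) (Suc i)) = e"
  by simp

lemma scons_eta: "e 0 ## (\<lambda>i. e (Suc i)) = e"
  by (rule ext) (simp add: scons_def split: nat.split)

context arith
begin

primrec tval :: "(nat \<Rightarrow> 'a) \<Rightarrow> tm \<Rightarrow> 'a" where
  "tval e (Var i) = e i"
| "tval e Zero = 0"
| "tval e (Sc t) = tval e t + 1"
| "tval e (Pl t u) = tval e t + tval e u"
| "tval e (Tm t u) = tval e t * tval e u"

text \<open>Quantifiers range over a set \<open>D\<close>, while the operations are those of the
  type. A submodel is thus a subset of the big model with one and the same \<open>tval\<close>, and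
  absoluteness compares \<open>sat K\<close> with \<open>sat UNIV\<close>.\<close>

primrec sat :: "'a set \<Rightarrow> (nat \<Rightarrow> 'a) \<Rightarrow> fm \<Rightarrow> bool" where
  "sat D e Fls = False"
| "sat D e (Eq t u) = (tval e t = tval e u)"
| "sat D e (Lt t u) = (tval e t < tval e u)"
| "sat D e (Imp p q) = (sat D e p \<longrightarrow> sat D e q)"
| "sat D e (All p) = (\<forall>x\<in>D. sat D (x ## e) p)"

end

lemma sat_defs [simp]:
  "sat D e (Neg p) = (\<not> sat D e p)"
  "sat D e (And p q) = (sat D e p \<and> sat D e q)"
  "sat D e (Iff p q) = (sat D e p = sat D e q)"
  "sat D e (Ex p) = (\<exists>x\<in>D. sat D (x ## e) p)"
  by (auto simp: Neg_def And_def Iff_def Ex_def)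

section \<open>Free variables and substitution\<close>

primrec fvars :: "fm \<Rightarrow> nat set" where
  "fvars Fls = {}"
| "fvars (Eq t u) = tvars t \<union> tvars u"
| "fvars (Lt t u) = tvars t \<union> tvars u"
| "fvars (Imp p q) = fvars p \<union> fvars q"
| "fvars (All p) = {i. Suc i \<in> fvars p}"

lemma finite_tvars [simp]: "finite (tvars t)"
  by (induction t) auto

lemma finite_fvars [simp]: "finite (fvars p)"
proof (induction p)
  case (All p)
  have "{i. Suc i \<in> fvars p} = Suc -` fvars p" by auto
  then show ?case using finite_vimageI[OF All, of Suc] by simp
qed auto

lemma up_Suc [simp]: "up s (Suc i) = tlift (s i)" and up_0 [simp]: "up s 0 = Var 0"
  by (simp_all add: up_def)

lemma tsubst_tsubst: "tsubst s (tsubst r t) = tsubst (\<lambda>i. tsubst s (r i)) t"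
  by (induction t) auto

lemma tsubst_cong: "(\<And>i. i \<in> tvars t \<Longrightarrow> s i = r i) \<Longrightarrow> tsubst s t = tsubst r t"
  by (induction t) auto

lemma fsubst_cong: "(\<And>i. i \<in> fvars p \<Longrightarrow> s i = r i) \<Longrightarrow> fsubst s p = fsubst r p"
proof (induction p arbitrary: s r)
  case (All p)
  show ?case
    using All.prems by (auto intro!: All.IH simp: up_def split: nat.splits)
next
  case (Eq t u)
  then have "tsubst s t = tsubst r t" "tsubst s u = tsubst r u" by (auto intro!: tsubst_cong)
  then show ?case by simp
next
  case (Lt t u)
  then have "tsubst s t = tsubst r t" "tsubst s u = tsubst r u" by (auto intro!: tsubst_cong)
  then show ?case by simp
next
  case (Imp p q)
  have "fsubst s p = fsubst r p" by (rule Imp.IH(1)) (use Imp.prems in auto)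
  moreover have "fsubst s q = fsubst r q" by (rule Imp.IH(2)) (use Imp.prems in auto)
  ultimately show ?case by simp
qed simp

lemma up_comp: "(\<lambda>i. tsubst (up s) (up r i)) = up (\<lambda>i. tsubst s (r i))"
  by (rule ext) (auto simp: up_def tlift_def tsubst_tsubst split: nat.splits)

lemma fsubst_fsubst: "fsubst s (fsubst r p) = fsubst (\<lambda>i. tsubst s (r i)) p"
  by (induction p arbitrary: s r) (simp_all add: tsubst_tsubst up_comp)

lemma tsubst_Var [simp]: "tsubst Var t = t"
  by (induction t) auto

lemma up_Var [simp]: "up Var = Var"
  by (rule ext) (simp add: up_def tlift_def split: nat.splits)

lemma fsubst_Var [simp]: "fsubst Var p = p"
  by (induction p) auto

lemma tval_tsubst: "tval e (tsubst s t) = tval (\<lambda>i. tval e (s i)) t"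
  by (induction t) auto

lemma tval_tlift [simp]: "tval (x ## e) (tlift t) = tval e t"
  by (simp add: tlift_def tval_tsubst)

lemma tval_up: "(\<lambda>i. tval (x ## e) (up s i)) = x ## (\<lambda>i. tval e (s i))"
  by (rule ext) (simp add: up_def scons_def[of x] tval_tlift[unfolded scons_def[abs_def]] split: nat.splits)

lemma sat_fsubst: "sat D e (fsubst s p) = sat D (\<lambda>i. tval e (s i)) p"
  by (induction p arbitrary: e s) (simp_all add: tval_tsubst tval_up)

lemma sat_flift [simp]: "sat D (x ## e) (flift p) = sat D e p"
  by (simp add: flift_def sat_fsubst)

lemma inst0_scons: "inst0 t p = fsubst (t ## Var) p"
  unfolding inst0_def by (rule fsubst_cong) (simp add: scons_def split: nat.splits)

lemma tval_scons: "(\<lambda>i. tval e ((t ## s) i)) = tval e t ## (\<lambda>i. tval e (s i))"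
  by (rule ext) (simp add: scons_def split: nat.splits)

lemma sat_inst0 [simp]: "sat D e (inst0 t p) = sat D (tval e t ## e) p"
  by (simp add: inst0_scons sat_fsubst tval_scons)

lemma tval_cong: "(\<And>i. i \<in> tvars t \<Longrightarrow> e i = e' i) \<Longrightarrow> tval e t = tval e' t"
  by (induction t) auto

lemma sat_cong: "(\<And>i. i \<in> fvars p \<Longrightarrow> e i = e' i) \<Longrightarrow> sat D e p = sat D e' p"
proof (induction p arbitrary: e e')
  case (Eq t u)
  then have "tval e t = tval e' t" "tval e u = tval e' u" by (auto intro!: tval_cong)
  then show ?case by simp
next
  case (Lt t u)
  then have "tval e t = tval e' t" "tval e u = tval e' u" by (auto intro!: tval_cong)
  then show ?case by simp
next
  case (Imp p q)
  have "sat D e p = sat D e' p" by (rule Imp.IH(1)) (use Imp.prems in auto)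
  moreover have "sat D e q = sat D e' q" by (rule Imp.IH(2)) (use Imp.prems in auto)
  ultimately show ?case by simp
next
  case (All p)
  have "sat D (x ## e) p = sat D (x ## e') p" for x
    using All.prems by (intro All.IH) (auto simp: scons_def split: nat.splits)
  then show ?case by simp
qed simp

lemma tclosed_tvars: "tclosed k t \<longleftrightarrow> tvars t \<subseteq> {..<k}"
  by (induction t) auto

lemma fclosed_fvars: "fclosed k p \<longleftrightarrow> fvars p \<subseteq> {..<k}"
proof (induction p arbitrary: k)
  case (All p)
  have "fvars p \<subseteq> {..<Suc k} \<longleftrightarrow> {i. Suc i \<in> fvars p} \<subseteq> {..<k}"
    by (auto simp: subset_iff less_Suc_eq_0_disj) (metis not0_implies_Suc)
  then show ?case using All by simp
qed (auto simp: tclosed_tvars)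

lemma sentence_fvars: "sentence p \<longleftrightarrow> fvars p = {}"
  by (simp add: sentence_def fclosed_fvars)

lemma sat_sentence: "sentence p \<Longrightarrow> sat D e p = sat D e' p"
  by (rule sat_cong) (simp add: sentence_fvars)

definition closed_dom :: "'a::arith set \<Rightarrow> bool" where
  "closed_dom D \<longleftrightarrow> 0 \<in> D \<and> 1 \<in> D \<and> (\<forall>x\<in>D. \<forall>y\<in>D. x + y \<in> D \<and> x * y \<in> D)"

lemma closed_dom_UNIV [simp]: "closed_dom UNIV"
  by (simp add: closed_dom_def)

lemma tval_closed: "closed_dom D \<Longrightarrow> (\<And>i. e i \<in> D) \<Longrightarrow> tval e t \<in> D"
  by (induction t) (auto simp: closed_dom_def)

lemma scons_in: "x \<in> D \<Longrightarrow> (\<And>i. e i \<in> D) \<Longrightarrow> (x ## e) i \<in> D"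
  by (simp add: scons_def split: nat.splits)

text \<open>\<open>D\<close> is closed under the operations because \<open>ax_inst\<close>
  instantiates with arbitrary terms, and the axioms are assumed in all environments over
  \<open>D\<close> because \<open>gen\<close> quantifies their free variables.\<close>

theorem soundness:
  assumes "prv T p" "closed_dom D" "\<And>q e. q \<in> T \<Longrightarrow> (\<And>i. e i \<in> D) \<Longrightarrow> sat D e q"
    and "\<And>i. e i \<in> D"
  shows "sat D e p"
  using assms(1,4)
proof (induction arbitrary: e rule: prv.induct)
  case (hyp p)
  then show ?case using assms(3) by blast
next
  case (ax_inst p t)
  then show ?case using tval_closed[OF assms(2)] by auto
next
  case (gen p)
  then show ?case by (auto intro!: gen.IH scons_in)
qed auto

lemmas prv_ax = prv.ax1 prv.ax2 prv.ax3 prv.ax_inst prv.ax_allimp prv.ax_refl prv.ax_subst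

lemma prv_mono:
  assumes "prv T p" "T \<subseteq> T'"
  shows "prv T' p"
  using assms(1)
proof (induction rule: prv.induct)
  case (hyp p)
  then show ?case using assms(2) by (auto intro: prv.hyp)
next
  case (mp p q)
  then show ?case by (blast intro: prv.mp)
next
  case (gen p)
  then show ?case by (blast intro: prv.gen)
qed (rule prv_ax)+

lemma prv_finite: "prv T p \<Longrightarrow> \<exists>F. finite F \<and> F \<subseteq> T \<and> prv F p"
proof (induction rule: prv.induct)
  case (hyp p)
  then show ?case by (intro exI[of _ "{p}"]) (auto intro: prv.hyp)
next
  case (mp p q)
  then obtain F G where "finite F" "F \<subseteq> T" "prv F (Imp p q)" "finite G" "G \<subseteq> T" "prv G p" by auto
  then show ?case
    by (intro exI[of _ "F \<union> G"]) (auto intro: prv.mp[of _ p] prv_mono)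
next
  case (gen p)
  then show ?case by (auto intro: prv.gen)
qed (rule exI[of _ "{}"], simp add: prv_ax)+

lemma flift_fsubst: "flift (fsubst s p) = fsubst (up s) (flift p)"
  by (simp add: flift_def fsubst_fsubst tlift_def)

lemma inst0_fsubst: "fsubst s (inst0 t p) = inst0 (tsubst s t) (fsubst (up s) p)"
proof -
  have "(\<lambda>i. tsubst s ((t ## Var) i)) = (\<lambda>i. tsubst (tsubst s t ## Var) (up s i))"
  proof
    fix i show "tsubst s ((t ## Var) i) = tsubst (tsubst s t ## Var) (up s i)"
      by (cases i) (simp_all add: tlift_def tsubst_tsubst)
  qed
  then show ?thesis by (simp add: inst0_scons fsubst_fsubst)
qed

lemma fsubst_Neg [simp]: "fsubst s (Neg p) = Neg (fsubst s p)"
  and fsubst_And [simp]: "fsubst s (And p q) = And (fsubst s p) (fsubst s q)"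
  and fsubst_Iff [simp]: "fsubst s (Iff p q) = Iff (fsubst s p) (fsubst s q)"
  and fsubst_Ex [simp]: "fsubst s (Ex p) = Ex (fsubst (up s) p)"
  by (simp_all add: Neg_def And_def Iff_def Ex_def)

lemma fsubst_sentence: "sentence p \<Longrightarrow> fsubst s p = p"
  using fsubst_cong[of p s Var] by (simp add: sentence_fvars)

lemma prv_fsubst:
  assumes "prv T p" "\<And>q. q \<in> T \<Longrightarrow> sentence q"
  shows "prv T (fsubst s p)"
  using assms(1)
proof (induction arbitrary: s rule: prv.induct)
  case (hyp p)
  then show ?case using assms(2) by (simp add: fsubst_sentence prv.hyp)
next
  case (ax_inst p t)
  show ?case by (simp add: inst0_fsubst prv.ax_inst)
next
  case (ax_allimp p q)
  show ?case by (simp add: flift_fsubst[symmetric] prv.ax_allimp)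
next
  case (ax_subst t u p)
  show ?case by (simp add: inst0_fsubst prv.ax_subst)
next
  case (mp p q)
  then show ?case using prv.mp[of T "fsubst s p" "fsubst s q"] by simp
next
  case (gen p)
  then show ?case by (simp add: prv.gen)
qed (simp_all add: prv_ax)

section \<open>Henkin sets\<close>

instance tm :: countable by countable_datatype
instance fm :: countable by countable_datatype

text \<open>In \<open>prv\<close> the rule \<open>gen\<close> is unrestricted, so free variables of
  members of \<open>T\<close> read as universally quantified. The hypotheses in \<open>G\<close> are
  closed under modus ponens only: their free variables act as constants, and the deduction theorem
  holds without side condition.\<close>

inductive der :: "fm set \<Rightarrow> fm set \<Rightarrow> fm \<Rightarrow> bool" for T G where
  prv: "prv T p \<Longrightarrow> der T G p"
| hyp: "p \<in> G \<Longrightarrow> der T G p"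
| mp: "der T G (Imp p q) \<Longrightarrow> der T G p \<Longrightarrow> der T G q"

lemma der_mono: "der T G p \<Longrightarrow> G \<subseteq> G' \<Longrightarrow> der T G' p"
  by (induction rule: der.induct) (auto intro: der.prv der.hyp der.mp)

lemma der_empty: "der T {} p \<Longrightarrow> prv T p"
  by (induction rule: der.induct) (auto intro: prv.mp)

lemma prv_id: "prv T (Imp p p)"
  by (rule prv.mp[OF prv.mp[OF prv.ax2[of T p "Imp p p" p] prv.ax1] prv.ax1])

lemma deduct: "der T (insert a G) q \<Longrightarrow> der T G (Imp a q)"
proof (induction rule: der.induct)
  case (prv p)
  then show ?case by (blast intro: der.prv prv.mp prv.ax1)
next
  case (hyp p)
  then show ?case by (blast intro: der.prv prv_id der.hyp der.mp prv.ax1)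
next
  case (mp p q)
  show ?case by (rule der.mp[OF der.mp[OF der.prv[OF prv.ax2] mp.IH(1)] mp.IH(2)])
qed

lemma undeduct: "der T G (Imp a q) \<Longrightarrow> der T (insert a G) q"
  by (rule der.mp[OF der_mono[of T G]]) (auto intro: der.hyp)

lemma der_fsubst:
  assumes "der T G p" "\<And>q. q \<in> T \<Longrightarrow> sentence q"
  shows "der T (fsubst s ` G) (fsubst s p)"
  using assms(1)
proof (induction rule: der.induct)
  case (prv p)
  then show ?case by (simp add: assms(2) der.prv prv_fsubst)
next
  case (mp p q)
  then show ?case using der.mp[of T "fsubst s ` G" "fsubst s p"] by simp
qed (simp add: der.hyp)

lemma inst_self: "inst0 (Var 0) (fsubst (up (\<lambda>i. Var (Suc i))) p) = p"
proof -
  have "(\<lambda>i. tsubst (Var 0 ## Var) (up (\<lambda>i. Var (Suc i)) i)) = Var"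
    by (rule ext) (simp add: up_def tlift_def split: nat.splits)
  then show ?thesis by (simp add: inst0_scons fsubst_fsubst)
qed

lemma der_all_imp: "der T G (All (Imp p q)) \<Longrightarrow> der T G (All p) \<Longrightarrow> der T G (All q)"
proof -
  let ?A = "All (Imp p q)" and ?B = "All p"
  have "der T {flift ?A, flift ?B} (inst0 (Var 0) (fsubst (up (\<lambda>i. Var (Suc i))) (Imp p q)))"
    by (rule der.mp[OF der.prv[OF prv.ax_inst]], rule der.hyp) (simp add: flift_def)
  then have 1: "der T {flift ?A, flift ?B} (Imp p q)" by (simp add: inst_self del: fsubst.simps(4))
  have "der T {flift ?A, flift ?B} (inst0 (Var 0) (fsubst (up (\<lambda>i. Var (Suc i))) p))"
    by (rule der.mp[OF der.prv[OF prv.ax_inst]], rule der.hyp) (simp add: flift_def)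
  then have 2: "der T {flift ?A, flift ?B} p" by (simp add: inst_self)
  have "der T (insert (flift ?B) {flift ?A}) q"
    using der.mp[OF 1 2] by (simp add: insert_commute)
  then have "prv T (Imp (flift ?A) (Imp (flift ?B) q))"
    by (intro der_empty deduct)
  then have "prv T (Imp ?A (All (Imp (flift ?B) q)))"
    by (blast intro: prv.gen prv.mp prv.ax_allimp)
  then have "der T G (Imp ?A (All (Imp (flift ?B) q)))" by (rule der.prv)
  moreover assume "der T G ?A"
  ultimately have "der T G (All (Imp (flift ?B) q))" by (rule der.mp)
  then have "der T G (Imp ?B (All q))" by (rule der.mp[OF der.prv[OF prv.ax_allimp]])
  moreover assume "der T G ?B"
  ultimately show ?thesis by (rule der.mp)
qed

text \<open>Lifting clears index 0 from the hypotheses, which is the eigenvariable condition in de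
  Bruijn form.\<close>

lemma der_gen: "der T (flift ` G) p \<Longrightarrow> der T G (All p)"
proof (induction rule: der.induct)
  case (prv p)
  then show ?case by (simp add: der.prv prv.gen)
next
  case (hyp p)
  then obtain q where q: "q \<in> G" "p = flift q" by auto
  have "der T G (Imp q (All p))"
    unfolding q(2) by (intro der.prv prv.mp[OF prv.ax_allimp] prv.gen prv_id)
  then show ?case using q by (blast intro: der.mp der.hyp)
next
  case (mp p q)
  then show ?case by (blast intro: der_all_imp)
qed

lemma der_Neg_Neg: "der T (insert (Neg p) G) Fls \<Longrightarrow> der T G p"
  using der.mp[OF der.prv[OF prv.ax3[of T p]]] deduct[of T "Neg p" G Fls] by (simp add: Neg_def)

lemma der_fresh:
  assumes "der T G (inst0 (Var c) p)" "\<And>q. q \<in> T \<Longrightarrow> sentence q"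
    and "\<And>q. q \<in> G \<Longrightarrow> c \<notin> fvars q" "c \<notin> fvars (All p)"
  shows "der T G (All p)"
proof -
  \<comment> \<open>The fresh variable \<open>c\<close> becomes index 0 and every other variable is
    shifted; on \<open>G\<close>, where \<open>c\<close> does not occur, this is plain lifting, so
    \<open>der_gen\<close> applies.\<close>
  let ?s = "\<lambda>i. if i = c then Var 0 else Var (Suc i)"
  have "fsubst ?s ` G = flift ` G"
    unfolding flift_def using assms(3) by (intro image_cong refl fsubst_cong) auto
  moreover have "fsubst ?s (inst0 (Var c) p) = p"
  proof -
    have "fsubst ?s (inst0 (Var c) p) = fsubst (\<lambda>i. tsubst (Var 0 ## Var) (up ?s i)) p"
      by (simp add: inst0_fsubst) (simp add: inst0_scons fsubst_fsubst)
    also have "\<dots> = fsubst Var p"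
      using assms(4) by (intro fsubst_cong) (auto simp: up_def tlift_def split: nat.splits)
    finally show ?thesis by simp
  qed
  ultimately have "der T (flift ` G) p"
    using der_fsubst[OF assms(1,2), where s = ?s] by metis
  then show ?thesis by (rule der_gen)
qed

definition con :: "fm set \<Rightarrow> fm set \<Rightarrow> bool" where "con T G \<longleftrightarrow> \<not> der T G Fls"

text \<open>Witnesses are terms of the original language: free variables serve as the Henkin
  constants, and the term model is built from \<open>tm\<close> itself.\<close>

definition henkin :: "fm set \<Rightarrow> fm set \<Rightarrow> bool" where
  "henkin T H \<longleftrightarrow> con T H \<and> (\<forall>p. der T H p \<longrightarrow> p \<in> H) \<and> (\<forall>p. p \<in> H \<or> Neg p \<in> H) \<and>
    (\<forall>p. Neg (All p) \<in> H \<longrightarrow> (\<exists>t. Neg (inst0 t p) \<in> H))"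

text \<open>Only finitely many variables are in use at each stage, so a fresh one is always at hand;
  the invariant is kept by \<open>hstep_finite\<close>.\<close>

definition hstep :: "fm set \<Rightarrow> fm \<Rightarrow> fm set \<Rightarrow> fm set" where
  "hstep T a G = (if con T (insert a G)
     then (if \<exists>p. a = Neg (All p)
       then insert a G \<union> {Neg (inst0 (Var (SOME c. \<forall>q\<in>insert a G. c \<notin> fvars q)) p) | p. a = Neg (All p)}
       else insert a G)
     else G)"

lemma Neg_inj [simp]: "Neg p = Neg q \<longleftrightarrow> p = q"
  by (simp add: Neg_def)

lemma fvars_Neg [simp]: "fvars (Neg p) = fvars p"
  by (simp add: Neg_def)

lemma hstep_con:
  assumes "con T G" "\<And>q. q \<in> T \<Longrightarrow> sentence q" "finite (\<Union>(fvars ` G))"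
  shows "con T (hstep T a G)"
proof (cases "con T (insert a G) \<and> (\<exists>p. a = Neg (All p))")
  case True
  then obtain p where a: "a = Neg (All p)" and c: "con T (insert a G)" by auto
  define c where "c = (SOME c. \<forall>q\<in>insert a G. c \<notin> fvars q)"
  have "finite (\<Union>(fvars ` insert a G))" using assms(3) by simp
  then have "\<exists>c. \<forall>q\<in>insert a G. c \<notin> fvars q"
    using ex_new_if_finite[OF infinite_UNIV_nat] by (metis UN_I)
  then have fr: "\<forall>q\<in>insert a G. c \<notin> fvars q" unfolding c_def by (rule someI_ex)
  have eq: "hstep T a G = insert (Neg (inst0 (Var c) p)) (insert a G)"
    using c a by (simp add: hstep_def c_def)
  show ?thesis
  proof (rule ccontr)
    assume "\<not> con T (hstep T a G)"
    then have "der T (insert a G) (inst0 (Var c) p)"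
      unfolding eq con_def by (simp add: der_Neg_Neg)
    then have "der T (insert a G) (All p)"
      by (rule der_fresh) (use assms(2) fr a in auto)
    moreover have "der T (insert a G) (Neg (All p))" by (simp add: a der.hyp)
    ultimately have "der T (insert a G) Fls" unfolding Neg_def by (blast intro: der.mp)
    then show False using c by (simp add: con_def)
  qed
next
  case False
  then show ?thesis using assms(1) by (auto simp: hstep_def)
qed

lemma hstep_finite: "finite (\<Union>(fvars ` G)) \<Longrightarrow> finite (\<Union>(fvars ` hstep T a G))"
proof -
  assume f: "finite (\<Union>(fvars ` G))"
  have "finite {Neg (inst0 (Var c) p) | p. a = Neg (All p)}" for c
  proof (cases "\<exists>p. a = Neg (All p)")
    case True
    then obtain p where "a = Neg (All p)" by auto
    then have "{Neg (inst0 (Var c) p) | p. a = Neg (All p)} = {Neg (inst0 (Var c) p)}" by auto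
    then show ?thesis by simp
  qed simp
  then show ?thesis using f by (auto simp: hstep_def)
qed

primrec hchain :: "fm set \<Rightarrow> fm set \<Rightarrow> nat \<Rightarrow> fm set" where
  "hchain T G 0 = G"
| "hchain T G (Suc k) = hstep T (from_nat k) (hchain T G k)"

lemma hchain_mono: "j \<le> k \<Longrightarrow> hchain T G j \<subseteq> hchain T G k"
  by (rule lift_Suc_mono_le[of "hchain T G"]) (auto simp: hstep_def)

lemma der_hchain: "der T (\<Union>k. hchain T G k) p \<Longrightarrow> \<exists>k. der T (hchain T G k) p"
proof (induction rule: der.induct)
  case (mp p q)
  then obtain j k where "der T (hchain T G j) (Imp p q)" "der T (hchain T G k) p" by auto
  then have "der T (hchain T G (max j k)) (Imp p q)" "der T (hchain T G (max j k)) p"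
    by (meson der_mono hchain_mono max.cobounded1 max.cobounded2)+
  then show ?case by (blast intro: der.mp)
qed (auto intro: der.prv der.hyp)

theorem henkin_exists:
  assumes "con T G" and sent: "\<And>q. q \<in> T \<Longrightarrow> sentence q" and "finite (\<Union>(fvars ` G))"
  obtains H where "henkin T H" "G \<subseteq> H"
proof -
  let ?H = "\<Union>k. hchain T G k"
  have ck: "con T (hchain T G k) \<and> finite (\<Union>(fvars ` hchain T G k))" for k
    by (induction k) (auto simp: assms(1,3) intro!: hstep_con hstep_finite sent simp del: finite_UN)
  have con: "con T ?H"
    using der_hchain ck unfolding con_def by blast
  have ins: "a \<in> ?H" if "con T (insert a (hchain T G (to_nat a)))" for a
  proof -
    have "a \<in> hchain T G (Suc (to_nat a))" using that by (simp add: hstep_def)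
    then show ?thesis by blast
  qed
  have sub: "hchain T G k \<subseteq> ?H" for k by blast
  have notin: "der T ?H (Neg a)" if "\<not> con T (insert a (hchain T G (to_nat a)))" for a
    using that der_mono[OF deduct sub] by (auto simp: con_def Neg_def)
  have closed: "p \<in> ?H" if "der T ?H p" for p
  proof (rule ccontr)
    assume "p \<notin> ?H"
    then have "der T ?H (Neg p)" using ins notin by blast
    then show False using that con unfolding con_def Neg_def by (blast intro: der.mp)
  qed
  have "p \<in> ?H \<or> Neg p \<in> ?H" for p using ins notin closed by blast
  moreover have "\<exists>t. Neg (inst0 t p) \<in> ?H" if "Neg (All p) \<in> ?H" for p
  proof -
    let ?a = "Neg (All p)"
    have "con T (insert ?a (hchain T G (to_nat ?a)))"
    proof (rule ccontr)
      assume "\<not> ?thesis"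
      then have "der T ?H (Neg ?a)" by (rule notin)
      then show False using der.hyp[OF that, of T] con unfolding con_def Neg_def by (blast intro: der.mp)
    qed
    then have "\<exists>t. Neg (inst0 t p) \<in> hchain T G (Suc (to_nat ?a))"
      by (auto simp: hstep_def)
    then show ?thesis by blast
  qed
  ultimately have "henkin T ?H" using con closed by (auto simp: henkin_def)
  moreover have "G \<subseteq> ?H" using sub[of 0] by simp
  ultimately show ?thesis using that by blast
qed

context
  fixes T H
  assumes H: "henkin T H"
begin

lemma hk_closed: "der T H p \<Longrightarrow> p \<in> H"
  using H by (auto simp: henkin_def)

lemma hk_prv: "prv T p \<Longrightarrow> p \<in> H"
  by (intro hk_closed der.prv)

lemma hk_Fls: "Fls \<notin> H"
  using H by (auto simp: henkin_def con_def intro: der.hyp)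

lemma hk_mp: "Imp p q \<in> H \<Longrightarrow> p \<in> H \<Longrightarrow> q \<in> H"
  by (blast intro: hk_closed der.mp der.hyp)

lemma hk_Neg: "Neg p \<in> H \<longleftrightarrow> p \<notin> H"
  using H hk_Fls hk_mp[of p Fls] by (auto simp: henkin_def Neg_def)

lemma hk_Imp: "Imp p q \<in> H \<longleftrightarrow> (p \<in> H \<longrightarrow> q \<in> H)"
proof -
  have "Imp p q \<in> H" if "p \<notin> H"
  proof -
    have "Neg p \<in> H" using that hk_Neg by simp
    then have "der T (insert p H) Fls"
      unfolding Neg_def by (rule undeduct[OF der.hyp])
    then have "der T (insert (Neg q) (insert p H)) Fls"
      by (rule der_mono) blast
    then show ?thesis by (rule hk_closed[OF deduct[OF der_Neg_Neg]])
  qed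
  moreover have "Imp p q \<in> H" if "q \<in> H"
    using that hk_mp[OF hk_prv[OF prv.ax1]] by blast
  ultimately show ?thesis using hk_mp by blast
qed

lemma hk_All: "All p \<in> H \<longleftrightarrow> (\<forall>t. inst0 t p \<in> H)"
proof -
  have "inst0 t p \<in> H" if "All p \<in> H" for t
    using hk_mp[OF hk_prv[OF prv.ax_inst] that] .
  moreover have "\<exists>t. inst0 t p \<notin> H" if "All p \<notin> H"
    using that H hk_Neg unfolding henkin_def by blast
  ultimately show ?thesis by blast
qed

lemma hk_Ex: "Ex p \<in> H \<longleftrightarrow> (\<exists>t. inst0 t p \<in> H)"
  using hk_Neg[of "All (Neg p)"] hk_All[of "Neg p"] hk_Neg
  by (simp add: Ex_def inst0_def)

lemma hk_And: "And p q \<in> H \<longleftrightarrow> p \<in> H \<and> q \<in> H"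
  by (simp add: And_def hk_Neg hk_Imp)

lemma hk_Iff: "Iff p q \<in> H \<longleftrightarrow> (p \<in> H \<longleftrightarrow> q \<in> H)"
  by (auto simp: Iff_def hk_And hk_Imp)

lemma hk_refl: "Eq t t \<in> H"
  by (rule hk_prv[OF prv.ax_refl])

lemma hk_subst: "Eq t u \<in> H \<Longrightarrow> inst0 t p \<in> H \<Longrightarrow> inst0 u p \<in> H"
  by (rule hk_mp[OF hk_mp[OF hk_prv[OF prv.ax_subst]]])

lemma tsubst_lift_inst [simp]: "tsubst (t ## s) (tlift u) = tsubst s u"
  by (simp add: tlift_def tsubst_tsubst)

text \<open>Each rule is \<open>ax_subst\<close> for a formula with one hole, the hole being
  \<open>Var 0\<close> and the other terms being lifted above it.\<close>

lemma hk_eqs: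
  assumes "Eq t u \<in> H"
  shows hk_sym: "Eq u t \<in> H"
    and hk_trans: "Eq u v \<in> H \<Longrightarrow> Eq t v \<in> H"
    and hk_Sc: "Eq (Sc t) (Sc u) \<in> H"
    and hk_Pl1: "Eq (Pl t v) (Pl u v) \<in> H"
    and hk_Pl2: "Eq (Pl v t) (Pl v u) \<in> H"
    and hk_Tm1: "Eq (Tm t v) (Tm u v) \<in> H"
    and hk_Tm2: "Eq (Tm v t) (Tm v u) \<in> H"
    and hk_Lt1: "Lt t v \<in> H \<Longrightarrow> Lt u v \<in> H"
    and hk_Lt2: "Lt v t \<in> H \<Longrightarrow> Lt v u \<in> H"
proof -
  note S = hk_subst[OF assms]
  show sy: "Eq u t \<in> H" using S[of "Eq (Var 0) (tlift t)"] by (simp add: inst0_scons hk_refl)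
  show "Eq u v \<in> H \<Longrightarrow> Eq t v \<in> H"
    using hk_subst[OF sy, of "Eq (Var 0) (tlift v)"] by (simp add: inst0_scons)
  show "Eq (Sc t) (Sc u) \<in> H"
    using S[of "Eq (Sc (tlift t)) (Sc (Var 0))"] by (simp add: inst0_scons hk_refl)
  show "Eq (Pl t v) (Pl u v) \<in> H"
    using S[of "Eq (Pl (tlift t) (tlift v)) (Pl (Var 0) (tlift v))"] by (simp add: inst0_scons hk_refl)
  show "Eq (Pl v t) (Pl v u) \<in> H"
    using S[of "Eq (Pl (tlift v) (tlift t)) (Pl (tlift v) (Var 0))"] by (simp add: inst0_scons hk_refl)
  show "Eq (Tm t v) (Tm u v) \<in> H"
    using S[of "Eq (Tm (tlift t) (tlift v)) (Tm (Var 0) (tlift v))"] by (simp add: inst0_scons hk_refl)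
  show "Eq (Tm v t) (Tm v u) \<in> H"
    using S[of "Eq (Tm (tlift v) (tlift t)) (Tm (tlift v) (Var 0))"] by (simp add: inst0_scons hk_refl)
  show "Lt t v \<in> H \<Longrightarrow> Lt u v \<in> H"
    using S[of "Lt (Var 0) (tlift v)"] by (simp add: inst0_scons)
  show "Lt v t \<in> H \<Longrightarrow> Lt v u \<in> H"
    using S[of "Lt (tlift v) (Var 0)"] by (simp add: inst0_scons)
qed

end

section \<open>Arithmetic in models of PA\<close>

text \<open>Truncated subtraction is included so that models of PA are instances of the cancellative
  ordered semiring classes.\<close>

class pa = arith + minus +
  assumes pa_S_nz: "x + 1 \<noteq> 0"
    and pa_S_inj: "x + 1 = y + 1 \<Longrightarrow> x = y"
    and pa_add0: "x + 0 = x"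
    and pa_addS: "x + (y + 1) = (x + y) + 1"
    and pa_mult0: "x * 0 = 0"
    and pa_multS: "x * (y + 1) = x * y + x"
    and pa_less: "x < y \<longleftrightarrow> (\<exists>z. x + (z + 1) = y)"
    and pa_le: "x \<le> y \<longleftrightarrow> x < y \<or> x = y"
    and pa_minus: "x - y = (if \<exists>z. x = y + z then THE z. x = y + z else 0)"
    and pa_ind: "sat UNIV (0 ## e) p \<Longrightarrow> (\<And>x. sat UNIV (x ## e) p \<Longrightarrow> sat UNIV ((x + 1) ## e) p)
      \<Longrightarrow> sat UNIV (x ## e) p"

section \<open>Semiring and order laws, by induction on explicit formulas\<close>

lemma pa_assoc: "(x + y) + z = x + (y + z)" for x y z :: "'a::pa"
  using pa_ind[of "x ## y ## (\<lambda>_. x)" "Eq (Pl (Pl (Var 1) (Var 2)) (Var 0)) (Pl (Var 1) (Pl (Var 2) (Var 0)))" z]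
  by (simp add: pa_add0 pa_addS numeral_2_eq_2)

lemma pa_0add: "0 + x = x" for x :: "'a::pa"
  using pa_ind[of "\<lambda>_. x" "Eq (Pl Zero (Var 0)) (Var 0)" x]
  by (simp add: pa_add0 pa_addS)

lemma pa_1add: "1 + x = x + 1" for x :: "'a::pa"
  using pa_ind[of "\<lambda>_. x" "Eq (Pl (Sc Zero) (Var 0)) (Pl (Var 0) (Sc Zero))" x]
  by (simp add: pa_add0 pa_addS pa_0add)

lemma pa_comm: "x + y = y + x" for x y :: "'a::pa"
  using pa_ind[of "\<lambda>_. x" "Eq (Pl (Var 1) (Var 0)) (Pl (Var 0) (Var 1))" y]
  by (simp add: pa_add0 pa_addS pa_0add) (metis pa_1add pa_addS pa_assoc)

lemma pa_cancel: "x + z = y + z \<Longrightarrow> x = y" for x y z :: "'a::pa"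
  using pa_ind[of "x ## y ## (\<lambda>_. x)" "Imp (Eq (Pl (Var 1) (Var 0)) (Pl (Var 2) (Var 0))) (Eq (Var 1) (Var 2))" z]
  by (simp add: pa_add0 pa_addS numeral_2_eq_2) (metis pa_S_inj)

lemma pa_lcancel: "z + x = z + y \<Longrightarrow> x = y" for x y z :: "'a::pa"
  using pa_cancel[of x z y] by (simp only: pa_comm)

lemma pa_distrib: "x * (y + z) = x * y + x * z" for x y z :: "'a::pa"
proof -
  have "x * (y + (z + 1)) = x * y + x * (z + 1)" if "x * (y + z) = x * y + x * z" for z
    by (subst pa_addS) (simp only: pa_multS that, rule pa_assoc)
  then show ?thesis
    using pa_ind[of "x ## y ## (\<lambda>_. x)" "Eq (Tm (Var 1) (Pl (Var 2) (Var 0))) (Pl (Tm (Var 1) (Var 2)) (Tm (Var 1) (Var 0)))" z]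
    by (simp add: pa_add0 pa_mult0 numeral_2_eq_2)
qed

lemma pa_0mult: "0 * x = 0" for x :: "'a::pa"
  using pa_ind[of "\<lambda>_. x" "Eq (Tm Zero (Var 0)) Zero" x]
  by (simp add: pa_add0 pa_mult0 pa_multS)

lemma pa_Smult: "(y + 1) * x = y * x + x" for x y :: "'a::pa"
proof -
  have "(y * x + y) + (x + 1) = (y * x + x) + (y + 1)" for x :: 'a
    by (metis pa_assoc pa_comm)
  then show ?thesis
    using pa_ind[of "\<lambda>_. y" "Eq (Tm (Sc (Var 1)) (Var 0)) (Pl (Tm (Var 1) (Var 0)) (Var 0))" x]
    by (simp add: pa_add0 pa_mult0 pa_multS)
qed

lemma pa_mcomm: "x * y = y * x" for x y :: "'a::pa"
  using pa_ind[of "\<lambda>_. x" "Eq (Tm (Var 1) (Var 0)) (Tm (Var 0) (Var 1))" y]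
  by (simp add: pa_mult0 pa_multS pa_0mult pa_Smult)

lemma pa_massoc: "(x * y) * z = x * (y * z)" for x y z :: "'a::pa"
proof -
  have "(x * y) * (z + 1) = x * (y * (z + 1))" if "(x * y) * z = x * (y * z)" for z
    by (simp only: pa_multS that) (simp only: pa_distrib)
  then show ?thesis
    using pa_ind[of "x ## y ## (\<lambda>_. x)" "Eq (Tm (Tm (Var 1) (Var 2)) (Var 0)) (Tm (Var 1) (Tm (Var 2) (Var 0)))" z]
    by (simp add: pa_mult0 numeral_2_eq_2)
qed

lemma pa_1mult: "1 * x = x" for x :: "'a::pa"
  using pa_Smult[of 0 x] by (simp add: pa_0add pa_0mult)

lemma pa_cases: "x = 0 \<or> (\<exists>y. x = y + 1)" for x :: "'a::pa"
  using pa_ind[of "\<lambda>_. x" "Imp (Neg (Eq (Var 0) Zero)) (Ex (Eq (Var 1) (Sc (Var 0))))" x] by auto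

lemma pa_le_iff: "x \<le> y \<longleftrightarrow> (\<exists>z. y = x + z)" for x y :: "'a::pa"
  unfolding pa_le pa_less using pa_cases by (metis pa_add0)

lemma pa_tri: "x < y \<or> x = y \<or> y < x" for x y :: "'a::pa"
proof -
  define P where "P x \<longleftrightarrow> x < y \<or> x = y \<or> y < x" for x
  let ?p = "Imp (Neg (Lt (Var 0) (Var 1))) (Imp (Neg (Eq (Var 0) (Var 1))) (Lt (Var 1) (Var 0)))"
  have eq: "sat UNIV (x ## (\<lambda>_. y)) ?p = P x" for x
    by (simp only: sat.simps sat_defs tval.simps scons_0 scons_1 P_def) blast
  have 0: "0 < y \<or> 0 = y" using pa_cases[of y] by (auto simp: pa_less pa_0add)
  have "P (x + 1)" if "P x" for x
    using that unfolding P_def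
  proof (elim disjE)
    assume "x < y"
    then obtain z where z: "x + (z + 1) = y" by (auto simp: pa_less)
    from pa_cases[of z] show "x + 1 < y \<or> x + 1 = y \<or> y < x + 1"
    proof
      assume "z = 0" then show "x + 1 < y \<or> x + 1 = y \<or> y < x + 1" using z by (simp add: pa_0add)
    next
      assume "\<exists>w. z = w + 1"
      then obtain w where "z = w + 1" by blast
      then have "(x + 1) + (w + 1) = y" using z by (metis pa_assoc pa_comm)
      then show "x + 1 < y \<or> x + 1 = y \<or> y < x + 1" by (auto simp: pa_less)
    qed
  next
    assume "x = y"
    then have "y + (0 + 1) = x + 1" by (simp add: pa_0add)
    then show "x + 1 < y \<or> x + 1 = y \<or> y < x + 1" unfolding pa_less by blast
  next
    assume "y < x"
    then obtain z where "y + (z + 1) = x" by (auto simp: pa_less)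
    then have "y + ((z + 1) + 1) = x + 1" by (metis pa_addS)
    then show "x + 1 < y \<or> x + 1 = y \<or> y < x + 1" unfolding pa_less by blast
  qed
  moreover have "P 0" using 0 by (auto simp: P_def)
  ultimately have "P x" using pa_ind[of "\<lambda>_. y" ?p x] unfolding eq by blast
  then show ?thesis by (simp only: P_def)
qed

lemma pa_add_eq0: "x + y = 0 \<Longrightarrow> x = 0" for x y :: "'a::pa"
  using pa_cases[of y] by (metis pa_S_nz pa_add0 pa_addS)

lemma pa_add_self: "x + y = x \<Longrightarrow> y = 0" for x y :: "'a::pa"
  by (metis pa_cancel pa_comm pa_0add)

lemma pa_diff: "(x + y) - x = y" for x y :: "'a::pa"
proof -
  have "(THE z. x + y = x + z) = y"
    by (rule the_equality) (use pa_cancel pa_comm in metis)+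
  then show ?thesis unfolding pa_minus by auto
qed

lemma pa_diff0: "\<not> y \<le> x \<Longrightarrow> x - y = 0" for x y :: "'a::pa"
  unfolding pa_minus pa_le_iff by auto

instance pa \<subseteq> linorder
proof
  fix x y z :: 'a
  have irr: "\<not> x < x" for x :: 'a
    using pa_add_self pa_S_nz unfolding pa_less by blast
  have tr: "x \<le> y \<Longrightarrow> y \<le> z \<Longrightarrow> x \<le> z" for x y z :: 'a
    unfolding pa_le_iff by (metis pa_assoc)
  show as: "x \<le> y \<Longrightarrow> y \<le> x \<Longrightarrow> x = y" for x y :: 'a
    unfolding pa_le_iff by (metis pa_assoc pa_add_self pa_add_eq0 pa_add0)
  show "x < y \<longleftrightarrow> x \<le> y \<and> \<not> y \<le> x"
    using irr as by (metis pa_le)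
  show "x \<le> x" by (simp add: pa_le)
  show "x \<le> y \<Longrightarrow> y \<le> z \<Longrightarrow> x \<le> z" by (rule tr)
  show "x \<le> y \<or> y \<le> x" using pa_tri by (auto simp: pa_le)
qed

lemma pa_0diff: "0 - x = 0" for x :: "'a::pa"
proof (cases "x \<le> 0")
  case True
  then have "x = 0" using pa_add_eq0 by (metis pa_le_iff)
  then show ?thesis using pa_diff[of 0 0] by (simp add: pa_0add)
qed (rule pa_diff0)

lemma pa_diff_diff: "a - b - c = a - (b + c)" for a b c :: "'a::pa"
proof (cases "b \<le> a")
  case True
  then obtain d where d: "a = b + d" by (auto simp: pa_le_iff)
  show ?thesis
  proof (cases "c \<le> d")
    case True
    then obtain f where f: "d = c + f" by (auto simp: pa_le_iff)
    have "a = (b + c) + f" by (simp only: d f pa_assoc)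
    then have "a - (b + c) = f" by (simp only: pa_diff)
    moreover have "a - b - c = f" by (simp only: d f pa_diff)
    ultimately show ?thesis by simp
  next
    case False
    have "\<not> b + c \<le> a"
    proof
      assume "b + c \<le> a"
      then obtain f where "b + d = (b + c) + f" by (auto simp: pa_le_iff d)
      then have "b + d = b + (c + f)" by (simp only: pa_assoc)
      then have "d = c + f" by (rule pa_lcancel)
      then show False using False by (auto simp: pa_le_iff)
    qed
    then show ?thesis using False by (simp add: d pa_diff pa_diff0)
  qed
next
  case False
  have "\<not> b + c \<le> a"
  proof
    assume "b + c \<le> a"
    then obtain f where "a = (b + c) + f" by (auto simp: pa_le_iff)
    then have "a = b + (c + f)" by (simp only: pa_assoc)
    then show False using False by (auto simp: pa_le_iff)
  qed
  then show ?thesis using False by (simp add: pa_diff0 pa_0diff)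
qed

lemma pa_add_le: "c + a \<le> c + b \<longleftrightarrow> a \<le> b" for a b c :: "'a::pa"
proof
  assume "c + a \<le> c + b"
  then obtain d where "c + b = (c + a) + d" by (auto simp: pa_le_iff)
  then have "c + b = c + (a + d)" by (simp only: pa_assoc)
  then have "b = a + d" by (rule pa_lcancel)
  then show "a \<le> b" by (auto simp: pa_le_iff)
next
  assume "a \<le> b"
  then obtain d where "b = a + d" by (auto simp: pa_le_iff)
  then have "c + b = (c + a) + d" by (simp only: pa_assoc)
  then show "c + a \<le> c + b" unfolding pa_le_iff by blast
qed

instance pa \<subseteq> ordered_cancel_comm_monoid_diff
proof
  fix a b c d :: 'a
  show "a + b + c = a + (b + c)" by (rule pa_assoc)
  show "a + b = b + a" by (rule pa_comm)
  show "0 + a = a" by (rule pa_0add)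
  show "a + b - a = b" by (rule pa_diff)
  show "a \<le> b \<longleftrightarrow> (\<exists>c. b = a + c)" by (rule pa_le_iff)
  show "a \<le> b \<Longrightarrow> c + a \<le> c + b" by (simp add: pa_add_le)
  show "c + a \<le> c + b \<Longrightarrow> a \<le> b" by (simp add: pa_add_le)
  show "a - b - c = a - (b + c)" by (rule pa_diff_diff)
  show "0 - a = 0" by (rule pa_0diff)
qed

instance pa \<subseteq> discrete_linordered_semidom
proof
  fix a b c :: 'a
  show "a * b * c = a * (b * c)" by (rule pa_massoc)
  show "a * b = b * a" by (rule pa_mcomm)
  show "1 * a = a" by (rule pa_1mult)
  show "(a + b) * c = a * c + b * c"
    by (subst pa_mcomm, subst pa_distrib) (simp only: pa_mcomm)
  show "a * (b + c) = a * b + a * c" by (rule pa_distrib)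
  show "0 * a = 0" by (rule pa_0mult)
  show "a * 0 = 0" by (rule pa_mult0)
  show n01: "(0::'a) \<noteq> 1" using pa_S_nz[of "0::'a"] by (simp only: pa_0add)
  show "(0::'a) < 1" unfolding pa_less by (rule exI[of _ 0]) simp
  have pos: "a * b \<noteq> 0" if an: "a \<noteq> 0" and bn: "b \<noteq> 0" for a b :: 'a
  proof
    assume 0: "a * b = 0"
    obtain c where "b = c + 1" using pa_cases[of b] bn by blast
    then have "a * c + a = 0" using 0 by (simp only: pa_multS)
    then have "a + a * c = 0" by (simp only: add.commute)
    then show False using an pa_add_eq0 by blast
  qed
  show "a \<noteq> 0 \<Longrightarrow> b \<noteq> 0 \<Longrightarrow> a * b \<noteq> 0" by (rule pos)
  have lt: "x < y \<longleftrightarrow> (\<exists>d. d \<noteq> 0 \<and> y = x + d)" for x y :: 'a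
  proof
    assume "x < y"
    then show "\<exists>d. d \<noteq> 0 \<and> y = x + d" using pa_S_nz unfolding pa_less by blast
  next
    assume "\<exists>d. d \<noteq> 0 \<and> y = x + d"
    then obtain d where "d \<noteq> 0" "y = x + d" by blast
    then show "x < y" using pa_cases[of d] unfolding pa_less by blast
  qed
  show "c * a < c * b" if ab: "a < b" and c: "0 < c"
  proof -
    obtain d where d: "d \<noteq> 0" "b = a + d" using ab lt by blast
    have "c \<noteq> 0" using c by blast
    then have "c * d \<noteq> 0" using d pos by blast
    moreover have "c * b = c * a + c * d" by (simp only: d pa_distrib)
    ultimately show ?thesis using lt by blast
  qed
  show "a < b \<longleftrightarrow> a + 1 \<le> b"
  proof -
    have "a + (z + 1) = (a + 1) + z" for z by (simp only: ac_simps)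
    then show ?thesis unfolding pa_less pa_le_iff by metis
  qed
  show "b \<le> a \<Longrightarrow> a - b + b = a" unfolding pa_le_iff by (auto simp: pa_diff add.commute)
  show "a * (b - c) = a * b - a * c"
  proof (cases "c \<le> b")
    case True
    then obtain d where "b = c + d" by (auto simp: pa_le_iff)
    then show ?thesis by (simp add: pa_distrib pa_diff)
  next
    case False
    then obtain d where "c = b + d" using linear[of b c] by (auto simp: pa_le_iff)
    then have "a * c = a * b + a * d" by (simp add: pa_distrib)
    moreover have "a * b - (a * b + a * d) = 0"
      using pa_diff_diff[of "a * b" "a * b" "a * d"] pa_diff[of "a * b" 0] by (simp add: pa_add0 pa_0diff)
    ultimately show ?thesis using False by (simp add: pa_diff0 pa_mult0)
  qed
qed

section \<open>Definability\<close>

named_theorems bd and fn and df and fd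

text \<open>\<open>BD\<close> are the predicates of an environment defined by bounded formulas, \<open>FN\<close> the functions with
  such a graph and a term as bound; \<open>DF\<close> and \<open>FD\<close> are the predicates and functions definable with
  parameters, which are placed at the odd positions of the environment.\<close>

definition TM :: "((nat \<Rightarrow> 'a::pa) \<Rightarrow> 'a) \<Rightarrow> bool" where
  "TM t \<longleftrightarrow> (\<exists>\<tau>. \<forall>e. t e = tval e \<tau>)"

definition BD :: "((nat \<Rightarrow> 'a::pa) \<Rightarrow> bool) \<Rightarrow> bool" where
  "BD A \<longleftrightarrow> (\<exists>\<phi>. bounded \<phi> \<and> (\<forall>e. sat UNIV e \<phi> = A e))"

definition FN :: "((nat \<Rightarrow> 'a::pa) \<Rightarrow> 'a) \<Rightarrow> bool" where
  "FN t \<longleftrightarrow> (\<exists>\<tau>. \<forall>e. t e \<le> tval e \<tau>) \<and> BD (\<lambda>e. e 0 = t (\<lambda>i. e (Suc i)))"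

lemma tvars_tsubst: "tvars (tsubst s t) = (\<Union>i\<in>tvars t. tvars (s i))"
  by (induction t) auto

lemma bounded_fsubst: "bounded p \<Longrightarrow> bounded (fsubst s p)"
proof (induction arbitrary: s rule: bounded.induct)
  case (5 t p)
  have "0 \<notin> tvars (tsubst (up s) t)"
    using 5(1) by (auto simp: tvars_tsubst up_def tlift_def intro!: gr0I split: nat.splits)
  then show ?case using 5 by (auto intro: bounded.intros)
qed (auto intro: bounded.intros)

lemma BD_ren: "BD A \<Longrightarrow> BD (\<lambda>e. A (\<lambda>i. e (r i)))"
proof -
  assume "BD A"
  then obtain \<phi> where "bounded \<phi>" "\<And>e. sat UNIV e \<phi> = A e" by (auto simp: BD_def)
  then have "bounded (fsubst (\<lambda>i. Var (r i)) \<phi>)"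
    and "sat UNIV e (fsubst (\<lambda>i. Var (r i)) \<phi>) = A (\<lambda>i. e (r i))" for e
    by (simp_all add: bounded_fsubst sat_fsubst)
  then show ?thesis unfolding BD_def by blast
qed

lemma BD_supp: "BD A \<Longrightarrow> \<exists>N. \<forall>e e'. (\<forall>i<N. e i = e' i) \<longrightarrow> A e = A e'"
proof -
  assume "BD A"
  then obtain \<phi> where \<phi>: "\<And>e. sat UNIV e \<phi> = A e" by (auto simp: BD_def)
  obtain N where "\<forall>i\<in>fvars \<phi>. i < N" using finite_nat_set_iff_bounded finite_fvars by blast
  then have "(\<forall>i<N. e i = e' i) \<longrightarrow> A e = A e'" for e e'
    using sat_cong[of \<phi> e e' UNIV] \<phi> by blast
  then show ?thesis by blast
qed

lemma BD_Imp [bd]: "BD A \<Longrightarrow> BD B \<Longrightarrow> BD (\<lambda>e. A e \<longrightarrow> B e)"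
  unfolding BD_def by (metis bounded.intros(4) sat.simps(4))

lemma BD_False [bd]: "BD (\<lambda>e. False)"
  unfolding BD_def by (intro exI[of _ Fls]) (auto intro: bounded.intros)

lemma BD_Not [bd]: "BD A \<Longrightarrow> BD (\<lambda>e. \<not> A e)"
  using BD_Imp[OF _ BD_False, of A] by simp

lemma BD_True [bd]: "BD (\<lambda>e. True)"
  using BD_Not[OF BD_False] by simp

lemma BD_And [bd]: "BD A \<Longrightarrow> BD B \<Longrightarrow> BD (\<lambda>e. A e \<and> B e)"
  using BD_Not[OF BD_Imp[OF _ BD_Not, of A B]] by simp

lemma BD_Or [bd]: "BD A \<Longrightarrow> BD B \<Longrightarrow> BD (\<lambda>e. A e \<or> B e)"
  using BD_Imp[OF BD_Not, of A B] by (simp add: disj_imp)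

lemma BD_Iff [bd]: "BD A \<Longrightarrow> BD B \<Longrightarrow> BD (\<lambda>e. A e \<longleftrightarrow> B e)"
  using BD_And[OF BD_Imp[of A B] BD_Imp[of B A]] by (simp add: iff_conv_conj_imp)

lemma BD_eq_tm: "TM t \<Longrightarrow> TM u \<Longrightarrow> BD (\<lambda>e. t e = u e)"
  unfolding BD_def TM_def using bounded.intros(2) sat.simps(2) by metis

lemma BD_less_tm: "TM t \<Longrightarrow> TM u \<Longrightarrow> BD (\<lambda>e. t e < u e)"
  unfolding BD_def TM_def using bounded.intros(3) sat.simps(3) by metis

lemma TM_var: "TM (\<lambda>e. e i)" and TM_0: "TM (\<lambda>e. 0)" and TM_1: "TM (\<lambda>e. 1)"
  unfolding TM_def by (rule exI[of _ "Var i"], simp, rule exI[of _ Zero], simp, rule exI[of _ "Sc Zero"], simp)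

lemma TM_add: "TM t \<Longrightarrow> TM u \<Longrightarrow> TM (\<lambda>e. t e + u e)"
  unfolding TM_def by (metis tval.simps(4))

lemma TM_mult: "TM t \<Longrightarrow> TM u \<Longrightarrow> TM (\<lambda>e. t e * u e)"
  unfolding TM_def by (metis tval.simps(5))

lemma TM_ren: "TM t \<Longrightarrow> TM (\<lambda>e. t (\<lambda>i. e (r i)))"
proof -
  assume "TM t"
  then obtain \<tau> where "\<And>e. t e = tval e \<tau>" by (auto simp: TM_def)
  then show ?thesis unfolding TM_def
    by (intro exI[of _ "tsubst (\<lambda>i. Var (r i)) \<tau>"]) (simp add: tval_tsubst)
qed

lemma BD_all_tm:
  assumes "TM t" "BD (\<lambda>e. A (e 0) (\<lambda>i. e (Suc i)))"
  shows "BD (\<lambda>e. \<forall>x<t e. A x e)"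
proof -
  obtain \<tau> \<phi> where t: "\<And>e. t e = tval e \<tau>" and p: "bounded \<phi>"
    "\<And>e. sat UNIV e \<phi> = A (e 0) (\<lambda>i. e (Suc i))"
    using assms by (auto simp: TM_def BD_def)
  have "0 \<notin> tvars (tlift \<tau>)" by (auto simp: tlift_def tvars_tsubst)
  then have "bounded (All (Imp (Lt (Var 0) (tlift \<tau>)) \<phi>))" using p(1) by (rule bounded.intros)
  moreover have "sat UNIV e (All (Imp (Lt (Var 0) (tlift \<tau>)) \<phi>)) = (\<forall>x<t e. A x e)" for e
    using p(2)[of "_ ## e"] by (simp add: t)
  ultimately show ?thesis unfolding BD_def by blast
qed

lemma BD_ex_tm:
  assumes "TM t" "BD (\<lambda>e. A (e 0) (\<lambda>i. e (Suc i)))"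
  shows "BD (\<lambda>e. \<exists>x<t e. A x e)"
  using BD_Not[OF BD_all_tm[OF assms(1) BD_Not[OF assms(2)]]] by simp

text \<open>The value of \<open>t\<close> is introduced by an existential quantifier, which is
  bounded because a term bounds \<open>t\<close>. This is why \<open>FN\<close> asks for a term as
  bound besides a bounded graph.\<close>

lemma BD_ins:
  assumes "FN t" "BD A"
  shows "BD (\<lambda>e. A (t e ## e))"
proof -
  obtain \<tau> where \<tau>: "\<And>e. t e \<le> tval e \<tau>" using assms(1) by (auto simp: FN_def)
  have 1: "TM (\<lambda>e. tval e \<tau> + 1)" by (intro TM_add TM_1) (auto simp: TM_def)
  have "BD (\<lambda>e. \<exists>x<tval e \<tau> + 1. x = t e \<and> A (x ## e))"
    by (rule BD_ex_tm[OF 1], rule BD_And) (use assms FN_def in \<open>auto simp: scons_eta\<close>)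
  also have "(\<lambda>e. \<exists>x<tval e \<tau> + 1. x = t e \<and> A (x ## e)) = (\<lambda>e. A (t e ## e))"
    using \<tau> by (auto simp: less_iff_succ_less_eq)
  finally show ?thesis .
qed

lemma FN_ren: "FN t \<Longrightarrow> FN (\<lambda>e. t (\<lambda>i. e (r i)))"
proof -
  assume a: "FN t"
  then obtain \<tau> where \<tau>: "\<And>e. t e \<le> tval e \<tau>" by (auto simp: FN_def)
  have "t (\<lambda>i. e (r i)) \<le> tval e (tsubst (\<lambda>i. Var (r i)) \<tau>)" for e
    using \<tau>[of "\<lambda>i. e (r i)"] by (simp add: tval_tsubst)
  moreover have "BD (\<lambda>e. e 0 = t (\<lambda>i. e (Suc i)))" using a by (simp add: FN_def)
  from BD_ren[OF this, of "\<lambda>i. case i of 0 \<Rightarrow> 0 | Suc j \<Rightarrow> Suc (r j)"]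
  have "BD (\<lambda>e. e 0 = t (\<lambda>i. e (Suc (r i))))" by simp
  ultimately show ?thesis unfolding FN_def by blast
qed

text \<open>Simultaneous substitution is obtained by inserting one function value after the other in
  front of the environment; only the first \<open>N\<close> positions matter.\<close>

lemma subst_iter:
  fixes Q :: "((nat \<Rightarrow> 'a) \<Rightarrow> bool) \<Rightarrow> bool"
  assumes ren: "\<And>A r. Q A \<Longrightarrow> Q (\<lambda>e. A (\<lambda>i. e (r i)))"
    and ins: "\<And>A k i. Q A \<Longrightarrow> Q (\<lambda>e. A (t i (\<lambda>j. e (j + k)) ## e))"
    and supp: "\<And>e e'. (\<forall>i<N. e i = e' i) \<Longrightarrow> A e = A e'"
    and A: "Q A"
  shows "Q (\<lambda>e. A (\<lambda>i. t i e))"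
proof -
  \<comment> \<open>In \<open>E k\<close> the first \<open>k\<close> values already stand in front
    of the environment, in reverse order, and the original environment starts at position
    \<open>k\<close>. The recursion runs downwards, from \<open>E N\<close>, a mere renaming of
    \<open>A\<close>, to \<open>E 0\<close>, where all substitutions are done.\<close>
  define E where "E k e = A (\<lambda>i. if i < k then e (k - 1 - i) else if i < N then t i (\<lambda>j. e (j + k)) else e 0)" for k e
  have EN: "Q (E N)"
  proof -
    have "E N e = A (\<lambda>i. e (N - 1 - i))" for e
      unfolding E_def by (rule supp) simp
    then have "E N = (\<lambda>e. A (\<lambda>i. e (N - 1 - i)))" by blast
    then show ?thesis using ren[OF A, of "\<lambda>i. N - 1 - i"] by simp
  qed
  have step: "Q (E k)" if "Q (E (Suc k))" "k < N" for k
  proof -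
    have "E k e = E (Suc k) (t k (\<lambda>j. e (j + k)) ## e)" for e
      unfolding E_def using that(2)
      by (intro supp) (auto simp: scons_def less_Suc_eq split: nat.split intro!: arg_cong[where f = e])
    then have "E k = (\<lambda>e. E (Suc k) (t k (\<lambda>j. e (j + k)) ## e))" by blast
    then show ?thesis using ins[OF that(1), of k k] by simp
  qed
  have "Q (E (N - m))" if "m \<le> N" for m
    using that
  proof (induction m)
    case (Suc m)
    then show ?case using step[of "N - Suc m"] by (simp add: Suc_diff_Suc)
  qed (simp add: EN)
  from this[of N] have "Q (E 0)" by simp
  moreover have "E 0 = (\<lambda>e. A (\<lambda>i. t i e))"
    unfolding E_def by (rule ext, rule supp) simp
  ultimately show ?thesis by simp
qed

lemma BD_subst: "BD A \<Longrightarrow> (\<And>i. FN (t i)) \<Longrightarrow> BD (\<lambda>e. A (\<lambda>i. t i e))"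
proof -
  assume A: "BD A" and t: "\<And>i. FN (t i)"
  obtain N where N: "\<And>e e'. (\<forall>i<N. e i = e' i) \<Longrightarrow> A e = A e'" using BD_supp[OF A] by blast
  show ?thesis
  proof (rule subst_iter[where Q = BD and A = A and t = t and N = N])
    show "BD (\<lambda>e. A (\<lambda>i. e (r i)))" if "BD A" for A r using that by (rule BD_ren)
    show "BD (\<lambda>e. A (t i (\<lambda>j. e (j + k)) ## e))" if "BD A" for A k i
      by (rule BD_ins[OF FN_ren[OF t, of i "\<lambda>j. j + k"] that])
  qed (use N A in blast)+
qed

lemma TM_FN: "TM t \<Longrightarrow> FN t"
  unfolding FN_def
  using BD_eq_tm[OF TM_var[of 0] TM_ren[of t Suc]] by (auto simp: TM_def)

lemma tval_mono: "(\<And>i. e i \<le> e' i) \<Longrightarrow> tval e \<tau> \<le> tval e' \<tau>" for e :: "nat \<Rightarrow> 'a::pa"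
  by (induction \<tau>) (auto intro: add_mono mult_mono)

lemma FN_comp: "FN f \<Longrightarrow> (\<And>i. FN (t i)) \<Longrightarrow> FN (\<lambda>e. f (\<lambda>i. t i e))"
proof -
  assume f: "FN f" and t: "\<And>i. FN (t i)"
  obtain \<sigma> where \<sigma>: "\<And>e. f e \<le> tval e \<sigma>" using f by (auto simp: FN_def)
  have "\<forall>i. \<exists>\<tau>. \<forall>e. t i e \<le> tval e \<tau>" using t by (auto simp: FN_def)
  then obtain \<tau> where \<tau>: "\<And>i e. t i e \<le> tval e (\<tau> i)" by metis
  have "f (\<lambda>i. t i e) \<le> tval e (tsubst \<tau> \<sigma>)" for e
    using order_trans[OF \<sigma> tval_mono[of "\<lambda>i. t i e" "\<lambda>i. tval e (\<tau> i)" \<sigma>]] \<tau> by (simp add: tval_tsubst)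
  moreover have "BD (\<lambda>e. (\<lambda>e. e 0 = f (\<lambda>i. e (Suc i))) (\<lambda>i. case i of 0 \<Rightarrow> e 0 | Suc j \<Rightarrow> t j (\<lambda>i. e (Suc i))))"
  proof (rule BD_subst)
    show "BD (\<lambda>e. e 0 = f (\<lambda>i. e (Suc i)))" using f by (simp add: FN_def)
    show "FN (\<lambda>e. case i of 0 \<Rightarrow> e 0 | Suc j \<Rightarrow> t j (\<lambda>i. e (Suc i)))" for i
      by (cases i) (simp_all add: TM_FN TM_var FN_ren[OF t])
  qed
  then have "BD (\<lambda>e. e 0 = f (\<lambda>i. t i (\<lambda>i. e (Suc i))))" by simp
  ultimately show ?thesis unfolding FN_def by blast
qed

text \<open>Padding with the head makes a property of all list members hold at every position, as
  the simultaneous substitution lemmas require.\<close>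

definition args :: "'b list \<Rightarrow> nat \<Rightarrow> 'b" where
  "args ts i = (if i < length ts then ts ! i else hd ts)"

lemma args_simps [simp]:
  "args (t # ts) 0 = t"
  "args (t # ts) (Suc 0) = (case ts of [] \<Rightarrow> t | u # us \<Rightarrow> u)"
  "args (t # ts) 2 = (case ts of u # v # us \<Rightarrow> v | _ \<Rightarrow> t)"
  "args (t # ts) 3 = (case ts of u # v # w # us \<Rightarrow> w | _ \<Rightarrow> t)"
  "args (t # ts) 4 = (case ts of u # v # w # x # us \<Rightarrow> x | _ \<Rightarrow> t)"
  by (auto simp: args_def numeral_eq_Suc split: list.splits)

lemma args_all: "ts \<noteq> [] \<Longrightarrow> \<forall>t\<in>set ts. P t \<Longrightarrow> P (args ts i)"
  by (auto simp: args_def)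

lemma BD1: "BD (\<lambda>e. P (e 0)) \<Longrightarrow> FN t \<Longrightarrow> BD (\<lambda>e. P (t e))"
  using BD_subst[of "\<lambda>e. P (e 0)" "args [t]"] args_all[of "[t]" FN] by simp

lemma BD2: "BD (\<lambda>e. P (e 0) (e 1)) \<Longrightarrow> FN t \<Longrightarrow> FN u \<Longrightarrow> BD (\<lambda>e. P (t e) (u e))"
  using BD_subst[of "\<lambda>e. P (e 0) (e 1)" "args [t, u]"] args_all[of "[t, u]" FN] by simp

lemma BD3: "BD (\<lambda>e. P (e 0) (e 1) (e 2)) \<Longrightarrow> FN t \<Longrightarrow> FN u \<Longrightarrow> FN v \<Longrightarrow> BD (\<lambda>e. P (t e) (u e) (v e))"
  using BD_subst[of "\<lambda>e. P (e 0) (e 1) (e 2)" "args [t, u, v]"] args_all[of "[t, u, v]" FN] by simp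

lemma BD4: "BD (\<lambda>e. P (e 0) (e 1) (e 2) (e 3)) \<Longrightarrow> FN t \<Longrightarrow> FN u \<Longrightarrow> FN v \<Longrightarrow> FN w \<Longrightarrow>
    BD (\<lambda>e. P (t e) (u e) (v e) (w e))"
  using BD_subst[of "\<lambda>e. P (e 0) (e 1) (e 2) (e 3)" "args [t, u, v, w]"] args_all[of "[t, u, v, w]" FN] by simp

lemma BD5: "BD (\<lambda>e. P (e 0) (e 1) (e 2) (e 3) (e 4)) \<Longrightarrow> FN t \<Longrightarrow> FN u \<Longrightarrow> FN v \<Longrightarrow> FN w \<Longrightarrow> FN x \<Longrightarrow>
    BD (\<lambda>e. P (t e) (u e) (v e) (w e) (x e))"
  using BD_subst[of "\<lambda>e. P (e 0) (e 1) (e 2) (e 3) (e 4)" "args [t, u, v, w, x]"]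
    args_all[of "[t, u, v, w, x]" FN] by simp

lemma FN1: "FN (\<lambda>e. f (e 0)) \<Longrightarrow> FN t \<Longrightarrow> FN (\<lambda>e. f (t e))"
  using FN_comp[of "\<lambda>e. f (e 0)" "args [t]"] args_all[of "[t]" FN] by simp

lemma FN2: "FN (\<lambda>e. f (e 0) (e 1)) \<Longrightarrow> FN t \<Longrightarrow> FN u \<Longrightarrow> FN (\<lambda>e. f (t e) (u e))"
  using FN_comp[of "\<lambda>e. f (e 0) (e 1)" "args [t, u]"] args_all[of "[t, u]" FN] by simp

lemma FN3: "FN (\<lambda>e. f (e 0) (e 1) (e 2)) \<Longrightarrow> FN t \<Longrightarrow> FN u \<Longrightarrow> FN v \<Longrightarrow> FN (\<lambda>e. f (t e) (u e) (v e))"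
  using FN_comp[of "\<lambda>e. f (e 0) (e 1) (e 2)" "args [t, u, v]"] args_all[of "[t, u, v]" FN] by simp

lemma FN_var [fn]: "FN (\<lambda>e. e i)" and FN_0 [fn]: "FN (\<lambda>e. 0)" and FN_one [fn]: "FN (\<lambda>e. 1)"
  by (intro TM_FN TM_var TM_0 TM_1)+

lemma FN_add [fn]: "FN t \<Longrightarrow> FN u \<Longrightarrow> FN (\<lambda>e. t e + u e)"
  by (rule FN2[where f = "(+)", OF TM_FN[OF TM_add[OF TM_var TM_var]]])

lemma FN_mult [fn]: "FN t \<Longrightarrow> FN u \<Longrightarrow> FN (\<lambda>e. t e * u e)"
  by (rule FN2[where f = "(*)", OF TM_FN[OF TM_mult[OF TM_var TM_var]]])

lemma FN_of_nat [fn]: "FN (\<lambda>e. of_nat n)"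
  by (induction n) (auto intro: fn)

lemma FN_numeral [fn]: "FN (\<lambda>e. numeral w)"
  using FN_of_nat[of "numeral w"] by simp

lemma BD_eq [bd]: "FN t \<Longrightarrow> FN u \<Longrightarrow> BD (\<lambda>e. t e = u e)"
  by (rule BD2[where P = "(=)", OF BD_eq_tm[OF TM_var TM_var]])

lemma BD_less [bd]: "FN t \<Longrightarrow> FN u \<Longrightarrow> BD (\<lambda>e. t e < u e)"
  by (rule BD2[where P = "(<)", OF BD_less_tm[OF TM_var TM_var]])

lemma BD_le [bd]: "FN t \<Longrightarrow> FN u \<Longrightarrow> BD (\<lambda>e. t e \<le> u e)"
  unfolding le_less by (intro bd)

lemma BD_all [bd]:
  assumes "FN t" "BD (\<lambda>e. A (e 0) (\<lambda>i. e (Suc i)))"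
  shows "BD (\<lambda>e. \<forall>x<t e. A x e)"
proof -
  have "BD (\<lambda>e. \<forall>x<e 0. A x (\<lambda>i. e (Suc i)))"
    using BD_ren[OF assms(2), of "\<lambda>i. case i of 0 \<Rightarrow> 0 | Suc j \<Rightarrow> Suc (Suc j)"]
    by (intro BD_all_tm TM_var) simp
  from BD_ins[OF assms(1) this] show ?thesis by simp
qed

lemma BD_ex [bd]:
  assumes "FN t" "BD (\<lambda>e. A (e 0) (\<lambda>i. e (Suc i)))"
  shows "BD (\<lambda>e. \<exists>x<t e. A x e)"
  using BD_Not[OF BD_all[OF assms(1) BD_Not[OF assms(2)]]] by simp

lemma less_S_iff: "x < t + 1 \<longleftrightarrow> x \<le> t" for x t :: "'a::pa"
  by (simp add: less_iff_succ_less_eq)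

lemma BD_all_le [bd]: "FN t \<Longrightarrow> BD (\<lambda>e. A (e 0) (\<lambda>i. e (Suc i))) \<Longrightarrow> BD (\<lambda>e. \<forall>x\<le>t e. A x e)"
  using BD_all[of "\<lambda>e. t e + 1" A] by (simp add: less_S_iff FN_add FN_one)

lemma BD_ex_le [bd]: "FN t \<Longrightarrow> BD (\<lambda>e. A (e 0) (\<lambda>i. e (Suc i))) \<Longrightarrow> BD (\<lambda>e. \<exists>x\<le>t e. A x e)"
  using BD_ex[of "\<lambda>e. t e + 1" A] by (simp add: less_S_iff FN_add FN_one)

lemma FN_I:
  assumes "FN u" "\<And>e. t e \<le> u e" "BD (\<lambda>e. G (e 0) (\<lambda>i. e (Suc i)))" "\<And>y e. G y e \<longleftrightarrow> y = t e"
  shows "FN t"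
proof -
  obtain \<tau> where "\<And>e. u e \<le> tval e \<tau>" using assms(1) by (auto simp: FN_def)
  then have "\<forall>e. t e \<le> tval e \<tau>" using assms(2) order_trans by blast
  then show ?thesis using assms(3) unfolding FN_def assms(4) by blast
qed

section \<open>Definability with parameters and the induction principle\<close>

definition DF :: "((nat \<Rightarrow> 'a::pa) \<Rightarrow> bool) \<Rightarrow> bool" where
  "DF A \<longleftrightarrow> (\<exists>\<phi> c. \<forall>e. sat UNIV (\<lambda>i. if even i then e (i div 2) else c (i div 2)) \<phi> = A e)"

definition FD :: "((nat \<Rightarrow> 'a::pa) \<Rightarrow> 'a) \<Rightarrow> bool" where
  "FD t \<longleftrightarrow> DF (\<lambda>e. e 0 = t (\<lambda>i. e (Suc i)))"

lemma DF_I: "(\<And>e. sat UNIV (\<lambda>i. if even i then e (i div 2) else c (i div 2)) \<phi> = A e) \<Longrightarrow> DF A"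
  unfolding DF_def by blast

lemma BD_DF: "BD A \<Longrightarrow> DF A"
proof -
  assume "BD A"
  then obtain \<phi> where "\<And>e. sat UNIV e \<phi> = A e" by (auto simp: BD_def)
  then show ?thesis by (intro DF_I[of undefined "fsubst (\<lambda>i. Var (2 * i)) \<phi>"]) (simp add: sat_fsubst)
qed

lemma DF_Not [df]: "DF A \<Longrightarrow> DF (\<lambda>e. \<not> A e)"
  unfolding DF_def by (metis sat_defs(1))

lemma DF_Imp [df]:
  assumes "DF A" "DF B" shows "DF (\<lambda>e. A e \<longrightarrow> B e)"
proof -
  obtain \<phi> c where A: "\<And>e. sat UNIV (\<lambda>i. if even i then e (i div 2) else c (i div 2)) \<phi> = A e"
    using assms(1) unfolding DF_def by blast
  obtain \<psi> d where B: "\<And>e. sat UNIV (\<lambda>i. if even i then e (i div 2) else d (i div 2)) \<psi> = B e"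
    using assms(2) unfolding DF_def by blast
  \<comment> \<open>The two parameter sequences are interleaved: odd position 2m + 1 moves to 4m + 1
    in the first formula and to 4m + 3 in the second.\<close>
  let ?r = "\<lambda>k i. Var (if even i then i else 4 * (i div 2) + k)"
  let ?c = "\<lambda>i. if even i then c (i div 2) else d (i div 2)"
  have 1: "(4 * m + 1) div 2 = 2 * m" "(4 * m + 3) div 2 = 2 * m + 1"
    "odd (4 * m + 1)" "odd (4 * m + 3)"
    "odd m \<Longrightarrow> (m - 1) div 2 = m div 2" for m :: nat by presburger+
  have "(\<lambda>i. tval (\<lambda>i. if even i then e (i div 2) else ?c (i div 2)) (?r 1 i)) =
      (\<lambda>i. if even i then e (i div 2) else c (i div 2))" for e
    by (rule ext) (simp add: 1 del: One_nat_def)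
  moreover have "(\<lambda>i. tval (\<lambda>i. if even i then e (i div 2) else ?c (i div 2)) (?r 3 i)) =
      (\<lambda>i. if even i then e (i div 2) else d (i div 2))" for e
    by (rule ext) (simp add: 1 del: One_nat_def)
  ultimately show ?thesis
    by (intro DF_I[of ?c "Imp (fsubst (?r 1) \<phi>) (fsubst (?r 3) \<psi>)"]) (simp only: sat.simps sat_fsubst A B)
qed

lemma DF_And [df]: "DF A \<Longrightarrow> DF B \<Longrightarrow> DF (\<lambda>e. A e \<and> B e)"
  using DF_Not[OF DF_Imp[OF _ DF_Not, of A B]] by simp

lemma DF_Or [df]: "DF A \<Longrightarrow> DF B \<Longrightarrow> DF (\<lambda>e. A e \<or> B e)"
  using DF_Imp[OF DF_Not, of A B] by (simp add: disj_imp)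

lemma DF_Iff [df]: "DF A \<Longrightarrow> DF B \<Longrightarrow> DF (\<lambda>e. A e \<longleftrightarrow> B e)"
  using DF_And[OF DF_Imp[of A B] DF_Imp[of B A]] by (simp add: iff_conv_conj_imp)

lemma DF_const [df]: "DF (\<lambda>e. P)"
  by (cases P) (simp_all add: BD_DF bd)

lemma DF_Ex [df]:
  assumes "DF (\<lambda>e. A (e 0) (\<lambda>i. e (Suc i)))" shows "DF (\<lambda>e. \<exists>x. A x e)"
proof -
  obtain \<phi> c where A: "\<And>e. sat UNIV (\<lambda>i. if even i then e (i div 2) else c (i div 2)) \<phi> = A (e 0) (\<lambda>i. e (Suc i))"
    using assms unfolding DF_def by blast
  let ?s = "\<lambda>i. Var (if i = 0 then 0 else if even i then i - 1 else i + 1)"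
  have "(\<lambda>i. tval (x ## (\<lambda>i. if even i then e (i div 2) else c (i div 2))) (?s i)) =
     (\<lambda>i. if even i then (x ## e) (i div 2) else c (i div 2))" for x e
  proof
    fix i :: nat
    have "i = 0 \<or> (\<exists>m. i = Suc (Suc (2 * m))) \<or> (\<exists>m. i = Suc (2 * m))" by presburger
    then consider "i = 0" | m where "i = Suc (Suc (2 * m))" | m where "i = Suc (2 * m)" by blast
    then show "tval (x ## (\<lambda>i. if even i then e (i div 2) else c (i div 2))) (?s i) =
      (if even i then (x ## e) (i div 2) else c (i div 2))"
      by cases (auto simp: scons_def split: nat.split)
  qed
  then show ?thesis
    by (intro DF_I[of c "Ex (fsubst ?s \<phi>)"]) (simp only: sat_defs sat_fsubst A scons_0 scons_o_Suc UNIV_I bex_UNIV)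
qed

lemma DF_All [df]: "DF (\<lambda>e. A (e 0) (\<lambda>i. e (Suc i))) \<Longrightarrow> DF (\<lambda>e. \<forall>x. A x e)"
  using DF_Not[OF DF_Ex[of "\<lambda>x e. \<not> A x e", OF DF_Not]] by simp

lemma DF_ren: "DF A \<Longrightarrow> DF (\<lambda>e. A (\<lambda>i. e (r i)))"
proof -
  assume "DF A"
  then obtain \<phi> c where A: "\<And>e. sat UNIV (\<lambda>i. if even i then e (i div 2) else c (i div 2)) \<phi> = A e"
    unfolding DF_def by blast
  let ?s = "\<lambda>i. Var (if even i then 2 * r (i div 2) else i)"
  have "(\<lambda>i. tval (\<lambda>i. if even i then e (i div 2) else c (i div 2)) (?s i)) =
     (\<lambda>i. if even i then e (r (i div 2)) else c (i div 2))" for e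
    by auto
  then show ?thesis
    using A[of "\<lambda>i. _ (r i)"] by (intro DF_I[of c "fsubst ?s \<phi>"]) (simp only: sat_fsubst)
qed

lemma DF_supp: "DF A \<Longrightarrow> \<exists>N. \<forall>e e'. (\<forall>i<N. e i = e' i) \<longrightarrow> A e = A e'"
proof -
  assume "DF A"
  then obtain \<phi> c where A: "\<And>e. sat UNIV (\<lambda>i. if even i then e (i div 2) else c (i div 2)) \<phi> = A e"
    unfolding DF_def by blast
  obtain N where N: "\<forall>i\<in>fvars \<phi>. i < N" using finite_nat_set_iff_bounded finite_fvars by blast
  have "A e = A e'" if "\<forall>i<N. e i = e' i" for e e'
  proof -
    have "i div 2 < N" if "i \<in> fvars \<phi>" for i using N that by (meson div_le_dividend le_less_trans)
    then show ?thesis unfolding A[symmetric] using that by (intro sat_cong) auto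
  qed
  then show ?thesis by blast
qed

lemma DF_ins: "FD t \<Longrightarrow> DF A \<Longrightarrow> DF (\<lambda>e. A (t e ## e))"
  using DF_Ex[of "\<lambda>x e. x = t e \<and> A (x ## e)"] by (simp add: FD_def DF_And scons_eta)

lemma FD_ren: "FD t \<Longrightarrow> FD (\<lambda>e. t (\<lambda>i. e (r i)))"
  unfolding FD_def
  using DF_ren[of "\<lambda>e. e 0 = t (\<lambda>i. e (Suc i))" "\<lambda>i. case i of 0 \<Rightarrow> 0 | Suc j \<Rightarrow> Suc (r j)"] by simp

lemma DF_subst: "DF A \<Longrightarrow> (\<And>i. FD (t i)) \<Longrightarrow> DF (\<lambda>e. A (\<lambda>i. t i e))"
proof -
  assume A: "DF A" and t: "\<And>i. FD (t i)"
  obtain N where N: "\<And>e e'. (\<forall>i<N. e i = e' i) \<Longrightarrow> A e = A e'" using DF_supp[OF A] by blast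
  show ?thesis
  proof (rule subst_iter[where Q = DF and A = A and t = t and N = N])
    show "DF (\<lambda>e. A (\<lambda>i. e (r i)))" if "DF A" for A r using that by (rule DF_ren)
    show "DF (\<lambda>e. A (t i (\<lambda>j. e (j + k)) ## e))" if "DF A" for A k i
      by (rule DF_ins[OF FD_ren[OF t, of i "\<lambda>j. j + k"] that])
  qed (use N A in blast)+
qed

lemma FN_FD: "FN t \<Longrightarrow> FD t"
  by (simp add: FN_def FD_def BD_DF)

lemma FD_const [fd]: "FD (\<lambda>e. c)"
  unfolding FD_def by (rule DF_I[of "\<lambda>_. c" "Eq (Var 0) (Var 1)"]) auto

lemma FD_var [fd]: "FD (\<lambda>e. e i)" by (rule FN_FD[OF FN_var])

lemma FD_comp: "FD f \<Longrightarrow> (\<And>i. FD (t i)) \<Longrightarrow> FD (\<lambda>e. f (\<lambda>i. t i e))"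
proof -
  assume f: "FD f" and t: "\<And>i. FD (t i)"
  have "DF (\<lambda>e. (\<lambda>e. e 0 = f (\<lambda>i. e (Suc i))) (\<lambda>i. case i of 0 \<Rightarrow> e 0 | Suc j \<Rightarrow> t j (\<lambda>i. e (Suc i))))"
  proof (rule DF_subst)
    show "DF (\<lambda>e. e 0 = f (\<lambda>i. e (Suc i)))" using f by (simp add: FD_def)
    show "FD (\<lambda>e. case i of 0 \<Rightarrow> e 0 | Suc j \<Rightarrow> t j (\<lambda>i. e (Suc i)))" for i
      by (cases i) (simp_all add: FD_var FD_ren[OF t])
  qed
  then show ?thesis by (simp add: FD_def)
qed

lemma DF1: "DF (\<lambda>e. P (e 0)) \<Longrightarrow> FD t \<Longrightarrow> DF (\<lambda>e. P (t e))"
  using DF_subst[of "\<lambda>e. P (e 0)" "args [t]"] args_all[of "[t]" FD] by simp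

lemma DF2: "DF (\<lambda>e. P (e 0) (e 1)) \<Longrightarrow> FD t \<Longrightarrow> FD u \<Longrightarrow> DF (\<lambda>e. P (t e) (u e))"
  using DF_subst[of "\<lambda>e. P (e 0) (e 1)" "args [t, u]"] args_all[of "[t, u]" FD] by simp

lemma DF3: "DF (\<lambda>e. P (e 0) (e 1) (e 2)) \<Longrightarrow> FD t \<Longrightarrow> FD u \<Longrightarrow> FD v \<Longrightarrow> DF (\<lambda>e. P (t e) (u e) (v e))"
  using DF_subst[of "\<lambda>e. P (e 0) (e 1) (e 2)" "args [t, u, v]"] args_all[of "[t, u, v]" FD] by simp

lemma DF4: "DF (\<lambda>e. P (e 0) (e 1) (e 2) (e 3)) \<Longrightarrow> FD t \<Longrightarrow> FD u \<Longrightarrow> FD v \<Longrightarrow> FD w \<Longrightarrow>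
    DF (\<lambda>e. P (t e) (u e) (v e) (w e))"
  using DF_subst[of "\<lambda>e. P (e 0) (e 1) (e 2) (e 3)" "args [t, u, v, w]"] args_all[of "[t, u, v, w]" FD] by simp

lemma FD1: "FD (\<lambda>e. f (e 0)) \<Longrightarrow> FD t \<Longrightarrow> FD (\<lambda>e. f (t e))"
  using FD_comp[of "\<lambda>e. f (e 0)" "args [t]"] args_all[of "[t]" FD] by simp

lemma FD2: "FD (\<lambda>e. f (e 0) (e 1)) \<Longrightarrow> FD t \<Longrightarrow> FD u \<Longrightarrow> FD (\<lambda>e. f (t e) (u e))"
  using FD_comp[of "\<lambda>e. f (e 0) (e 1)" "args [t, u]"] args_all[of "[t, u]" FD] by simp

lemma FD3: "FD (\<lambda>e. f (e 0) (e 1) (e 2)) \<Longrightarrow> FD t \<Longrightarrow> FD u \<Longrightarrow> FD v \<Longrightarrow> FD (\<lambda>e. f (t e) (u e) (v e))"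
  using FD_comp[of "\<lambda>e. f (e 0) (e 1) (e 2)" "args [t, u, v]"] args_all[of "[t, u, v]" FD] by simp

lemma FD_I: "DF (\<lambda>e. G (e 0) (\<lambda>i. e (Suc i))) \<Longrightarrow> (\<And>y e. G y e \<longleftrightarrow> y = t e) \<Longrightarrow> FD t"
  by (simp add: FD_def)

lemma FD_add [fd]: "FD t \<Longrightarrow> FD u \<Longrightarrow> FD (\<lambda>e. t e + u e)"
  by (rule FD2[where f = "(+)", OF FN_FD[OF FN_add[OF FN_var FN_var]]])

lemma FD_mult [fd]: "FD t \<Longrightarrow> FD u \<Longrightarrow> FD (\<lambda>e. t e * u e)"
  by (rule FD2[where f = "(*)", OF FN_FD[OF FN_mult[OF FN_var FN_var]]])

lemma DF_eq [df]: "FD t \<Longrightarrow> FD u \<Longrightarrow> DF (\<lambda>e. t e = u e)"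
  by (rule DF2[where P = "(=)", OF BD_DF[OF BD_eq[OF FN_var FN_var]]])

lemma DF_less [df]: "FD t \<Longrightarrow> FD u \<Longrightarrow> DF (\<lambda>e. t e < u e)"
  by (rule DF2[where P = "(<)", OF BD_DF[OF BD_less[OF FN_var FN_var]]])

lemma DF_le [df]: "FD t \<Longrightarrow> FD u \<Longrightarrow> DF (\<lambda>e. t e \<le> u e)"
  by (rule DF2[where P = "(\<le>)", OF BD_DF[OF BD_le[OF FN_var FN_var]]])

text \<open>From here on induction is applied to predicates, not to formulas: \<open>df\<close> and
  \<open>fd\<close> derive definability from the shape of the predicate, and elements of the model
  may occur as parameters by \<open>FD_const\<close>.\<close>

lemma induct_DF:
  assumes "DF (\<lambda>e. P (e 0))" "P 0" "\<And>x. P x \<Longrightarrow> P (x + 1)"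
  shows "P x"
proof -
  obtain \<phi> c where P: "\<And>e. sat UNIV (\<lambda>i. if even i then e (i div 2) else c (i div 2)) \<phi> = P (e 0)"
    using assms(1) unfolding DF_def by blast
  define d where "d = (\<lambda>i. if even i then c (i div 2 - 1) else c (i div 2))"
  have "sat UNIV (y ## d) \<phi>' = P y" if "\<phi>' = fsubst (\<lambda>i. if i = 0 then Var 0 else Var (Suc i)) \<phi>" for y \<phi>'
  proof -
    have "(\<lambda>i. tval (y ## d) (if i = 0 then Var 0 else Var (Suc i))) =
      (\<lambda>i. if even i then (y ## (\<lambda>i. c i)) (i div 2) else c (i div 2))"
    proof
      fix i :: nat
      have "i = 0 \<or> (\<exists>m. i = Suc (Suc (2 * m))) \<or> (\<exists>m. i = Suc (2 * m))" by presburger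
    then consider "i = 0" | m where "i = Suc (Suc (2 * m))" | m where "i = Suc (2 * m)" by blast
      then show "tval (y ## d) (if i = 0 then Var 0 else Var (Suc i)) =
        (if even i then (y ## (\<lambda>i. c i)) (i div 2) else c (i div 2))"
        by cases (auto simp: d_def)
    qed
    then show ?thesis using P[of "y ## c"] by (simp add: that sat_fsubst)
  qed
  note eq = this[OF refl]
  show ?thesis
    using pa_ind[of d "fsubst (\<lambda>i. if i = 0 then Var 0 else Var (Suc i)) \<phi>" x] assms(2,3)
    unfolding eq by blast
qed

lemma least_DF:
  assumes "DF (\<lambda>e. P (e 0))" "P x"
  shows "\<exists>y. P y \<and> (\<forall>z<y. \<not> P z)"
proof (rule ccontr)
  assume n: "\<not> ?thesis"
  have "\<forall>z<y. \<not> P z" for y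
  proof (rule induct_DF[where P = "\<lambda>y. \<forall>z<y. \<not> P z"])
    show "DF (\<lambda>e. \<forall>z<e 0. \<not> P z)" by (intro df DF1[OF assms(1)] fd)
  next
    fix y assume "\<forall>z<y. \<not> P z"
    then show "\<forall>z<y + 1. \<not> P z" using n by (auto simp: less_S_iff le_less)
  qed simp
  then show False using assms(2) less_S_iff by blast
qed

lemma less_induct_DF:
  assumes "DF (\<lambda>e. P (e 0))" "\<And>x. (\<forall>y<x. P y) \<Longrightarrow> P x"
  shows "P x"
  using least_DF[OF DF_Not[OF assms(1)], of x] assms(2) by blast

section \<open>Coding of sets and sequences\<close>

lemma pa_pos_ge1: "x \<noteq> 0 \<Longrightarrow> 1 \<le> x" for x :: "'a::pa"
  using less_iff_succ_less_eq[of 0 x] by (simp add: zero_less_iff_neq_zero)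

lemma le_mult_self: "y \<noteq> 0 \<Longrightarrow> x \<le> x * y" for x y :: "'a::pa"
  using mult_left_mono[OF pa_pos_ge1, of y x] by simp

lemma square_ge: "x \<le> x * x" for x :: "'a::pa"
  using le_mult_self[of x x] by (cases "x = 0") auto

lemma dvd_le: "d dvd c \<Longrightarrow> c \<noteq> 0 \<Longrightarrow> d \<le> c" for d c :: "'a::pa"
  using le_mult_self by (auto simp: dvd_def)

lemma dvd_iff_bex: "d dvd c \<longleftrightarrow> (\<exists>q\<le>c. c = d * q)" for d c :: "'a::pa"
proof
  assume "d dvd c"
  then obtain q where q: "c = d * q" by (auto simp: dvd_def)
  show "\<exists>q\<le>c. c = d * q"
  proof (cases "d = 0")
    case True
    then show ?thesis using q by (intro exI[of _ 0]) simp
  next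
    case False
    then show ?thesis using q le_mult_self[of d q] by (metis mult.commute)
  qed
qed auto

lemma BD_dvd [bd]: "FN t \<Longrightarrow> FN u \<Longrightarrow> BD (\<lambda>e. t e dvd u e)"
  unfolding dvd_iff_bex by (rule BD2[where P = "\<lambda>x y. \<exists>q\<le>y. y = x * q"]) (intro bd fn)+

lemma DF_dvd [df]: "FD t \<Longrightarrow> FD u \<Longrightarrow> DF (\<lambda>e. t e dvd u e)"
  by (rule DF2[where P = "(dvd)", OF BD_DF[OF BD_dvd[OF FN_var FN_var]]])

definition lst :: "('a::pa \<Rightarrow> bool) \<Rightarrow> 'a" where
  "lst P = (if \<exists>y. P y \<and> (\<forall>z<y. \<not> P z) then (THE y. P y \<and> (\<forall>z<y. \<not> P z)) else 0)"

lemma lst_eq: "P y \<Longrightarrow> (\<And>z. z < y \<Longrightarrow> \<not> P z) \<Longrightarrow> lst P = y"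
proof -
  assume a: "P y" "\<And>z. z < y \<Longrightarrow> \<not> P z"
  then have "(THE y. P y \<and> (\<forall>z<y. \<not> P z)) = y"
    by (intro the_equality) (auto, metis linorder_neqE)
  then show ?thesis using a unfolding lst_def by auto
qed

lemma lst_works:
  assumes "DF (\<lambda>e. P (e 0))" "P x"
  shows "P (lst P)" "z < lst P \<Longrightarrow> \<not> P z" "lst P \<le> x"
proof -
  obtain y where "P y" "\<forall>z<y. \<not> P z" using least_DF[OF assms] by blast
  moreover from this have "lst P = y" by (intro lst_eq) auto
  ultimately show "P (lst P)" "z < lst P \<Longrightarrow> \<not> P z" "lst P \<le> x"
    using assms(2) by (auto simp: not_less[symmetric])
qed

lemma lst_graph: "y = lst P \<longleftrightarrow> (P y \<and> (\<forall>z<y. \<not> P z)) \<or> (\<not> (\<exists>y. P y \<and> (\<forall>z<y. \<not> P z)) \<and> y = 0)"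
proof (cases "\<exists>y. P y \<and> (\<forall>z<y. \<not> P z)")
  case True
  then obtain w where w: "P w" "\<forall>z<w. \<not> P z" by blast
  then have "lst P = w" by (intro lst_eq) auto
  moreover have "y = w" if "P y" "\<forall>z<y. \<not> P z" using that w linorder_neqE by blast
  ultimately show ?thesis using w by auto
next
  case False
  then have "lst P = 0" unfolding lst_def by (rule if_not_P)
  then show ?thesis using False by auto
qed

text \<open>The bound of the search also bounds its result, the default 0 included. Almost every
  element that has to be found inside the submodel is obtained as such a bounded search.\<close>

lemma FN_lst [fn]:
  assumes "FN t" "BD (\<lambda>e. A (e 0) (\<lambda>i. e (Suc i)))"
  shows "FN (\<lambda>e. lst (\<lambda>x. x < t e \<and> A x e))"
proof (rule FN_I[OF assms(1)])
  let ?P = "\<lambda>e x. x < t e \<and> A x e"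
  show "lst (\<lambda>x. x < t e \<and> A x e) \<le> t e" for e
    using lst_graph[of "lst (?P e)" "?P e"] by auto
  have t': "FN (\<lambda>e. t (\<lambda>i. e (r i)))" for r by (rule FN_ren[OF assms(1)])
  have A': "BD (\<lambda>e. A (e (r 0)) (\<lambda>i. e (r (Suc i))))" for r
    using BD_ren[OF assms(2), of r] by simp
  have t1: "FN (\<lambda>e. t (\<lambda>i. e (Suc i)))" and t2: "FN (\<lambda>e. t (\<lambda>i. e (Suc (Suc i))))"
    and t3: "FN (\<lambda>e. t (\<lambda>i. e (Suc (Suc (Suc i)))))"
    using t'[of Suc] t'[of "\<lambda>i. Suc (Suc i)"] t'[of "\<lambda>i. Suc (Suc (Suc i))"] by simp_all
  have A2: "BD (\<lambda>e. A (e 0) (\<lambda>i. e (Suc (Suc i))))"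
    using A'[of "\<lambda>i. case i of 0 \<Rightarrow> 0 | Suc j \<Rightarrow> Suc (Suc j)"] by simp
  have A3: "BD (\<lambda>e. A (e 0) (\<lambda>i. e (Suc (Suc (Suc i)))))"
    using A'[of "\<lambda>i. case i of 0 \<Rightarrow> 0 | Suc j \<Rightarrow> Suc (Suc (Suc j))"] by simp
  show "BD (\<lambda>e. (\<lambda>y e. (y < t e \<and> A y e \<and> (\<forall>z<y. \<not> (z < t e \<and> A z e))) \<or>
     (\<not> (\<exists>y<t e. A y e \<and> (\<forall>z<y. \<not> (z < t e \<and> A z e))) \<and> y = 0)) (e 0) (\<lambda>i. e (Suc i)))"
    by (intro bd t1 t2 t3 A2 A3 assms(2) fn)
  show "(y < t e \<and> A y e \<and> (\<forall>z<y. \<not> (z < t e \<and> A z e))) \<or>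
     (\<not> (\<exists>y<t e. A y e \<and> (\<forall>z<y. \<not> (z < t e \<and> A z e))) \<and> y = 0) \<longleftrightarrow> y = lst (?P e)" for y e
    unfolding lst_graph by blast
qed

lemma FD_lst [fd]: "DF (\<lambda>e. A (e 0) (\<lambda>i. e (Suc i))) \<Longrightarrow> FD (\<lambda>e. lst (\<lambda>x. A x e))"
proof (rule FD_I)
  assume a: "DF (\<lambda>e. A (e 0) (\<lambda>i. e (Suc i)))"
  have A2: "DF (\<lambda>e. A (e 0) (\<lambda>i. e (Suc (Suc i))))"
    using DF_ren[OF a, of "\<lambda>i. case i of 0 \<Rightarrow> 0 | Suc j \<Rightarrow> Suc (Suc j)"] by simp
  have A3: "DF (\<lambda>e. A (e 0) (\<lambda>i. e (Suc (Suc (Suc i)))))"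
    using DF_ren[OF a, of "\<lambda>i. case i of 0 \<Rightarrow> 0 | Suc j \<Rightarrow> Suc (Suc (Suc j))"] by simp
  show "DF (\<lambda>e. (\<lambda>y e. (A y e \<and> (\<forall>z<y. \<not> A z e)) \<or>
     (\<not> (\<exists>y. A y e \<and> (\<forall>z<y. \<not> A z e)) \<and> y = 0)) (e 0) (\<lambda>i. e (Suc i)))"
    by (intro df A2 A3 a fd)
  show "(A y e \<and> (\<forall>z<y. \<not> A z e)) \<or> (\<not> (\<exists>y. A y e \<and> (\<forall>z<y. \<not> A z e)) \<and> y = 0) \<longleftrightarrow>
     y = lst (\<lambda>x. A x e)" for y e
    unfolding lst_graph by blast
qed

text \<open>The square of x + y takes the place of the triangular number in Cantor's pairing, so
  that \<open>pair\<close> is a term and hence monotone. It is injective but not onto;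
  \<open>fstp\<close> and \<open>sndp\<close> are 0 outside its range.\<close>

definition pair :: "'a::pa \<Rightarrow> 'a \<Rightarrow> 'a" where
  "pair x y = (x + y) * (x + y) + x"

lemma pair_mono: "x \<le> x' \<Longrightarrow> y \<le> y' \<Longrightarrow> pair x y \<le> pair x' y'"
  unfolding pair_def by (intro add_mono mult_mono) auto

lemma le_pair1 [simp]: "x \<le> pair x y" and le_pair2 [simp]: "y \<le> pair x y"
proof -
  show "x \<le> pair x y" by (simp add: pair_def)
  have "y \<le> (x + y) * (x + y)" using square_ge[of "x + y"] order_trans[of y "x + y"] by simp
  then show "y \<le> pair x y" unfolding pair_def by (rule order_trans) simp
qed

lemma pair_less: "x + y < x' + y' \<Longrightarrow> pair x y < pair x' y'"
proof -
  define s where "s = x + y"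
  assume "x + y < x' + y'"
  then have "s + 1 \<le> x' + y'" by (simp add: s_def less_iff_succ_less_eq)
  then have "(s + 1) * (s + 1) \<le> (x' + y') * (x' + y')" by (intro mult_mono) auto
  also have "\<dots> \<le> pair x' y'" by (simp add: pair_def)
  finally have "s * s + s + (s + 1) \<le> pair x' y'" by (simp add: algebra_simps)
  moreover have "s * s + s + 1 \<le> s * s + s + (s + 1)" by simp
  moreover have "pair x y + 1 \<le> s * s + s + 1" by (simp add: pair_def s_def add_mono)
  ultimately show ?thesis unfolding less_iff_succ_less_eq by (meson order_trans)
qed

lemma pair_inj [simp]: "pair x y = pair x' y' \<longleftrightarrow> x = x' \<and> y = y'"
proof
  assume eq: "pair x y = pair x' y'"
  have s: "x + y = x' + y'"
    by (rule linorder_cases[of "x + y" "x' + y'"]) (use pair_less[of x y x' y'] pair_less[of x' y' x y] eq in auto)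
  then have "x = x'" using eq by (simp add: pair_def)
  then show "x = x' \<and> y = y'" using s by simp
qed simp

definition fstp :: "'a::pa \<Rightarrow> 'a" where
  "fstp q = (if \<exists>x y. q = pair x y then (THE x. \<exists>y. q = pair x y) else 0)"
definition sndp :: "'a::pa \<Rightarrow> 'a" where
  "sndp q = (if \<exists>x y. q = pair x y then (THE y. \<exists>x. q = pair x y) else 0)"

lemma fstp_pair [simp]: "fstp (pair x y) = x" and sndp_pair [simp]: "sndp (pair x y) = y"
  by (auto simp: fstp_def sndp_def)

lemma fstp_le [simp]: "fstp q \<le> q" and sndp_le [simp]: "sndp q \<le> q"
  by (cases "\<exists>x y. q = pair x y"; auto simp: fstp_def sndp_def)+

lemma FN_pair [fn]: "FN t \<Longrightarrow> FN u \<Longrightarrow> FN (\<lambda>e. pair (t e) (u e))"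
  unfolding pair_def by (intro fn)

lemma FD_pair [fd]: "FD t \<Longrightarrow> FD u \<Longrightarrow> FD (\<lambda>e. pair (t e) (u e))"
  unfolding pair_def by (intro fd)

lemma pair_bex: "(\<exists>x\<le>q. \<exists>z\<le>q. q = pair x z) \<longleftrightarrow> (\<exists>x z. q = pair x z)"
  and pair_bex1: "(\<exists>z\<le>q. q = pair y z) \<longleftrightarrow> (\<exists>z. q = pair y z)"
  and pair_bex2: "(\<exists>z\<le>q. q = pair z y) \<longleftrightarrow> (\<exists>z. q = pair z y)"
  by (metis le_pair1 le_pair2)+

lemma FN_fstp0: "FN (\<lambda>e. fstp (e 0))"
proof (rule FN_I[OF FN_var[of 0]])
  show "BD (\<lambda>e. (\<lambda>y e. (\<exists>z\<le>e 0. e 0 = pair y z) \<or> (\<not> (\<exists>x\<le>e 0. \<exists>z\<le>e 0. e 0 = pair x z) \<and> y = 0))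
     (e 0) (\<lambda>i. e (Suc i)))" by (intro bd fn)
  show "(\<exists>z\<le>e 0. e 0 = pair y z) \<or> (\<not> (\<exists>x\<le>e 0. \<exists>z\<le>e 0. e 0 = pair x z) \<and> y = 0) \<longleftrightarrow> y = fstp (e 0)" for y e
    unfolding pair_bex unfolding pair_bex1 by (cases "\<exists>x z. e 0 = pair x z") (auto, auto simp: fstp_def)
qed simp

lemma FN_sndp0: "FN (\<lambda>e. sndp (e 0))"
proof (rule FN_I[OF FN_var[of 0]])
  show "BD (\<lambda>e. (\<lambda>y e. (\<exists>z\<le>e 0. e 0 = pair z y) \<or> (\<not> (\<exists>x\<le>e 0. \<exists>z\<le>e 0. e 0 = pair x z) \<and> y = 0))
     (e 0) (\<lambda>i. e (Suc i)))" by (intro bd fn)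
  show "(\<exists>z\<le>e 0. e 0 = pair z y) \<or> (\<not> (\<exists>x\<le>e 0. \<exists>z\<le>e 0. e 0 = pair x z) \<and> y = 0) \<longleftrightarrow> y = sndp (e 0)" for y e
    unfolding pair_bex unfolding pair_bex2 by (cases "\<exists>x z. e 0 = pair x z") (auto, auto simp: sndp_def)
qed simp

lemma FN_fstp [fn]: "FN t \<Longrightarrow> FN (\<lambda>e. fstp (t e))" by (rule FN1[OF FN_fstp0])
lemma FN_sndp [fn]: "FN t \<Longrightarrow> FN (\<lambda>e. sndp (t e))" by (rule FN1[OF FN_sndp0])
lemma FD_fstp [fd]: "FD t \<Longrightarrow> FD (\<lambda>e. fstp (t e))" by (rule FD1[OF FN_FD[OF FN_fstp0]])
lemma FD_sndp [fd]: "FD t \<Longrightarrow> FD (\<lambda>e. sndp (t e))" by (rule FD1[OF FN_FD[OF FN_sndp0]])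

text \<open>Goedel's beta function: a set with elements below \<open>b\<close> is coded by \<open>b\<close>, a number \<open>d\<close> and
  a product of some of the pairwise coprime numbers \<open>1 + (x + 1) d\<close>.\<close>

definition mem :: "'a::pa \<Rightarrow> 'a \<Rightarrow> bool" where
  "mem x s \<longleftrightarrow> x < fstp s \<and> (1 + (x + 1) * sndp (sndp s)) dvd fstp (sndp s)"

lemma BD_mem [bd]: "FN t \<Longrightarrow> FN u \<Longrightarrow> BD (\<lambda>e. mem (t e) (u e))"
  unfolding mem_def by (intro bd fn) auto

lemma DF_mem [df]: "FD t \<Longrightarrow> FD u \<Longrightarrow> DF (\<lambda>e. mem (t e) (u e))"
  by (rule DF2[where P = mem, OF BD_DF[OF BD_mem[OF FN_var FN_var]]])

lemma mem_less: "mem x s \<Longrightarrow> x < s"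
  unfolding mem_def using fstp_le less_le_trans by blast

lemma add_dvd_cancel: "a dvd b + c \<Longrightarrow> a dvd b \<Longrightarrow> a dvd c" for a b c :: "'a::pa"
  by (simp add: dvd_add_right_iff)

text \<open>This stands in for the factorial of \<open>b\<close>, before recursion is available: the
  induction multiplies by the next number.\<close>

lemma common_multiple: "\<exists>m. m \<noteq> 0 \<and> (\<forall>i. 0 < i \<longrightarrow> i \<le> b \<longrightarrow> i dvd m)" for b :: "'a::pa"
proof (rule induct_DF[where P = "\<lambda>b. \<exists>m. m \<noteq> 0 \<and> (\<forall>i. 0 < i \<longrightarrow> i \<le> b \<longrightarrow> i dvd m)"])
  show "DF (\<lambda>e. \<exists>m. m \<noteq> (0::'a) \<and> (\<forall>i. 0 < i \<longrightarrow> i \<le> e 0 \<longrightarrow> i dvd m))" by (intro df fd)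
  show "\<exists>m. m \<noteq> (0::'a) \<and> (\<forall>i. 0 < i \<longrightarrow> i \<le> 0 \<longrightarrow> i dvd m)" by (intro exI[of _ 1]) auto
  fix x :: 'a assume "\<exists>m. m \<noteq> 0 \<and> (\<forall>i. 0 < i \<longrightarrow> i \<le> x \<longrightarrow> i dvd m)"
  then obtain m where m: "m \<noteq> 0" "\<And>i. 0 < i \<Longrightarrow> i \<le> x \<Longrightarrow> i dvd m" by blast
  have "i dvd m * (x + 1)" if i: "0 < i" "i \<le> x + 1" for i
  proof (cases "i = x + 1")
    case False
    then have "i < x + 1" using i(2) by (rule le_neq_trans[rotated])
    then have "i dvd m" using m(2) i(1) by (simp only: less_S_iff)
    then show ?thesis by (rule dvd_mult2)
  qed simp
  then show "\<exists>m. m \<noteq> 0 \<and> (\<forall>i. 0 < i \<longrightarrow> i \<le> x + 1 \<longrightarrow> i dvd m)"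
    using m(1) by (intro exI[of _ "m * (x + 1)"]) auto
qed

text \<open>Coprimality of \<open>?d x\<close> to \<open>m\<close> is used as the cancellation rule
  \<open>A\<close>, which holds since \<open>?d x\<close> divides y * ?d x = (x + 1) * (y * m) + y.
  The two moduli differ by k * m with 0 < k \<le> b, so \<open>?d x\<close> divides c * k * m; as k
  divides m, cancelling \<open>m\<close> twice leaves c.\<close>

lemma coprime_step:
  fixes m :: "'a::pa"
  assumes m: "\<And>i. 0 < i \<Longrightarrow> i \<le> b \<Longrightarrow> i dvd m" and x: "x < b" "j < b" "x \<noteq> j"
    and d: "(1 + (x + 1) * m) dvd c * (1 + (j + 1) * m)"
  shows "(1 + (x + 1) * m) dvd c"
proof -
  let ?d = "\<lambda>x. 1 + (x + 1) * m"
  have A: "?d x dvd y" if "?d x dvd y * m" for y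
  proof -
    have "y * ?d x = (x + 1) * (y * m) + y" by (simp add: algebra_simps)
    then have "?d x dvd (x + 1) * (y * m) + y" by (metis dvd_triv_right)
    then show ?thesis using dvd_mult[OF that, of "x + 1"] by (rule add_dvd_cancel)
  qed
  have "\<exists>k. 0 < k \<and> k \<le> b \<and> ?d x dvd c * k * m"
  proof (rule linorder_cases[of x j])
    assume "x < j"
    then obtain k where k: "j = x + k" using le_iff_add[of x j] less_imp_le by blast
    then have "c * ?d j = c * ?d x + c * k * m" by (simp add: algebra_simps)
    then have "?d x dvd c * k * m" using d by (metis add_dvd_cancel dvd_triv_right)
    moreover have "k \<le> j" "0 < k" using k \<open>x < j\<close> by (auto simp: zero_less_iff_neq_zero)
    ultimately show ?thesis using x(2) by (intro exI[of _ k]) auto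
  next
    assume "j < x"
    then obtain k where k: "x = j + k" using le_iff_add[of j x] less_imp_le by blast
    then have "c * ?d x = c * ?d j + c * k * m" by (simp add: algebra_simps)
    then have "?d x dvd c * k * m" using d by (metis add_dvd_cancel dvd_triv_right)
    moreover have "k \<le> x" "0 < k" using k \<open>j < x\<close> by (auto simp: zero_less_iff_neq_zero)
    ultimately show ?thesis using x(1) by (intro exI[of _ k]) auto
  qed (use x in simp)
  then obtain k where k: "0 < k" "k \<le> b" "?d x dvd c * k * m" by blast
  obtain m' where m': "m = k * m'" using m[OF k(1,2)] by (auto simp: dvd_def)
  have "?d x dvd c * k * m'" using A[OF k(3)] by (rule dvd_mult2)
  then have "?d x dvd c * m" by (simp only: m' mult.assoc)
  then show ?thesis by (rule A)
qed

theorem compr: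
  fixes b :: "'a::pa"
  assumes P: "DF (\<lambda>e. P (e 0))"
  shows "\<exists>s. \<forall>x. mem x s \<longleftrightarrow> x < b \<and> P x"
proof -
  obtain m where m0: "m \<noteq> 0" and m: "\<And>i. 0 < i \<Longrightarrow> i \<le> b \<Longrightarrow> i dvd m"
    using common_multiple[of b] by blast
  have "\<exists>c. \<forall>x. x < b \<longrightarrow> ((1 + (x + 1) * m) dvd c \<longleftrightarrow> x < j \<and> P x)" for j
  proof (rule induct_DF[where P = "\<lambda>j. \<exists>c. \<forall>x. x < b \<longrightarrow> ((1 + (x + 1) * m) dvd c \<longleftrightarrow> x < j \<and> P x)"])
    show "DF (\<lambda>e. \<exists>c. \<forall>x. x < b \<longrightarrow> ((1 + (x + 1) * m) dvd c \<longleftrightarrow> x < e 0 \<and> P x))"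
      by (intro df fd DF1[OF P])
    \<comment> \<open>The induction starts from the empty product 1, which must code the empty set;
      m \<noteq> 0 makes every modulus larger than 1.\<close>
    have "\<not> (1 + (x + 1) * m) dvd 1" for x
    proof
      assume "(1 + (x + 1) * m) dvd 1"
      then have "1 + (x + 1) * m \<le> 1 + 0" using dvd_le one_neq_zero by (simp only: add_0_right)
      then have "(x + 1) * m = 0" by (simp only: add_le_cancel_left le_zero_eq)
      then show False using m0 by simp
    qed
    then show "\<exists>c. \<forall>x. x < b \<longrightarrow> ((1 + (x + 1) * m) dvd c \<longleftrightarrow> x < 0 \<and> P x)"
      by (intro exI[of _ 1]) simp
    fix j assume "\<exists>c. \<forall>x. x < b \<longrightarrow> ((1 + (x + 1) * m) dvd c \<longleftrightarrow> x < j \<and> P x)"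
    then obtain c where c: "\<And>x. x < b \<Longrightarrow> (1 + (x + 1) * m) dvd c \<longleftrightarrow> x < j \<and> P x" by blast
    show "\<exists>c. \<forall>x. x < b \<longrightarrow> ((1 + (x + 1) * m) dvd c \<longleftrightarrow> x < j + 1 \<and> P x)"
    proof (cases "P j \<and> j < b")
      case True
      have "(1 + (x + 1) * m) dvd c * (1 + (j + 1) * m) \<longleftrightarrow> x < j + 1 \<and> P x" if "x < b" for x
      proof (cases "x = j")
        case False
        have "(1 + (x + 1) * m) dvd c * (1 + (j + 1) * m) \<longleftrightarrow> (1 + (x + 1) * m) dvd c"
          using coprime_step[OF m \<open>x < b\<close> _ False] True dvd_mult2 by blast
        then show ?thesis using c[OF that] False by (auto simp: less_S_iff le_less)
      qed (use True in \<open>simp add: less_S_iff\<close>)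
      then show ?thesis by blast
    next
      case False
      then have "x < j + 1 \<and> P x \<longleftrightarrow> x < j \<and> P x" if "x < b" for x
        using that by (auto simp: less_S_iff le_less)
      then show ?thesis using c by auto
    qed
  qed
  then obtain c where "\<And>x. x < b \<Longrightarrow> (1 + (x + 1) * m) dvd c \<longleftrightarrow> x < b \<and> P x" by blast
  then have "mem x (pair b (pair c m)) \<longleftrightarrow> x < b \<and> P x" for x by (auto simp: mem_def)
  then show ?thesis by blast
qed

theorem collection:
  fixes b :: "'a::pa"
  assumes P: "DF (\<lambda>e. P (e 0) (e 1))" and ex: "\<And>x. x < b \<Longrightarrow> \<exists>y. P x y"
  shows "\<exists>c. \<forall>x<b. \<exists>y<c. P x y"
proof -
  have "\<exists>c. \<forall>x<k. x < b \<longrightarrow> (\<exists>y<c. P x y)" for k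
  proof (rule induct_DF[where P = "\<lambda>k. \<exists>c. \<forall>x<k. x < b \<longrightarrow> (\<exists>y<c. P x y)"])
    show "DF (\<lambda>e. \<exists>c. \<forall>x<e 0. x < b \<longrightarrow> (\<exists>y<c. P x y))" by (intro df fd DF2[OF P])
    fix k assume "\<exists>c. \<forall>x<k. x < b \<longrightarrow> (\<exists>y<c. P x y)"
    then obtain c where c: "\<And>x. x < k \<Longrightarrow> x < b \<Longrightarrow> \<exists>y<c. P x y" by blast
    show "\<exists>c. \<forall>x<k + 1. x < b \<longrightarrow> (\<exists>y<c. P x y)"
    proof (cases "k < b")
      case True
      then obtain y where y: "P k y" using ex by blast
      have "\<exists>z<c + (y + 1). P x z" if xk: "x < k + 1" and xb: "x < b" for x
      proof (cases "x = k")
        case True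
        have "y < c + (y + 1)" by (simp add: less_iff_succ_less_eq)
        then show ?thesis using y True by blast
      next
        case False
        then have "x < k" using xk by (simp add: less_S_iff)
        then obtain z where "z < c" "P x z" using c xb by blast
        moreover from this have "z < c + (y + 1)" using less_le_trans[of z c "c + (y + 1)"] by simp
        ultimately show ?thesis by blast
      qed
      then show ?thesis by blast
    next
      case False
      then have "x < k" if "x < k + 1" "x < b" for x using that by (auto simp: less_S_iff le_less)
      then show ?thesis using c by blast
    qed
  qed simp
  from this[of b] show ?thesis by blast
qed

text \<open>A coded relation is made single-valued by taking the least value. Searching below the
  code \<open>f\<close> loses nothing, because members of a coded set and components of a pair are
  never larger.\<close>

definition app :: "'a::pa \<Rightarrow> 'a \<Rightarrow> 'a" where
  "app f x = lst (\<lambda>y. y < f \<and> mem (pair x y) f)"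

lemma FN_app [fn]: "FN t \<Longrightarrow> FN u \<Longrightarrow> FN (\<lambda>e. app (t e) (u e))"
  by (rule FN2[where f = app]) (auto simp: app_def intro!: fn bd)

lemma FD_app [fd]: "FD t \<Longrightarrow> FD u \<Longrightarrow> FD (\<lambda>e. app (t e) (u e))"
  by (rule FD2[where f = app, OF FN_FD[OF FN_app[OF FN_var FN_var]]])

lemma mem_pair_less: "mem (pair x y) f \<Longrightarrow> y < f"
  using mem_less le_pair2 le_less_trans by blast

lemma app_eq: "mem (pair x y) f \<Longrightarrow> (\<And>z. mem (pair x z) f \<Longrightarrow> y \<le> z) \<Longrightarrow> app f x = y"
  unfolding app_def by (rule lst_eq) (auto intro: mem_pair_less dest: leD)

lemma app_le: "app f x \<le> f"
  using lst_graph[of "app f x" "\<lambda>y. y < f \<and> mem (pair x y) f"] by (auto simp: app_def)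

theorem fun_compr:
  fixes b :: "'a::pa"
  assumes G: "DF (\<lambda>e. G (e 0) (e 1))" and ex: "\<And>x. x < b \<Longrightarrow> \<exists>y. G x y"
  shows "\<exists>f. \<forall>x<b. G x (app f x)"
proof -
  obtain c where c: "\<And>x. x < b \<Longrightarrow> \<exists>y<c. G x y" using collection[OF G ex] by blast
  have "DF (\<lambda>e. G (fstp (e 0)) (sndp (e 0)) \<and> (\<forall>z<sndp (e 0). \<not> G (fstp (e 0)) z) \<and> e 0 = pair (fstp (e 0)) (sndp (e 0)))"
    by (intro df fd DF2[OF G])
  from compr[OF this, of "pair b c"] obtain f where f: "\<And>q. mem q f \<longleftrightarrow> q < pair b c \<and> G (fstp q) (sndp q) \<and>
      (\<forall>z<sndp q. \<not> G (fstp q) z) \<and> q = pair (fstp q) (sndp q)" by blast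
  have "G x (app f x)" if "x < b" for x
  proof -
    obtain y where y: "y < c" "G x y" using c \<open>x < b\<close> by blast
    obtain w where w: "G x w" "\<forall>z<w. \<not> G x z"
      using least_DF[of "G x" y] y(2) DF2[OF G FD_const FD_var] by blast
    then have "w \<le> y" using y(2) not_le by blast
    then have "x + w < b + c" using that y(1) by (intro add_less_le_mono) auto
    then have "pair x w < pair b c" by (rule pair_less)
    then have "app f x = w" using w by (intro app_eq) (auto simp: f, meson not_le)
    then show ?thesis using w by simp
  qed
  then show ?thesis by blast
qed

text \<open>Dependent choice along a possibly nonstandard number \<open>n\<close>: as sequences are
  coded, the existence of a sequence of length \<open>k\<close> that respects the invariant
  \<open>I\<close> is definable and can be proved by induction on \<open>k\<close>.\<close>

theorem recursion:
  fixes n :: "'a::pa"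
  assumes R: "DF (\<lambda>e. R (e 0) (e 1) (e 2))" and I: "DF (\<lambda>e. I (e 0) (e 1))"
    and I0: "I 0 x0" and step: "\<And>i x. i < n \<Longrightarrow> I i x \<Longrightarrow> \<exists>y. R i x y \<and> I (i + 1) y"
  shows "\<exists>f. app f 0 = x0 \<and> (\<forall>i<n. R i (app f i) (app f (i + 1))) \<and> (\<forall>i\<le>n. I i (app f i))"
proof -
  let ?Q = "\<lambda>k f. app f 0 = x0 \<and> (\<forall>i<k. R i (app f i) (app f (i + 1))) \<and> (\<forall>i\<le>k. I i (app f i))"
  have "k \<le> n \<longrightarrow> (\<exists>f. ?Q k f)" for k
  proof (rule induct_DF[where P = "\<lambda>k. k \<le> n \<longrightarrow> (\<exists>f. ?Q k f)"])
    show "DF (\<lambda>e. e 0 \<le> n \<longrightarrow> (\<exists>f. ?Q (e 0) f))"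
      by (intro df fd DF2[OF I] DF3[OF R])
    have "DF (\<lambda>e. (\<lambda>x y. y = x0) (e 0) (e 1))" by (intro df fd)
    from fun_compr[OF this, of 1] have "\<exists>f. \<forall>x<1. app f x = x0" by auto
    then obtain f where "app f 0 = x0" using zero_less_one by blast
    then show "0 \<le> n \<longrightarrow> (\<exists>f. ?Q 0 f)" using I0 by (intro impI exI[of _ f]) auto
    fix k assume IH: "k \<le> n \<longrightarrow> (\<exists>f. ?Q k f)"
    show "k + 1 \<le> n \<longrightarrow> (\<exists>f. ?Q (k + 1) f)"
    proof
      assume "k + 1 \<le> n"
      then have kn: "k < n" by (simp add: less_iff_succ_less_eq)
      then obtain f where f: "?Q k f" using IH by auto
      then obtain y where y: "R k (app f k) y" "I (k + 1) y" using step[OF kn, of "app f k"] by auto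
      have "DF (\<lambda>e. (\<lambda>x v. (x \<le> k \<and> v = app f x) \<or> (k < x \<and> v = y)) (e 0) (e 1))" by (intro df fd)
      from fun_compr[OF this, of "k + 1 + 1"] obtain g where
        g: "\<And>x. x < k + 1 + 1 \<Longrightarrow> (x \<le> k \<and> app g x = app f x) \<or> (k < x \<and> app g x = y)"
        by (metis not_le)
      have gk: "app g x = app f x" if "x \<le> k" for x
      proof -
        have "x < k + 1 + 1" using that by (meson le_less_trans less_S_iff order_refl less_imp_le)
        then show ?thesis using g[of x] that by auto
      qed
      have gy: "app g (k + 1) = y"
      proof -
        have "k < k + 1" "k + 1 < k + 1 + 1" by (simp_all only: less_S_iff)
        then show ?thesis using g[of "k + 1"] by (auto dest: leD)
      qed
      have "?Q (k + 1) g"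
      proof (intro conjI allI impI)
        show "app g 0 = x0" using gk[of 0] f by simp
        show "R i (app g i) (app g (i + 1))" if "i < k + 1" for i
        proof (cases "i = k")
          case True
          then show ?thesis using y(1) gk[of k] gy by simp
        next
          case False
          then have "i < k" using that by (simp add: less_S_iff)
          then have "i + 1 \<le> k" by (simp add: less_iff_succ_less_eq)
          then show ?thesis using f gk[of i] gk[of "i + 1"] \<open>i < k\<close> by simp
        qed
        show "I i (app g i)" if "i \<le> k + 1" for i
        proof (cases "i = k + 1")
          case False
          then have "i < k + 1" using that by (rule le_neq_trans[rotated])
          then show ?thesis using f gk[of i] by (simp add: less_S_iff)
        qed (use gy y in simp)
      qed
      then show "\<exists>f. ?Q (k + 1) f" by blast
    qed
  qed
  then show ?thesis by blast
qed

section \<open>Certificates for bounded truth\<close>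

abbreviation cl :: "'a::pa \<Rightarrow> 'a \<Rightarrow> 'a \<Rightarrow> 'a \<Rightarrow> bool" where
  "cl s c y v \<equiv> mem (pair c (pair y v)) s"

lemma cl_less: "cl s c y v \<Longrightarrow> c < s" "cl s c y v \<Longrightarrow> y < s" "cl s c y v \<Longrightarrow> v < s"
proof -
  assume "cl s c y v"
  then have "pair c (pair y v) < s" by (rule mem_less)
  moreover have "c \<le> pair c (pair y v)" "y \<le> pair c (pair y v)" "v \<le> pair c (pair y v)"
    by (auto intro: order_trans[OF _ le_pair2])
  ultimately show "c < s" "y < s" "v < s" using le_less_trans by blast+
qed

text \<open>A claim \<open>cl s c y v\<close> says that the term or bounded formula with code \<open>c\<close> has value \<open>v\<close>
  in the environment coded by the nested list \<open>y\<close>. A certificate justifies each of its claims by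
  claims about the immediate constituents.\<close>

definition okc :: "'a::pa \<Rightarrow> 'a \<Rightarrow> 'a \<Rightarrow> 'a \<Rightarrow> bool" where
  "okc s c y v \<longleftrightarrow>
     (fstp c = 1 \<and> ((sndp c = 0 \<and> v = fstp y) \<or> (\<exists>j<sndp c. sndp c = j + 1 \<and> cl s (pair 1 j) (sndp y) v))) \<or>
     (fstp c = 2 \<and> v = 0) \<or>
     (fstp c = 3 \<and> (\<exists>u<s. cl s (sndp c) y u \<and> v = u + 1)) \<or>
     (fstp c = 4 \<and> (\<exists>u<s. \<exists>w<s. cl s (fstp (sndp c)) y u \<and> cl s (sndp (sndp c)) y w \<and> v = u + w)) \<or>
     (fstp c = 5 \<and> (\<exists>u<s. \<exists>w<s. cl s (fstp (sndp c)) y u \<and> cl s (sndp (sndp c)) y w \<and> v = u * w)) \<or>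
     (fstp c = 6 \<and> (\<exists>u<s. \<exists>w<s. cl s (fstp (sndp c)) y u \<and> cl s (sndp (sndp c)) y w \<and>
        (v = 1 \<and> u = w \<or> v = 0 \<and> u \<noteq> w))) \<or>
     (fstp c = 7 \<and> (\<exists>u<s. \<exists>w<s. cl s (fstp (sndp c)) y u \<and> cl s (sndp (sndp c)) y w \<and>
        (v = 1 \<and> u < w \<or> v = 0 \<and> \<not> u < w))) \<or>
     (fstp c = 8 \<and> (v = 1 \<and> (cl s (fstp (sndp c)) y 0 \<or> cl s (sndp (sndp c)) y 1) \<or>
        v = 0 \<and> cl s (fstp (sndp c)) y 1 \<and> cl s (sndp (sndp c)) y 0)) \<or>
     (fstp c = 9 \<and> (\<exists>u<s. cl s (fstp (sndp c)) y u \<and> (v = 1 \<and> (\<forall>x<u. cl s (sndp (sndp c)) (pair x y) 1) \<or>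
        v = 0 \<and> (\<exists>x<u. cl s (sndp (sndp c)) (pair x y) 0)))) \<or>
     (fstp c = 10 \<and> v = 0)"

definition Cert :: "'a::pa \<Rightarrow> bool" where
  "Cert s \<longleftrightarrow> (\<forall>c<s. \<forall>y<s. \<forall>v<s. cl s c y v \<longrightarrow> okc s c y v)"

lemma BD_okc: "BD (\<lambda>e. okc (e 0) (e 1) (e 2) (e 3))"
  unfolding okc_def by (intro bd fn)

lemma BD_Cert [bd]: "FN t \<Longrightarrow> BD (\<lambda>e. Cert (t e))"
proof (rule BD1[where P = Cert])
  show "BD (\<lambda>e. Cert (e 0))"
    unfolding Cert_def by (intro bd fn BD4[OF BD_okc])
qed

lemma CertD: "Cert s \<Longrightarrow> cl s c y v \<Longrightarrow> okc s c y v"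
  unfolding Cert_def using cl_less by blast

lemma okc_mono:
  assumes "okc s c y v" "\<And>q. mem q s \<Longrightarrow> mem q s'"
  shows "okc s' c y v"
proof -
  show ?thesis
    using assms(1) unfolding okc_def
    by (elim disj_forward conj_forward; (assumption | use assms(2) cl_less(3) in blast))
qed

text \<open>The nested list has no end marker, so every number is a full environment, and evaluation
  never meets an undefined variable.\<close>

definition dec :: "'a::pa \<Rightarrow> nat \<Rightarrow> 'a" where
  "dec y i = fstp ((sndp ^^ i) y)"

lemma dec_0 [simp]: "dec y 0 = fstp y" and dec_Suc [simp]: "dec y (Suc i) = dec (sndp y) i"
  by (simp_all add: dec_def funpow_swap1)

lemma dec_pair: "dec (pair x y) = x ## dec y"
  by (rule ext) (simp add: scons_def split: nat.split)

lemma FN_funpow: "FN (\<lambda>e. (sndp ^^ i) (e 0))"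
  by (induction i) (auto intro: fn)

lemma FN_dec: "FN t \<Longrightarrow> FN (\<lambda>e. dec (t e) i)"
  by (rule FN1[where f = "\<lambda>y. dec y i"]) (auto simp: dec_def intro!: fn FN_funpow)

lemma BD_dec: "BD A \<Longrightarrow> FN t \<Longrightarrow> BD (\<lambda>e. A (dec (t e)))"
  by (rule BD_subst[of A "\<lambda>i e. dec (t e) i", OF _ FN_dec])

lemma FN_tval_dec: "FN (\<lambda>e. tval (dec (e 0)) t)"
  by (induction t) (auto intro: fn FN_dec)

text \<open>\<open>d\<close> bounds codes for all subsets of {x. x < b}; it takes the role of the
  power of two. Closure under it is what a cut needs in order to contain certificates.\<close>

definition Sub :: "'a::pa \<Rightarrow> 'a \<Rightarrow> bool" where
  "Sub b d \<longleftrightarrow> (\<forall>s. \<exists>s'<d. \<forall>x. mem x s' \<longleftrightarrow> x < b \<and> mem x s)"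

lemma DF_Sub [df]: "FD t \<Longrightarrow> FD u \<Longrightarrow> DF (\<lambda>e. Sub (t e) (u e))"
  by (rule DF2[where P = Sub]) (auto simp: Sub_def intro!: df fd)

lemma Sub_mono: "Sub b d \<Longrightarrow> d \<le> d' \<Longrightarrow> Sub b d'"
  unfolding Sub_def by (meson less_le_trans)

lemma Sub_compr: "Sub b d \<Longrightarrow> DF (\<lambda>e. P (e 0)) \<Longrightarrow> \<exists>s<d. \<forall>x. mem x s \<longleftrightarrow> x < b \<and> P x"
  using compr[of P b] unfolding Sub_def by (metis (no_types, lifting))

lemma Sub_ex: "\<exists>d. Sub b d" for b :: "'a::pa"
proof (rule induct_DF[where P = "\<lambda>b. \<exists>d. Sub b d"])
  show "DF (\<lambda>e. \<exists>d. Sub (e 0 :: 'a) d)" by (intro df fd)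
  show "\<exists>d::'a. Sub 0 d"
  proof
    show "Sub (0::'a) 1" unfolding Sub_def
      by (intro allI exI[of _ 0]) (auto simp: mem_def dest: less_le_trans[OF _ fstp_le])
  qed
  fix b :: 'a assume "\<exists>d. Sub b d"
  then obtain d where d: "Sub b d" by blast
  have "DF (\<lambda>e. (\<lambda>s s'. \<forall>x. mem x s' \<longleftrightarrow> x < b + 1 \<and> (mem x s \<or> x = b)) (e 0) (e 1))" by (intro df fd)
  moreover have "\<exists>s'. \<forall>x. mem x s' \<longleftrightarrow> x < b + 1 \<and> (mem x s \<or> x = b)" for s
    by (rule compr) (intro df fd)
  \<comment> \<open>Collection yields one bound for codes of s together with the new element
    \<open>b\<close>, over all codes s < d at once.\<close>
  ultimately obtain d' where d': "\<And>s. s < d \<Longrightarrow> \<exists>s'<d'. \<forall>x. mem x s' \<longleftrightarrow> x < b + 1 \<and> (mem x s \<or> x = b)"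
    using collection[of "\<lambda>s s'. \<forall>x. mem x s' \<longleftrightarrow> x < b + 1 \<and> (mem x s \<or> x = b)" d] by blast
  have "\<exists>s'<d + d'. \<forall>x. mem x s' \<longleftrightarrow> x < b + 1 \<and> mem x s" for s
  proof -
    obtain r where r: "r < d" "\<And>x. mem x r \<longleftrightarrow> x < b \<and> mem x s" using d unfolding Sub_def by blast
    have lt: "x < b + 1 \<longleftrightarrow> x < b \<or> x = b" for x by (auto simp: less_S_iff le_less)
    show ?thesis
    proof (cases "mem b s")
      case True
      obtain s' where s': "s' < d'" "\<And>x. mem x s' \<longleftrightarrow> x < b + 1 \<and> (mem x r \<or> x = b)" using d' r(1) by blast
      have "\<forall>x. mem x s' \<longleftrightarrow> x < b + 1 \<and> mem x s" unfolding s'(2) r(2) lt using True by auto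
      moreover have "s' < d + d'" using s'(1) by (rule less_le_trans) simp
      ultimately show ?thesis by blast
    next
      case False
      have "\<forall>x. mem x r \<longleftrightarrow> x < b + 1 \<and> mem x s" unfolding r(2) lt using False by auto
      moreover have "r < d + d'" using r(1) by (rule less_le_trans) simp
      ultimately show ?thesis by blast
    qed
  qed
  then show "\<exists>d. Sub (b + 1) d" unfolding Sub_def by blast
qed

definition cutI :: "'a::pa set \<Rightarrow> bool" where
  "cutI I \<longleftrightarrow> 1 \<in> I \<and> (\<forall>x\<in>I. \<forall>y\<in>I. x + y \<in> I \<and> x * y \<in> I) \<and> (\<forall>x\<in>I. \<forall>y\<le>x. y \<in> I) \<and> (\<forall>b\<in>I. \<exists>d\<in>I. Sub b d)"

lemma cutI_UNIV: "cutI UNIV"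
  by (simp add: cutI_def Sub_ex)

lemma cutI_simps:
  assumes "cutI I"
  shows "0 \<in> I" "1 \<in> I" "x \<in> I \<Longrightarrow> y \<in> I \<Longrightarrow> x + y \<in> I" "x \<in> I \<Longrightarrow> y \<in> I \<Longrightarrow> x * y \<in> I"
    "x \<in> I \<Longrightarrow> y \<in> I \<Longrightarrow> pair x y \<in> I" "x \<in> I \<Longrightarrow> y \<le> x \<Longrightarrow> y \<in> I"
  using assms zero_le[of 1] unfolding cutI_def pair_def by blast+

lemmas cutI_intros = cutI_simps(1-5)

lemma cutI_of_nat: "cutI I \<Longrightarrow> of_nat n \<in> I"
  by (induction n) (auto intro: cutI_intros)

lemma cutI_numeral: "cutI I \<Longrightarrow> numeral w \<in> I"
  using cutI_of_nat[of I "numeral w"] by simp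

text \<open>Two certificates are joined and the claims for a new code \<open>c\<close> at all
  \<open>y < b\<close> are added. The explicit bound \<open>?B\<close> on the members of the union
  and the closure of the cut under \<open>Sub\<close> keep the new certificate in the cut.\<close>

lemma ext_cert:
  assumes I: "cutI I" "S1 \<in> I" "S2 \<in> I" "c \<in> I" "b \<in> I" "V \<in> I" and S: "Cert S1" "Cert S2"
    and f: "FD (\<lambda>e. f (e 0))" "\<And>y. y < b \<Longrightarrow> f y \<le> V"
    and ok: "\<And>y s. y < b \<Longrightarrow> (\<And>q. mem q S1 \<Longrightarrow> mem q s) \<Longrightarrow> (\<And>q. mem q S2 \<Longrightarrow> mem q s) \<Longrightarrow> okc s c y (f y)"
  shows "\<exists>S\<in>I. Cert S \<and> (\<forall>y<b. cl S c y (f y))"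
proof -
  let ?P = "\<lambda>q. mem q S1 \<or> mem q S2 \<or> (\<exists>y<b. q = pair c (pair y (f y)))"
  let ?B = "S1 + S2 + (pair c (pair b V) + 1)"
  have "?B \<in> I" using I by (intro cutI_intros)
  then obtain d where d: "d \<in> I" "Sub ?B d" using I(1) unfolding cutI_def by blast
  have "DF (\<lambda>e. ?P (e 0))" by (intro df fd FD1[OF f(1)])
  from Sub_compr[OF d(2) this] obtain s where s: "s < d" "\<And>q. mem q s \<longleftrightarrow> q < ?B \<and> ?P q" by blast
  have S1: "mem q s" if "mem q S1" for q
  proof -
    have "q < S1" using that by (rule mem_less)
    also have "\<dots> \<le> ?B" unfolding add.assoc by simp
    finally show ?thesis using s(2) that by blast
  qed
  have S2: "mem q s" if "mem q S2" for q
  proof -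
    have "q < S2" using that by (rule mem_less)
    also have "S2 \<le> S1 + S2" by simp
    also have "\<dots> \<le> ?B" by simp
    finally show ?thesis using s(2) that by blast
  qed
  have new: "cl s c y (f y)" if "y < b" for y
  proof -
    have "pair c (pair y (f y)) \<le> pair c (pair b V)" using that f(2) by (intro pair_mono) auto
    also have "\<dots> < pair c (pair b V) + 1" by (simp add: less_S_iff)
    also have "\<dots> \<le> ?B" by simp
    finally show ?thesis using s(2) that by blast
  qed
  have "Cert s" unfolding Cert_def
  proof (intro allI impI)
    fix c' y v assume "cl s c' y v"
    then consider "cl S1 c' y v" | "cl S2 c' y v" | "y < b" "c' = c" "v = f y" using s(2) by auto
    then show "okc s c' y v"
    proof cases
      case 1
      then show ?thesis using okc_mono[OF CertD[OF S(1)]] S1 by blast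
    next
      case 2
      then show ?thesis using okc_mono[OF CertD[OF S(2)]] S2 by blast
    next
      case 3
      then show ?thesis using ok S1 S2 by blast
    qed
  qed
  moreover have "s \<in> I" using cutI_simps(6)[OF I(1) d(1)] s(1) by simp
  ultimately show ?thesis using new by blast
qed

text \<open>The first half says that certificates are never wrong about the code \<open>n\<close>,
  the second that they exist in each cut for arguments of the cut. Completeness is stated for cuts
  because later a certificate about a state has to lie below the bound of the next state.\<close>

definition coded :: "nat \<Rightarrow> ('a::pa \<Rightarrow> 'a) \<Rightarrow> bool" where
  "coded n f \<longleftrightarrow> (\<forall>s y v. Cert s \<longrightarrow> cl s (of_nat n) y v \<longrightarrow> v = f y) \<and>
     (\<forall>I. cutI I \<longrightarrow> (\<forall>b\<in>I. \<exists>S\<in>I. Cert S \<and> (\<forall>y<b. cl S (of_nat n) y (f y))))"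

lemma codedI:
  assumes "\<And>s y v. Cert s \<Longrightarrow> okc s (of_nat n) y v \<Longrightarrow> v = f y"
    and "\<And>I b. cutI I \<Longrightarrow> b \<in> I \<Longrightarrow> \<exists>S\<in>I. Cert S \<and> (\<forall>y<b. cl S (of_nat n) y (f y))"
  shows "coded n f"
  unfolding coded_def
proof (intro conjI allI impI ballI)
  show "v = f y" if "Cert s" "cl s (of_nat n) y v" for s y v
    by (rule assms(1)[OF that(1) CertD[OF that]])
qed (rule assms(2))

lemma of_nat_pair: "\<exists>n. pair (of_nat a) (of_nat b) = of_nat n"
  by (rule exI[of _ "(a + b) * (a + b) + a"]) (simp add: pair_def)

lemma of_nat_pair3: "\<exists>n. pair (numeral w) (pair (of_nat a) (of_nat b)) = of_nat n"
  using of_nat_pair[of a b] of_nat_pair[of "numeral w"] by (metis of_nat_numeral)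

lemma of_nat_pair2: "\<exists>n. pair (numeral w) (of_nat b) = of_nat n"
  using of_nat_pair[of "numeral w" b] by (metis of_nat_numeral)

lemma Cert_0: "Cert 0"
  by (auto simp: Cert_def)

lemma coded_sound: "coded n f \<Longrightarrow> Cert s \<Longrightarrow> cl s (of_nat n) y v \<Longrightarrow> v = f y"
  unfolding coded_def by blast

lemma coded_complete:
  "coded n f \<Longrightarrow> cutI I \<Longrightarrow> b \<in> I \<Longrightarrow> \<exists>S\<in>I. Cert S \<and> (\<forall>y<b. cl S (of_nat n) y (f y))"
  unfolding coded_def by blast

lemma coded_binary:
  fixes f g h :: "'a::pa \<Rightarrow> 'a"
  assumes l: "coded l f" and r: "coded r g" and n: "of_nat n = pair (numeral w) (pair (of_nat l) (of_nat r))"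
    and h: "FD (\<lambda>e. h (e 0))"
    and bound: "\<And>I F G. cutI I \<Longrightarrow> F \<in> I \<Longrightarrow> G \<in> I \<Longrightarrow> \<exists>V\<in>I. \<forall>y. f y < F \<longrightarrow> g y < G \<longrightarrow> h y \<le> V"
    and ok: "\<And>s y. cl s (of_nat l) y (f y) \<Longrightarrow> cl s (of_nat r) y (g y) \<Longrightarrow> okc s (of_nat n) y (h y)"
    and ok': "\<And>s y v. okc s (of_nat n) y v \<Longrightarrow> (\<And>u. cl s (of_nat l) y u \<Longrightarrow> u = f y) \<Longrightarrow>
      (\<And>u. cl s (of_nat r) y u \<Longrightarrow> u = g y) \<Longrightarrow> v = h y"
  shows "coded n h"
proof (rule codedI)
  fix s y v :: 'a assume "Cert s" "okc s (of_nat n) y v"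
  then show "v = h y" using ok' coded_sound[OF l] coded_sound[OF r] by blast
next
  fix I and b :: 'a assume I: "cutI I" "b \<in> I"
  obtain S1 S2 where S: "S1 \<in> I" "Cert S1" "S2 \<in> I" "Cert S2"
    "\<And>y. y < b \<Longrightarrow> cl S1 (of_nat l) y (f y)" "\<And>y. y < b \<Longrightarrow> cl S2 (of_nat r) y (g y)"
    using coded_complete[OF l I] coded_complete[OF r I] by blast
  obtain V where V: "V \<in> I" "\<And>y. f y < S1 \<Longrightarrow> g y < S2 \<Longrightarrow> h y \<le> V" using bound[OF I(1) S(1,3)] by blast
  show "\<exists>S\<in>I. Cert S \<and> (\<forall>y<b. cl S (of_nat n) y (h y))"
  proof (rule ext_cert[OF I(1) S(1,3) cutI_of_nat[OF I(1)] I(2) V(1) S(2,4) h])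
    show "h y \<le> V" if "y < b" for y using V(2) S(5,6)[OF that] cl_less(3) by blast
    show "okc s (of_nat n) y (h y)" if "y < b" "\<And>q. mem q S1 \<Longrightarrow> mem q s" "\<And>q. mem q S2 \<Longrightarrow> mem q s" for y s
      using ok S(5,6) that by blast
  qed
qed

lemma coded_Var: "\<exists>n. of_nat n = (pair 1 (of_nat i) :: 'a::pa) \<and> coded n (\<lambda>y::'a::pa. dec y i)"
proof (induction i)
  case 0
  obtain n where n: "of_nat n = (pair 1 0 :: 'a)" using of_nat_pair[of 1 0] by (metis of_nat_0 of_nat_1)
  have "coded n (\<lambda>y::'a. dec y 0)"
  proof (rule codedI)
    fix s y v :: 'a assume "okc s (of_nat n) y v"
    then show "v = dec y 0" by (simp add: n okc_def)
  next
    fix I and b :: 'a assume I: "cutI I" "b \<in> I"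
    show "\<exists>S\<in>I. Cert S \<and> (\<forall>y<b. cl S (of_nat n) y (dec y 0))"
      by (rule ext_cert[where ?S1.0 = 0 and ?S2.0 = 0 and V = b])
        (use I in \<open>auto simp: n okc_def Cert_0 intro!: cutI_intros fd order_trans[OF fstp_le]\<close>)
  qed
  then show ?case using n by (intro exI[of _ n]) auto
next
  case (Suc i)
  then obtain m where m: "of_nat m = (pair 1 (of_nat i) :: 'a)" "coded m (\<lambda>y::'a. dec y i)" by blast
  obtain n where n: "of_nat n = (pair 1 (of_nat (Suc i)) :: 'a)" using of_nat_pair[of 1 "Suc i"] by (metis of_nat_1)
  have n': "fstp (of_nat n) = (1::'a)" "sndp (of_nat n) = (of_nat i + 1::'a)" by (simp_all add: n add.commute)
  have lt: "(of_nat i :: 'a) < of_nat i + 1" by (simp add: less_S_iff)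
  have "coded n (\<lambda>y::'a. dec y (Suc i))"
  proof (rule codedI)
    fix s y v :: 'a assume "Cert s" "okc s (of_nat n) y v"
    then have "cl s (of_nat m) (sndp y) v" by (auto simp: m n' okc_def)
    then show "v = dec y (Suc i)" using coded_sound[OF m(2) \<open>Cert s\<close>] by simp
  next
    fix I and b :: 'a assume I: "cutI I" "b \<in> I"
    obtain S where S: "S \<in> I" "Cert S" "\<And>y. y < b \<Longrightarrow> cl S (of_nat m) y (dec y i)"
      using coded_complete[OF m(2) I] by blast
    show "\<exists>S\<in>I. Cert S \<and> (\<forall>y<b. cl S (of_nat n) y (dec y (Suc i)))"
    proof (rule ext_cert[OF I(1) S(1,1) cutI_of_nat[OF I(1)] I(2) S(1) S(2,2)])
      show "FD (\<lambda>e. dec (e 0) (Suc i))" by (rule FN_FD[OF FN_dec[OF FN_var]])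
      have cl: "cl S (of_nat m) (sndp y) (dec (sndp y) i)" if "y < b" for y
        using S(3) that sndp_le le_less_trans by blast
      show "dec y (Suc i) \<le> S" if "y < b" for y
        using cl_less(3)[OF cl[OF that]] by simp
      show "okc s (of_nat n) y (dec y (Suc i))" if "y < b" "\<And>q. mem q S \<Longrightarrow> mem q s" for y s
        using cl[OF that(1)] that(2) lt unfolding okc_def n' m(1) by auto
    qed
  qed
  then show ?case using n by (intro exI[of _ n]) auto
qed

lemma coded_tm: "\<exists>n. coded n (\<lambda>y::'a::pa. tval (dec y) t)"
proof (induction t)
  case (Var i)
  then show ?case using coded_Var by auto
next
  case Zero
  obtain n where n: "of_nat n = (pair 2 0 :: 'a)" using of_nat_pair[of 2 0] by (metis of_nat_0 of_nat_numeral)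
  have "coded n (\<lambda>y::'a. tval (dec y) Zero)"
  proof (rule codedI)
    fix s y v :: 'a assume "okc s (of_nat n) y v"
    then show "v = tval (dec y) Zero" by (simp add: n okc_def)
  next
    fix I and b :: 'a assume I: "cutI I" "b \<in> I"
    show "\<exists>S\<in>I. Cert S \<and> (\<forall>y<b. cl S (of_nat n) y (tval (dec y) Zero))"
      by (rule ext_cert[where ?S1.0 = 0 and ?S2.0 = 0 and V = b])
        (use I in \<open>auto simp: n okc_def Cert_0 intro!: cutI_intros cutI_numeral fd\<close>)
  qed
  then show ?case by blast
next
  case (Sc t)
  then obtain m where m: "coded m (\<lambda>y::'a. tval (dec y) t)" by blast
  obtain n where n: "of_nat n = (pair 3 (of_nat m) :: 'a)" using of_nat_pair2[of _ m] by metis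
  have n': "fstp (of_nat n) = (3::'a)" "sndp (of_nat n) = (of_nat m::'a)" by (simp_all add: n)
  have "coded n (\<lambda>y::'a. tval (dec y) (Sc t))"
  proof (rule codedI)
    fix s y v :: 'a assume "Cert s" "okc s (of_nat n) y v"
    then obtain u where "cl s (of_nat m) y u" "v = u + 1" by (auto simp: n' okc_def)
    then show "v = tval (dec y) (Sc t)" using coded_sound[OF m \<open>Cert s\<close>] by simp
  next
    fix I and b :: 'a assume I: "cutI I" "b \<in> I"
    obtain S where S: "S \<in> I" "Cert S" "\<And>y. y < b \<Longrightarrow> cl S (of_nat m) y (tval (dec y) t)"
      using coded_complete[OF m I] by blast
    show "\<exists>S\<in>I. Cert S \<and> (\<forall>y<b. cl S (of_nat n) y (tval (dec y) (Sc t)))"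
    proof (rule ext_cert[OF I(1) S(1,1) cutI_of_nat[OF I(1)] I(2) S(1) S(2,2)])
      show "FD (\<lambda>e. tval (dec (e 0)) (Sc t))" by (rule FN_FD[OF FN_tval_dec])
      show "tval (dec y) (Sc t) \<le> S" if "y < b" for y
        using cl_less(3)[OF S(3)[OF that]] by (simp add: less_iff_succ_less_eq)
      show "okc s (of_nat n) y (tval (dec y) (Sc t))" if "y < b" "\<And>q. mem q S \<Longrightarrow> mem q s" for y s
      proof -
        have "cl s (of_nat m) y (tval (dec y) t)" using S(3) that by blast
        then show ?thesis using cl_less(3) unfolding okc_def n' by auto
      qed
    qed
  qed
  then show ?case by blast
next
  case (Pl t u)
  then obtain l r where lr: "coded l (\<lambda>y::'a. tval (dec y) t)" "coded r (\<lambda>y::'a. tval (dec y) u)" by blast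
  obtain n where n: "of_nat n = (pair 4 (pair (of_nat l) (of_nat r)) :: 'a)" using of_nat_pair3[of _ l r] by metis
  have n': "fstp (of_nat n) = (4::'a)" "fstp (sndp (of_nat n)) = (of_nat l::'a)" "sndp (sndp (of_nat n)) = (of_nat r::'a)"
    by (simp_all add: n)
  have "coded n (\<lambda>y::'a. tval (dec y) (Pl t u))"
  proof (rule coded_binary[OF lr n FN_FD[OF FN_tval_dec]])
    show "\<exists>V\<in>I. \<forall>y. tval (dec y) t < F \<longrightarrow> tval (dec y) u < G \<longrightarrow> tval (dec y) (Pl t u) \<le> V"
      if "cutI I" "F \<in> I" "G \<in> I" for I and F G :: 'a
      by (rule bexI[of _ "F + G"]) (use that in \<open>auto intro!: cutI_intros add_mono\<close>)
    show "okc s (of_nat n) y (tval (dec y) (Pl t u))"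
      if "cl s (of_nat l) y (tval (dec y) t)" "cl s (of_nat r) y (tval (dec y) u)" for s y :: 'a
      using that cl_less(3)[OF that(1)] cl_less(3)[OF that(2)] unfolding okc_def n' by auto
  qed (auto simp: okc_def n')
  then show ?case by blast
next
  case (Tm t u)
  then obtain l r where lr: "coded l (\<lambda>y::'a. tval (dec y) t)" "coded r (\<lambda>y::'a. tval (dec y) u)" by blast
  obtain n where n: "of_nat n = (pair 5 (pair (of_nat l) (of_nat r)) :: 'a)" using of_nat_pair3[of _ l r] by metis
  have n': "fstp (of_nat n) = (5::'a)" "fstp (sndp (of_nat n)) = (of_nat l::'a)" "sndp (sndp (of_nat n)) = (of_nat r::'a)"
    by (simp_all add: n)
  have "coded n (\<lambda>y::'a. tval (dec y) (Tm t u))"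
  proof (rule coded_binary[OF lr n FN_FD[OF FN_tval_dec]])
    show "\<exists>V\<in>I. \<forall>y. tval (dec y) t < F \<longrightarrow> tval (dec y) u < G \<longrightarrow> tval (dec y) (Tm t u) \<le> V"
      if "cutI I" "F \<in> I" "G \<in> I" for I and F G :: 'a
      by (rule bexI[of _ "F * G"]) (use that in \<open>auto intro!: cutI_intros mult_mono\<close>)
    show "okc s (of_nat n) y (tval (dec y) (Tm t u))"
      if "cl s (of_nat l) y (tval (dec y) t)" "cl s (of_nat r) y (tval (dec y) u)" for s y :: 'a
      using that cl_less(3)[OF that(1)] cl_less(3)[OF that(2)] unfolding okc_def n' by auto
  qed (auto simp: okc_def n')
  then show ?case by blast
qed

definition tv :: "bool \<Rightarrow> 'a::pa" where "tv b = (if b then 1 else 0)"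

lemma tv_simps [simp]: "tv True = 1" "tv False = 0" "tv b = 1 \<longleftrightarrow> b" "tv b = 0 \<longleftrightarrow> \<not> b" "1 = tv b \<longleftrightarrow> b" "0 = tv b \<longleftrightarrow> \<not> b"
  by (auto simp: tv_def)

lemma tv_le: "tv b \<le> 1"
  by (simp add: tv_def)

lemma FD_tv: "DF (\<lambda>e. P (e 0)) \<Longrightarrow> FD (\<lambda>e. tv (P (e 0)))"
proof (rule FD_I)
  assume a: "DF (\<lambda>e. P (e 0))"
  show "DF (\<lambda>e. (\<lambda>y e. (y = 1 \<and> P (e 0)) \<or> (y = 0 \<and> \<not> P (e 0))) (e 0) (\<lambda>i. e (Suc i)))"
    by (intro df fd DF1[OF a])
qed (auto simp: tv_def)

lemma DF_sat_dec: "bounded p \<Longrightarrow> DF (\<lambda>e. sat UNIV (dec (e 0)) p)"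
proof -
  assume "bounded p"
  then have "BD (\<lambda>e. sat UNIV e p)" unfolding BD_def by blast
  then show ?thesis by (rule BD_DF[OF BD_dec[OF _ FN_var]])
qed

lemma coded_bounded: "bounded p \<Longrightarrow> \<exists>n. coded n (\<lambda>y::'a::pa. tv (sat UNIV (dec y) p))"
proof (induction rule: bounded.induct)
  case 1
  obtain n where n: "of_nat n = (pair 10 0 :: 'a)" using of_nat_pair[of 10 0] by (metis of_nat_0 of_nat_numeral)
  have "coded n (\<lambda>y::'a. tv (sat UNIV (dec y) Fls))"
  proof (rule codedI)
    fix s y v :: 'a assume "okc s (of_nat n) y v"
    then show "v = tv (sat UNIV (dec y) Fls)" by (simp add: n okc_def)
  next
    fix I and b :: 'a assume I: "cutI I" "b \<in> I"
    show "\<exists>S\<in>I. Cert S \<and> (\<forall>y<b. cl S (of_nat n) y (tv (sat UNIV (dec y) Fls)))"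
      by (rule ext_cert[where ?S1.0 = 0 and ?S2.0 = 0 and V = b])
        (use I in \<open>auto simp: n okc_def Cert_0 intro!: cutI_intros cutI_numeral fd\<close>)
  qed
  then show ?case by blast
next
  case (2 t u)
  obtain l r where lr: "coded l (\<lambda>y::'a. tval (dec y) t)" "coded r (\<lambda>y::'a. tval (dec y) u)" using coded_tm by blast
  obtain n where n: "of_nat n = (pair 6 (pair (of_nat l) (of_nat r)) :: 'a)" using of_nat_pair3[of _ l r] by metis
  have n': "fstp (of_nat n) = (6::'a)" "fstp (sndp (of_nat n)) = (of_nat l::'a)" "sndp (sndp (of_nat n)) = (of_nat r::'a)"
    by (simp_all add: n)
  have "coded n (\<lambda>y::'a. tv (sat UNIV (dec y) (Eq t u)))"
  proof (rule coded_binary[OF lr n FD_tv[OF DF_sat_dec[OF bounded.intros(2)]]])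
    show "\<exists>V\<in>I. \<forall>y. tval (dec y) t < F \<longrightarrow> tval (dec y) u < G \<longrightarrow> tv (sat UNIV (dec y) (Eq t u)) \<le> V"
      if "cutI I" for I and F G :: 'a
      by (rule bexI[of _ 1]) (use that in \<open>auto intro!: cutI_intros tv_le\<close>)
    show "okc s (of_nat n) y (tv (sat UNIV (dec y) (Eq t u)))"
      if "cl s (of_nat l) y (tval (dec y) t)" "cl s (of_nat r) y (tval (dec y) u)" for s y :: 'a
      using that cl_less(3)[OF that(1)] cl_less(3)[OF that(2)] unfolding okc_def n' by auto
  qed (auto simp: okc_def n')
  then show ?case by blast
next
  case (3 t u)
  obtain l r where lr: "coded l (\<lambda>y::'a. tval (dec y) t)" "coded r (\<lambda>y::'a. tval (dec y) u)" using coded_tm by blast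
  obtain n where n: "of_nat n = (pair 7 (pair (of_nat l) (of_nat r)) :: 'a)" using of_nat_pair3[of _ l r] by metis
  have n': "fstp (of_nat n) = (7::'a)" "fstp (sndp (of_nat n)) = (of_nat l::'a)" "sndp (sndp (of_nat n)) = (of_nat r::'a)"
    by (simp_all add: n)
  have "coded n (\<lambda>y::'a. tv (sat UNIV (dec y) (Lt t u)))"
  proof (rule coded_binary[OF lr n FD_tv[OF DF_sat_dec[OF bounded.intros(3)]]])
    show "\<exists>V\<in>I. \<forall>y. tval (dec y) t < F \<longrightarrow> tval (dec y) u < G \<longrightarrow> tv (sat UNIV (dec y) (Lt t u)) \<le> V"
      if "cutI I" for I and F G :: 'a
      by (rule bexI[of _ 1]) (use that in \<open>auto intro!: cutI_intros tv_le\<close>)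
    show "okc s (of_nat n) y (tv (sat UNIV (dec y) (Lt t u)))"
      if "cl s (of_nat l) y (tval (dec y) t)" "cl s (of_nat r) y (tval (dec y) u)" for s y :: 'a
      using that cl_less(3)[OF that(1)] cl_less(3)[OF that(2)] unfolding okc_def n' by auto
  qed (auto simp: okc_def n')
  then show ?case by blast
next
  case (4 p q)
  then obtain l r where lr: "coded l (\<lambda>y::'a. tv (sat UNIV (dec y) p))" "coded r (\<lambda>y::'a. tv (sat UNIV (dec y) q))" by blast
  obtain n where n: "of_nat n = (pair 8 (pair (of_nat l) (of_nat r)) :: 'a)" using of_nat_pair3[of _ l r] by metis
  have n': "fstp (of_nat n) = (8::'a)" "fstp (sndp (of_nat n)) = (of_nat l::'a)" "sndp (sndp (of_nat n)) = (of_nat r::'a)"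
    by (simp_all add: n)
  have "coded n (\<lambda>y::'a. tv (sat UNIV (dec y) (Imp p q)))"
  proof (rule coded_binary[OF lr n FD_tv[OF DF_sat_dec[OF bounded.intros(4)[OF 4(1,2)]]]])
    show "\<exists>V\<in>I. \<forall>y. tv (sat UNIV (dec y) p) < F \<longrightarrow> tv (sat UNIV (dec y) q) < G \<longrightarrow> tv (sat UNIV (dec y) (Imp p q)) \<le> V"
      if "cutI I" for I and F G :: 'a
      by (rule bexI[of _ 1]) (use that in \<open>auto intro!: cutI_intros tv_le\<close>)
    show "okc s (of_nat n) y (tv (sat UNIV (dec y) (Imp p q)))"
      if "cl s (of_nat l) y (tv (sat UNIV (dec y) p))" "cl s (of_nat r) y (tv (sat UNIV (dec y) q))" for s y :: 'a
      using that unfolding okc_def n'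
      by (cases "sat UNIV (dec y) p"; cases "sat UNIV (dec y) q") auto
  next
    fix s y v :: 'a
    assume ok: "okc s (of_nat n) y v" and l: "\<And>u. cl s (of_nat l) y u \<Longrightarrow> u = tv (sat UNIV (dec y) p)"
      and r: "\<And>u. cl s (of_nat r) y u \<Longrightarrow> u = tv (sat UNIV (dec y) q)"
    from ok have "v = 1 \<and> (cl s (of_nat l) y 0 \<or> cl s (of_nat r) y 1) \<or> v = 0 \<and> cl s (of_nat l) y 1 \<and> cl s (of_nat r) y 0"
      unfolding okc_def n' by simp
    then show "v = tv (sat UNIV (dec y) (Imp p q))" using l[of 0] l[of 1] r[of 0] r[of 1] by auto
  qed
  then show ?case by blast
next
  case (5 t p)
  let ?t = "tsubst (\<lambda>i. Var (i - 1)) t"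
  have tlift: "tlift ?t = t"
  proof -
    have "tsubst (\<lambda>i. Var (Suc (i - 1))) t = tsubst Var t"
      using 5(1) by (intro tsubst_cong) (auto intro!: Suc_pred gr0I)
    then show ?thesis by (simp add: tlift_def tsubst_tsubst)
  qed
  have sat: "sat UNIV (dec y) (All (Imp (Lt (Var 0) t) p)) = (\<forall>x<tval (dec y) ?t. sat UNIV (dec (pair x y)) p)" for y :: 'a
    using tval_tlift[of _ "dec y" ?t] unfolding tlift by (simp add: dec_pair)
  obtain l r where lr: "coded l (\<lambda>y::'a. tval (dec y) ?t)" "coded r (\<lambda>y::'a. tv (sat UNIV (dec y) p))"
    using 5(3) coded_tm by blast
  obtain n where n: "of_nat n = (pair 9 (pair (of_nat l) (of_nat r)) :: 'a)" using of_nat_pair3[of _ l r] by metis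
  have n': "fstp (of_nat n) = (9::'a)" "fstp (sndp (of_nat n)) = (of_nat l::'a)" "sndp (sndp (of_nat n)) = (of_nat r::'a)"
    by (simp_all add: n)
  have ok: "okc s (of_nat n) y v \<longleftrightarrow> (\<exists>u<s. cl s (of_nat l) y u \<and> (v = 1 \<and> (\<forall>x<u. cl s (of_nat r) (pair x y) 1) \<or>
        v = 0 \<and> (\<exists>x<u. cl s (of_nat r) (pair x y) 0)))" for s y v :: 'a
    unfolding okc_def n' by simp
  have "coded n (\<lambda>y::'a. tv (sat UNIV (dec y) (All (Imp (Lt (Var 0) t) p))))"
  proof (rule codedI)
    fix s y v :: 'a assume s: "Cert s" and "okc s (of_nat n) y v"
    then obtain u where u: "cl s (of_nat l) y u" "v = 1 \<and> (\<forall>x<u. cl s (of_nat r) (pair x y) 1) \<or>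
        v = 0 \<and> (\<exists>x<u. cl s (of_nat r) (pair x y) 0)" unfolding ok by blast
    have "u = tval (dec y) ?t" using coded_sound[OF lr(1) s u(1)] .
    moreover have "cl s (of_nat r) (pair x y) w \<Longrightarrow> w = tv (sat UNIV (dec (pair x y)) p)" for x w
      using coded_sound[OF lr(2) s] by blast
    ultimately show "v = tv (sat UNIV (dec y) (All (Imp (Lt (Var 0) t) p)))"
      using u(2) unfolding sat by fastforce
  next
    fix I and b :: 'a assume I: "cutI I" "b \<in> I"
    obtain S1 where S1: "S1 \<in> I" "Cert S1" "\<And>y. y < b \<Longrightarrow> cl S1 (of_nat l) y (tval (dec y) ?t)"
      using coded_complete[OF lr(1) I] by blast
    \<comment> \<open>The values of the bounding term are below \<open>S1\<close>, so the extended
      environments \<open>pair x y\<close> that the quantifier visits are all at most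
      \<open>pair S1 b\<close>.\<close>
    have "pair S1 b + 1 \<in> I" using I S1 by (intro cutI_intros)
    then obtain S2 where S2: "S2 \<in> I" "Cert S2"
      "\<And>y. y < pair S1 b + 1 \<Longrightarrow> cl S2 (of_nat r) y (tv (sat UNIV (dec y) p))"
      using coded_complete[OF lr(2) I(1)] by blast
    show "\<exists>S\<in>I. Cert S \<and> (\<forall>y<b. cl S (of_nat n) y (tv (sat UNIV (dec y) (All (Imp (Lt (Var 0) t) p)))))"
    proof (rule ext_cert[OF I(1) S1(1) S2(1) cutI_of_nat[OF I(1)] I(2) cutI_simps(2)[OF I(1)] S1(2) S2(2)])
      show "FD (\<lambda>e. tv (sat UNIV (dec (e 0)) (All (Imp (Lt (Var 0) t) p))))"
        by (rule FD_tv[OF DF_sat_dec]) (rule bounded.intros(5)[OF 5(1,2)])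
    next
      fix y s assume y: "y < b" and s1: "\<And>q. mem q S1 \<Longrightarrow> mem q s" and s2: "\<And>q. mem q S2 \<Longrightarrow> mem q s"
      have l: "cl S1 (of_nat l) y (tval (dec y) ?t)" using S1(3) y by blast
      then have ls: "tval (dec y) ?t < S1" by (rule cl_less(3))
      have r: "cl s (of_nat r) (pair x y) (tv (sat UNIV (dec (pair x y)) p))" if "x < tval (dec y) ?t" for x
      proof -
        have "pair x y \<le> pair S1 b" using that ls y by (intro pair_mono) auto
        then show ?thesis using S2(3) s2 by (simp add: less_S_iff)
      qed
      have "cl s (of_nat l) y (tval (dec y) ?t)" using l s1 by blast
      moreover from this have "tval (dec y) ?t < s" by (rule cl_less(3))
      moreover have "(tv (sat UNIV (dec y) (All (Imp (Lt (Var 0) t) p))) = (1::'a) \<and> (\<forall>x<tval (dec y) ?t. cl s (of_nat r) (pair x y) 1)) \<or>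
        (tv (sat UNIV (dec y) (All (Imp (Lt (Var 0) t) p))) = (0::'a) \<and> (\<exists>x<tval (dec y) ?t. cl s (of_nat r) (pair x y) 0))"
      proof (cases "\<forall>x<tval (dec y) ?t. sat UNIV (dec (pair x y)) p")
        case True
        then show ?thesis using r unfolding sat by simp
      next
        case False
        then obtain x where "x < tval (dec y) ?t" "\<not> sat UNIV (dec (pair x y)) p" by blast
        then show ?thesis using r[of x] unfolding sat by auto
      qed
      ultimately show "okc s (of_nat n) y (tv (sat UNIV (dec y) (All (Imp (Lt (Var 0) t) p))))"
        unfolding ok by blast
    qed (rule tv_le)
  qed
  then show ?case by blast
qed

theorem coded_BD1: "BD (\<lambda>e. B (e 0)) \<Longrightarrow> \<exists>n. coded n (\<lambda>y::'a::pa. tv (B (fstp y)))"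
proof -
  assume "BD (\<lambda>e. B (e 0))"
  then obtain p where "bounded p" "\<And>e. sat UNIV e p = B (e 0)" unfolding BD_def by blast
  moreover from this obtain n where "coded n (\<lambda>y::'a. tv (sat UNIV (dec y) p))" using coded_bounded by blast
  ultimately show ?thesis by (intro exI[of _ n]) simp
qed

section \<open>Universal formulas and closed submodels\<close>

text \<open>A semantic form of the hierarchy: \<open>G k True\<close> is Sigma_k and
  \<open>G k False\<close> is Pi_k, for predicates of one number with exactly one quantifier per
  block. Free variables are packed into that number by \<open>pair\<close>, and
  \<open>G_merge\<close> contracts a block.\<close>

primrec G :: "nat \<Rightarrow> bool \<Rightarrow> ('a::pa \<Rightarrow> bool) \<Rightarrow> bool" where
  "G 0 b A = BD (\<lambda>e. A (e 0))"
| "G (Suc k) b A = (\<exists>C. G k (\<not> b) C \<and> (\<forall>y. A y \<longleftrightarrow> (if b then \<exists>x. C (pair x y) else \<forall>x. C (pair x y))))"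

lemma G_SucI:
  assumes "G k (\<not> b) C" "\<And>y. A y \<longleftrightarrow> (if b then \<exists>x. C (pair x y) else \<forall>x. C (pair x y))"
  shows "G (Suc k) b A"
  using assms by auto

lemma G_not: "G k b A \<Longrightarrow> G k (\<not> b) (\<lambda>y. \<not> A y)"
proof (induction k arbitrary: b A)
  case (Suc k)
  then obtain C where "G k (\<not> b) C" "\<And>y. A y \<longleftrightarrow> (if b then \<exists>x. C (pair x y) else \<forall>x. C (pair x y))" by auto
  then show ?case using Suc.IH[of "\<not> b" C] by (intro G_SucI[where C = "\<lambda>y. \<not> C y"]) auto
qed (simp add: BD_Not)

lemma G_sub: "G k b A \<Longrightarrow> FN (\<lambda>e. r (e 0)) \<Longrightarrow> G k b (\<lambda>y. A (r y))"
proof (induction k arbitrary: b A r)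
  case 0
  then show ?case using BD1[of A "\<lambda>e. r (e 0)"] by simp
next
  case (Suc k)
  then obtain C where C: "G k (\<not> b) C" "\<And>y. A y \<longleftrightarrow> (if b then \<exists>x. C (pair x y) else \<forall>x. C (pair x y))" by auto
  have "G k (\<not> b) (\<lambda>Y. C (pair (fstp Y) (r (sndp Y))))"
    by (rule Suc.IH[OF C(1)]) (intro fn FN1[OF Suc.prems(2)])
  then show ?case by (rule G_SucI) (simp add: C(2))
qed

lemma G_and: "G k b A \<Longrightarrow> G k b B \<Longrightarrow> G k b (\<lambda>y. A y \<and> B y)"
proof (induction k arbitrary: b A B)
  case (Suc k)
  obtain C where C: "G k (\<not> b) C" "\<And>y. A y \<longleftrightarrow> (if b then \<exists>x. C (pair x y) else \<forall>x. C (pair x y))" using Suc.prems(1) by auto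
  obtain D where D: "G k (\<not> b) D" "\<And>y. B y \<longleftrightarrow> (if b then \<exists>x. D (pair x y) else \<forall>x. D (pair x y))" using Suc.prems(2) by auto
  have "G k (\<not> b) (\<lambda>Y. C (pair (fstp (fstp Y)) (sndp Y)))" by (rule G_sub[OF C(1)]) (intro fn)
  moreover have "G k (\<not> b) (\<lambda>Y. D (pair (sndp (fstp Y)) (sndp Y)))" by (rule G_sub[OF D(1)]) (intro fn)
  ultimately have "G k (\<not> b) (\<lambda>Y. C (pair (fstp (fstp Y)) (sndp Y)) \<and> D (pair (sndp (fstp Y)) (sndp Y)))"
    by (rule Suc.IH)
  then show ?case
  proof (rule G_SucI)
    fix y
    have "(\<exists>x. C (pair x y)) \<and> (\<exists>x. D (pair x y)) \<longleftrightarrow> (\<exists>x. C (pair (fstp x) y) \<and> D (pair (sndp x) y))"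
      by (metis fstp_pair sndp_pair)
    moreover have "(\<forall>x. C (pair x y)) \<and> (\<forall>x. D (pair x y)) \<longleftrightarrow> (\<forall>x. C (pair (fstp x) y) \<and> D (pair (sndp x) y))"
      by (metis fstp_pair sndp_pair)
    ultimately show "A y \<and> B y \<longleftrightarrow> (if b
       then \<exists>x. C (pair (fstp (fstp (pair x y))) (sndp (pair x y))) \<and> D (pair (sndp (fstp (pair x y))) (sndp (pair x y)))
       else \<forall>x. C (pair (fstp (fstp (pair x y))) (sndp (pair x y))) \<and> D (pair (sndp (fstp (pair x y))) (sndp (pair x y))))"
      unfolding C(2) D(2) by simp
  qed
qed (simp add: BD_And)

lemma G_or: "G k b A \<Longrightarrow> G k b B \<Longrightarrow> G k b (\<lambda>y. A y \<or> B y)"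
  using G_not[OF G_and[OF G_not G_not, of k "b" A B]] by simp

lemma G_dummy: "G k b A \<Longrightarrow> G (Suc k) (\<not> b) A"
  by (rule G_SucI[where C = "\<lambda>Y. A (sndp Y)"]) (simp_all add: G_sub FN_sndp FN_var)

lemma G_up: "G k b A \<Longrightarrow> G (Suc k) b A"
proof (induction k arbitrary: b A)
  case 0
  then have "G 0 (\<not> b) A" by simp
  from G_dummy[OF this] show ?case by simp
next
  case (Suc k)
  then obtain C where C: "G k (\<not> b) C" "\<And>y. A y \<longleftrightarrow> (if b then \<exists>x. C (pair x y) else \<forall>x. C (pair x y))" by auto
  show ?case by (rule G_SucI[OF Suc.IH[OF C(1)] C(2)])
qed

lemma G_le: "G j b A \<Longrightarrow> j \<le> k \<Longrightarrow> G k b A"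
  by (rule dec_induct[of j k "\<lambda>k. G k b A"]) (auto intro: G_up simp del: G.simps)

lemma G_BD: "BD (\<lambda>e. A (e 0)) \<Longrightarrow> G k b A"
  by (rule G_le[of 0]) auto

lemma G_merge: "G (Suc k) b A \<Longrightarrow> G (Suc k) b (\<lambda>y. if b then \<exists>x. A (pair x y) else \<forall>x. A (pair x y))"
proof -
  assume "G (Suc k) b A"
  then obtain C where C: "G k (\<not> b) C" "\<And>y. A y \<longleftrightarrow> (if b then \<exists>x. C (pair x y) else \<forall>x. C (pair x y))" by auto
  have "G k (\<not> b) (\<lambda>Y. C (pair (fstp (fstp Y)) (pair (sndp (fstp Y)) (sndp Y))))"
    by (rule G_sub[OF C(1)]) (intro fn)
  then show ?thesis
  proof (rule G_SucI)
    fix y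
    have "(\<exists>x z. C (pair z (pair x y))) \<longleftrightarrow> (\<exists>x. C (pair (fstp x) (pair (sndp x) y)))"
      by (metis fstp_pair sndp_pair)
    moreover have "(\<forall>x z. C (pair z (pair x y))) \<longleftrightarrow> (\<forall>x. C (pair (fstp x) (pair (sndp x) y)))"
      by (metis fstp_pair sndp_pair)
    ultimately show "(if b then \<exists>x. A (pair x y) else \<forall>x. A (pair x y)) \<longleftrightarrow> (if b
       then \<exists>x. C (pair (fstp (fstp (pair x y))) (pair (sndp (fstp (pair x y))) (sndp (pair x y))))
       else \<forall>x. C (pair (fstp (fstp (pair x y))) (pair (sndp (fstp (pair x y))) (sndp (pair x y)))))"
      unfolding C(2) by simp
  qed
qed

lemma G_DF: "G k b A \<Longrightarrow> DF (\<lambda>e. A (e 0))"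
proof (induction k arbitrary: b A)
  case (Suc k)
  then obtain C where C: "G k (\<not> b) C" "\<And>y. A y \<longleftrightarrow> (if b then \<exists>x. C (pair x y) else \<forall>x. C (pair x y))" by auto
  have "DF (\<lambda>e. C (e 0))" by (rule Suc.IH[OF C(1)])
  note d = DF1[OF this]
  show ?case unfolding C(2) by (cases b) (simp_all, (intro df d fd)+)
qed (simp add: BD_DF)

lemma G_ball:
  assumes A: "G n False A" and t: "FN (\<lambda>e. t (e 0))"
  shows "G n False (\<lambda>y. \<forall>q<t y. A (pair q y))"
proof (cases n)
  case 0
  then have "BD (\<lambda>e. A (e 0))" using A by simp
  note d = BD1[OF this]
  show ?thesis unfolding 0 G.simps by (intro bd d fn t)
next
  case (Suc k)
  have "G n False (\<lambda>Y. \<not> fstp Y < t (sndp Y) \<or> A Y)"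
    by (rule G_or[OF G_BD A]) (intro bd fn FN1[OF t])
  from G_merge[OF this[unfolded Suc]] show ?thesis unfolding Suc by (simp del: G.simps)
qed

lemma sigma_pi_G:
  "sigma k p \<Longrightarrow> G k True (\<lambda>y::'a::pa. sat UNIV (dec y) p)"
  "pi k p \<Longrightarrow> G k False (\<lambda>y::'a::pa. sat UNIV (dec y) p)"
proof (induction rule: sigma_pi.inducts)
  case (1 p)
  then have "BD (\<lambda>e::nat \<Rightarrow> 'a. sat UNIV e p)" unfolding BD_def by blast
  then show ?case using BD_dec FN_var by fastforce
next
  case (2 p)
  then have "BD (\<lambda>e::nat \<Rightarrow> 'a. sat UNIV e p)" unfolding BD_def by blast
  then show ?case using BD_dec FN_var by fastforce
next
  case (3 k p)
  then show ?case using G_dummy by fastforce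
next
  case (4 k p)
  then show ?case using G_dummy by fastforce
next
  case (5 k p)
  from G_merge[OF 5(2)] show ?case by (simp add: dec_pair del: G.simps)
next
  case (6 k p)
  from G_merge[OF 6(2)] show ?case by (simp add: dec_pair del: G.simps)
qed

text \<open>\<open>Y\<close> is read as \<open>pair (pair s x) y\<close>, with s a certificate, x
  the genuine value of the innermost variable and y the remaining arguments; the outer pair with 0
  turns \<open>pair x y\<close> into position 0 of an environment.\<close>

definition K1 :: "'a::pa \<Rightarrow> 'a \<Rightarrow> bool" where
  "K1 e Y \<longleftrightarrow> Cert (fstp (fstp Y)) \<and> cl (fstp (fstp Y)) e (pair (pair (sndp (fstp Y)) (sndp Y)) 0) 1"
definition K0 :: "'a::pa \<Rightarrow> 'a \<Rightarrow> bool" where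
  "K0 e Y \<longleftrightarrow> Cert (fstp (fstp Y)) \<and> cl (fstp (fstp Y)) e (pair (pair (sndp (fstp Y)) (sndp Y)) 0) 0"

primrec pref :: "nat \<Rightarrow> bool \<Rightarrow> ('a::pa \<Rightarrow> 'a \<Rightarrow> bool) \<Rightarrow> 'a \<Rightarrow> 'a \<Rightarrow> bool" where
  "pref 0 b N e Y = N e Y"
| "pref (Suc k) b N e Y = (if b then \<exists>x. pref k (\<not> b) N e (pair x Y) else \<forall>x. pref k (\<not> b) N e (pair x Y))"

text \<open>The certificate is absorbed into the innermost quantified variable: positive certificates
  are used if that quantifier is existential, negative ones if it is universal.\<close>

definition kernel :: "bool \<Rightarrow> 'a::pa \<Rightarrow> 'a \<Rightarrow> bool" where
  "kernel b e Y \<longleftrightarrow> (if b then K1 e Y else \<not> K0 e Y)"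

lemma pref_G:
  assumes N: "BD (\<lambda>e. N (e 0) (e 1))"
  shows "G k b (\<lambda>q. pref k b N (fstp q) (sndp q))"
proof (induction k arbitrary: b)
  case 0
  show ?case using BD2[OF N] by (simp add: fn)
next
  case (Suc k)
  have "G k (\<not> b) (\<lambda>Y. (\<lambda>q. pref k (\<not> b) N (fstp q) (sndp q)) (pair (fstp (sndp Y)) (pair (fstp Y) (sndp (sndp Y)))))"
    by (rule G_sub[OF Suc.IH]) (intro fn)
  then show ?case by (rule G_SucI) simp
qed

lemma BD_kernel: "BD (\<lambda>e. kernel b (e 0) (e 1))"
  unfolding kernel_def K1_def K0_def by (cases b) (simp_all, (intro bd fn)+)

lemma kernel_univ:
  assumes "coded m (\<lambda>y. tv (B (fstp y)))"
  shows "(\<exists>z. K1 (of_nat m) (pair z Y)) \<longleftrightarrow> (\<exists>x. B (pair x Y))"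
    and "(\<forall>z. \<not> K0 (of_nat m) (pair z Y)) \<longleftrightarrow> (\<forall>x. B (pair x Y))"
    and "K1 (of_nat m) (pair z Y) \<Longrightarrow> B (pair (sndp z) Y)"
proof -
  have s: "tv (B q) = v" if "Cert s" "cl s (of_nat m) (pair q 0) v" for s q v
    using coded_sound[OF assms that] by simp
  have c: "\<exists>s. Cert s \<and> cl s (of_nat m) (pair q 0) (tv (B q))" for q
    using coded_complete[OF assms cutI_UNIV, of "pair q 0 + 1"]
    by (auto simp: less_S_iff dest!: spec[of _ "pair q 0"])
  show 3: "K1 (of_nat m) (pair z Y) \<Longrightarrow> B (pair (sndp z) Y)" for z
    using s by (fastforce simp: K1_def)
  have 0: "K0 (of_nat m) (pair z Y) \<Longrightarrow> \<not> B (pair (sndp z) Y)" for z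
    using s by (fastforce simp: K0_def)
  have 4: "\<exists>z. K1 (of_nat m) (pair z Y)" if B: "B (pair x Y)" for x
  proof -
    obtain s where "Cert s" "cl s (of_nat m) (pair (pair x Y) 0) 1" using c[of "pair x Y"] B by auto
    then have "K1 (of_nat m) (pair (pair s x) Y)" by (simp add: K1_def)
    then show ?thesis by blast
  qed
  have 5: "\<exists>z. K0 (of_nat m) (pair z Y)" if B: "\<not> B (pair x Y)" for x
  proof -
    obtain s where "Cert s" "cl s (of_nat m) (pair (pair x Y) 0) 0" using c[of "pair x Y"] B by auto
    then have "K0 (of_nat m) (pair (pair s x) Y)" by (simp add: K0_def)
    then show ?thesis by blast
  qed
  show "(\<exists>z. K1 (of_nat m) (pair z Y)) \<longleftrightarrow> (\<exists>x. B (pair x Y))" using 3 4 by blast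
  show "(\<forall>z. \<not> K0 (of_nat m) (pair z Y)) \<longleftrightarrow> (\<forall>x. B (pair x Y))" using 0 5 by blast
qed

lemma pref_univ:
  "G (Suc k) b A \<Longrightarrow> \<exists>m. \<forall>Y. A Y \<longleftrightarrow> pref (Suc k) b (kernel (b = even k)) (of_nat m) Y"
proof (induction k arbitrary: b A)
  case 0
  then obtain C where C: "BD (\<lambda>e. C (e 0))" "\<And>y. A y \<longleftrightarrow> (if b then \<exists>x. C (pair x y) else \<forall>x. C (pair x y))" by auto
  obtain m where "coded m (\<lambda>y. tv (C (fstp y)))" using coded_BD1[OF C(1)] by blast
  note m = kernel_univ[OF this]
  show ?case by (rule exI[of _ m]) (simp add: C(2) kernel_def m)
next
  case (Suc k)
  from Suc.prems obtain C where C: "G (Suc k) (\<not> b) C" "\<And>y. A y \<longleftrightarrow> (if b then \<exists>x. C (pair x y) else \<forall>x. C (pair x y))"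
    unfolding G.simps(2)[of "Suc k"] by blast
  obtain m where m: "\<And>Y. C Y \<longleftrightarrow> pref (Suc k) (\<not> b) (kernel ((\<not> b) = even k)) (of_nat m) Y"
    using Suc.IH[OF C(1)] by blast
  have "((\<not> b) = even k) = (b = even (Suc k))" by auto
  then show ?case
    by (intro exI[of _ m] allI) (simp only: C(2) m pref.simps(2)[of "Suc k"])
qed

text \<open>Of n alternating quantifiers starting with a universal one, the last is existential
  exactly for positive even n; positive certificates are therefore used for even n. At n = 0 there
  is no quantifier and \<open>U\<close> is \<open>K1\<close> itself.\<close>

definition U :: "nat \<Rightarrow> 'a::pa \<Rightarrow> 'a \<Rightarrow> bool" where
  "U n = pref n False (kernel (even n))"

text \<open>At level 0 no quantifier can absorb the certificate, so it has to travel with the Skolem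
  value, from which \<open>zt\<close> strips it. At higher levels the Skolem value is taken as it
  is.\<close>

definition zt :: "nat \<Rightarrow> 'a::pa \<Rightarrow> 'a" where
  "zt n z = (if n = 0 then sndp z else z)"

lemma U_univ:
  assumes "G n False C"
  obtains m where "\<And>y. (\<exists>z. C (pair z y)) \<Longrightarrow> \<exists>z. U n (of_nat m) (pair z y)"
    "\<And>z y. U n (of_nat m) (pair z y) \<Longrightarrow> C (pair (zt n z) y)"
proof (cases n)
  case 0
  then have "BD (\<lambda>e. C (e 0))" using assms by simp
  then obtain m where "coded m (\<lambda>y. tv (C (fstp y)))" using coded_BD1 by blast
  note m = kernel_univ[OF this]
  show ?thesis
    by (rule that[of m]) (use m in \<open>auto simp: 0 U_def zt_def kernel_def\<close>)
next
  case (Suc k)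
  obtain m where m: "\<And>Y. C Y \<longleftrightarrow> pref (Suc k) False (kernel (False = even k)) (of_nat m) Y"
    using pref_univ[OF assms[unfolded Suc]] by blast
  have "C Y \<longleftrightarrow> U n (of_nat m) Y" for Y unfolding m U_def Suc by simp
  then show ?thesis by (intro that[of m]) (auto simp: zt_def Suc)
qed

text \<open>The argument has the form \<open>pair r (pair z y)\<close>, where r =
  \<open>pair m c\<close> consists of the code of a Pi_n relation and a parameter. It says that z is
  a value of relation r at y, so a single number names a Pi_n relation with parameter.\<close>

definition Th :: "nat \<Rightarrow> 'a::pa \<Rightarrow> bool" where
  "Th n q \<longleftrightarrow> U n (fstp (fstp q)) (pair (fstp (sndp q)) (pair (sndp (sndp q)) (sndp (fstp q))))"

lemma Th_G: "G n False (Th n)"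
proof -
  have "G n False (\<lambda>q. (\<lambda>q. pref n False (kernel (even n)) (fstp q) (sndp q))
      (pair (fstp (fstp q)) (pair (fstp (sndp q)) (pair (sndp (sndp q)) (sndp (fstp q))))))"
    by (rule G_sub[OF pref_G[OF BD_kernel]]) (intro fn)
  then show ?thesis by (simp add: Th_def[abs_def] U_def)
qed

definition good :: "nat \<Rightarrow> 'a::pa \<Rightarrow> bool" where
  "good n r \<longleftrightarrow> (\<forall>y. \<exists>z. Th n (pair r (pair z y)))"

lemma good_ex:
  assumes C: "G n False C" and tot: "\<And>y. \<exists>z. C (pair z (pair y c))"
  obtains r where "good n r" "\<And>z y. Th n (pair r (pair z y)) \<Longrightarrow> C (pair (zt n z) (pair y c))"
proof -
  obtain m where m: "\<And>y. (\<exists>z. C (pair z y)) \<Longrightarrow> \<exists>z. U n (of_nat m) (pair z y)"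
    "\<And>z y. U n (of_nat m) (pair z y) \<Longrightarrow> C (pair (zt n z) y)" using U_univ[OF C] by blast
  show ?thesis
    by (rule that[of "pair (of_nat m) c"]) (use m tot in \<open>auto simp: good_def Th_def\<close>)
qed

definition Kel :: "'a::pa set \<Rightarrow> bool" where
  "Kel K \<longleftrightarrow> (\<forall>t. FN t \<longrightarrow> (\<forall>e. (\<forall>i. e i \<in> K) \<longrightarrow> t e \<in> K)) \<and> K \<noteq> {}"

lemma KelD: "Kel K \<Longrightarrow> FN t \<Longrightarrow> (\<And>i. e i \<in> K) \<Longrightarrow> t e \<in> K"
  by (simp add: Kel_def)

lemma Kel_intros:
  assumes K: "Kel K"
  shows Kel_0: "0 \<in> K" and Kel_1: "1 \<in> K" and Kel_add: "x \<in> K \<Longrightarrow> y \<in> K \<Longrightarrow> x + y \<in> K"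
    and Kel_mult: "x \<in> K \<Longrightarrow> y \<in> K \<Longrightarrow> x * y \<in> K" and Kel_pair: "x \<in> K \<Longrightarrow> y \<in> K \<Longrightarrow> pair x y \<in> K"
    and Kel_fstp: "x \<in> K \<Longrightarrow> fstp x \<in> K" and Kel_sndp: "x \<in> K \<Longrightarrow> sndp x \<in> K"
    and Kel_dec: "x \<in> K \<Longrightarrow> dec x i \<in> K" and Kel_zt: "x \<in> K \<Longrightarrow> zt n x \<in> K"
proof -
  obtain k where k: "k \<in> K" using K by (auto simp: Kel_def)
  have un: "FN (\<lambda>e. f (e 0)) \<Longrightarrow> x \<in> K \<Longrightarrow> f x \<in> K" for f x using KelD[OF K, of "\<lambda>e. f (e 0)" "\<lambda>_. x"] by simp
  have bin: "FN (\<lambda>e. f (e 0) (e 1)) \<Longrightarrow> x \<in> K \<Longrightarrow> y \<in> K \<Longrightarrow> f x y \<in> K" for f x y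
    using KelD[OF K, of "\<lambda>e. f (e 0) (e 1)" "x ## (\<lambda>_. y)"] by (simp add: scons_in)
  show "0 \<in> K" by (rule un[where f = "\<lambda>_. 0", OF FN_0 k])
  show "1 \<in> K" by (rule un[where f = "\<lambda>_. 1", OF FN_one k])
  show "x \<in> K \<Longrightarrow> y \<in> K \<Longrightarrow> x + y \<in> K" by (rule bin[where f = "(+)"]) (auto intro: fn)
  show "x \<in> K \<Longrightarrow> y \<in> K \<Longrightarrow> x * y \<in> K" by (rule bin[where f = "(*)"]) (auto intro: fn)
  show "x \<in> K \<Longrightarrow> y \<in> K \<Longrightarrow> pair x y \<in> K" by (rule bin[where f = "pair"]) (auto intro: fn)
  show f: "x \<in> K \<Longrightarrow> fstp x \<in> K" for x by (rule un[where f = fstp]) (auto intro: fn)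
  show s: "x \<in> K \<Longrightarrow> sndp x \<in> K" by (rule un[where f = sndp]) (auto intro: fn)
  show "x \<in> K \<Longrightarrow> dec x i \<in> K" by (rule un[where f = "\<lambda>x. dec x i"]) (auto intro: FN_dec fn)
  show "x \<in> K \<Longrightarrow> zt n x \<in> K" using s by (simp add: zt_def)
qed

lemma Kel_closed_dom: "Kel K \<Longrightarrow> closed_dom K"
  by (simp add: closed_dom_def Kel_0 Kel_1 Kel_add Kel_mult)

text \<open>The least counterexample to a bounded universal quantifier is a bounded search, hence a
  function in \<open>FN\<close> of the environment, and so it already lies in
  \<open>K\<close>.\<close>

lemma Kel_bounded: "bounded p \<Longrightarrow> Kel K \<Longrightarrow> (\<And>i. e i \<in> K) \<Longrightarrow> sat K e p = sat UNIV e p"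
proof (induction arbitrary: e rule: bounded.induct)
  case (5 t p)
  let ?t = "tsubst (\<lambda>i. Var (i - 1)) t"
  have tlift: "tlift ?t = t"
  proof -
    have "tsubst (\<lambda>i. Var (Suc (i - 1))) t = tsubst Var t"
      using 5(1) by (intro tsubst_cong) (auto intro!: Suc_pred gr0I)
    then show ?thesis by (simp add: tlift_def tsubst_tsubst)
  qed
  note tl = tval_tlift[of _ _ ?t, unfolded tlift]
  have IH: "x \<in> K \<Longrightarrow> sat K (x ## e) p = sat UNIV (x ## e) p" for x
    by (rule 5(3)[OF 5(4)]) (simp add: scons_in 5(5))
  have "BD (\<lambda>e. sat UNIV e p)" using 5(2) unfolding BD_def by blast
  then have b: "BD (\<lambda>e. \<not> sat UNIV (e 0 ## (\<lambda>i. e (Suc i))) p)" unfolding scons_eta by (rule BD_Not)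
  have "FN (\<lambda>e. tval e ?t)" by (rule TM_FN) (auto simp: TM_def)
  from FN_lst[OF this, of "\<lambda>x e. \<not> sat UNIV (x ## e) p", OF b]
  have w: "lst (\<lambda>x. x < tval e ?t \<and> \<not> sat UNIV (x ## e) p) \<in> K" using KelD[OF 5(4)] 5(5) by blast
  have d: "DF (\<lambda>x. x 0 < tval e ?t \<and> \<not> sat UNIV (x 0 ## e) p)"
  proof -
    have "DF (\<lambda>x. sat UNIV (\<lambda>i. (case i of 0 \<Rightarrow> x 0 | Suc j \<Rightarrow> e j)) p)"
    proof (rule DF_subst[OF BD_DF[OF \<open>BD (\<lambda>e. sat UNIV e p)\<close>]])
      show "FD (\<lambda>x. case i of 0 \<Rightarrow> x 0 | Suc j \<Rightarrow> e j)" for i by (cases i) (auto intro: fd)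
    qed
    then have "DF (\<lambda>x. sat UNIV (x 0 ## e) p)" by (simp add: scons_def[abs_def])
    then show ?thesis by (intro df fd)
  qed
  have "\<exists>x\<in>K. x < tval e ?t \<and> \<not> sat UNIV (x ## e) p" if "x < tval e ?t" "\<not> sat UNIV (x ## e) p" for x
    using lst_works(1)[OF d, of x] that w by blast
  then show ?case using IH by (simp add: tl) blast
qed simp_all

definition Kcl :: "nat \<Rightarrow> 'a::pa set \<Rightarrow> 'a set \<Rightarrow> bool" where
  "Kcl n E K \<longleftrightarrow> Kel K \<and> (\<forall>r\<in>E. \<forall>y\<in>K. \<exists>z\<in>K. Th n (pair r (pair z y)))"

lemma Kcl_Kel: "Kcl n E K \<Longrightarrow> Kel K" and Kcl_subset: "Kcl n E K \<Longrightarrow> F \<subseteq> E \<Longrightarrow> Kcl n F K"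
  by (auto simp: Kcl_def)

lemma enc_ex: "Kel K \<Longrightarrow> (\<And>i. e i \<in> K) \<Longrightarrow> \<exists>y\<in>K. \<forall>i<N. dec y i = e i"
proof (induction N arbitrary: e)
  case 0
  then show ?case by (auto intro: Kel_0)
next
  case (Suc N)
  obtain y where y: "y \<in> K" "\<And>i. i < N \<Longrightarrow> dec y i = e (Suc i)" using Suc.IH[of "\<lambda>i. e (Suc i)"] Suc.prems by blast
  have "dec (pair (e 0) y) i = e i" if "i < Suc N" for i
    using that y(2) by (cases i) auto
  then show ?case using y(1) Suc.prems by (intro bexI[of _ "pair (e 0) y"]) (auto intro: Kel_pair)
qed

text \<open>A partial Skolem function can be made total when its totalisation does not raise the
  complexity, that is, strictly below the top level.\<close>

lemma skolem_partial:
  assumes A: "G (Suc k) True A" and k: "Suc k \<le> n"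
  obtains r where "good n r"
    "\<And>K y. Kcl n {r} K \<Longrightarrow> y \<in> K \<Longrightarrow> \<exists>x. A (pair x y) \<Longrightarrow> \<exists>x\<in>K. A (pair x y)"
proof -
  obtain D where D: "G k False D" "\<And>y. A y \<longleftrightarrow> (\<exists>x. D (pair x y))" using A by auto
  define D' where "D' Y = D (pair (fstp (fstp Y)) (pair (sndp (fstp Y)) (sndp Y)))" for Y
  have ex: "(\<exists>x. A (pair x y)) \<longleftrightarrow> (\<exists>u. D' (pair u y))" for y
    unfolding D(2) D'_def by (metis fstp_pair sndp_pair)
  have A': "G (Suc k) False (\<lambda>y. \<not> (\<exists>x. A (pair x y)))"
    using G_not[OF G_merge[OF A]] by (simp del: G.simps)
  have "G k False D'" unfolding D'_def[abs_def] by (rule G_sub[OF D(1)]) (intro fn)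
  then have "G n False D'" using k by (auto intro: G_le)
  then have 1: "G n False (\<lambda>Y. D' (pair (fstp Y) (fstp (sndp Y))))" by (rule G_sub) (intro fn)
  have "G n False (\<lambda>y. \<not> (\<exists>x. A (pair x y)))" using A' k by (rule G_le)
  then have 2: "G n False (\<lambda>Y. \<not> (\<exists>x. A (pair x (fstp (sndp Y)))))"
    by (rule G_sub[where r = "\<lambda>Y. fstp (sndp Y)"]) (intro fn)
  let ?C = "\<lambda>Y. D' (pair (fstp Y) (fstp (sndp Y))) \<or> \<not> (\<exists>x. A (pair x (fstp (sndp Y))))"
  have "\<exists>z. ?C (pair z (pair y 0))" for y using ex by auto
  then obtain r where r: "good n r" "\<And>z y. Th n (pair r (pair z y)) \<Longrightarrow> ?C (pair (zt n z) (pair y 0))"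
    using good_ex[OF G_or[OF 1 2]] by blast
  show ?thesis
  proof (rule that[OF r(1)])
    fix K y assume K: "Kcl n {r} K" "y \<in> K" and x: "\<exists>x. A (pair x y)"
    obtain z where z: "z \<in> K" "Th n (pair r (pair z y))" using K by (auto simp: Kcl_def)
    then have "D' (pair (zt n z) y)" using r(2) x by fastforce
    then have "A (pair (sndp (zt n z)) y)" unfolding D(2) D'_def by auto
    moreover have "sndp (zt n z) \<in> K" using z(1) Kcl_Kel[OF K(1)] by (intro Kel_sndp Kel_zt)
    ultimately show "\<exists>x\<in>K. A (pair x y)" by blast
  qed
qed

lemma fvars_bounded: "\<exists>N. \<forall>i\<in>fvars p. i < N"
  using finite_fvars[of p] by (simp add: finite_nat_set_iff_bounded)

lemma skolem_fm:
  assumes A: "G (Suc k) True (\<lambda>y::'a::pa. sat UNIV (dec y) p)" and k: "Suc k \<le> n"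
  obtains r :: "'a::pa" where "good n r"
    "\<And>K e. Kcl n {r} K \<Longrightarrow> (\<And>i. e i \<in> K) \<Longrightarrow> \<exists>x. sat UNIV (x ## e) p \<Longrightarrow> \<exists>x\<in>K. sat UNIV (x ## e) p"
proof -
  obtain r :: 'a where r: "good n r"
    "\<And>K y. Kcl n {r} K \<Longrightarrow> y \<in> K \<Longrightarrow> \<exists>x. sat UNIV (dec (pair x y)) p \<Longrightarrow> \<exists>x\<in>K. sat UNIV (dec (pair x y)) p"
    using skolem_partial[OF A k] by blast
  obtain N where N: "\<forall>i\<in>fvars p. i < N" using fvars_bounded by blast
  show ?thesis
  proof (rule that[OF r(1)])
    fix K and e :: "nat \<Rightarrow> 'a" assume K: "Kcl n {r} K" "\<And>i. e i \<in> K" and ex: "\<exists>x. sat UNIV (x ## e) p"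
    obtain y where y: "y \<in> K" "\<forall>i<N. dec y i = e i" using enc_ex[of K e N] Kcl_Kel[OF K(1)] K(2) by metis
    have "sat UNIV (x ## e) p = sat UNIV (dec (pair x y)) p" for x
      unfolding dec_pair
    proof (rule sat_cong)
      fix i assume "i \<in> fvars p"
      then show "(x ## e) i = (x ## dec y) i" using N y(2) by (cases i) auto
    qed
    then show "\<exists>x\<in>K. sat UNIV (x ## e) p" using r(2)[OF K(1) y(1)] ex by (simp only:)
  qed
qed

definition absol :: "nat \<Rightarrow> 'a::pa set \<Rightarrow> fm \<Rightarrow> bool" where
  "absol n E p \<longleftrightarrow> finite E \<and> (\<forall>r\<in>E. good n r) \<and>
     (\<forall>K e. Kcl n E K \<longrightarrow> (\<forall>i. e i \<in> K) \<longrightarrow> sat K e p = sat UNIV e p)"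

text \<open>The classes stop at level n because the Skolem function for a quantifier has to be
  totalised within Pi_n. Each quantifier contributes one good relation, so a finite set
  \<open>E\<close> suffices for a formula.\<close>

lemma absoluteness:
  "sigma k p \<Longrightarrow> k \<le> n \<Longrightarrow> \<exists>E::'a::pa set. absol n E p"
  "pi k p \<Longrightarrow> k \<le> n \<Longrightarrow> \<exists>E::'a::pa set. absol n E p"
proof (induction rule: sigma_pi.inducts)
  case (1 p)
  then show ?case by (intro exI[of _ "{}"]) (auto simp: absol_def Kel_bounded Kcl_Kel)
next
  case (2 p)
  then show ?case by (intro exI[of _ "{}"]) (auto simp: absol_def Kel_bounded Kcl_Kel)
next
  case (5 k p)
  then obtain E :: "'a set" where E: "absol n E p" by blast
  obtain r :: 'a where r: "good n r"
    "\<And>K e. Kcl n {r} K \<Longrightarrow> (\<And>i. e i \<in> K) \<Longrightarrow> \<exists>x. sat UNIV (x ## e) p \<Longrightarrow> \<exists>x\<in>K. sat UNIV (x ## e) p"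
    using skolem_fm[OF sigma_pi_G(1)[OF 5(1)] 5(3)] by blast
  have "sat K e (Ex p) = sat UNIV e (Ex p)" if K: "Kcl n (insert r E) K" "\<forall>i. e i \<in> K" for K and e :: "nat \<Rightarrow> 'a"
  proof -
    have "sat K (x ## e) p = sat UNIV (x ## e) p" if "x \<in> K" for x
      using E Kcl_subset[OF K(1), of E] K(2) that scons_in[of x K e] unfolding absol_def by blast
    then show ?thesis using r(2)[OF Kcl_subset[OF K(1), of "{r}"], of e] K(2) by auto
  qed
  then have "absol n (insert r E) (Ex p)" using E r(1) unfolding absol_def by blast
  then show ?case by blast
next
  case (6 k p)
  then obtain E :: "'a set" where E: "absol n E p" by blast
  have "G (Suc k) True (\<lambda>y::'a. sat UNIV (dec y) (Neg p))"
    using G_not[OF sigma_pi_G(2)[OF 6(1)]] by (simp del: G.simps)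
  then obtain r :: 'a where r: "good n r"
    "\<And>K e. Kcl n {r} K \<Longrightarrow> (\<And>i. e i \<in> K) \<Longrightarrow> \<exists>x. sat UNIV (x ## e) (Neg p) \<Longrightarrow> \<exists>x\<in>K. sat UNIV (x ## e) (Neg p)"
    using skolem_fm[OF _ 6(3)] by blast
  have "sat K e (All p) = sat UNIV e (All p)" if K: "Kcl n (insert r E) K" "\<forall>i. e i \<in> K" for K and e :: "nat \<Rightarrow> 'a"
  proof -
    have "sat K (x ## e) p = sat UNIV (x ## e) p" if "x \<in> K" for x
      using E Kcl_subset[OF K(1), of E] K(2) that scons_in[of x K e] unfolding absol_def by blast
    then show ?thesis using r(2)[OF Kcl_subset[OF K(1), of "{r}"], of e] K(2) by auto
  qed
  then have "absol n (insert r E) (All p)" using E r(1) unfolding absol_def by blast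
  then show ?case by blast
qed auto

text \<open>At level n + 1 totalising the Skolem relation would leave Pi_n, so full absoluteness is
  out of reach. What remains is that truth passes to \<open>K\<close> at those points whose witness
  \<open>u\<close>, packing all existential variables, belongs to \<open>K\<close>.\<close>

lemma sigma_witness:
  assumes "sigma (Suc n) p"
  shows "\<exists>(E::'a::pa set) D. finite E \<and> (\<forall>r\<in>E. good n r) \<and> G n False D \<and>
    (\<forall>y. sat UNIV (dec y) p \<longleftrightarrow> (\<exists>u. D (pair u y))) \<and>
    (\<forall>K y u. Kcl n E K \<longrightarrow> y \<in> K \<longrightarrow> u \<in> K \<longrightarrow> D (pair u y) \<longrightarrow> sat K (dec y) p)"
  using assms
proof (induction "Suc n" p rule: sigma_pi.inducts(1)[where ?P2.0 = "\<lambda>_ _. True"])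
  case (3 p)
  obtain E :: "'a set" where E: "absol n E p" using absoluteness(2)[OF 3(1)] by blast
  have "G n False (\<lambda>Y::'a. sat UNIV (dec (sndp Y)) p)" by (rule G_sub[OF sigma_pi_G(2)[OF 3(1)]]) (intro fn)
  moreover have "sat K (dec y) p" if "Kcl n E K" "y \<in> K" "sat UNIV (dec y) p" for K and y :: 'a
    using E that Kel_dec[OF Kcl_Kel[OF that(1)] that(2)] unfolding absol_def by blast
  ultimately show ?case
    using E by (intro exI[of _ E] exI[of _ "\<lambda>Y. sat UNIV (dec (sndp Y)) p"]) (auto simp: absol_def)
next
  case (5 p)
  then obtain E :: "'a set" and D where E: "finite E" "\<forall>r\<in>E. good n r" and D: "G n False D"
    "\<And>y. sat UNIV (dec y) p \<longleftrightarrow> (\<exists>u. D (pair u y))"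
    "\<And>K y u. Kcl n E K \<Longrightarrow> y \<in> K \<Longrightarrow> u \<in> K \<Longrightarrow> D (pair u y) \<Longrightarrow> sat K (dec y) p" by auto
  define D' where "D' Y = D (pair (fstp (fstp Y)) (pair (sndp (fstp Y)) (sndp Y)))" for Y
  have "G n False D'" unfolding D'_def[abs_def] by (rule G_sub[OF D(1)]) (intro fn)
  moreover have "sat UNIV (dec y) (Ex p) \<longleftrightarrow> (\<exists>u. D' (pair u y))" for y
  proof -
    have "(\<exists>x u. D (pair u (pair x y))) \<longleftrightarrow> (\<exists>u. D (pair (fstp u) (pair (sndp u) y)))"
      by (metis fstp_pair sndp_pair)
    then show ?thesis using D(2)[of "pair _ y"] by (simp add: D'_def dec_pair)
  qed
  moreover have "sat K (dec y) (Ex p)" if K: "Kcl n E K" "y \<in> K" "u \<in> K" "D' (pair u y)" for K y u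
  proof -
    note i = Kel_intros[OF Kcl_Kel[OF K(1)]]
    have "sat K (dec (pair (sndp u) y)) p"
      by (rule D(3)[OF K(1), of _ "fstp u"]) (use K(4) in \<open>auto simp: D'_def intro: i K(2,3)\<close>)
    then show ?thesis using i(7)[OF K(3)] by (auto simp: dec_pair)
  qed
  ultimately show ?case using E by (intro exI[of _ E] exI[of _ D']) auto
qed auto

text \<open>\<open>(sndp ^^ j) y = c\<close> says that y extends the fixed environment c by j
  arbitrary entries, one for each universal quantifier stripped off. At other y the relation
  \<open>?C\<close> is made true outright, so it is total and still Pi_n, and its Skolem function
  supplies the witnesses.\<close>

lemma sigma_total:
  assumes "sigma (Suc n) p" and tot: "\<And>y::'a::pa. (sndp ^^ j) y = c \<Longrightarrow> sat UNIV (dec y) p"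
  shows "\<exists>E::'a::pa set. finite E \<and> (\<forall>r\<in>E. good n r) \<and>
    (\<forall>K y. Kcl n E K \<longrightarrow> y \<in> K \<longrightarrow> (sndp ^^ j) y = c \<longrightarrow> sat K (dec y) p)"
proof -
  obtain E :: "'a set" and D where E: "finite E" "\<forall>r\<in>E. good n r" and D: "G n False D"
    "\<And>y. sat UNIV (dec y) p \<longleftrightarrow> (\<exists>u. D (pair u y))"
    "\<And>K y u. Kcl n E K \<Longrightarrow> y \<in> K \<Longrightarrow> u \<in> K \<Longrightarrow> D (pair u y) \<Longrightarrow> sat K (dec y) p"
    using sigma_witness[OF assms(1)] by metis
  let ?C = "\<lambda>Y. D (pair (fstp Y) (fstp (sndp Y))) \<or> (sndp ^^ j) (fstp (sndp Y)) \<noteq> sndp (sndp Y)"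
  have 1: "G n False (\<lambda>Y. D (pair (fstp Y) (fstp (sndp Y))))" by (rule G_sub[OF D(1)]) (intro fn)
  have 2: "G n False (\<lambda>Y::'a. (sndp ^^ j) (fstp (sndp Y)) \<noteq> sndp (sndp Y))"
    by (rule G_BD) (intro bd fn FN1[OF FN_funpow])
  have "\<exists>z. ?C (pair z (pair y c))" for y
    using tot D(2) by (cases "(sndp ^^ j) y = c") auto
  then obtain r where r: "good n r" "\<And>z y. Th n (pair r (pair z y)) \<Longrightarrow> ?C (pair (zt n z) (pair y c))"
    using good_ex[OF G_or[OF 1 2]] by blast
  have "sat K (dec y) p" if K: "Kcl n (insert r E) K" "y \<in> K" "(sndp ^^ j) y = c" for K y
  proof -
    obtain z where z: "z \<in> K" "Th n (pair r (pair z y))" using K(1,2) by (auto simp: Kcl_def)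
    have "D (pair (zt n z) y)" using r(2)[OF z(2)] K(3) by simp
    then show ?thesis
      using D(3)[OF Kcl_subset[OF K(1), of E] K(2) Kel_zt[OF Kcl_Kel[OF K(1)] z(1)]] by blast
  qed
  then show ?thesis using E r(1) by (intro exI[of _ "insert r E"]) auto
qed

lemma pi_total:
  assumes "pi (Suc (Suc n)) p" and tot: "\<And>y::'a::pa. (sndp ^^ j) y = c \<Longrightarrow> sat UNIV (dec y) p"
  shows "\<exists>E::'a::pa set. finite E \<and> (\<forall>r\<in>E. good n r) \<and>
    (\<forall>K y. Kcl n E K \<longrightarrow> y \<in> K \<longrightarrow> (sndp ^^ j) y = c \<longrightarrow> sat K (dec y) p)"
  using assms
proof (induction "Suc (Suc n)" p arbitrary: j rule: sigma_pi.inducts(2)[where ?P1.0 = "\<lambda>_ _. True"])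
  case (4 p)
  then show ?case using sigma_total[of n p j c] by blast
next
  case (6 p)
  have tt: "sat UNIV (dec y) p" if "(sndp ^^ Suc j) y = c" for y :: 'a
  proof -
    have "sat UNIV (dec (sndp y)) (All p)" using 6(3)[of "sndp y"] that by (simp add: funpow_swap1)
    moreover have "dec y = fstp y ## dec (sndp y)" by (rule ext) (simp add: scons_def split: nat.split)
    ultimately show ?thesis by simp
  qed
  have "\<exists>E::'a set. finite E \<and> (\<forall>r\<in>E. good n r) \<and>
    (\<forall>K y. Kcl n E K \<longrightarrow> y \<in> K \<longrightarrow> (sndp ^^ Suc j) y = c \<longrightarrow> sat K (dec y) p)"
    by (rule 6(2)) (rule tt)
  then obtain E :: "'a set" where E: "finite E" "\<forall>r\<in>E. good n r"
    and E3: "\<forall>K y. Kcl n E K \<longrightarrow> y \<in> K \<longrightarrow> (sndp ^^ Suc j) y = c \<longrightarrow> sat K (dec y) p" by (elim exE conjE)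
  have "sat K (dec y) (All p)" if K: "Kcl n E K" "y \<in> K" "(sndp ^^ j) y = c" for K y
  proof -
    have "sat K (dec (pair x y)) p" if "x \<in> K" for x
      using E3[rule_format, OF K(1) Kel_pair[OF Kcl_Kel[OF K(1)] that K(2)]] K(3) by (simp add: funpow_swap1)
    then show ?thesis by (simp add: dec_pair)
  qed
  then show ?case using E(1,2) by blast
qed auto

text \<open>The witnesses of the leading existential block are collected in \<open>c'\<close>, which
  \<open>K\<close> is asked to contain; what is left is a Pi_(n+2) statement true at all extensions
  of a fixed environment, the case of \<open>pi_total\<close>.\<close>

lemma sigma3_reflect:
  assumes "sigma (Suc (Suc (Suc n))) p" and "sat UNIV (dec (c::'a::pa)) p"
  shows "\<exists>(E::'a::pa set) c'. finite E \<and> (\<forall>r\<in>E. good n r) \<and>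
    (\<forall>K. Kcl n E K \<longrightarrow> c' \<in> K \<longrightarrow> sat K (dec c) p)"
  using assms
proof (induction "Suc (Suc (Suc n))" p arbitrary: c rule: sigma_pi.inducts(1)[where ?P2.0 = "\<lambda>_ _. True"])
  case (3 p)
  obtain E :: "'a set" where "finite E" "\<forall>r\<in>E. good n r"
    "\<forall>K y. Kcl n E K \<longrightarrow> y \<in> K \<longrightarrow> (sndp ^^ 0) y = c \<longrightarrow> sat K (dec y) p"
    using pi_total[OF 3(1), of 0 c] 3(3) by auto
  then show ?case by (intro exI[of _ E] exI[of _ c]) auto
next
  case (5 p)
  then obtain x where "sat UNIV (dec (pair x c)) p" by (auto simp: dec_pair)
  from 5(2)[OF this] obtain E :: "'a set" and c' where E: "finite E" "\<forall>r\<in>E. good n r"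
    and E3: "\<forall>K. Kcl n E K \<longrightarrow> c' \<in> K \<longrightarrow> sat K (dec (pair x c)) p" by (elim exE conjE)
  have "sat K (dec c) (Ex p)" if K: "Kcl n E K" "pair c' x \<in> K" for K
  proof -
    have "c' \<in> K" "x \<in> K" using Kel_fstp[OF Kcl_Kel[OF K(1)] K(2)] Kel_sndp[OF Kcl_Kel[OF K(1)] K(2)] by simp_all
    then show ?thesis using E3 K(1) by (auto simp: dec_pair)
  qed
  then show ?case using E(1,2) by (intro exI[of _ E] exI[of _ "pair c' x"]) auto
qed auto

section \<open>The chain of states\<close>

lemma TM_pair: "TM t \<Longrightarrow> TM u \<Longrightarrow> TM (\<lambda>e. pair (t e) (u e))"
  unfolding pair_def by (intro TM_add TM_mult)

text \<open>The way back from semantic classes to formulas: the term \<open>t\<close> packs the free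
  variables, which turns the matrix of the later injection into a genuine \<open>pi n\<close>
  formula.\<close>

lemma G_fm: "G k b A \<Longrightarrow> TM t \<Longrightarrow> \<exists>p. (if b then sigma k p else pi k p) \<and> (\<forall>e. sat UNIV e p = A (t e))"
proof (induction k arbitrary: b A t)
  case 0
  then have "BD (\<lambda>e. A (t e))" using BD1[of A t] TM_FN[of t] by simp
  then obtain p where "bounded p" "\<forall>e. sat UNIV e p = A (t e)" unfolding BD_def by blast
  then show ?case by (intro exI[of _ p]) (auto intro: sigma_pi.intros)
next
  case (Suc k)
  from Suc.prems(1) obtain C where C: "G k (\<not> b) C" "\<And>y. A y \<longleftrightarrow> (if b then \<exists>x. C (pair x y) else \<forall>x. C (pair x y))" by auto
  have "TM (\<lambda>e. pair (e 0) (t (\<lambda>i. e (Suc i))))" using TM_ren[OF Suc.prems(2), of Suc] by (intro TM_pair TM_var)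
  from Suc.IH[OF C(1) this] obtain p where p: "if \<not> b then sigma k p else pi k p"
    "\<And>e. sat UNIV e p = C (pair (e 0) (t (\<lambda>i. e (Suc i))))" by blast
  show ?case
  proof (cases b)
    case True
    then have "sigma (Suc k) (Ex p)" using p(1) by (auto intro: sigma_pi.intros)
    moreover have "sat UNIV e (Ex p) = A (t e)" for e using p(2) by (simp add: C(2) True)
    ultimately show ?thesis using True by auto
  next
    case False
    then have "pi (Suc k) (All p)" using p(1) by (auto intro: sigma_pi.intros)
    moreover have "sat UNIV e (All p) = A (t e)" for e using p(2) by (simp add: C(2) False)
    ultimately show ?thesis using False by auto
  qed
qed

text \<open>That T codes the Pi_n truths below w is not Pi_n as it stands, because false statements
  must be excluded. Pairing T with a function that gives a counterexample for each q < w outside T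
  repairs this: then only Pi_n statements and refuted instances occur, under bounded
  quantifiers.\<close>

lemma TV_exists:
  "\<exists>P. G n False (\<lambda>Y::'a::pa. P (fstp Y) (sndp Y)) \<and>
     (\<forall>w z. P w z \<longrightarrow> (\<forall>q. mem q (fstp z) \<longleftrightarrow> q < w \<and> Th n q)) \<and> (\<forall>w. \<exists>z. P w z)"
proof -
  have TD: "DF (\<lambda>e. Th n (e 0 :: 'a))" by (rule G_DF[OF Th_G])
  have T: "\<exists>T. \<forall>q. mem q T \<longleftrightarrow> q < w \<and> Th n q" for w :: 'a by (rule compr[OF TD])
  show ?thesis
  proof (cases n)
    case 0
    have "BD (\<lambda>e. Th n (e 0 :: 'a))" using Th_G[of n] 0 by simp
    note TB = BD1[OF this]
    let ?P = "\<lambda>w z. (\<forall>q<fstp z. mem q (fstp z) \<longrightarrow> q < w) \<and> (\<forall>q<w. mem q (fstp z) \<longleftrightarrow> Th n q)"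
    have "G n False (\<lambda>Y::'a. ?P (fstp Y) (sndp Y))"
      by (rule G_BD) (intro bd fn TB)
    moreover have "\<forall>q. mem q (fstp z) \<longleftrightarrow> q < w \<and> Th n q" if "?P w z" for w z :: 'a
      using that mem_less by blast
    moreover have "\<exists>z. ?P w z" for w :: 'a
    proof -
      obtain T where "\<And>q. mem q T \<longleftrightarrow> q < w \<and> Th n q" using T by blast
      then show ?thesis by (intro exI[of _ "pair T 0"]) auto
    qed
    ultimately show ?thesis by (intro exI[of _ ?P]) blast
  next
    case (Suc k)
    obtain D where D: "G k True D" "\<And>q::'a. Th n q \<longleftrightarrow> (\<forall>x. D (pair x q))"
      using Th_G[of n] Suc by auto
    let ?P = "\<lambda>w z. (\<forall>q<fstp z. mem q (fstp z) \<longrightarrow> q < w) \<and> (\<forall>q<w. \<not> mem q (fstp z) \<or> Th n q) \<and>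
       (\<forall>q<w. mem q (fstp z) \<or> \<not> D (pair (app (sndp z) q) q))"
    have 1: "G n False (\<lambda>Y::'a. \<forall>q<fstp (sndp Y). mem q (fstp (sndp Y)) \<longrightarrow> q < fstp Y)"
      by (rule G_BD) (intro bd fn)
    have "G n False (\<lambda>Y::'a. \<not> mem (fstp Y) (fstp (sndp (sndp Y))) \<or> Th n (fstp Y))"
      by (rule G_or[OF G_BD G_sub[OF Th_G]]) (intro bd fn)+
    from G_ball[OF this, of fstp] have 2: "G n False (\<lambda>Y::'a. \<forall>q<fstp Y. \<not> mem q (fstp (sndp Y)) \<or> Th n q)"
      by (simp add: FN_fstp FN_var del: G.simps)
    have "G n False (\<lambda>Y. \<not> D Y)"
      using G_le[OF G_not[OF D(1)], of n] Suc by simp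
    from G_sub[OF this, of "\<lambda>Y. pair (app (sndp (sndp (sndp Y))) (fstp Y)) (fstp Y)"]
    have "G n False (\<lambda>Y. \<not> D (pair (app (sndp (sndp (sndp Y))) (fstp Y)) (fstp Y)))" by (simp add: fn del: G.simps)
    from G_or[OF G_BD this, of "\<lambda>Y. mem (fstp Y) (fstp (sndp (sndp Y)))"]
    have "G n False (\<lambda>Y. mem (fstp Y) (fstp (sndp (sndp Y))) \<or> \<not> D (pair (app (sndp (sndp (sndp Y))) (fstp Y)) (fstp Y)))"
      by (simp add: bd fn del: G.simps)
    from G_ball[OF this, of fstp] have 3: "G n False (\<lambda>Y. \<forall>q<fstp Y. mem q (fstp (sndp Y)) \<or> \<not> D (pair (app (sndp (sndp Y)) q) q))"
      by (simp add: FN_fstp FN_var del: G.simps)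
    have "G n False (\<lambda>Y. ?P (fstp Y) (sndp Y))"
      by (intro G_and 1 2 3)
    moreover have "\<forall>q. mem q (fstp z) \<longleftrightarrow> q < w \<and> Th n q" if "?P w z" for w z :: 'a
    proof
      fix q
      have a: "mem q (fstp z) \<Longrightarrow> q < w" using that mem_less by blast
      moreover have "mem q (fstp z) \<Longrightarrow> Th n q" using that a by blast
      moreover have "q < w \<Longrightarrow> Th n q \<Longrightarrow> mem q (fstp z)" using that D(2) by blast
      ultimately show "mem q (fstp z) \<longleftrightarrow> q < w \<and> Th n q" by blast
    qed
    moreover have "\<exists>z. ?P w z" for w :: 'a
    proof -
      obtain T where T': "\<And>q. mem q T \<longleftrightarrow> q < w \<and> Th n q" using T by blast
      have "DF (\<lambda>e. (\<lambda>q v. Th n q \<or> \<not> D (pair v q)) (e 0) (e 1))"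
        by (intro df DF1[OF TD] DF1[OF G_DF[OF D(1)]] fd)
      from fun_compr[OF this, of w] obtain f where "\<forall>q<w. Th n q \<or> \<not> D (pair (app f q) q)" using D(2) by blast
      then show ?thesis using T' by (intro exI[of _ "pair T f"]) auto
    qed
    ultimately show ?thesis by (intro exI[of _ ?P]) blast
  qed
qed

definition TV :: "nat \<Rightarrow> 'a::pa \<Rightarrow> 'a \<Rightarrow> bool" where
  "TV n = (SOME P. G n False (\<lambda>Y. P (fstp Y) (sndp Y)) \<and>
     (\<forall>w z. P w z \<longrightarrow> (\<forall>q. mem q (fstp z) \<longleftrightarrow> q < w \<and> Th n q)) \<and> (\<forall>w. \<exists>z. P w z))"

lemma TV_G: "G n False (\<lambda>Y. TV n (fstp Y) (sndp Y))"
  and TV_Th: "TV n w z \<Longrightarrow> mem q (fstp z) \<longleftrightarrow> q < w \<and> Th n q"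
  and TV_ex: "\<exists>z. TV n w z"
  using someI_ex[OF TV_exists[of n]] unfolding TV_def[symmetric] by blast+

text \<open>\<open>Sub\<close> speaks about all codes s. The bounded equivalent says that codes
  below d exist for the empty set and for adding one element below b; induction on j then builds a
  code of the part of s below j.\<close>

lemma Sub_bounded: "Sub b d \<longleftrightarrow> (\<exists>s<d. \<forall>x<s. \<not> mem x s) \<and>
   (\<forall>s<d. (\<forall>x<s. mem x s \<longrightarrow> x < b) \<longrightarrow> (\<forall>y<b. \<exists>s'<d. (\<forall>x<b. mem x s' \<longleftrightarrow> mem x s \<or> x = y) \<and> (\<forall>x<s'. mem x s' \<longrightarrow> x < b)))"
  (is "_ \<longleftrightarrow> ?e \<and> ?c")
proof
  assume S: "Sub b d"
  have "DF (\<lambda>e::nat \<Rightarrow> 'a. False)" by (intro df)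
  from Sub_compr[OF S this] have ?e by blast
  moreover have ?c
  proof (intro allI impI)
    fix s y assume "s < d" "\<forall>x<s. mem x s \<longrightarrow> x < b" "y < b"
    have "DF (\<lambda>e. mem (e 0) s \<or> e 0 = y)" by (intro df fd)
    from Sub_compr[OF S this] show "\<exists>s'<d. (\<forall>x<b. mem x s' \<longleftrightarrow> mem x s \<or> x = y) \<and> (\<forall>x<s'. mem x s' \<longrightarrow> x < b)" by blast
  qed
  ultimately show "?e \<and> ?c" by blast
next
  assume a: "?e \<and> ?c"
  show "Sub b d" unfolding Sub_def
  proof
    fix s
    have "\<exists>s'<d. \<forall>x. mem x s' \<longleftrightarrow> x < b \<and> x < j \<and> mem x s" for j
    proof (rule induct_DF[where P = "\<lambda>j. \<exists>s'<d. \<forall>x. mem x s' \<longleftrightarrow> x < b \<and> x < j \<and> mem x s"])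
      show "DF (\<lambda>e. \<exists>s'<d. \<forall>x. mem x s' \<longleftrightarrow> x < b \<and> x < e 0 \<and> mem x s)" by (intro df fd)
      obtain s0 where s0: "s0 < d" "\<forall>x<s0. \<not> mem x s0" using a by blast
      then have "\<not> mem x s0" for x using mem_less by blast
      then show "\<exists>s'<d. \<forall>x. mem x s' \<longleftrightarrow> x < b \<and> x < 0 \<and> mem x s" using s0(1) by auto
      fix j assume "\<exists>s'<d. \<forall>x. mem x s' \<longleftrightarrow> x < b \<and> x < j \<and> mem x s"
      then obtain s' where s': "s' < d" "\<And>x. mem x s' \<longleftrightarrow> x < b \<and> x < j \<and> mem x s" by blast
      have lt: "x < j + 1 \<longleftrightarrow> x < j \<or> x = j" for x by (auto simp: less_S_iff le_less)
      show "\<exists>s'<d. \<forall>x. mem x s' \<longleftrightarrow> x < b \<and> x < j + 1 \<and> mem x s"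
      proof (cases "j < b \<and> mem j s")
        case True
        have "\<forall>x<s'. mem x s' \<longrightarrow> x < b" using s'(2) by blast
        then obtain s2 where s2: "s2 < d" "\<forall>x<b. mem x s2 \<longleftrightarrow> mem x s' \<or> x = j" "\<forall>x<s2. mem x s2 \<longrightarrow> x < b"
          using a s'(1) True by blast
        have "mem x s2 \<longleftrightarrow> x < b \<and> x < j + 1 \<and> mem x s" for x
        proof (cases "x < b")
          case x: True
          then have "mem x s2 \<longleftrightarrow> mem x s' \<or> x = j" using s2(2) by blast
          then show ?thesis unfolding lt s'(2) using x True by blast
        next
          case False
          then have "\<not> mem x s2" using s2(3) mem_less by blast
          then show ?thesis using False by blast
        qed
        then show ?thesis using s2(1) by blast
      next
        case False
        then have "mem x s' \<longleftrightarrow> x < b \<and> x < j + 1 \<and> mem x s" for x unfolding s'(2) lt by blast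
        then show ?thesis using s'(1) by blast
      qed
    qed
    from this[of b] show "\<exists>s'<d. \<forall>x. mem x s' \<longleftrightarrow> x < b \<and> mem x s" by auto
  qed
qed

lemma BD_Sub [bd]: "FN t \<Longrightarrow> FN u \<Longrightarrow> BD (\<lambda>e. Sub (t e) (u e))"
proof (rule BD2[where P = Sub])
  show "BD (\<lambda>e. Sub (e 0) (e 1))" unfolding Sub_bounded by (intro bd fn)
qed

text \<open>The bound \<open>app f s\<close> is the size needed for the pigeonhole argument of the thinning lemma
  below with \<open>s\<close> colours and \<open>s\<close> steps.\<close>

definition Gap :: "'a::pa \<Rightarrow> 'a \<Rightarrow> bool" where
  "Gap s s' \<longleftrightarrow> pair s s + 1 < s' \<and> Sub s s' \<and>
     (\<exists>f<s'. app f 0 = 0 \<and> (\<forall>i<s. app f (i + 1) = s * (1 + app f i)) \<and> app f s < s')"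

lemma BD_Gap [bd]: "FN t \<Longrightarrow> FN u \<Longrightarrow> BD (\<lambda>e. Gap (t e) (u e))"
proof (rule BD2[where P = Gap])
  show "BD (\<lambda>e. Gap (e 0) (e 1))" unfolding Gap_def by (intro bd fn)
qed

lemma DF_Gap [df]: "FD t \<Longrightarrow> FD u \<Longrightarrow> DF (\<lambda>e. Gap (t e) (u e))"
  by (rule DF2[where P = Gap, OF BD_DF[OF BD_Gap[OF FN_var FN_var]]])

lemma Gap_ex: "\<exists>s'. Gap s s'" for s :: "'a::pa"
proof -
  obtain d where d: "Sub s d" using Sub_ex by blast
  have 1: "DF (\<lambda>e. (\<lambda>i x y. y = s * (1 + x)) (e 0) (e 1) (e 2))" by (intro df fd)
  have 2: "DF (\<lambda>e. (\<lambda>i x. True) (e 0) (e 1))" by (intro df fd)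
  obtain f where f: "app f 0 = 0" "\<forall>i<s. app f (i + 1) = s * (1 + app f i)"
    using recursion[OF 1 2, where ?x0.0 = 0 and n = s] by auto
  let ?s = "pair s s + 1 + (d + (f + 1))"
  have lt: "x < y + 1" if "x \<le> y" for x y :: 'a using that by (simp add: less_S_iff)
  have "1 \<le> d + (f + 1)" by (intro add_increasing zero_le order_refl)
  then have "pair s s + 1 < ?s" by (simp add: less_iff_succ_less_eq)
  moreover have "Sub s ?s" by (rule Sub_mono[OF d]) (simp add: add.assoc add_increasing add_increasing2)
  moreover have "f < ?s" by (rule less_le_trans[OF lt[of f f]]) (simp_all add: add_increasing)
  moreover have "app f s < ?s" by (rule less_le_trans[OF lt[OF app_le]]) (simp_all add: add_increasing)
  ultimately show ?thesis using f unfolding Gap_def by blast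
qed

text \<open>A tower above y has height y. Its entries at standard heights generate a cut above y,
  and entries at nonstandard heights, which dominate that cut, serve as lengths of the sequences of
  indiscernibles.\<close>

definition tower :: "'a::pa \<Rightarrow> 'a \<Rightarrow> bool" where
  "tower y z \<longleftrightarrow> app z 0 = y \<and> (\<forall>i<y. Gap (app z i) (app z (i + 1)))"

lemma BD_tower [bd]: "FN t \<Longrightarrow> FN u \<Longrightarrow> BD (\<lambda>e. tower (t e) (u e))"
proof (rule BD2[where P = tower])
  show "BD (\<lambda>e. tower (e 0) (e 1))" unfolding tower_def by (intro bd fn)
qed

lemma tower_ex: "\<exists>z. tower y z" for y :: "'a::pa"
proof -
  have 1: "DF (\<lambda>e. (\<lambda>i. Gap) (e 0) (e 1) (e 2))" by (intro df fd)
  have 2: "DF (\<lambda>e. (\<lambda>i x. True) (e 0) (e 1))" by (intro df fd)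
  show ?thesis using recursion[OF 1 2, where ?x0.0 = y and n = y] Gap_ex unfolding tower_def by blast
qed

text \<open>With this relation among those under whose Skolem functions the submodel is closed,
  codes of truth together with their refutations exist inside the submodel;
  \<open>good_tower\<close> does the same for towers.\<close>

lemma good_TV: obtains r where "good n r" "\<And>z y. Th n (pair r (pair z y)) \<Longrightarrow> TV n y (zt n z)"
proof -
  have "G n False (\<lambda>Y::'a. TV n (fstp (sndp Y)) (fstp Y))"
    using G_sub[OF TV_G[of n], of "\<lambda>Y. pair (fstp (sndp Y)) (fstp Y)"] by (simp add: fn del: G.simps)
  moreover have "\<exists>z. TV n (fstp (sndp (pair z (pair y 0)))) (fstp (pair z (pair y (0::'a))))" for y
    by (simp add: TV_ex)
  ultimately obtain r :: 'a where r: "good n r" and r2: "\<And>z y. Th n (pair r (pair z y)) \<Longrightarrow>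
     TV n (fstp (sndp (pair (zt n z) (pair y 0)))) (fstp (pair (zt n z) (pair y 0)))"
    by (rule good_ex) blast
  show ?thesis by (rule that[OF r]) (use r2 in simp)
qed

lemma good_tower: obtains r where "good n r" "\<And>z y. Th n (pair r (pair z y)) \<Longrightarrow> tower y (zt n z)"
proof -
  have "G n False (\<lambda>Y::'a. tower (fstp (sndp Y)) (fstp Y))"
    by (rule G_BD) (intro bd fn)
  moreover have "\<exists>z. tower (fstp (sndp (pair z (pair y 0)))) (fstp (pair z (pair y (0::'a))))" for y
    by (simp add: tower_ex)
  ultimately obtain r :: 'a where r: "good n r" and r2: "\<And>z y. Th n (pair r (pair z y)) \<Longrightarrow>
     tower (fstp (sndp (pair (zt n z) (pair y 0)))) (fstp (pair (zt n z) (pair y 0)))"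
    by (rule good_ex) blast
  show ?thesis by (rule that[OF r]) (use r2 in simp)
qed

definition idx :: "'a::pa \<Rightarrow> 'a" where "idx h = sndp (sndp (sndp h))"
definition bnd :: "'a::pa \<Rightarrow> 'a" where "bnd h = fstp (sndp h)"
definition tru :: "'a::pa \<Rightarrow> 'a" where "tru h = fstp (sndp (sndp h))"

lemma FN_parts [fn]: "FN t \<Longrightarrow> FN (\<lambda>e. idx (t e))" "FN t \<Longrightarrow> FN (\<lambda>e. bnd (t e))" "FN t \<Longrightarrow> FN (\<lambda>e. tru (t e))"
  unfolding idx_def bnd_def tru_def by (intro fn; assumption)+

lemma FD_parts [fd]: "FD t \<Longrightarrow> FD (\<lambda>e. idx (t e))" "FD t \<Longrightarrow> FD (\<lambda>e. bnd (t e))" "FD t \<Longrightarrow> FD (\<lambda>e. tru (t e))"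
  unfolding idx_def bnd_def tru_def by (intro fd; assumption)+

text \<open>\<open>x\<close> exceeds a value of every relation in \<open>\<epsilon>\<close> at all
  arguments up to \<open>g\<close>, and also the number stating this fact, so that the truth code of
  a state with bound \<open>x\<close> records it. The truth predicate is a parameter, because the
  chain is later verified with membership in a coded set in place of \<open>Th n\<close>.\<close>

definition BT :: "('a::pa \<Rightarrow> bool) \<Rightarrow> 'a \<Rightarrow> 'a \<Rightarrow> 'a \<Rightarrow> bool" where
  "BT P \<epsilon> g x \<longleftrightarrow> g < x \<and> (\<forall>r<\<epsilon>. mem r \<epsilon> \<longrightarrow> (\<forall>y\<le>g. \<exists>z<x. pair r (pair z y) < x \<and> P (pair r (pair z y))))"

definition codes :: "('a::pa \<Rightarrow> bool) \<Rightarrow> 'a \<Rightarrow> 'a \<Rightarrow> bool" where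
  "codes P x t \<longleftrightarrow> (\<forall>q<t. mem q t \<longrightarrow> q < x) \<and> (\<forall>q<x. mem q t \<longleftrightarrow> P q)"

text \<open>A state \<open>h\<close> consists of its predecessor, a bound, the code of the set of
  true \<open>q\<close> below the bound, and its index in the chain.\<close>

definition Stp :: "('a::pa \<Rightarrow> bool) \<Rightarrow> 'a \<Rightarrow> 'a \<Rightarrow> 'a \<Rightarrow> bool" where
  "Stp P \<epsilon> g h \<longleftrightarrow> h = pair g (pair (bnd h) (pair (tru h) (idx g + 1))) \<and>
     BT P \<epsilon> g (bnd h) \<and> (\<forall>x<bnd h. \<not> BT P \<epsilon> g x) \<and> codes P (bnd h) (tru h) \<and> (\<forall>t<tru h. \<not> codes P (bnd h) t)"

lemma codes_iff: "codes P x t \<longleftrightarrow> (\<forall>q. mem q t \<longleftrightarrow> q < x \<and> P q)"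
  unfolding codes_def using mem_less by blast

lemma BT_cong: "(\<And>q. q < w \<Longrightarrow> P q = P' q) \<Longrightarrow> x \<le> w \<Longrightarrow> BT P \<epsilon> g x = BT P' \<epsilon> g x"
  unfolding BT_def by (meson less_le_trans)

lemma codes_cong: "(\<And>q. q < w \<Longrightarrow> P q = P' q) \<Longrightarrow> x \<le> w \<Longrightarrow> codes P x t = codes P' x t"
  unfolding codes_def by (meson less_le_trans)

text \<open>A step consults the truth predicate only below the bound of the new state. A code of the
  truths below w therefore decides all steps with bounds up to w, which keeps the description of the
  chain at the level of \<open>TV\<close>.\<close>

lemma Stp_cong:
  assumes "\<And>q. q < w \<Longrightarrow> P q = P' q" "bnd h \<le> w"
  shows "Stp P \<epsilon> g h = Stp P' \<epsilon> g h"
proof -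
  have "BT P \<epsilon> g x = BT P' \<epsilon> g x" if "x \<le> bnd h" for x
    by (rule BT_cong[OF assms(1)]) (use that assms(2) in auto)
  moreover have "codes P (bnd h) t = codes P' (bnd h) t" for t by (rule codes_cong[OF assms])
  ultimately show ?thesis unfolding Stp_def by (auto simp: less_imp_le)
qed

lemma BD_Stp: "BD (\<lambda>e. Stp (\<lambda>q. mem q (e 0)) (e 1) (e 2) (e 3))"
  unfolding Stp_def BT_def codes_def by (intro bd fn)

lemma DF_BT:
  assumes "DF (\<lambda>e. P (e 0))" shows "DF (\<lambda>e. BT P \<epsilon> (e 0) (e 1))"
  unfolding BT_def by (intro df fd DF1[OF assms])

lemma DF_Stp:
  assumes "DF (\<lambda>e. P (e 0))" shows "DF (\<lambda>e. Stp P \<epsilon> (e 0) (e 1))"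
  unfolding Stp_def BT_def codes_def by (intro df fd DF1[OF assms])

lemma Stp_less: "Stp P \<epsilon> g h \<Longrightarrow> g < h"
proof -
  assume S: "Stp P \<epsilon> g h"
  then have "g < bnd h" by (simp add: Stp_def BT_def)
  also have "bnd h \<le> h" unfolding bnd_def by (rule order_trans[OF fstp_le sndp_le])
  finally show ?thesis .
qed

lemma Stp_eq: "Stp P \<epsilon> g h \<Longrightarrow> h = pair g (pair (bnd h) (pair (tru h) (idx g + 1)))"
  by (simp only: Stp_def)

lemma Stp_parts: "Stp P \<epsilon> g h \<Longrightarrow> fstp h = g" "Stp P \<epsilon> g h \<Longrightarrow> idx h = idx g + 1"
proof -
  assume "Stp P \<epsilon> g h"
  note e = Stp_eq[OF this]
  show "fstp h = g" by (subst e) simp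
  have "sndp (sndp (sndp h)) = idx g + 1" by (subst e) simp
  then show "idx h = idx g + 1" by (simp add: idx_def)
qed

text \<open>The minimality clauses in \<open>Stp\<close> serve this: with the least bound and the
  least truth code the whole chain is determined by its initial state.\<close>

lemma Stp_unique: "Stp P \<epsilon> g h \<Longrightarrow> Stp P \<epsilon> g h' \<Longrightarrow> h = h'"
proof -
  assume S: "Stp P \<epsilon> g h" "Stp P \<epsilon> g h'"
  have B: "BT P \<epsilon> g (bnd h)" "\<forall>x<bnd h. \<not> BT P \<epsilon> g x" "BT P \<epsilon> g (bnd h')" "\<forall>x<bnd h'. \<not> BT P \<epsilon> g x"
    and C: "codes P (bnd h) (tru h)" "\<forall>t<tru h. \<not> codes P (bnd h) t"
      "codes P (bnd h') (tru h')" "\<forall>t<tru h'. \<not> codes P (bnd h') t"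
    using S unfolding Stp_def by blast+
  have b: "bnd h = bnd h'" using B linorder_neqE by blast
  have t: "tru h = tru h'" using C linorder_neqE unfolding b by blast
  have "h = pair g (pair (bnd h) (pair (tru h) (idx g + 1)))" by (rule Stp_eq[OF S(1)])
  also have "\<dots> = h'" unfolding b t by (rule Stp_eq[OF S(2), symmetric])
  finally show ?thesis .
qed

locale chain =
  fixes n :: nat and \<epsilon> h0 :: "'a::pa"
  assumes eps: "mem r \<epsilon> \<Longrightarrow> good n r" and idx_h0: "idx h0 = 0"
begin

abbreviation St :: "'a \<Rightarrow> 'a \<Rightarrow> bool" where "St \<equiv> Stp (Th n) \<epsilon>"

lemma DF_Th [df]: "FD t \<Longrightarrow> DF (\<lambda>e. Th n (t e :: 'a))"
  by (rule DF1[OF G_DF[OF Th_G]])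

lemma DF_St [df]: "FD t \<Longrightarrow> FD u \<Longrightarrow> DF (\<lambda>e. St (t e) (u e))"
  by (rule DF2[OF DF_Stp[OF DF_Th[OF FD_var]]])

lemma BT_ex: "\<exists>x. BT (Th n) \<epsilon> g x"
proof -
  have "DF (\<lambda>e. (\<lambda>q v. mem (fstp q) \<epsilon> \<longrightarrow> Th n (pair (fstp q) (pair v (sndp q)))) (e 0) (e 1))" by (intro df fd)
  moreover have "\<exists>v. mem (fstp q) \<epsilon> \<longrightarrow> Th n (pair (fstp q) (pair v (sndp q)))" for q
    using eps[of "fstp q"] unfolding good_def by blast
  ultimately obtain c where c: "\<And>q. q < pair \<epsilon> g + 1 \<Longrightarrow> \<exists>v<c. mem (fstp q) \<epsilon> \<longrightarrow> Th n (pair (fstp q) (pair v (sndp q)))"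
    using collection[of "\<lambda>q v. mem (fstp q) \<epsilon> \<longrightarrow> Th n (pair (fstp q) (pair v (sndp q)))" "pair \<epsilon> g + 1"] by blast
  let ?x = "pair \<epsilon> (pair c g) + 1"
  have "BT (Th n) \<epsilon> g ?x" unfolding BT_def
  proof (intro conjI allI impI)
    show "g < ?x" unfolding less_S_iff by (rule order_trans[OF le_pair2 le_pair2])
    fix r y assume r: "r < \<epsilon>" "mem r \<epsilon>" and y: "y \<le> g"
    have "pair r y < pair \<epsilon> g + 1" unfolding less_S_iff using r y by (intro pair_mono) auto
    then obtain z where z: "z < c" "Th n (pair r (pair z y))" using c[of "pair r y"] r by auto
    have "pair r (pair z y) < ?x" unfolding less_S_iff using r y z by (intro pair_mono) auto
    moreover have "z < ?x"
      using z(1) less_le_trans[of z c ?x] by (simp add: add_increasing2 order_trans[OF le_pair1 le_pair2])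
    ultimately show "\<exists>z<?x. pair r (pair z y) < ?x \<and> Th n (pair r (pair z y))" using z by blast
  qed
  then show ?thesis by blast
qed

lemma St_ex: "\<exists>h. St g h"
proof -
  have "DF (\<lambda>e. BT (Th n) \<epsilon> g (e 0))" by (rule DF2[OF DF_BT[OF DF_Th[OF FD_var]]]) (intro fd)+
  from least_DF[OF this] BT_ex obtain x where x: "BT (Th n) \<epsilon> g x" "\<And>z. z < x \<Longrightarrow> \<not> BT (Th n) \<epsilon> g z" by blast
  have "\<exists>t. codes (Th n) x t" unfolding codes_iff by (rule compr) (intro df fd)
  moreover have "DF (\<lambda>e. codes (Th n) x (e 0))" unfolding codes_def by (intro df fd)
  ultimately obtain t where t: "codes (Th n) x t" "\<And>z. z < t \<Longrightarrow> \<not> codes (Th n) x z"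
    using least_DF[of "codes (Th n) x"] by blast
  have "St g (pair g (pair x (pair t (idx g + 1))))"
    unfolding Stp_def using x t by (simp add: bnd_def tru_def)
  then show ?thesis by blast
qed

text \<open>A coded set in which every member other than \<open>h0\<close> has its predecessor. As
  predecessors are smaller, such a set goes down to \<open>h0\<close> and is a witness for its
  members being in the chain.\<close>

definition valid :: "'a \<Rightarrow> bool" where
  "valid O' \<longleftrightarrow> (\<forall>g. mem g O' \<longrightarrow> g = h0 \<or> (\<exists>g'. mem g' O' \<and> St g' g))"

definition Ch :: "'a \<Rightarrow> bool" where "Ch h \<longleftrightarrow> (\<exists>O'. mem h O' \<and> valid O')"

lemma DF_valid [df]: "FD t \<Longrightarrow> DF (\<lambda>e. valid (t e))"
  by (rule DF1[where P = valid]) (auto simp: valid_def intro!: df fd)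

lemma DF_Ch [df]: "FD t \<Longrightarrow> DF (\<lambda>e. Ch (t e))"
  by (rule DF1[where P = Ch]) (auto simp: Ch_def intro!: df fd)

lemma set_ins: "\<exists>s'. \<forall>x. mem x s' \<longleftrightarrow> mem x s \<or> x = y" for s y :: 'a
proof -
  have "DF (\<lambda>e. mem (e 0) s \<or> e 0 = y)" by (intro df fd)
  from compr[OF this, of "s + (y + 1)"] obtain s' where s': "\<And>x. mem x s' \<longleftrightarrow> x < s + (y + 1) \<and> (mem x s \<or> x = y)" by blast
  have "x < s + (y + 1)" if "mem x s" for x using mem_less[OF that] by (rule less_le_trans) simp
  moreover have "y < s + (y + 1)" using less_le_trans[of y "y + 1" "s + (y + 1)"] by (simp add: less_S_iff)
  ultimately show ?thesis using s' by blast
qed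

lemma Ch_h0: "Ch h0"
proof -
  obtain s' where "\<And>x. mem x s' \<longleftrightarrow> mem x 0 \<or> x = h0" using set_ins[of 0 h0] by blast
  then show ?thesis unfolding Ch_def valid_def using mem_less[of _ 0] by (intro exI[of _ s']) auto
qed

lemma Ch_St: "Ch g \<Longrightarrow> St g h \<Longrightarrow> Ch h"
proof -
  assume "Ch g" and S: "St g h"
  then obtain O' where O': "mem g O'" "valid O'" unfolding Ch_def by blast
  obtain s' where s': "\<And>x. mem x s' \<longleftrightarrow> mem x O' \<or> x = h" using set_ins[of O' h] by blast
  then have "valid s'" using O' S unfolding valid_def by blast
  then show ?thesis using s' unfolding Ch_def by blast
qed

lemma Ch_cases: "Ch h \<Longrightarrow> h = h0 \<or> (\<exists>g. Ch g \<and> St g h)"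
  unfolding Ch_def valid_def by blast

lemma valid_Ch: "valid O' \<Longrightarrow> mem h O' \<Longrightarrow> Ch h"
  unfolding Ch_def by blast

lemma St_idx_nz: "St g h \<Longrightarrow> idx h \<noteq> 0"
  by (simp add: Stp_parts)

lemma Ch_idx_unique: "Ch h \<Longrightarrow> Ch h' \<Longrightarrow> idx h = idx h' \<Longrightarrow> h = h'"
proof -
  have "\<forall>h h'. Ch h \<longrightarrow> Ch h' \<longrightarrow> idx h = j \<longrightarrow> idx h' = j \<longrightarrow> h = h'" for j
  proof (rule induct_DF[where P = "\<lambda>j. \<forall>h h'. Ch h \<longrightarrow> Ch h' \<longrightarrow> idx h = j \<longrightarrow> idx h' = j \<longrightarrow> h = h'"])
    show "DF (\<lambda>e. \<forall>h h'. Ch h \<longrightarrow> Ch h' \<longrightarrow> idx h = e 0 \<longrightarrow> idx h' = e 0 \<longrightarrow> h = h')" by (intro df fd)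
    show "\<forall>h h'. Ch h \<longrightarrow> Ch h' \<longrightarrow> idx h = 0 \<longrightarrow> idx h' = 0 \<longrightarrow> h = h'"
    proof (intro allI impI)
      fix h h' assume "Ch h" "Ch h'" "idx h = 0" "idx h' = 0"
      then have "h = h0" "h' = h0" using Ch_cases St_idx_nz by blast+
      then show "h = h'" by simp
    qed
    fix j assume IH: "\<forall>h h'. Ch h \<longrightarrow> Ch h' \<longrightarrow> idx h = j \<longrightarrow> idx h' = j \<longrightarrow> h = h'"
    show "\<forall>h h'. Ch h \<longrightarrow> Ch h' \<longrightarrow> idx h = j + 1 \<longrightarrow> idx h' = j + 1 \<longrightarrow> h = h'"
    proof (intro allI impI)
      fix h h' assume h: "Ch h" "Ch h'" "idx h = j + 1" "idx h' = j + 1"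
      then have "h \<noteq> h0" "h' \<noteq> h0" using idx_h0 by auto
      then obtain g g' where g: "Ch g" "St g h" "Ch g'" "St g' h'" using Ch_cases h by blast
      then have "idx g = j" "idx g' = j" using Stp_parts(2)[OF g(2)] Stp_parts(2)[OF g(4)] h by simp_all
      then have "g = g'" using IH g by blast
      then show "h = h'" using g Stp_unique by blast
    qed
  qed
  then show "Ch h \<Longrightarrow> Ch h' \<Longrightarrow> idx h = idx h' \<Longrightarrow> h = h'" by blast
qed

lemma Ch_idx_ex: "\<exists>h. Ch h \<and> idx h = j"
proof (rule induct_DF[where P = "\<lambda>j. \<exists>h. Ch h \<and> idx h = j"])
  show "DF (\<lambda>e. \<exists>h. Ch h \<and> idx h = e 0)" by (intro df fd)
  show "\<exists>h. Ch h \<and> idx h = 0" using Ch_h0 idx_h0 by blast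
  fix j assume "\<exists>h. Ch h \<and> idx h = j"
  then obtain h where h: "Ch h" "idx h = j" by blast
  obtain h' where h': "St h h'" using St_ex by blast
  have "Ch h'" "idx h' = j + 1" using Ch_St[OF h(1) h'] Stp_parts(2)[OF h'] h(2) by simp_all
  then show "\<exists>h. Ch h \<and> idx h = j + 1" by blast
qed

lemma valid_initial: "valid O' \<Longrightarrow> mem h O' \<Longrightarrow> Ch g \<Longrightarrow> idx g \<le> idx h \<Longrightarrow> mem g O'"
proof -
  assume V: "valid O'"
  have "mem h O' \<longrightarrow> (\<forall>g. Ch g \<longrightarrow> idx g \<le> idx h \<longrightarrow> mem g O')" for h
  proof (rule less_induct_DF[where P = "\<lambda>h. mem h O' \<longrightarrow> (\<forall>g. Ch g \<longrightarrow> idx g \<le> idx h \<longrightarrow> mem g O')"])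
    show "DF (\<lambda>e. mem (e 0) O' \<longrightarrow> (\<forall>g. Ch g \<longrightarrow> idx g \<le> idx (e 0) \<longrightarrow> mem g O'))" by (intro df fd)
    fix h assume IH: "\<forall>y<h. mem y O' \<longrightarrow> (\<forall>g. Ch g \<longrightarrow> idx g \<le> idx y \<longrightarrow> mem g O')"
    show "mem h O' \<longrightarrow> (\<forall>g. Ch g \<longrightarrow> idx g \<le> idx h \<longrightarrow> mem g O')"
    proof (intro impI allI)
      fix g assume h: "mem h O'" and g: "Ch g" "idx g \<le> idx h"
      show "mem g O'"
      proof (cases "idx g = idx h")
        case True
        then show ?thesis using Ch_idx_unique[OF g(1) valid_Ch[OF V h]] h by simp
      next
        case False
        then have lt: "idx g < idx h" using g(2) by (rule le_neq_trans[rotated])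
        then have "h \<noteq> h0" using idx_h0 by auto
        then obtain h1 where h1: "mem h1 O'" "St h1 h" using V h unfolding valid_def by blast
        have "idx g \<le> idx h1" using lt Stp_parts(2)[OF h1(2)] by (simp add: less_S_iff)
        then show ?thesis using IH h1 Stp_less g(1) by blast
      qed
    qed
  qed
  then show "mem h O' \<Longrightarrow> Ch g \<Longrightarrow> idx g \<le> idx h \<Longrightarrow> mem g O'" by blast
qed

text \<open>The index runs through the whole model, since the rounds of thinning are nonstandardly
  many and each consults its own state.\<close>

definition hh :: "'a \<Rightarrow> 'a" where "hh j = (THE h. Ch h \<and> idx h = j)"

lemma hh: "Ch (hh j)" "idx (hh j) = j"
proof -
  have "\<exists>!h. Ch h \<and> idx h = j" by (rule ex_ex1I) (use Ch_idx_ex Ch_idx_unique in blast)+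
  from theI'[OF this] show "Ch (hh j)" "idx (hh j) = j" unfolding hh_def by blast+
qed

lemma hh_eq: "Ch h \<Longrightarrow> hh (idx h) = h"
  by (rule Ch_idx_unique[OF hh(1) _ hh(2)])

lemma FD_hh [fd]: "FD t \<Longrightarrow> FD (\<lambda>e. hh (t e))"
proof (rule FD1[where f = hh])
  show "FD (\<lambda>e. hh (e 0))"
  proof (rule FD_I)
    show "DF (\<lambda>e. (\<lambda>y e. Ch y \<and> idx y = e 0) (e 0) (\<lambda>i. e (Suc i)))" by (intro df fd)
    show "Ch y \<and> idx y = e 0 \<longleftrightarrow> y = hh (e 0)" for y e
      using hh_eq[of y] hh[of "e 0"] by auto
  qed
qed

lemma hh_0: "hh 0 = h0"
  using hh_eq[OF Ch_h0] idx_h0 by simp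

lemma St_hh: "St (hh j) (hh (j + 1))"
proof -
  obtain h where h: "St (hh j) h" using St_ex by blast
  have "Ch h" "idx h = j + 1" using Ch_St[OF hh(1) h] Stp_parts(2)[OF h] hh(2) by simp_all
  then have "hh (j + 1) = h" using hh_eq[of h] by simp
  then show ?thesis using h by simp
qed

end

section \<open>End-homogeneous sequences\<close>

definition inc :: "'a::pa \<Rightarrow> 'a \<Rightarrow> bool" where
  "inc \<sigma> N \<longleftrightarrow> (\<forall>i<N. \<forall>j<i. app \<sigma> j < app \<sigma> i)"

definition from_seq :: "'a::pa \<Rightarrow> 'a \<Rightarrow> 'a \<Rightarrow> 'a \<Rightarrow> bool" where
  "from_seq \<tau> p \<sigma> L \<longleftrightarrow> (\<forall>i<p. \<exists>j<L. app \<tau> i = app \<sigma> j)"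

lemma DF_inc [df]: "FD t \<Longrightarrow> FD u \<Longrightarrow> DF (\<lambda>e. inc (t e) (u e))"
  by (rule DF2[where P = inc]) (auto simp: inc_def intro!: df fd)

lemma BD_inc [bd]: "FN t \<Longrightarrow> FN u \<Longrightarrow> BD (\<lambda>e. inc (t e) (u e))"
  by (rule BD2[where P = inc]) (auto simp: inc_def intro!: bd fn)

lemma DF_from_seq [df]: "FD t \<Longrightarrow> FD u \<Longrightarrow> FD v \<Longrightarrow> FD w \<Longrightarrow> DF (\<lambda>e. from_seq (t e) (u e) (v e) (w e))"
  by (rule DF4[where P = from_seq]) (auto simp: from_seq_def intro!: df fd)

lemma BD_from_seq [bd]: "FN t \<Longrightarrow> FN u \<Longrightarrow> FN v \<Longrightarrow> FN w \<Longrightarrow> BD (\<lambda>e. from_seq (t e) (u e) (v e) (w e))"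
  by (rule BD4[where P = from_seq]) (auto simp: from_seq_def intro!: bd fn)

lemma less_S_cases: "x < y + 1 \<longleftrightarrow> x < y \<or> x = y" for x y :: "'a::pa"
  by (auto simp: less_S_iff le_less)

lemma append_ex: "\<exists>\<tau>'. (\<forall>i<p. app \<tau>' i = app \<tau> i) \<and> app \<tau>' p = v" for \<tau> p v :: "'a::pa"
proof -
  have "DF (\<lambda>e. (\<lambda>x y. (x < p \<and> y = app \<tau> x) \<or> (\<not> x < p \<and> y = v)) (e 0) (e 1))" by (intro df fd)
  from fun_compr[OF this, of "p + 1"] obtain f where
    f: "\<And>x. x < p + 1 \<Longrightarrow> (x < p \<and> app f x = app \<tau> x) \<or> (\<not> x < p \<and> app f x = v)" by blast
  have "app f i = app \<tau> i" if "i < p" for i using f[of i] that by (simp add: less_S_cases)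
  moreover have "app f p = v" using f[of p] by (simp add: less_S_cases)
  ultimately show ?thesis by blast
qed

lemma shift_ex: "\<exists>\<tau>. \<forall>i<p. app \<tau> i = app \<sigma> (i + 1)" for \<sigma> p :: "'a::pa"
proof -
  have "DF (\<lambda>e. (\<lambda>x y. y = app \<sigma> (x + 1)) (e 0) (e 1))" by (intro df fd)
  from fun_compr[OF this, of p] show ?thesis by blast
qed

lemma inc_mono: "inc \<sigma> N \<Longrightarrow> M \<le> N \<Longrightarrow> inc \<sigma> M"
  unfolding inc_def by (meson less_le_trans)

lemma from_seq_mono: "from_seq \<tau> p \<sigma> L \<Longrightarrow> p' \<le> p \<Longrightarrow> L \<le> L' \<Longrightarrow> from_seq \<tau> p' \<sigma> L'"
  unfolding from_seq_def by (meson less_le_trans)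

lemma from_seq_trans: "from_seq \<tau> p \<sigma> L \<Longrightarrow> from_seq \<sigma> L \<rho> M \<Longrightarrow> from_seq \<tau> p \<rho> M"
  unfolding from_seq_def by metis

lemma inc_append:
  assumes "inc \<tau> p" "\<And>i. i < p \<Longrightarrow> app \<tau>' i = app \<tau> i" "\<And>i. i < p \<Longrightarrow> app \<tau> i < app \<tau>' p"
  shows "inc \<tau>' (p + 1)"
  unfolding inc_def less_S_cases
proof (intro allI impI)
  fix i j assume i: "i < p \<or> i = p" and j: "j < i"
  from i show "app \<tau>' j < app \<tau>' i"
  proof
    assume "i < p"
    moreover from this have "j < p" using j by simp
    ultimately show ?thesis using assms(1,2) j unfolding inc_def by simp
  next
    assume "i = p"
    then show ?thesis using assms(2,3) j by simp
  qed
qed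

lemma sub_append:
  fixes \<tau> :: "'a::pa"
  assumes "inc \<tau> p" "from_seq \<tau> p \<sigma> L" "\<forall>i<p. Q (app \<tau> i)" "inc \<sigma> (L + 1)" "Q (app \<sigma> L)"
  shows "\<exists>\<tau>'. inc \<tau>' (p + 1) \<and> from_seq \<tau>' (p + 1) \<sigma> (L + 1) \<and> (\<forall>i<p + 1. Q (app \<tau>' i))"
proof -
  obtain \<tau>' where t: "\<And>i. i < p \<Longrightarrow> app \<tau>' i = app \<tau> i" "app \<tau>' p = app \<sigma> L" using append_ex by blast
  have "app \<tau> i < app \<tau>' p" if i: "i < p" for i
  proof -
    obtain j where "j < L" "app \<tau> i = app \<sigma> j" using assms(2) i unfolding from_seq_def by blast
    then show ?thesis using assms(4) unfolding inc_def t(2) by (simp add: less_S_cases)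
  qed
  then have "inc \<tau>' (p + 1)" using inc_append[OF assms(1)] t(1) by blast
  moreover have "from_seq \<tau>' (p + 1) \<sigma> (L + 1)"
    using assms(2) t unfolding from_seq_def less_S_cases by auto
  moreover have "\<forall>i<p + 1. Q (app \<tau>' i)" using assms(3,5) t unfolding less_S_cases by auto
  ultimately show ?thesis by blast
qed

lemma split_seq:
  fixes \<sigma> :: "'a::pa"
  assumes Q: "DF (\<lambda>e. Q (e 0))" and inc: "inc \<sigma> L"
  shows "\<exists>p r \<tau> \<upsilon>. p + r = L \<and> inc \<tau> p \<and> from_seq \<tau> p \<sigma> L \<and> (\<forall>i<p. Q (app \<tau> i)) \<and>
    inc \<upsilon> r \<and> from_seq \<upsilon> r \<sigma> L \<and> (\<forall>i<r. \<not> Q (app \<upsilon> i))"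
proof -
  let ?P = "\<lambda>L. inc \<sigma> L \<longrightarrow> (\<exists>p r \<tau> \<upsilon>. p + r = L \<and> inc \<tau> p \<and> from_seq \<tau> p \<sigma> L \<and> (\<forall>i<p. Q (app \<tau> i)) \<and>
    inc \<upsilon> r \<and> from_seq \<upsilon> r \<sigma> L \<and> (\<forall>i<r. \<not> Q (app \<upsilon> i)))"
  have "?P L"
  proof (rule induct_DF[where P = ?P])
    show "DF (\<lambda>e. ?P (e 0))" by (intro df fd DF1[OF Q])
    show "?P 0" by (intro impI exI[of _ 0]) (auto simp: inc_def from_seq_def)
    fix L assume IH: "?P L"
    show "?P (L + 1)"
    proof
      assume inc: "inc \<sigma> (L + 1)"
      have LL: "L \<le> L + 1" by simp
      obtain p r \<tau> \<upsilon> where t: "p + r = L" "inc \<tau> p" "from_seq \<tau> p \<sigma> L" "\<forall>i<p. Q (app \<tau> i)"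
        "inc \<upsilon> r" "from_seq \<upsilon> r \<sigma> L" "\<forall>i<r. \<not> Q (app \<upsilon> i)"
        using IH inc_mono[OF inc LL] by blast
      show "\<exists>p r \<tau> \<upsilon>. p + r = L + 1 \<and> inc \<tau> p \<and> from_seq \<tau> p \<sigma> (L + 1) \<and> (\<forall>i<p. Q (app \<tau> i)) \<and>
        inc \<upsilon> r \<and> from_seq \<upsilon> r \<sigma> (L + 1) \<and> (\<forall>i<r. \<not> Q (app \<upsilon> i))"
      proof (cases "Q (app \<sigma> L)")
        case True
        obtain \<tau>' where "inc \<tau>' (p + 1)" "from_seq \<tau>' (p + 1) \<sigma> (L + 1)" "\<forall>i<p + 1. Q (app \<tau>' i)"
          using sub_append[of \<tau> p \<sigma> L Q, OF t(2,3,4) inc True] by blast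
        moreover have "p + 1 + r = L + 1" using t(1) by (simp add: ac_simps)
        ultimately show ?thesis using t(5,7) from_seq_mono[OF t(6) order_refl LL] by blast
      next
        case False
        obtain \<upsilon>' where "inc \<upsilon>' (r + 1)" "from_seq \<upsilon>' (r + 1) \<sigma> (L + 1)" "\<forall>i<r + 1. \<not> Q (app \<upsilon>' i)"
          using sub_append[of \<upsilon> r \<sigma> L "\<lambda>x. \<not> Q x", OF t(5,6,7) inc False] by blast
        moreover have "p + (r + 1) = L + 1" using t(1) by (simp add: add.assoc[symmetric])
        ultimately show ?thesis using t(2,4) from_seq_mono[OF t(3) order_refl LL] by blast
      qed
    qed
  qed
  then show ?thesis using inc by blast
qed

text \<open>Split off the entries of the last colour. If there are at least p of them, they serve;
  otherwise enough entries remain for one colour fewer. Stating the induction for K + 1 colours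
  excludes the case without colours.\<close>

lemma pigeonhole:
  fixes \<sigma> :: "'a::pa"
  assumes col: "FD (\<lambda>e. col (e 0))" and "inc \<sigma> L" "\<And>j. j < L \<Longrightarrow> col (app \<sigma> j) < K" "K * p \<le> L" "K \<noteq> 0"
  shows "\<exists>v \<tau>. inc \<tau> p \<and> from_seq \<tau> p \<sigma> L \<and> (\<forall>i<p. col (app \<tau> i) = v)"
proof -
  let ?P = "\<lambda>K. \<forall>\<sigma> L. inc \<sigma> L \<longrightarrow> (\<forall>j<L. col (app \<sigma> j) < K + 1) \<longrightarrow> (K + 1) * p \<le> L \<longrightarrow>
    (\<exists>v \<tau>. inc \<tau> p \<and> from_seq \<tau> p \<sigma> L \<and> (\<forall>i<p. col (app \<tau> i) = v))"
  have "?P K" for K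
  proof (rule induct_DF[where P = ?P])
    show "DF (\<lambda>e. ?P (e 0))" by (intro df fd FD1[OF col])
    show "?P 0"
    proof (intro allI impI)
      fix \<sigma> L assume a: "inc \<sigma> L" "\<forall>j<L. col (app \<sigma> j) < 0 + 1" "(0 + 1) * p \<le> L"
      then have p: "p \<le> L" by simp
      have "col (app \<sigma> j) = 0" if "j < p" for j using a(2) less_le_trans[OF that p] by (simp add: less_iff_succ_less_eq)
      moreover have "from_seq \<sigma> p \<sigma> L" unfolding from_seq_def using less_le_trans[OF _ p] by blast
      ultimately show "\<exists>v \<tau>. inc \<tau> p \<and> from_seq \<tau> p \<sigma> L \<and> (\<forall>i<p. col (app \<tau> i) = v)"
        using inc_mono[OF a(1) p] by blast
    qed
    fix K assume IH: "?P K"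
    show "?P (K + 1)"
    proof (intro allI impI)
      fix \<sigma> L assume a: "inc \<sigma> L" "\<forall>j<L. col (app \<sigma> j) < K + 1 + 1" "(K + 1 + 1) * p \<le> L"
      have "DF (\<lambda>e. col (e 0) = K + 1)" by (intro df fd FD1[OF col])
      from split_seq[OF this a(1)] obtain p' r \<tau> \<upsilon> where t: "p' + r = L" "inc \<tau> p'" "from_seq \<tau> p' \<sigma> L"
        "\<forall>i<p'. col (app \<tau> i) = K + 1" "inc \<upsilon> r" "from_seq \<upsilon> r \<sigma> L" "\<forall>i<r. col (app \<upsilon> i) \<noteq> K + 1" by blast
      show "\<exists>v \<tau>. inc \<tau> p \<and> from_seq \<tau> p \<sigma> L \<and> (\<forall>i<p. col (app \<tau> i) = v)"
      proof (cases "p \<le> p'")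
        case True
        then show ?thesis using t(2,3,4) inc_mono from_seq_mono[OF t(3) True order_refl] less_le_trans by meson
      next
        case False
        have "(K + 1) * p + p \<le> p' + r" using a(3) t(1) by (simp add: algebra_simps)
        have r: "(K + 1) * p \<le> r"
        proof (rule ccontr)
          assume "\<not> (K + 1) * p \<le> r"
          then have "p' + r < p + (K + 1) * p" using False by (intro add_strict_mono) simp_all
          also have "\<dots> = (K + 1) * p + p" by (rule add.commute)
          finally show False using \<open>(K + 1) * p + p \<le> p' + r\<close> by simp
        qed
        have "\<forall>j<r. col (app \<upsilon> j) < K + 1"
        proof (intro allI impI)
          fix j assume j: "j < r"
          then obtain i where "i < L" "app \<upsilon> j = app \<sigma> i" using t(6) unfolding from_seq_def by blast
          then show "col (app \<upsilon> j) < K + 1" using a(2) t(7) j less_S_cases[of _ "K + 1"] by force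
        qed
        then obtain v \<tau>' where "inc \<tau>' p" "from_seq \<tau>' p \<upsilon> r" "\<forall>i<p. col (app \<tau>' i) = v"
          using IH t(5) r by blast
        then show ?thesis using from_seq_trans[OF _ t(6)] by blast
      qed
    qed
  qed
  moreover obtain K' where "K = K' + 1" using assms(5) pa_cases[of K] by blast
  ultimately show ?thesis using assms(2,3,4) by blast
qed

text \<open>The least code makes the restriction a function of the values below m alone
  (\<open>rs_cong\<close>), so an initial segment can be handed to a relation as a single argument
  that different sequences share.\<close>

definition rs :: "'a::pa \<Rightarrow> 'a \<Rightarrow> 'a" where
  "rs \<sigma> m = lst (\<lambda>X. \<forall>q. mem q X \<longleftrightarrow> (\<exists>i<m. q = pair i (app \<sigma> i)))"

lemma FD_rs [fd]: "FD t \<Longrightarrow> FD u \<Longrightarrow> FD (\<lambda>e. rs (t e) (u e))"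
  by (rule FD2[where f = rs]) (auto simp: rs_def intro!: df fd)

lemma rs_cong: "(\<And>i. i < m \<Longrightarrow> app \<sigma> i = app \<tau> i) \<Longrightarrow> rs \<sigma> m = rs \<tau> m"
proof -
  assume a: "\<And>i. i < m \<Longrightarrow> app \<sigma> i = app \<tau> i"
  have "(\<exists>i<m. q = pair i (app \<sigma> i)) \<longleftrightarrow> (\<exists>i<m. q = pair i (app \<tau> i))" for q using a by auto
  then show ?thesis unfolding rs_def by simp
qed

lemma rs_mem: "mem q (rs \<sigma> m) \<longleftrightarrow> (\<exists>i<m. q = pair i (app \<sigma> i))" for q \<sigma> m :: "'a::pa"
proof -
  have D: "DF (\<lambda>e. \<exists>i<m. e 0 = pair i (app \<sigma> i))" by (intro df fd)
  have "DF (\<lambda>e. (\<lambda>i y. y = app \<sigma> i) (e 0) (e 1))" by (intro df fd)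
  then obtain c where c: "\<And>i. i < m \<Longrightarrow> app \<sigma> i < c" using collection[of "\<lambda>i y. y = app \<sigma> i" m] by auto
  obtain X where X: "\<And>q. mem q X \<longleftrightarrow> q < pair m c \<and> (\<exists>i<m. q = pair i (app \<sigma> i))"
    using compr[OF D, of "pair m c"] by blast
  have "pair i (app \<sigma> i) < pair m c" if "i < m" for i
    by (rule pair_less) (use that c[OF that] in \<open>auto intro: add_strict_mono\<close>)
  then have X': "\<forall>q. mem q X \<longleftrightarrow> (\<exists>i<m. q = pair i (app \<sigma> i))" using X by blast
  have "DF (\<lambda>e. \<forall>q. mem q (e 0) \<longleftrightarrow> (\<exists>i<m. q = pair i (app \<sigma> i)))" by (intro df fd)
  from lst_works(1)[OF this, of X] X' show ?thesis unfolding rs_def by blast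
qed

lemma rs_app: "i < m \<Longrightarrow> app (rs \<sigma> m) i = app \<sigma> i"
  by (rule app_eq) (auto simp: rs_mem)

text \<open>Given an initial segment of length m, no statement q < b distinguishes the entries from
  position m on. Positions inside the segment may be named by q, so all tuples are covered as far as
  their largest member is concerned.\<close>

definition ehom :: "('a::pa \<Rightarrow> 'a \<Rightarrow> 'a \<Rightarrow> bool) \<Rightarrow> 'a \<Rightarrow> 'a \<Rightarrow> 'a \<Rightarrow> bool" where
  "ehom R b \<sigma> N \<longleftrightarrow> (\<forall>j<N. \<forall>j'<N. \<forall>m. m \<le> j \<longrightarrow> m \<le> j' \<longrightarrow>
     (\<forall>q<b. R q (rs \<sigma> m) (app \<sigma> j) \<longleftrightarrow> R q (rs \<sigma> m) (app \<sigma> j')))"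

lemma end_homogeneous:
  fixes b :: "'a::pa"
  assumes R: "DF (\<lambda>e. R (e 0) (e 1) (e 2))" and K: "Sub b K"
    and f: "app f 0 = 0" "\<forall>i<M. app f (i + 1) = K * (1 + app f i)"
    and A: "inc A L" "app f M \<le> L"
  shows "\<exists>\<sigma>. inc \<sigma> M \<and> from_seq \<sigma> M A L \<and> ehom R b \<sigma> M"
proof -
  have K0: "K \<noteq> 0" using K unfolding Sub_def by auto
  let ?E = "\<lambda>\<sigma> m0 N. \<forall>m j j'. m0 \<le> m \<longrightarrow> m \<le> j \<longrightarrow> m \<le> j' \<longrightarrow> j < m0 + N \<longrightarrow> j' < m0 + N \<longrightarrow>
     (\<forall>q<b. R q (rs \<sigma> m) (app \<sigma> j) \<longleftrightarrow> R q (rs \<sigma> m) (app \<sigma> j'))"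
  \<comment> \<open>The induction is on the number of entries still to be chosen:
    \<open>\<sigma>0\<close> is the part already built and \<open>A\<close> the pool of candidates
    above it. \<open>app f N\<close> is the size of pool that suffices for N further
    entries.\<close>
  let ?P = "\<lambda>N. N \<le> M \<longrightarrow> (\<forall>\<sigma>0 m0 A L. inc \<sigma>0 m0 \<longrightarrow> inc A L \<longrightarrow> (\<forall>i<m0. \<forall>j<L. app \<sigma>0 i < app A j) \<longrightarrow> app f N \<le> L \<longrightarrow>
     (\<exists>\<sigma>. (\<forall>i<m0. app \<sigma> i = app \<sigma>0 i) \<and> inc \<sigma> (m0 + N) \<and> (\<forall>i. m0 \<le> i \<longrightarrow> i < m0 + N \<longrightarrow> (\<exists>j<L. app \<sigma> i = app A j)) \<and> ?E \<sigma> m0 N))"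
  have "?P M"
  proof (rule induct_DF[where P = ?P])
    show "DF (\<lambda>e. ?P (e 0))" by (intro df fd DF3[OF R])
    show "?P 0" by (auto dest: leD)
    fix N assume IH: "?P N"
    show "?P (N + 1)"
    proof (intro impI allI)
      fix \<sigma>0 m0 A L assume NM: "N + 1 \<le> M" and s0: "inc \<sigma>0 m0" and A: "inc A L"
        and lt: "\<forall>i<m0. \<forall>j<L. app \<sigma>0 i < app A j" and L: "app f (N + 1) \<le> L"
      have N: "N < M" "N \<le> M" using NM by (simp_all add: less_iff_succ_less_eq less_imp_le)
      define X where "X = rs \<sigma>0 m0"
      \<comment> \<open>A candidate is coloured by the set of statements q < b that hold of it over
        the segment built so far; \<open>Sub b K\<close> bounds the number of colours by
        \<open>K\<close>.\<close>
      define col where "col x = lst (\<lambda>s. \<forall>q. mem q s \<longleftrightarrow> q < b \<and> R q X x)" for x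
      have Dx: "DF (\<lambda>e. \<forall>q. mem q (e 0) \<longleftrightarrow> q < b \<and> R q X x)" for x by (intro df fd DF3[OF R])
      have "FD (\<lambda>e. col (e 0))" unfolding col_def by (intro fd df DF3[OF R])
      moreover have colK: "col x < K" "mem q (col x) \<longleftrightarrow> q < b \<and> R q X x" for x q
      proof -
        have "DF (\<lambda>e. R (e 0) X x)" by (intro DF3[OF R] fd)
        from Sub_compr[OF K this] obtain s where s: "s < K" "\<forall>q. mem q s \<longleftrightarrow> q < b \<and> R q X x" by blast
        from lst_works(1,3)[OF Dx[of x] s(2)] s(1) show "col x < K" "mem q (col x) \<longleftrightarrow> q < b \<and> R q X x"
          unfolding col_def by auto
      qed
      moreover have "K * (1 + app f N) \<le> L" using L f(2) N(1) by simp
      ultimately obtain v A' where A': "inc A' (1 + app f N)" "from_seq A' (1 + app f N) A L"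
        "\<forall>i<1 + app f N. col (app A' i) = v"
        using pigeonhole[of col A L K "1 + app f N"] A K0 by blast
      \<comment> \<open>From the 1 + f N entries of one colour the first extends the segment and the
        rest becomes the new pool, which explains the recursion f (N + 1) = K * (1 + f N).\<close>
      define x0 where "x0 = app A' 0"
      have pos: "0 < 1 + app f N" by (simp add: add_pos_nonneg)
      obtain \<sigma>1 where s1: "\<And>i. i < m0 \<Longrightarrow> app \<sigma>1 i = app \<sigma>0 i" "app \<sigma>1 m0 = x0" using append_ex by blast
      obtain A2 where A2: "\<And>i. i < app f N \<Longrightarrow> app A2 i = app A' (i + 1)" using shift_ex by blast
      have i1: "i + 1 < 1 + app f N" if "i < app f N" for i using that by (simp add: add.commute)
      have A2A': "from_seq A2 (app f N) A' (1 + app f N)" unfolding from_seq_def using A2 i1 by blast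
      have fromA: "\<exists>j<L. app A' i = app A j" if "i < 1 + app f N" for i
        using A'(2) that unfolding from_seq_def by blast
      have "inc \<sigma>1 (m0 + 1)"
        by (rule inc_append[OF s0 s1(1)]) (use lt fromA[OF pos] s1(2) x0_def in auto)
      moreover have "inc A2 (app f N)" unfolding inc_def
      proof (intro allI impI)
        fix i j assume ij: "i < app f N" "j < i"
        then have "j < app f N" by simp
        then show "app A2 j < app A2 i" using A2 ij A'(1) i1[OF ij(1)] unfolding inc_def by simp
      qed
      moreover have "\<forall>i<m0 + 1. \<forall>j<app f N. app \<sigma>1 i < app A2 j"
      proof (intro allI impI)
        fix i j assume i: "i < m0 + 1" and j: "j < app f N"
        obtain k where k: "k < L" "app A' (j + 1) = app A k" using fromA[OF i1[OF j]] by blast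
        from i show "app \<sigma>1 i < app A2 j" unfolding less_S_cases
        proof
          assume "i < m0"
          then show ?thesis using lt k A2[OF j] s1(1) by simp
        next
          assume "i = m0"
          moreover have "0 < j + 1" by (simp add: add_nonneg_pos)
          ultimately show ?thesis using A'(1) i1[OF j] A2[OF j] s1(2) unfolding inc_def x0_def by simp
        qed
      qed
      moreover have "app f N \<le> app f N" by simp
      ultimately obtain \<sigma> where s: "\<forall>i<m0 + 1. app \<sigma> i = app \<sigma>1 i" "inc \<sigma> (m0 + 1 + N)"
        "\<forall>i. m0 + 1 \<le> i \<longrightarrow> i < m0 + 1 + N \<longrightarrow> (\<exists>j<app f N. app \<sigma> i = app A2 j)" "?E \<sigma> (m0 + 1) N"
        using IH N(2) by blast
      have eq: "m0 + 1 + N = m0 + (N + 1)" by (simp add: ac_simps)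
      have sm: "app \<sigma> i = app \<sigma>0 i" if "i < m0" for i using s(1) s1(1) that by (simp add: less_S_cases)
      have sx: "app \<sigma> m0 = x0" using s(1) s1(2) by (simp add: less_S_cases)
      have inA': "\<exists>i<1 + app f N. app \<sigma> j = app A' i" if j1: "m0 \<le> j" and j2: "j < m0 + (N + 1)" for j
      proof (cases "j = m0")
        case True
        then show ?thesis using sx x0_def pos by blast
      next
        case False
        then have "m0 < j" using j1 by (simp add: less_le)
        then have "m0 + 1 \<le> j" by (simp add: less_iff_succ_less_eq)
        then obtain i where "i < app f N" "app \<sigma> j = app A2 i" using s(3) j2 unfolding eq by blast
        then show ?thesis using A2 i1 by metis
      qed
      have "?E \<sigma> m0 (N + 1)"
      proof (intro allI impI)
        fix m j j' q assume m: "m0 \<le> m" "m \<le> j" "m \<le> j'" "j < m0 + (N + 1)" "j' < m0 + (N + 1)" "q < b"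
        show "R q (rs \<sigma> m) (app \<sigma> j) \<longleftrightarrow> R q (rs \<sigma> m) (app \<sigma> j')"
        proof (cases "m = m0")
          case True
          have "rs \<sigma> m = X" unfolding True X_def by (rule rs_cong[OF sm])
          moreover have "col (app \<sigma> j) = v" "col (app \<sigma> j') = v"
            using inA'[of j] inA'[of j'] A'(3) m order_trans[OF m(1) m(2)] order_trans[OF m(1) m(3)] by auto
          ultimately show ?thesis using colK(2)[of q "app \<sigma> j"] colK(2)[of q "app \<sigma> j'"] m(6) by simp
        next
          case False
          then have "m0 + 1 \<le> m" using m(1) by (simp add: less_iff_succ_less_eq[symmetric] less_le)
          then show ?thesis using s(4) m unfolding eq by blast
        qed
      qed
      moreover have "\<exists>j<L. app \<sigma> i = app A j" if "m0 \<le> i" "i < m0 + (N + 1)" for i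
        using inA'[OF that] fromA by metis
      ultimately show "\<exists>\<sigma>. (\<forall>i<m0. app \<sigma> i = app \<sigma>0 i) \<and> inc \<sigma> (m0 + (N + 1)) \<and>
        (\<forall>i. m0 \<le> i \<longrightarrow> i < m0 + (N + 1) \<longrightarrow> (\<exists>j<L. app \<sigma> i = app A j)) \<and> ?E \<sigma> m0 (N + 1)"
        using sm s(2) unfolding eq by blast
    qed
  qed
  then have P: "inc \<sigma>0 m0 \<Longrightarrow> inc A L \<Longrightarrow> (\<forall>i<m0. \<forall>j<L. app \<sigma>0 i < app A j) \<Longrightarrow> app f M \<le> L \<Longrightarrow>
     (\<exists>\<sigma>. (\<forall>i<m0. app \<sigma> i = app \<sigma>0 i) \<and> inc \<sigma> (m0 + M) \<and> (\<forall>i. m0 \<le> i \<longrightarrow> i < m0 + M \<longrightarrow> (\<exists>j<L. app \<sigma> i = app A j)) \<and> ?E \<sigma> m0 M)"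
    for \<sigma>0 m0 A L by (simp only: order_refl)
  have "inc A 0" "\<forall>i<0. \<forall>j<L. app A i < app A j" by (simp_all add: inc_def)
  from P[OF this(1) A(1) this(2) A(2)] obtain \<sigma> where s: "inc \<sigma> (0 + M)"
    "\<forall>i. 0 \<le> i \<longrightarrow> i < 0 + M \<longrightarrow> (\<exists>j<L. app \<sigma> i = app A j)" "?E \<sigma> 0 M" by (elim exE conjE) rule
  have "inc \<sigma> M" using s(1) by simp
  moreover have "from_seq \<sigma> M A L" using s(2) by (simp add: from_seq_def)
  moreover have "ehom R b \<sigma> M" using s(3) unfolding ehom_def add_0_left by (meson zero_le)
  ultimately show ?thesis by blast
qed

lemma Gap_less: "Gap s s' \<Longrightarrow> s < s'"
proof -
  assume "Gap s s'"
  then have "pair s s + 1 < s'" by (simp add: Gap_def)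
  moreover have "s \<le> pair s s + 1" using order_trans[OF le_pair1[of s s]] by (simp add: add_increasing2)
  ultimately show ?thesis by (rule le_less_trans[rotated])
qed

text \<open>The roles of the levels: s1 is the final length, s2 bounds the statements, s3 the
  colours by \<open>Sub s2 s3\<close>, and s4 exceeds what s3 rounds of the pigeonhole argument
  consume. One thinning thus descends three levels of a tower.\<close>

theorem thinning:
  fixes A :: "'a::pa"
  assumes R: "DF (\<lambda>e. R (e 0) (e 1) (e 2))" and g: "Gap s1 s2" "Gap s2 s3" "Gap s3 s4" and A: "inc A L" "s4 \<le> L"
  shows "\<exists>\<sigma>. inc \<sigma> s1 \<and> from_seq \<sigma> s1 A L \<and> ehom R s2 \<sigma> s1"
proof -
  obtain f where f: "app f 0 = 0" "\<forall>i<s3. app f (i + 1) = s3 * (1 + app f i)" "app f s3 < s4"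
    using g(3) unfolding Gap_def by blast
  have "Sub s2 s3" using g(2) by (simp add: Gap_def)
  moreover have "app f s3 \<le> L" using f(3) A(2) by simp
  ultimately obtain \<sigma> where s: "inc \<sigma> s3" "from_seq \<sigma> s3 A L" "ehom R s2 \<sigma> s3"
    using end_homogeneous[OF R _ f(1,2) A(1)] by blast
  have le: "s1 \<le> s3" using Gap_less[OF g(1)] Gap_less[OF g(2)] by simp
  have "ehom R s2 \<sigma> s1" using s(3) le unfolding ehom_def by (meson less_le_trans)
  then show ?thesis using inc_mono[OF s(1) le] from_seq_mono[OF s(2) le order_refl] by blast
qed

section \<open>Towers and cuts\<close>

lemma cutI_Kel: "cutI I \<Longrightarrow> Kel I"
proof -
  assume I: "cutI I"
  have T: "tval e \<tau> \<in> I" if "\<And>i. e i \<in> I" for e \<tau>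
    using that by (induction \<tau>) (auto intro: cutI_intros[OF I])
  have "t e \<in> I" if t: "FN t" and e: "\<And>i. e i \<in> I" for t e
  proof -
    obtain \<tau> where "\<forall>e. t e \<le> tval e \<tau>" using t unfolding FN_def by blast
    then have "t e \<le> tval e \<tau>" by blast
    moreover have "tval e \<tau> \<in> I" by (rule T) (rule e)
    ultimately show ?thesis using cutI_simps(6)[OF I] by blast
  qed
  then show ?thesis unfolding Kel_def using cutI_simps(1)[OF I] by blast
qed

lemma FN_supp: "FN t \<Longrightarrow> \<exists>N. \<forall>e e'. (\<forall>i<N. e i = e' i) \<longrightarrow> t e = t e'"
proof -
  assume "FN t"
  then have "BD (\<lambda>e. e 0 = t (\<lambda>i. e (Suc i)))" by (simp add: FN_def)
  then obtain N where N: "\<And>e e'. (\<forall>i<N. e i = e' i) \<Longrightarrow> (e 0 = t (\<lambda>i. e (Suc i))) = (e' 0 = t (\<lambda>i. e' (Suc i)))"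
    using BD_supp by blast
  have "t e = t e'" if "\<forall>i<N. e i = e' i" for e e'
  proof -
    have "\<forall>i<N. (t e ## e) i = (t e ## e') i" using that by (auto simp: scons_def split: nat.splits)
    from N[OF this] show ?thesis by simp
  qed
  then show ?thesis by blast
qed

definition nst :: "'a::pa \<Rightarrow> bool" where "nst x \<longleftrightarrow> (\<forall>k. of_nat k < x)"

lemma nst_le: "nst x \<Longrightarrow> x \<le> y \<Longrightarrow> nst y"
  unfolding nst_def by (meson less_le_trans)

lemma nst_add: "nst (x + y) \<Longrightarrow> nst x \<or> nst y"
proof (rule ccontr)
  assume xy: "nst (x + y)" "\<not> (nst x \<or> nst y)"
  then obtain j k where "x \<le> of_nat j" "y \<le> of_nat k" unfolding nst_def by (auto simp: not_less)
  then have "x + y \<le> of_nat (j + k)" by (simp add: add_mono)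
  then show False using xy(1) unfolding nst_def by (meson leD)
qed

text \<open>The recursion f (i + 1) = s * (1 + f i) gives f j \<ge> s ^ j for standard j > 0, and f
  increases up to f s < s'. So the function introduced for the pigeonhole also makes each gap exceed
  all standard powers.\<close>

lemma Gap_power: "Gap s s' \<Longrightarrow> nst s \<Longrightarrow> s ^ k < s'"
proof -
  assume G: "Gap s s'" and s: "nst s"
  then obtain f where f: "app f 0 = 0" "\<And>i. i < s \<Longrightarrow> app f (i + 1) = s * (1 + app f i)" "app f s < s'"
    unfolding Gap_def by blast
  have "s ^ j \<le> app f (of_nat j)" if "j > 0" for j
    using that
  proof (induction j)
    case (Suc j)
    have "app f (of_nat (Suc j)) = s * (1 + app f (of_nat j))"
      using f(2)[of "of_nat j"] s unfolding nst_def by (simp add: add.commute)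
    moreover have "s ^ j \<le> 1 + app f (of_nat j)"
      using Suc.IH by (cases "j = 0") (auto intro: add_increasing)
    ultimately show ?case by (simp add: mult_left_mono)
  qed simp
  moreover have mono: "app f x \<le> app f (x + 1)" if "x < s" for x
  proof -
    have "app f x \<le> app f x * s" using s by (intro le_mult_self) (auto simp: nst_def dest: spec[of _ 0])
    also have "\<dots> \<le> s * (1 + app f x)" by (simp add: mult.commute mult_left_mono)
    finally show ?thesis using f(2)[OF that] by simp
  qed
  have le: "app f (of_nat j) \<le> app f (of_nat j + x)" if "of_nat j + x \<le> s" for j x
  proof -
    have "of_nat j + x \<le> s \<longrightarrow> app f (of_nat j) \<le> app f (of_nat j + x)"
    proof (rule induct_DF[where P = "\<lambda>x. of_nat j + x \<le> s \<longrightarrow> app f (of_nat j) \<le> app f (of_nat j + x)"])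
      fix x assume IH: "of_nat j + x \<le> s \<longrightarrow> app f (of_nat j) \<le> app f (of_nat j + x)"
      show "of_nat j + (x + 1) \<le> s \<longrightarrow> app f (of_nat j) \<le> app f (of_nat j + (x + 1))"
      proof
        assume a: "of_nat j + (x + 1) \<le> s"
        then have l: "of_nat j + x < s" by (simp add: less_iff_succ_less_eq add.assoc)
        then have "app f (of_nat j) \<le> app f (of_nat j + x)" using IH by simp
        also have "\<dots> \<le> app f (of_nat j + (x + 1))" using mono[OF l] by (simp add: add.assoc)
        finally show "app f (of_nat j) \<le> app f (of_nat j + (x + 1))" .
      qed
    qed (intro df fd, simp)
    then show ?thesis using that by blast
  qed
  have "app f (of_nat j) \<le> app f s" for j
  proof -
    have "of_nat j \<le> s" using s unfolding nst_def by (simp add: less_imp_le)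
    then obtain x where "s = of_nat j + x" using le_iff_add by blast
    then show ?thesis using le[of j x] by simp
  qed
  moreover have "s ^ k \<le> s ^ Suc k"
    using le_mult_self[of s "s ^ k"] s by (auto simp: nst_def mult.commute dest: spec[of _ 0])
  ultimately show ?thesis using f(3) order_trans by (meson le_less_trans zero_less_Suc)
qed

text \<open>A function in \<open>FN\<close> is bounded by a term, hence by a standard power of s;
  one gap therefore swallows any fixed bounded function.\<close>

lemma Gap_FN:
  assumes "Gap s s'" "nst s" "FN t" "\<And>i. e i \<le> s"
  shows "t e < s'"
proof -
  obtain \<tau> where "\<forall>e. t e \<le> tval e \<tau>" using assms(3) unfolding FN_def by blast
  then have t: "t e \<le> tval e \<tau>" by blast
  have s2: "1 + 1 \<le> s" using assms(2) spec[of _ 2] unfolding nst_def by (metis less_imp_le of_nat_numeral one_add_one)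
  have s1: "1 \<le> s" using order_trans[OF _ s2, of 1] by simp
  have sk: "1 \<le> s ^ k" for k using s1 by (rule one_le_power)
  have "\<exists>k. tval e \<tau> \<le> s ^ k"
  proof (induction \<tau>)
    case (Var x) then show ?case using assms(4) by (auto intro: exI[of _ 1])
  next
    case Zero then show ?case by simp
  next
    case (Sc \<tau>)
    then obtain k where "tval e \<tau> \<le> s ^ k" by blast
    then have "tval e \<tau> + 1 \<le> s ^ k + s ^ k" using sk[of k] by (rule add_mono)
    also have "\<dots> = (1 + 1) * s ^ k" by (simp only: distrib_right mult_1_left)
    also have "\<dots> \<le> s ^ Suc k" using s2 by (simp add: mult_right_mono)
    finally show ?case by (metis tval.simps(3))
  next
    case (Pl \<tau> \<upsilon>)
    then obtain k l where k: "tval e \<tau> \<le> s ^ k" "tval e \<upsilon> \<le> s ^ l" by blast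
    have "tval e \<tau> \<le> s ^ (k + l)" using k(1) power_increasing[OF _ s1, of k "k + l"] by simp
    moreover have "tval e \<upsilon> \<le> s ^ (k + l)" using k(2) power_increasing[OF _ s1, of l "k + l"] by simp
    ultimately have "tval e \<tau> + tval e \<upsilon> \<le> s ^ (k + l) + s ^ (k + l)" by (rule add_mono)
    also have "\<dots> = (1 + 1) * s ^ (k + l)" by (simp only: distrib_right mult_1_left)
    also have "\<dots> \<le> s ^ Suc (k + l)" using s2 by (simp add: mult_right_mono)
    finally show ?case by (metis tval.simps(4))
  next
    case (Tm \<tau> \<upsilon>)
    then obtain k l where "tval e \<tau> \<le> s ^ k" "tval e \<upsilon> \<le> s ^ l" by blast
    then have "tval e \<tau> * tval e \<upsilon> \<le> s ^ (k + l)" by (simp add: power_add mult_mono)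
    then show ?case by auto
  qed
  then show ?thesis using t Gap_power[OF assms(1,2)] by (meson le_less_trans order_trans)
qed

text \<open>The formula coded by \<open>e\<close> is evaluated at the predecessor of
  \<open>h\<close>, not at \<open>h\<close>: certificates for it are sought below
  \<open>bnd h\<close>, which keeps the predicate bounded and still leaves room for those about the
  predecessor.\<close>

definition Ev :: "'a::pa \<Rightarrow> 'a \<Rightarrow> 'a \<Rightarrow> bool" where
  "Ev h e w \<longleftrightarrow> (\<exists>s<bnd h. Cert s \<and> cl s e (pair (pair (fstp h) w) 0) 1)"

lemma BD_Ev [bd]: "FN t \<Longrightarrow> FN u \<Longrightarrow> FN v \<Longrightarrow> BD (\<lambda>e. Ev (t e) (u e) (v e))"
proof (rule BD3[where P = Ev])
  show "BD (\<lambda>e. Ev (e 0) (e 1) (e 2))" unfolding Ev_def by (intro bd fn)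
qed

lemma DF_Ev [df]: "FD t \<Longrightarrow> FD u \<Longrightarrow> FD v \<Longrightarrow> DF (\<lambda>e. Ev (t e) (u e) (v e))"
  by (rule DF3[where P = Ev]) (rule BD_DF, intro bd fn)

text \<open>No term bounds \<open>rs\<close>; the cut-off at \<open>w\<close> makes the search bounded and is harmless by \<open>rsb_eq\<close> below.\<close>

definition rsb :: "'a::pa \<Rightarrow> 'a \<Rightarrow> 'a \<Rightarrow> 'a" where
  "rsb w \<sigma> m = lst (\<lambda>X. X < w \<and> (\<forall>q<w. mem q X \<longleftrightarrow> (\<exists>i<m. q = pair i (app \<sigma> i))))"

lemma FN_rsb [fn]: "FN t \<Longrightarrow> FN u \<Longrightarrow> FN v \<Longrightarrow> FN (\<lambda>e. rsb (t e) (u e) (v e))"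
proof (rule FN3[where f = rsb])
  show "FN (\<lambda>e. rsb (e 0) (e 1) (e 2))" unfolding rsb_def by (intro fn bd)
qed

lemma rsb_eq: "rs \<sigma> m < w \<Longrightarrow> rsb w \<sigma> m = rs \<sigma> m"
proof -
  assume w: "rs \<sigma> m < w"
  have pw: "pair i (app \<sigma> i) < w" if "i < m" for i
    using mem_less[of "pair i (app \<sigma> i)" "rs \<sigma> m"] that w by (auto simp: rs_mem)
  have iff: "X < w \<and> (\<forall>q<w. mem q X \<longleftrightarrow> (\<exists>i<m. q = pair i (app \<sigma> i))) \<longleftrightarrow>
     X < w \<and> (\<forall>q. mem q X \<longleftrightarrow> (\<exists>i<m. q = pair i (app \<sigma> i)))" for X
  proof (rule conj_cong[OF refl])
    assume X: "X < w"
    have m: "mem q X \<Longrightarrow> q < w" for q using less_trans[OF mem_less X] .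
    show "(\<forall>q<w. mem q X \<longleftrightarrow> (\<exists>i<m. q = pair i (app \<sigma> i))) \<longleftrightarrow> (\<forall>q. mem q X \<longleftrightarrow> (\<exists>i<m. q = pair i (app \<sigma> i)))"
    proof
      assume a: "\<forall>q<w. mem q X \<longleftrightarrow> (\<exists>i<m. q = pair i (app \<sigma> i))"
      show "\<forall>q. mem q X \<longleftrightarrow> (\<exists>i<m. q = pair i (app \<sigma> i))"
      proof
        fix q show "mem q X \<longleftrightarrow> (\<exists>i<m. q = pair i (app \<sigma> i))"
        proof (cases "q < w")
          case False
          then show ?thesis using m pw by blast
        qed (use a in blast)
      qed
    qed blast
  qed
  show ?thesis unfolding rsb_def iff
  proof (rule lst_eq)
    show "rs \<sigma> m < w \<and> (\<forall>q. mem q (rs \<sigma> m) \<longleftrightarrow> (\<exists>i<m. q = pair i (app \<sigma> i)))" using w rs_mem by blast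
    fix z assume z: "z < rs \<sigma> m"
    have D: "DF (\<lambda>e. \<forall>q. mem q (e 0) \<longleftrightarrow> (\<exists>i<m. q = pair i (app \<sigma> i)))" by (intro df fd)
    have "\<not> (\<forall>q. mem q z \<longleftrightarrow> (\<exists>i<m. q = pair i (app \<sigma> i)))"
      using lst_works(2)[OF D, of "rs \<sigma> m" z] rs_mem z unfolding rs_def by blast
    then show "\<not> (z < w \<and> (\<forall>q. mem q z \<longleftrightarrow> (\<exists>i<m. q = pair i (app \<sigma> i))))" by blast
  qed
qed

lemma rs_small:
  assumes "Sub b d" "\<And>i. i < m \<Longrightarrow> pair i (app \<sigma> i) < b"
  shows "rs \<sigma> m < d"
proof -
  have "DF (\<lambda>e. \<exists>i<m. e 0 = pair i (app \<sigma> i))" by (intro df fd)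
  from Sub_compr[OF assms(1) this] obtain s where s: "s < d" "\<forall>q. mem q s \<longleftrightarrow> (\<exists>i<m. q = pair i (app \<sigma> i))"
    using assms(2) by auto
  have "DF (\<lambda>e. \<forall>q. mem q (e 0) \<longleftrightarrow> (\<exists>i<m. q = pair i (app \<sigma> i)))" by (intro df fd)
  from lst_works(3)[OF this s(2)] s(1) show ?thesis unfolding rs_def by simp
qed

text \<open>Three times \<open>a0\<close> fits below \<open>h0\<close> because \<open>a0\<close>
  rounds of thinning descend three levels each in towers of height at least \<open>h0\<close>. The
  square of \<open>a0\<close> fits because multiples of \<open>a0\<close> will provide infinitely
  many distinct galaxies in every sequence. Each relation in \<open>\<epsilon>\<close> is a bounded
  function of \<open>h0\<close>, so that it belongs to the submodel.\<close>

locale ladder = chain +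
  fixes rt a0 :: 'a
  assumes rt: "mem rt \<epsilon>" "Th n (pair rt (pair z y)) \<Longrightarrow> tower y (zt n z)"
    and a0: "nst a0" "a0 + a0 + a0 \<le> h0" "a0 * a0 \<le> h0"
    and eps_def: "mem r \<epsilon> \<Longrightarrow> \<exists>f. FN (\<lambda>e. f (e 0)) \<and> r = f h0"
begin

definition hs :: "nat \<Rightarrow> 'a" where "hs i = hh (of_nat i)"

lemma hs_0: "hs 0 = h0"
  by (simp add: hs_def hh_0)

lemma St_hs: "St (hs i) (hs (Suc i))"
  using St_hh[of "of_nat i"] by (simp add: hs_def add.commute)

lemma fstp_hs: "fstp (hs (Suc i)) = hs i"
  by (rule Stp_parts(1)[OF St_hs])

lemma hs_BT: "BT (Th n) \<epsilon> (hs i) (bnd (hs (Suc i)))"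
  using St_hs[of i] unfolding Stp_def by blast

lemma hs_tru: "mem q (tru (hs (Suc i))) \<longleftrightarrow> q < bnd (hs (Suc i)) \<and> Th n q"
  using St_hs[of i] unfolding Stp_def codes_iff by blast

lemma hs_bnd: "hs i < bnd (hs (Suc i))"
  using hs_BT unfolding BT_def by blast

lemma bnd_le: "bnd h \<le> h"
  unfolding bnd_def using order_trans[OF fstp_le sndp_le] .

lemma hs_less_Suc: "hs i < hs (Suc i)"
  using hs_bnd[of i] bnd_le[of "hs (Suc i)"] by simp

lemma hs_mono: "i \<le> j \<Longrightarrow> hs i \<le> hs j"
  by (rule lift_Suc_mono_le[of hs]) (simp_all add: less_imp_le hs_less_Suc)

lemma nst_hs: "nst (hs i)"
proof -
  have "a0 \<le> a0 + (a0 + a0)" by (intro add_increasing2 zero_le order_refl)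
  then have "a0 \<le> h0" using a0(2) unfolding add.assoc by (rule order_trans)
  moreover have "h0 \<le> hs i" using hs_mono[of 0 i] by (simp add: hs_0)
  ultimately have "a0 \<le> hs i" by (rule order_trans)
  then show ?thesis by (rule nst_le[OF a0(1)])
qed

lemma hs_funpow: "(fstp ^^ k) (hs (i + k)) = hs i"
  by (induction k) (simp_all add: funpow_Suc_right fstp_hs del: funpow.simps(2))

text \<open>As \<open>rt\<close> is among the relations in \<open>\<epsilon>\<close>, some tower
  above a state lies below the bound of the next state, and so does the least one; being least, it
  is definable from that next state.\<close>

definition zz :: "nat \<Rightarrow> 'a" where "zz i = lst (\<lambda>z. tower (hs i) z)"
definition tw :: "nat \<Rightarrow> 'a \<Rightarrow> 'a" where "tw i k = app (zz i) k"

lemma zz: "tower (hs i) (zz i)" "zz i < bnd (hs (Suc i))"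
proof -
  obtain z where z: "z < bnd (hs (Suc i))" "Th n (pair rt (pair z (hs i)))"
    using hs_BT[of i] rt(1) mem_less[OF rt(1)] unfolding BT_def by blast
  then have t: "tower (hs i) (zt n z)" using rt(2) by blast
  have D: "DF (\<lambda>e. tower (hs i) (e 0))" by (rule BD_DF[OF BD_tower, THEN DF2[where P = tower]]) (intro fn fd)+
  show "tower (hs i) (zz i)" unfolding zz_def by (rule lst_works(1)[OF D t])
  have "zz i \<le> zt n z" unfolding zz_def by (rule lst_works(3)[OF D t])
  also have "\<dots> \<le> z" by (simp add: zt_def)
  finally show "zz i < bnd (hs (Suc i))" using z(1) by simp
qed

lemma tw_0: "tw i 0 = hs i"
  using zz(1)[of i] by (simp add: tower_def tw_def)

lemma tw_Gap: "k < hs i \<Longrightarrow> Gap (tw i k) (tw i (k + 1))"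
  using zz(1)[of i] by (simp add: tower_def tw_def)

lemma tw_bnd: "tw i k < bnd (hs (Suc i))"
  unfolding tw_def by (rule le_less_trans[OF app_le zz(2)])

lemma tw_hs: "tw i k < hs (Suc i)"
  by (rule less_le_trans[OF tw_bnd bnd_le])

lemma FD_tw [fd]: "FD t \<Longrightarrow> FD (\<lambda>e. tw i (t e))"
  unfolding tw_def by (intro fd)

lemma tw_mono: "k \<le> k' \<Longrightarrow> k' \<le> hs i \<Longrightarrow> tw i k \<le> tw i k'"
proof -
  assume "k \<le> k'" and k': "k' \<le> hs i"
  then obtain x where x: "k' = k + x" using le_iff_add by blast
  have "k + x \<le> hs i \<longrightarrow> tw i k \<le> tw i (k + x)"
  proof (rule induct_DF[where P = "\<lambda>x. k + x \<le> hs i \<longrightarrow> tw i k \<le> tw i (k + x)"])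
    fix x assume IH: "k + x \<le> hs i \<longrightarrow> tw i k \<le> tw i (k + x)"
    show "k + (x + 1) \<le> hs i \<longrightarrow> tw i k \<le> tw i (k + (x + 1))"
    proof
      assume a: "k + (x + 1) \<le> hs i"
      then have l: "k + x < hs i" by (simp add: less_iff_succ_less_eq add.assoc)
      then have "tw i k \<le> tw i (k + x)" using IH by simp
      also have "\<dots> \<le> tw i (k + (x + 1))" using Gap_less[OF tw_Gap[OF l]] by (simp add: add.assoc)
      finally show "tw i k \<le> tw i (k + (x + 1))" .
    qed
  qed (intro df fd, simp)
  then show ?thesis using k' x by blast
qed

text \<open>The entries at standard heights give a proper cut strictly between \<open>hs i\<close>
  and \<open>bnd (hs (Suc i))\<close>, whose elements are all dominated by any entry at a
  nonstandard height.\<close>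

definition cut :: "nat \<Rightarrow> 'a set" where "cut i = {x. \<exists>k. x \<le> tw i (of_nat k)}"

lemma of_nat_less_hs: "of_nat k < hs i"
  using nst_hs unfolding nst_def by blast

lemma cut_2: "x \<in> cut i \<Longrightarrow> y \<in> cut i \<Longrightarrow> \<exists>k. x \<le> tw i (of_nat k) \<and> y \<le> tw i (of_nat k)"
proof -
  assume "x \<in> cut i" "y \<in> cut i"
  then obtain k l where k: "x \<le> tw i (of_nat k)" "y \<le> tw i (of_nat l)" unfolding cut_def by blast
  have "tw i (of_nat k) \<le> tw i (of_nat (k + l))" "tw i (of_nat l) \<le> tw i (of_nat (k + l))"
    by (rule tw_mono; use of_nat_less_hs[of "k + l" i] in simp)+
  then show ?thesis using k order_trans by blast
qed

lemma tw_Gap_of_nat: "Gap (tw i (of_nat k)) (tw i (of_nat (Suc k)))"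
  using tw_Gap[OF of_nat_less_hs[of k i]] by (simp add: add.commute)

lemma pair_less_Gap: "Gap s s' \<Longrightarrow> x \<le> s \<Longrightarrow> y \<le> s \<Longrightarrow> pair x y < s'"
proof -
  assume "Gap s s'" "x \<le> s" "y \<le> s"
  then have "pair x y \<le> pair s s" "pair s s + 1 < s'" by (simp_all add: pair_mono Gap_def)
  moreover have "pair s s \<le> pair s s + 1" by simp
  ultimately show ?thesis by (meson le_less_trans order_trans)
qed

lemma cutI_cut: "cutI (cut i)"
  unfolding cutI_def
proof (intro conjI ballI allI impI)
  have hs_cut: "hs i \<in> cut i" unfolding cut_def using tw_0 by (auto intro: exI[of _ 0])
  then show "1 \<in> cut i" unfolding cut_def using of_nat_less_hs[of 1 i] tw_0[of i] by (auto intro!: exI[of _ 0] simp: less_imp_le)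
  fix x y assume x: "x \<in> cut i"
  { assume y: "y \<in> cut i"
    obtain k where k: "x \<le> tw i (of_nat k)" "y \<le> tw i (of_nat k)" using cut_2[OF x y] by blast
    have p: "pair x y < tw i (of_nat (Suc k))" by (rule pair_less_Gap[OF tw_Gap_of_nat k])
    have "x + y \<le> (x + y) * (x + y)" by (rule square_ge)
    also have le: "\<dots> \<le> pair x y" by (simp add: pair_def)
    finally show "x + y \<in> cut i" unfolding cut_def using p by (auto intro: exI[of _ "Suc k"])
    have "x * y \<le> (x + y) * (x + y)" by (rule mult_mono) simp_all
    then show "x * y \<in> cut i" unfolding cut_def using p le order_trans by (metis less_imp_le mem_Collect_eq) }
  { assume "y \<le> x" then show "y \<in> cut i" using x unfolding cut_def by (auto intro: order_trans) }
next
  fix b assume "b \<in> cut i"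
  then obtain k where k: "b \<le> tw i (of_nat k)" unfolding cut_def by blast
  have S: "Sub (tw i (of_nat k)) (tw i (of_nat (Suc k)))" using tw_Gap_of_nat unfolding Gap_def by blast
  have "Sub b (tw i (of_nat (Suc k)))" unfolding Sub_def
  proof
    fix s
    have "DF (\<lambda>e. e 0 < b \<and> mem (e 0) s)" by (intro df fd)
    from Sub_compr[OF S this] obtain s' where "s' < tw i (of_nat (Suc k))"
      "\<forall>x. mem x s' \<longleftrightarrow> x < tw i (of_nat k) \<and> x < b \<and> mem x s" by blast
    then show "\<exists>s'<tw i (of_nat (Suc k)). \<forall>x. mem x s' \<longleftrightarrow> x < b \<and> mem x s"
      using k less_le_trans by blast
  qed
  then show "\<exists>d\<in>cut i. Sub b d" unfolding cut_def by blast
qed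

lemma hs_cut: "hs i \<in> cut i"
  unfolding cut_def using tw_0 by (auto intro: exI[of _ 0])

lemma cut_less: "x \<in> cut i \<Longrightarrow> x < bnd (hs (Suc i))"
  unfolding cut_def using tw_bnd le_less_trans by blast

lemma cut_down: "y \<in> cut i \<Longrightarrow> x \<le> y \<Longrightarrow> x \<in> cut i"
  using cutI_simps(6)[OF cutI_cut] .

lemma cut_mono: "i \<le> j \<Longrightarrow> cut i \<subseteq> cut j"
proof (induction rule: dec_induct)
  case (step j)
  have "x \<in> cut (Suc j)" if "x \<in> cut j" for x
    using cut_less[OF that] bnd_le[of "hs (Suc j)"] cut_down[OF hs_cut[of "Suc j"], of x] by simp
  then show ?case using step.IH by blast
qed simp

lemma cut_less_tw: "x \<in> cut i \<Longrightarrow> nst k \<Longrightarrow> k \<le> hs i \<Longrightarrow> x \<le> tw i k"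
  unfolding cut_def nst_def using tw_mono by (smt (verit) less_imp_le mem_Collect_eq order_trans)

text \<open>For standard codes and arguments in the cut, completeness of certificates inside the cut
  finds one there, and the cut lies below the bound of the next state. So the bounded predicate
  \<open>Ev\<close> is genuine truth.\<close>

lemma Ev_iff:
  assumes "coded k (\<lambda>y. tv (B (fstp y)))" "w \<in> cut i"
  shows "Ev (hs (Suc i)) (of_nat k) w \<longleftrightarrow> B (pair (hs i) w)"
proof
  assume "Ev (hs (Suc i)) (of_nat k) w"
  then obtain s where "Cert s" "cl s (of_nat k) (pair (pair (hs i) w) 0) 1" unfolding Ev_def fstp_hs by blast
  from coded_sound[OF assms(1) this] show "B (pair (hs i) w)" by simp
next
  assume B: "B (pair (hs i) w)"
  let ?y = "pair (pair (hs i) w) 0"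
  have "?y + 1 \<in> cut i" using assms(2) hs_cut by (intro cutI_intros[OF cutI_cut])
  from coded_complete[OF assms(1) cutI_cut this] obtain S where S: "S \<in> cut i" "Cert S"
    "\<forall>y<?y + 1. cl S (of_nat k) y (tv (B (fstp y)))" by blast
  then have "cl S (of_nat k) ?y 1" using B by (auto simp: less_S_iff dest: spec[of _ ?y])
  then show "Ev (hs (Suc i)) (of_nat k) w" unfolding Ev_def fstp_hs using S cut_less by blast
qed

end

section \<open>Iterated thinning\<close>

text \<open>\<open>ehom\<close> for the relation \<open>Ev H\<close>, with segments coded by
  \<open>rsb\<close> so that it is bounded; q packs the code of the formula with the parameters and
  positions.\<close>

definition ehb :: "'a::pa \<Rightarrow> 'a \<Rightarrow> 'a \<Rightarrow> 'a \<Rightarrow> 'a \<Rightarrow> bool" where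
  "ehb H w b \<sigma> N \<longleftrightarrow> (\<forall>j<N. \<forall>j'<N. \<forall>m\<le>N. m \<le> j \<longrightarrow> m \<le> j' \<longrightarrow> (\<forall>q<b.
     Ev H (fstp q) (pair (sndp q) (pair (rsb w \<sigma> m) (app \<sigma> j))) \<longleftrightarrow>
     Ev H (fstp q) (pair (sndp q) (pair (rsb w \<sigma> m) (app \<sigma> j')))))"

lemma BD_ehb [bd]: "FN t1 \<Longrightarrow> FN t2 \<Longrightarrow> FN t3 \<Longrightarrow> FN t4 \<Longrightarrow> FN t5 \<Longrightarrow> BD (\<lambda>e. ehb (t1 e) (t2 e) (t3 e) (t4 e) (t5 e))"
proof (rule BD5[where P = ehb])
  show "BD (\<lambda>e. ehb (e 0) (e 1) (e 2) (e 3) (e 4))" unfolding ehb_def by (intro bd fn)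
qed

text \<open>Here \<open>P\<close> packs the state used for the truth of relations, a bound, the code of a tower and
  its height.\<close>

definition Thn :: "'a::pa \<Rightarrow> 'a \<Rightarrow> 'a \<Rightarrow> 'a \<Rightarrow> bool" where
  "Thn P t \<sigma> \<sigma>' \<longleftrightarrow> (\<exists>u\<le>sndp (sndp (sndp P)). u + ((t + 1) + (t + 1) + (t + 1)) = sndp (sndp (sndp P)) \<and>
     inc \<sigma>' (app (fstp (sndp (sndp P))) u) \<and>
     from_seq \<sigma>' (app (fstp (sndp (sndp P))) u) \<sigma> (app (fstp (sndp (sndp P))) (u + 1 + 1 + 1)) \<and>
     ehb (fstp P) (fstp (sndp P)) (app (fstp (sndp (sndp P))) (u + 1)) \<sigma>' (app (fstp (sndp (sndp P))) u))"

lemma BD_Thn: "BD (\<lambda>e. Thn (e 0) (e 1) (e 2) (e 3))"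
  unfolding Thn_def by (intro bd fn)

lemma DF_Thn [df]: "FD t1 \<Longrightarrow> FD t2 \<Longrightarrow> FD t3 \<Longrightarrow> FD t4 \<Longrightarrow> DF (\<lambda>e. Thn (t1 e) (t2 e) (t3 e) (t4 e))"
  by (rule DF4[where P = Thn]) (rule BD_DF[OF BD_Thn])

definition nx :: "'a::pa \<Rightarrow> 'a \<Rightarrow> 'a \<Rightarrow> 'a" where
  "nx P t \<sigma> = lst (\<lambda>\<sigma>'. \<sigma>' < fstp (sndp P) \<and> Thn P t \<sigma> \<sigma>')"

lemma FN_nx: "FN (\<lambda>e. nx (e 0) (e 1) (e 2))"
  unfolding nx_def by (intro fn BD4[OF BD_Thn])

lemma FD_nx [fd]: "FD t1 \<Longrightarrow> FD t2 \<Longrightarrow> FD t3 \<Longrightarrow> FD (\<lambda>e. nx (t1 e) (t2 e) (t3 e))"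
  by (rule FD3[where f = nx]) (rule FN_FD[OF FN_nx])

definition idf :: "'a::pa \<Rightarrow> 'a \<Rightarrow> 'a" where
  "idf w N = lst (\<lambda>\<sigma>. \<sigma> < w \<and> (\<forall>i<N. app \<sigma> i = i))"

lemma FN_idf: "FN (\<lambda>e. idf (e 0) (e 1))"
  unfolding idf_def by (intro fn bd)

lemma lst_bounded: "DF (\<lambda>e. P (e 0)) \<Longrightarrow> P x \<Longrightarrow> lst P < b \<Longrightarrow> lst (\<lambda>z. z < b \<and> P z) = lst P"
proof (rule lst_eq)
  assume a: "DF (\<lambda>e. P (e 0))" "P x" "lst P < b"
  show "lst P < b \<and> P (lst P)" using lst_works(1)[OF a(1,2)] a(3) by blast
  show "\<not> (z < b \<and> P z)" if "z < lst P" for z using lst_works(2)[OF a(1,2) that] by blast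
qed

context ladder
begin

text \<open>Definable from one state by a bounded function. Earlier states are iterated
  predecessors, so one state is as good as finitely many and definability passes upwards.\<close>

definition dfn :: "nat \<Rightarrow> 'a \<Rightarrow> bool" where
  "dfn i x \<longleftrightarrow> (\<exists>f. FN (\<lambda>e::nat \<Rightarrow> 'a. f (e 0)) \<and> x = f (hs i))"

lemma dfn_FN:
  assumes "FN t" "\<And>j. dfn i (x j)" shows "dfn i (t x)"
proof -
  have "\<forall>j. \<exists>f. FN (\<lambda>e::nat \<Rightarrow> 'a. f (e 0)) \<and> x j = f (hs i)" using assms(2) unfolding dfn_def by blast
  then obtain f where f: "\<And>j. FN (\<lambda>e::nat \<Rightarrow> 'a. f j (e 0))" "\<And>j. x j = f j (hs i)" by metis
  have "FN (\<lambda>e. t (\<lambda>j. f j (e 0)))" by (rule FN_comp[OF assms(1) f(1)])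
  moreover have "x = (\<lambda>j. f j (hs i))" using f(2) by (rule ext)
  ultimately show ?thesis unfolding dfn_def by (intro exI[of _ "\<lambda>h. t (\<lambda>j. f j h)"]) simp
qed

lemma dfn_1: "FN (\<lambda>e. f (e 0)) \<Longrightarrow> dfn i x \<Longrightarrow> dfn i (f x)"
  using dfn_FN[of "\<lambda>e. f (e 0)" i "args [x]"] args_all[of "[x]" "dfn i"] by simp

lemma dfn_2: "FN (\<lambda>e. f (e 0) (e 1)) \<Longrightarrow> dfn i x \<Longrightarrow> dfn i y \<Longrightarrow> dfn i (f x y)"
  using dfn_FN[of "\<lambda>e. f (e 0) (e 1)" i "args [x, y]"] args_all[of "[x, y]" "dfn i"] by simp

lemma dfn_3: "FN (\<lambda>e. f (e 0) (e 1) (e 2)) \<Longrightarrow> dfn i x \<Longrightarrow> dfn i y \<Longrightarrow> dfn i z \<Longrightarrow> dfn i (f x y z)"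
  using dfn_FN[of "\<lambda>e. f (e 0) (e 1) (e 2)" i "args [x, y, z]"] args_all[of "[x, y, z]" "dfn i"] by simp

lemma dfn_hs: "i \<le> j \<Longrightarrow> dfn j (hs i)"
proof -
  assume "i \<le> j"
  then have "hs i = (fstp ^^ (j - i)) (hs j)" using hs_funpow[of "j - i" i] by simp
  moreover have "FN (\<lambda>e. (fstp ^^ k) (e 0) :: 'a)" for k by (induction k) (auto intro: fn)
  ultimately show ?thesis unfolding dfn_def by (intro exI[of _ "fstp ^^ (j - i)"]) simp
qed

lemma dfn_mono: "dfn i x \<Longrightarrow> i \<le> j \<Longrightarrow> dfn j x"
  using dfn_1[OF _ dfn_hs] unfolding dfn_def by blast

lemma dfn_of_nat: "dfn i (of_nat k)"
  unfolding dfn_def by (intro exI[of _ "\<lambda>_. of_nat k"]) (simp add: fn)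

lemma dfn_zz: "dfn (Suc i) (zz i)"
proof -
  have D: "DF (\<lambda>e. tower (hs i) (e 0))" by (rule BD_DF[OF BD_tower, THEN DF2[where P = tower]]) (intro fn fd)+
  have "zz i = lst (\<lambda>z. z < bnd (hs (Suc i)) \<and> tower (fstp (hs (Suc i))) z)"
    using lst_bounded[OF D zz(1)] zz(2) unfolding fstp_hs zz_def by simp
  moreover have "FN (\<lambda>e. (\<lambda>h. lst (\<lambda>z. z < bnd h \<and> tower (fstp h) z)) (e 0))" by (intro fn bd)
  ultimately show ?thesis unfolding dfn_def by (intro exI[of _ "\<lambda>h. lst (\<lambda>z. z < bnd h \<and> tower (fstp h) z)"]) simp
qed

lemma dfn_tw: "dfn (Suc i) k \<Longrightarrow> dfn (Suc i) (tw i k)"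
  unfolding tw_def by (rule dfn_2[where f = app]) (intro fn dfn_zz | assumption)+

text \<open>Two further gaps above \<open>hs (Suc l)\<close> are used: one for the pairs of position
  and value, one for the code of a set of such pairs. Two standard levels of the next tower contain
  the result.\<close>

lemma rs_hs:
  assumes "m \<le> tw l u" "u \<le> hs l" "\<And>i. i < m \<Longrightarrow> app \<sigma> i < tw l (hs l)"
  shows "rs \<sigma> m \<in> cut (Suc l)" "rs \<sigma> m < hs (l + 2)"
proof -
  have b: "tw l u \<le> tw l (hs l)" by (rule tw_mono[OF assms(2) order_refl])
  have G: "Gap (hs (Suc l)) (tw (Suc l) (of_nat 1))" "Gap (tw (Suc l) (of_nat 1)) (tw (Suc l) (of_nat 2))"
    using tw_Gap_of_nat[of "Suc l" 0] tw_Gap_of_nat[of "Suc l" 1] by (simp_all add: tw_0 numeral_2_eq_2)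
  have p: "pair i (app \<sigma> i) < tw (Suc l) (of_nat 1)" if i: "i < m" for i
  proof (rule pair_less_Gap[OF G(1)])
    have "i < tw l (hs l)" using i assms(1) b by simp
    then show "i \<le> hs (Suc l)" using tw_hs[of l "hs l"] by simp
    show "app \<sigma> i \<le> hs (Suc l)" using assms(3)[OF i] tw_hs[of l "hs l"] by simp
  qed
  have r: "rs \<sigma> m < tw (Suc l) (of_nat 2)"
    by (rule rs_small[OF _ p]) (use G(2) in \<open>simp_all add: Gap_def\<close>)
  then show "rs \<sigma> m \<in> cut (Suc l)" unfolding cut_def using less_imp_le by blast
  show "rs \<sigma> m < hs (l + 2)" using r tw_hs[of "Suc l" "of_nat 2"] by simp
qed

text \<open>Round \<open>t\<close> consults the state of index l + 3 + t, and hence makes the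
  sequence homogeneous for truth at its predecessor, of index l + 2 + t. The offset leaves room for
  the sequences themselves, whose codes are below \<open>hs (l + 2)\<close>.\<close>

definition par :: "nat \<Rightarrow> 'a \<Rightarrow> 'a" where
  "par l t = pair (hh (of_nat (l + 3) + t)) (pair (hs (l + 2)) (pair (zz l) (hs l)))"

definition Inv :: "nat \<Rightarrow> 'a \<Rightarrow> 'a \<Rightarrow> bool" where
  "Inv l t \<sigma> \<longleftrightarrow> (\<exists>u. u + (t + t + t) = hs l \<and> inc \<sigma> (tw l u) \<and> (\<forall>i<tw l u. app \<sigma> i < tw l (hs l)))"

lemma Thn_par: "Thn (par l t) t \<sigma> \<sigma>' \<longleftrightarrow> (\<exists>u. u + ((t + 1) + (t + 1) + (t + 1)) = hs l \<and>
     inc \<sigma>' (tw l u) \<and> from_seq \<sigma>' (tw l u) \<sigma> (tw l (u + 1 + 1 + 1)) \<and>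
     ehb (hh (of_nat (l + 3) + t)) (hs (l + 2)) (tw l (u + 1)) \<sigma>' (tw l u))"
proof -
  have "u \<le> hs l" if "u + x = hs l" for u x using that le_iff_add by metis
  then show ?thesis unfolding Thn_def par_def tw_def by auto
qed

lemma sum3: "u + ((t + 1) + (t + 1) + (t + 1)) = (u + 1 + 1 + 1) + (t + t + t)" for u t :: 'a
  by (simp add: ac_simps)

lemma Inv_Thn: "Inv l t \<sigma> \<Longrightarrow> Thn (par l t) t \<sigma> \<sigma>' \<Longrightarrow> Inv l (t + 1) \<sigma>'"
proof -
  assume I: "Inv l t \<sigma>" and T: "Thn (par l t) t \<sigma> \<sigma>'"
  obtain u where u: "u + (t + t + t) = hs l" "\<forall>i<tw l u. app \<sigma> i < tw l (hs l)" using I unfolding Inv_def by blast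
  obtain v where v: "v + ((t + 1) + (t + 1) + (t + 1)) = hs l" "inc \<sigma>' (tw l v)"
    "from_seq \<sigma>' (tw l v) \<sigma> (tw l (v + 1 + 1 + 1))" using T unfolding Thn_par by blast
  have "v + 1 + 1 + 1 = u" using u(1) v(1) unfolding sum3 by (metis add_right_cancel)
  then have "\<forall>i<tw l v. app \<sigma>' i < tw l (hs l)" using v(3) u(2) unfolding from_seq_def by auto
  then show ?thesis unfolding Inv_def using v by blast
qed

lemma thin_ex:
  assumes I: "Inv l t \<sigma>" and t: "(t + 1) + (t + 1) + (t + 1) \<le> hs l"
  shows "\<exists>\<sigma>'<hs (l + 2). Thn (par l t) t \<sigma> \<sigma>'"
proof -
  obtain v where "hs l = ((t + 1) + (t + 1) + (t + 1)) + v" using t le_iff_add by metis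
  then have v: "v + ((t + 1) + (t + 1) + (t + 1)) = hs l" by (simp add: add.commute)
  obtain u where u: "u + (t + t + t) = hs l" "inc \<sigma> (tw l u)" "\<forall>i<tw l u. app \<sigma> i < tw l (hs l)"
    using I unfolding Inv_def by blast
  have uv: "v + 1 + 1 + 1 = u" using u(1) v unfolding sum3 by (metis add_right_cancel)
  have u_le: "u \<le> hs l" using u(1) le_iff_add by metis
  then have lt: "v + 1 + 1 < hs l" "v + 1 < hs l" "v < hs l"
    unfolding uv[symmetric] by (simp_all add: less_iff_succ_less_eq)
      (metis (no_types) add.assoc less_iff_succ_less_eq less_imp_le order_trans)+
  let ?H = "hh (of_nat (l + 3) + t)"
  let ?R = "\<lambda>q X x. Ev ?H (fstp q) (pair (sndp q) (pair X x))"
  have R: "DF (\<lambda>e. ?R (e 0) (e 1) (e 2))" by (intro df fd)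
  have u_refl: "tw l (v + 1 + 1 + 1) \<le> tw l u" by (simp add: uv)
  obtain \<tau> where \<tau>: "inc \<tau> (tw l v)" "from_seq \<tau> (tw l v) \<sigma> (tw l u)" "ehom ?R (tw l (v + 1)) \<tau> (tw l v)"
    using thinning[OF R tw_Gap[OF lt(3)] tw_Gap[OF lt(2)] tw_Gap[OF lt(1)] u(2) u_refl] by blast
  have val: "app \<tau> i < tw l (hs l)" if "i < tw l v" for i
    using \<tau>(2) u(3) that unfolding from_seq_def by auto
  \<comment> \<open>The thinned sequence comes without any bound on its code; its canonical
    restriction has one by \<open>rs_hs\<close>, and this makes the search in \<open>nx\<close>
    succeed.\<close>
  define \<sigma>' where "\<sigma>' = rs \<tau> (tw l v)"
  have app: "app \<sigma>' i = app \<tau> i" if "i < tw l v" for i using that unfolding \<sigma>'_def by (rule rs_app)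
  have v_le: "v \<le> hs l" using lt(3) by simp
  have "\<sigma>' < hs (l + 2)" unfolding \<sigma>'_def by (rule rs_hs(2)[OF order_refl v_le val])
  moreover have "inc \<sigma>' (tw l v)" using \<tau>(1) app unfolding inc_def by (metis less_trans)
  moreover have "from_seq \<sigma>' (tw l v) \<sigma> (tw l (v + 1 + 1 + 1))"
    using \<tau>(2) app unfolding from_seq_def uv by simp
  moreover have "ehb ?H (hs (l + 2)) (tw l (v + 1)) \<sigma>' (tw l v)"
    unfolding ehb_def
  proof (intro allI impI)
    fix j j' m q assume a: "j < tw l v" "j' < tw l v" "m \<le> tw l v" "m \<le> j" "m \<le> j'" "q < tw l (v + 1)"
    have am: "app \<sigma>' i = app \<tau> i" "app \<sigma>' i < tw l (hs l)" if "i < m" for i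
      using app[of i] val[of i] less_le_trans[OF that a(3)] by simp_all
    have "rsb (hs (l + 2)) \<sigma>' m = rs \<sigma>' m" by (rule rsb_eq[OF rs_hs(2)[OF a(3) v_le am(2)]])
    also have "\<dots> = rs \<tau> m" by (rule rs_cong[OF am(1)])
    finally have r: "rsb (hs (l + 2)) \<sigma>' m = rs \<tau> m" .
    show "Ev ?H (fstp q) (pair (sndp q) (pair (rsb (hs (l + 2)) \<sigma>' m) (app \<sigma>' j))) \<longleftrightarrow>
      Ev ?H (fstp q) (pair (sndp q) (pair (rsb (hs (l + 2)) \<sigma>' m) (app \<sigma>' j')))"
      unfolding r app[OF a(1)] app[OF a(2)] using \<tau>(3) a unfolding ehom_def by blast
  qed
  ultimately show ?thesis unfolding Thn_par using v by blast
qed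

lemma nx_works:
  assumes "Inv l t \<sigma>" "(t + 1) + (t + 1) + (t + 1) \<le> hs l"
  shows "Thn (par l t) t \<sigma> (nx (par l t) t \<sigma>)"
proof -
  have "DF (\<lambda>e. e 0 < fstp (sndp (par l t)) \<and> Thn (par l t) t \<sigma> (e 0))" by (intro df fd)
  from lst_works(1)[OF this] thin_ex[OF assms] show ?thesis unfolding nx_def by (auto simp: par_def)
qed

lemma idf_works: "\<forall>i<tw l (hs l). app (idf (hs (l + 2)) (tw l (hs l))) i = i"
proof -
  have "DF (\<lambda>e. (\<lambda>x y. y = x) (e 0) (e 1))" by (intro df fd)
  from fun_compr[OF this, of "tw l (hs l)"] obtain f where f: "\<And>x. x < tw l (hs l) \<Longrightarrow> app f x = x" by auto
  have "rs f (tw l (hs l)) < hs (l + 2)" by (rule rs_hs(2)[OF order_refl order_refl]) (simp add: f)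
  moreover have "\<forall>i<tw l (hs l). app (rs f (tw l (hs l))) i = i" using rs_app f by metis
  moreover have "DF (\<lambda>e. e 0 < hs (l + 2) \<and> (\<forall>i<tw l (hs l). app (e 0) i = i))" by (intro df fd)
  ultimately show ?thesis unfolding idf_def
    using lst_works(1)[of "\<lambda>\<sigma>. \<sigma> < hs (l + 2) \<and> (\<forall>i<tw l (hs l). app \<sigma> i = i)"] by blast
qed

lemma a0_hs: "a0 + a0 + a0 \<le> hs l"
  using order_trans[OF a0(2)] hs_mono[of 0 l] by (simp add: hs_0)

lemma a0_step: "t < a0 \<Longrightarrow> (t + 1) + (t + 1) + (t + 1) \<le> hs l"
proof -
  assume "t < a0"
  then have "t + 1 \<le> a0" by (simp add: less_iff_succ_less_eq)
  then have "(t + 1) + (t + 1) + (t + 1) \<le> a0 + a0 + a0" by (intro add_mono)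
  then show ?thesis using a0_hs by (rule order_trans)
qed

definition isOm :: "nat \<Rightarrow> 'a \<Rightarrow> bool" where
  "isOm l F \<longleftrightarrow> app F 0 = idf (hs (l + 2)) (tw l (hs l)) \<and>
     (\<forall>t<a0. app F (t + 1) = nx (par l t) t (app F t)) \<and> (\<forall>t\<le>a0. Inv l t (app F t))"

lemma isOm_ex: "\<exists>F. isOm l F"
proof -
  have 1: "DF (\<lambda>e. (\<lambda>t x y. y = nx (par l t) t x) (e 0) (e 1) (e 2))" unfolding par_def by (intro df fd)
  have 2: "DF (\<lambda>e. Inv l (e 0) (e 1))" unfolding Inv_def by (intro df fd)
  have "Inv l 0 (idf (hs (l + 2)) (tw l (hs l)))"
    unfolding Inv_def
  proof (intro exI[of _ "hs l"] conjI)
    show "inc (idf (hs (l + 2)) (tw l (hs l))) (tw l (hs l))"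
      unfolding inc_def using idf_works[of l] less_trans by simp
    show "\<forall>i<tw l (hs l). app (idf (hs (l + 2)) (tw l (hs l))) i < tw l (hs l)" using idf_works[of l] by simp
  qed simp
  moreover have "\<exists>y. y = nx (par l t) t x \<and> Inv l (t + 1) y" if t: "t < a0" and I: "Inv l t x" for t x
    using Inv_Thn[OF I nx_works[OF I a0_step[OF t]]] by blast
  ultimately show ?thesis unfolding isOm_def
    using recursion[OF 1 2, where ?x0.0 = "idf (hs (l + 2)) (tw l (hs l))" and n = a0] by blast
qed

text \<open>The sequence of all rounds is chosen outside the submodel. Its entries are nevertheless
  fixed by the least choices in \<open>idf\<close> and \<open>nx\<close>: those of standard rounds
  are definable from states, and the entry at \<open>a0\<close> will provide the
  indiscernibles.\<close>

definition Om :: "nat \<Rightarrow> 'a" where "Om l = (SOME F. isOm l F)"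

lemma Om: "app (Om l) 0 = idf (hs (l + 2)) (tw l (hs l))"
    "t < a0 \<Longrightarrow> app (Om l) (t + 1) = nx (par l t) t (app (Om l) t)" "t \<le> a0 \<Longrightarrow> Inv l t (app (Om l) t)"
  using someI_ex[OF isOm_ex[of l]] unfolding Om_def isOm_def by blast+

lemma Om_Thn: "t < a0 \<Longrightarrow> Thn (par l t) t (app (Om l) t) (app (Om l) (t + 1))"
  unfolding Om(2) by (intro nx_works Om(3) a0_step less_imp_le)

lemma of_nat_a0: "of_nat t < a0"
  using a0(1) unfolding nst_def by blast

text \<open>Round \<open>t\<close> consults the state of index l + 3 + t, so the result of the first
  t rounds is available from the state of index l + t + 2.\<close>

lemma dfn_Om: "dfn (l + t + 2) (app (Om l) (of_nat t))"
proof (induction t)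
  case 0
  have "dfn (l + 2) (tw l (hs l))" by (rule dfn_mono[OF dfn_tw[OF dfn_hs]]) simp_all
  then have "dfn (l + 2) (idf (hs (l + 2)) (tw l (hs l)))" by (rule dfn_2[OF FN_idf dfn_hs[OF order_refl]])
  then show ?case using Om(1) by simp
next
  case (Suc t)
  have p: "dfn i (pair x y)" if "dfn i x" "dfn i y" for i x y by (rule dfn_2[OF _ that]) (intro fn)
  have "l + 3 + t = l + Suc t + 2" by simp
  then have "hh (of_nat (l + 3) + of_nat t) = hs (l + Suc t + 2)" unfolding hs_def of_nat_add[symmetric] by (simp only:)
  then have "dfn (l + Suc t + 2) (par l (of_nat t))"
    unfolding par_def by (auto intro!: p dfn_hs dfn_mono[OF dfn_zz])
  moreover have "dfn (l + Suc t + 2) (app (Om l) (of_nat t))" by (rule dfn_mono[OF Suc.IH]) simp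
  ultimately have "dfn (l + Suc t + 2) (nx (par l (of_nat t)) (of_nat t) (app (Om l) (of_nat t)))"
    by (intro dfn_3[OF FN_nx] dfn_of_nat)
  then show ?case using Om(2)[OF of_nat_a0[of t], of l] by (simp add: add.commute)
qed

definition ht :: "nat \<Rightarrow> 'a \<Rightarrow> 'a" where "ht l t = lst (\<lambda>u. u + (t + t + t) = hs l)"

lemma ht_eq: "u + (t + t + t) = hs l \<Longrightarrow> ht l t = u"
  unfolding ht_def by (rule lst_eq) (metis add_right_cancel less_irrefl)+

lemma FD_ht [fd]: "FD t \<Longrightarrow> FD (\<lambda>e. ht l (t e))"
  by (rule FD1[where f = "ht l"]) (auto simp: ht_def intro!: df fd)

lemma Om_inc: "t \<le> a0 \<Longrightarrow> inc (app (Om l) t) (tw l (ht l t))"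
  and Om_val: "t \<le> a0 \<Longrightarrow> i < tw l (ht l t) \<Longrightarrow> app (app (Om l) t) i < tw l (hs l)"
  and ht_sum: "t \<le> a0 \<Longrightarrow> ht l t + (t + t + t) = hs l"
proof -
  assume t: "t \<le> a0"
  obtain u where u: "u + (t + t + t) = hs l" "inc (app (Om l) t) (tw l u)"
    "\<forall>i<tw l u. app (app (Om l) t) i < tw l (hs l)"
    using Om(3)[OF t, of l] unfolding Inv_def by blast
  note e = ht_eq[OF u(1)]
  show "inc (app (Om l) t) (tw l (ht l t))" "ht l t + (t + t + t) = hs l" using u e by simp_all
  show "app (app (Om l) t) i < tw l (hs l)" if "i < tw l (ht l t)" using u(3) that e by simp
qed

lemma ht_le: "t \<le> a0 \<Longrightarrow> ht l t \<le> hs l"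
  using ht_sum[of t l] le_iff_add by metis

lemma ht_Suc: "t < a0 \<Longrightarrow> ht l t = ht l (t + 1) + 1 + 1 + 1"
proof -
  assume t: "t < a0"
  have "ht l (t + 1) + ((t + 1) + (t + 1) + (t + 1)) = hs l" by (rule ht_sum) (use t in \<open>simp add: less_iff_succ_less_eq\<close>)
  then show ?thesis by (intro ht_eq) (simp only: sum3)
qed

lemma Om_step:
  assumes "t < a0"
  shows "from_seq (app (Om l) (t + 1)) (tw l (ht l (t + 1))) (app (Om l) t) (tw l (ht l t))"
    "ehb (hh (of_nat (l + 3) + t)) (hs (l + 2)) (tw l (ht l (t + 1) + 1)) (app (Om l) (t + 1)) (tw l (ht l (t + 1)))"
proof -
  obtain u where u: "u + ((t + 1) + (t + 1) + (t + 1)) = hs l"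
    "from_seq (app (Om l) (t + 1)) (tw l u) (app (Om l) t) (tw l (u + 1 + 1 + 1))"
    "ehb (hh (of_nat (l + 3) + t)) (hs (l + 2)) (tw l (u + 1)) (app (Om l) (t + 1)) (tw l u)"
    using Om_Thn[OF assms, of l] unfolding Thn_par by blast
  have "ht l (t + 1) = u" by (rule ht_eq[OF u(1)])
  then show "from_seq (app (Om l) (t + 1)) (tw l (ht l (t + 1))) (app (Om l) t) (tw l (ht l t))"
    "ehb (hh (of_nat (l + 3) + t)) (hs (l + 2)) (tw l (ht l (t + 1) + 1)) (app (Om l) (t + 1)) (tw l (ht l (t + 1)))"
    using u(2,3) ht_Suc[OF assms] by simp_all
qed

lemma Om_from: "t + x \<le> a0 \<Longrightarrow> from_seq (app (Om l) (t + x)) (tw l (ht l (t + x))) (app (Om l) t) (tw l (ht l t))"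
proof -
  assume "t + x \<le> a0"
  moreover have "t + x \<le> a0 \<longrightarrow> from_seq (app (Om l) (t + x)) (tw l (ht l (t + x))) (app (Om l) t) (tw l (ht l t))"
  proof (rule induct_DF[where P = "\<lambda>x. t + x \<le> a0 \<longrightarrow> from_seq (app (Om l) (t + x)) (tw l (ht l (t + x))) (app (Om l) t) (tw l (ht l t))"])
    show "DF (\<lambda>e. t + e 0 \<le> a0 \<longrightarrow> from_seq (app (Om l) (t + e 0)) (tw l (ht l (t + e 0))) (app (Om l) t) (tw l (ht l t)))"
      by (intro df fd)
    show "t + 0 \<le> a0 \<longrightarrow> from_seq (app (Om l) (t + 0)) (tw l (ht l (t + 0))) (app (Om l) t) (tw l (ht l t))"
      by (auto simp: from_seq_def)
    fix x assume IH: "t + x \<le> a0 \<longrightarrow> from_seq (app (Om l) (t + x)) (tw l (ht l (t + x))) (app (Om l) t) (tw l (ht l t))"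
    show "t + (x + 1) \<le> a0 \<longrightarrow> from_seq (app (Om l) (t + (x + 1))) (tw l (ht l (t + (x + 1)))) (app (Om l) t) (tw l (ht l t))"
    proof
      assume "t + (x + 1) \<le> a0"
      then have l: "t + x < a0" by (simp add: less_iff_succ_less_eq add.assoc)
      then show "from_seq (app (Om l) (t + (x + 1))) (tw l (ht l (t + (x + 1)))) (app (Om l) t) (tw l (ht l t))"
        using from_seq_trans[OF Om_step(1)[OF l, of l]] IH by (simp add: add.assoc)
    qed
  qed
  ultimately show ?thesis by blast
qed

lemma nst_ht: "nst (ht l (of_nat t))"
proof -
  have "hs l = ht l (of_nat t) + of_nat (t + t + t)" using ht_sum[of "of_nat t" l] of_nat_a0[of t] by simp
  then have "nst (ht l (of_nat t)) \<or> nst (of_nat (t + t + t) :: 'a)" using nst_add nst_hs by metis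
  then show ?thesis unfolding nst_def using less_irrefl by blast
qed

lemma hs_le_tw: "u \<le> hs l \<Longrightarrow> hs l \<le> tw l u"
  using tw_mono[of 0 u l] by (simp add: tw_0)

end

section \<open>Elimination of indiscernibles\<close>

definition apps :: "'b list \<Rightarrow> (nat \<Rightarrow> 'b) \<Rightarrow> nat \<Rightarrow> 'b" where
  "apps ds w j = (if j < length ds then ds ! j else w (j - length ds))"

lemma apps_Nil [simp]: "apps [] w = w" and apps_Cons [simp]: "apps (d # ds) w = d ## apps ds w"
  by (rule ext, simp add: apps_def) (rule ext, auto simp: apps_def scons_def split: nat.splits)

lemma apps_append: "apps (xs @ ys) w = apps xs (apps ys w)"
  by (induction xs) auto

fun encf :: "nat \<Rightarrow> (nat \<Rightarrow> 'a::pa) \<Rightarrow> 'a" where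
  "encf 0 e = 0"
| "encf (Suc k) e = pair (e 0) (encf k (\<lambda>i. e (Suc i)))"

lemma FN_encf: "FN (encf k)"
proof (induction k)
  case (Suc k)
  then show ?case using FN_pair[OF FN_var[of 0] FN_ren[OF Suc.IH, of Suc]] by simp
qed (simp add: FN_0)

lemma dec_encf: "j < k \<Longrightarrow> dec (encf k e) j = e j"
proof (induction k arbitrary: e j)
  case (Suc k)
  then show ?case by (cases j) auto
qed simp

lemma FN_scons: "FN a \<Longrightarrow> (\<And>j. FN (\<lambda>e. r e j)) \<Longrightarrow> FN (\<lambda>e. (a e ## r e) j)"
  by (cases j) auto

lemma FN_funpow_fstp: "FN t \<Longrightarrow> FN (\<lambda>e. (fstp ^^ k) (t e))"
  by (induction k) (auto intro: fn)

context ladder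
begin

text \<open>The sequence left after all \<open>a0\<close> rounds is a subsequence of the result of
  each standard round (\<open>D_pos\<close>), so it inherits homogeneity for truth at every standard
  state of large index.\<close>

definition nD :: "nat \<Rightarrow> 'a" where "nD l = tw l (ht l a0)"
definition D :: "nat \<Rightarrow> 'a \<Rightarrow> 'a" where "D l p = app (app (Om l) a0) p"

lemma D_less: "q < nD l \<Longrightarrow> p < q \<Longrightarrow> D l p < D l q"
  using Om_inc[of a0 l] unfolding D_def nD_def inc_def by simp

lemma D_bnd: "p < nD l \<Longrightarrow> D l p < hs (Suc l)"
  using Om_val[of a0 p l] tw_hs[of l "hs l"] unfolding D_def nD_def by simp

lemma nD: "hs l \<le> nD l"
  unfolding nD_def by (rule hs_le_tw[OF ht_le]) simp

lemma D_pos: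
  assumes "p < nD l"
  shows "\<exists>j<tw l (ht l (of_nat t)). D l p = app (app (Om l) (of_nat t)) j"
proof -
  obtain x where x: "a0 = of_nat t + x" using of_nat_a0[of t] le_iff_add less_imp_le by metis
  have "from_seq (app (Om l) (of_nat t + x)) (tw l (ht l (of_nat t + x))) (app (Om l) (of_nat t)) (tw l (ht l (of_nat t)))"
    by (rule Om_from) (simp add: x)
  then show ?thesis using assms unfolding D_def nD_def from_seq_def x[symmetric] by blast
qed

lemma dfn_ht: "dfn l (ht l (of_nat t))"
proof -
  have D: "DF (\<lambda>e. e 0 + (of_nat t + of_nat t + of_nat t) = hs l)" by (intro df fd)
  have s: "ht l (of_nat t) + (of_nat t + of_nat t + of_nat t) = hs l" by (rule ht_sum[OF less_imp_le[OF of_nat_a0]])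
  have "ht l (of_nat t) < hs l + 1" using ht_le[OF less_imp_le[OF of_nat_a0]] by (simp add: less_S_iff)
  then have "ht l (of_nat t) = lst (\<lambda>u. u < hs l + 1 \<and> u + (of_nat t + of_nat t + of_nat t) = hs l)"
    using lst_bounded[OF D s] unfolding ht_def by simp
  moreover have "FN (\<lambda>e. (\<lambda>h. lst (\<lambda>u. u < h + 1 \<and> u + (of_nat t + of_nat t + of_nat t) = h)) (e 0))" by (intro fn bd)
  ultimately show ?thesis unfolding dfn_def
    by (intro exI[of _ "\<lambda>h. lst (\<lambda>u. u < h + 1 \<and> u + (of_nat t + of_nat t + of_nat t) = h)"]) simp
qed

lemma dfn_last:
  "\<exists>v. tw L (ht L (of_nat (Suc t))) = v + 1 \<and> dfn (L + t + 3) (app (app (Om L) (of_nat (Suc t))) v)"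
proof -
  let ?N = "tw L (ht L (of_nat (Suc t)))"
  have "hs L \<le> ?N" by (rule hs_le_tw[OF ht_le[OF less_imp_le[OF of_nat_a0]]])
  then have "?N \<noteq> 0" using of_nat_less_hs[of 0 L] by auto
  then obtain v where v: "?N = v + 1" using pa_cases by blast
  have "lst (\<lambda>x. x < ?N \<and> x + 1 = ?N) = v" by (rule lst_eq) (unfold v, auto simp: less_S_iff simp del: of_nat_Suc)
  moreover have "FN (\<lambda>e. (\<lambda>N. lst (\<lambda>x. x < N \<and> x + 1 = N)) (e 0) :: 'a)" by (intro fn bd)
  moreover have "dfn (L + t + 3) ?N"
    by (rule dfn_mono[OF dfn_tw[OF dfn_mono[OF dfn_ht]]]) simp_all
  ultimately have a1: "dfn (L + t + 3) v" using dfn_1[of "\<lambda>N. lst (\<lambda>x. x < N \<and> x + 1 = N)" "L + t + 3" ?N] by simp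
  have a2: "dfn (L + t + 3) (app (Om L) (of_nat (Suc t)))"
    by (rule dfn_mono[OF dfn_Om]) simp
  have "FN (\<lambda>e. app (e 0) (e 1) :: 'a)" by (intro fn)
  from dfn_2[where f = app, OF this a2 a1] have "dfn (L + t + 3) (app (app (Om L) (of_nat (Suc t))) v)" .
  then show ?thesis using v by blast
qed

text \<open>By end-homogeneity the largest indiscernible may be replaced by the last member of a longer
  sequence, which is definable from a later state.\<close>

lemma D_last:
  assumes coded: "coded c (\<lambda>y. tv (B (fstp y)))" and p: "p < nD L"
    and ps: "\<And>j. j < k \<Longrightarrow> ps j < p" and y: "y \<in> cut L" and N: "tw L (ht L (of_nat (Suc t))) = v + 1"
  shows "\<exists>pc X. (\<forall>j<k. app X (dec pc j) = D L (ps j)) \<and>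
    (B (pair (hs (L + t + 2)) (pair (pair y pc) (pair X (D L p)))) \<longleftrightarrow>
     B (pair (hs (L + t + 2)) (pair (pair y pc) (pair X (app (app (Om L) (of_nat (Suc t))) v)))))"
proof -
  let ?t = "of_nat (Suc t) :: 'a"
  define \<sigma> where "\<sigma> = app (Om L) ?t"
  let ?u = "ht L ?t" let ?N = "tw L ?u"
  have ta: "?t \<le> a0" "of_nat t < a0" using of_nat_a0 less_imp_le by blast+
  have inc: "inc \<sigma> ?N" unfolding \<sigma>_def by (rule Om_inc[OF ta(1)])
  have u_le: "?u \<le> hs L" by (rule ht_le[OF ta(1)])
  \<comment> \<open>\<open>P\<close> translates positions in the final sequence into positions in
    the longer sequence of round t + 1, to which homogeneity refers.\<close>
  have "\<forall>x. \<exists>j. x < nD L \<longrightarrow> j < ?N \<and> D L x = app \<sigma> j" using D_pos unfolding \<sigma>_def by metis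
  then obtain P where P: "\<And>x. x < nD L \<Longrightarrow> P x < ?N" "\<And>x. x < nD L \<Longrightarrow> D L x = app \<sigma> (P x)" by metis
  have pn: "ps j < nD L" if "j < k" for j using ps[OF that] p by simp
  have PP: "P (ps j) < P p" if j: "j < k" for j
  proof (rule ccontr)
    assume "\<not> P (ps j) < P p"
    then have "app \<sigma> (P p) \<le> app \<sigma> (P (ps j))"
      using inc P(1)[OF pn[OF j]] unfolding inc_def by (cases "P p = P (ps j)") (auto simp: not_less less_imp_le)
    then show False using D_less[OF p ps[OF j]] P(2)[OF pn[OF j]] P(2)[OF p] by simp
  qed
  \<comment> \<open>The smaller indiscernibles are passed by their positions \<open>pc\<close>
    within the coded initial segment \<open>X\<close>: the positions go into the statement q, the
    values are read off from \<open>X\<close>.\<close>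
  define pc where "pc = encf k (\<lambda>j. if j < k then P (ps j) else 0)"
  have dpc: "dec pc j = P (ps j)" if "j < k" for j unfolding pc_def using that by (simp add: dec_encf)
  define X where "X = rs \<sigma> (P p)"
  have X: "app X (dec pc j) = D L (ps j)" if j: "j < k" for j
    unfolding X_def dpc[OF j] rs_app[OF PP[OF j]] using P(2)[OF pn[OF j]] by simp
  have val: "app \<sigma> i < tw L (hs L)" if "i < P p" for i
    unfolding \<sigma>_def by (rule Om_val[OF ta(1)]) (use that P(1)[OF p] in simp)
  note Xc = rs_hs[OF less_imp_le[OF P(1)[OF p]] u_le val]
  define q where "q = pair (of_nat c) (pair y pc)"
  have hsN: "hs L \<le> ?N" by (rule hs_le_tw[OF u_le])
  have "?u < hs L"
  proof -
    have "0 < ?t + ?t + ?t" by (simp del: of_nat_Suc add: add_pos_pos)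
    then have "?u + 0 < ?u + (?t + ?t + ?t)" by (rule add_strict_left_mono)
    then show ?thesis unfolding ht_sum[OF ta(1), of L] add_0_right .
  qed
  \<comment> \<open>The parameter y is below the nonstandard level \<open>?N\<close> because it is
    in the cut, and so are the positions; packing them costs one gap, and homogeneity was arranged
    for statements up to the next level.\<close>
  have qb: "q < tw L (?u + 1)"
  proof -
    let ?e = "y ## (\<lambda>j. if j < k then P (ps j) else 0)"
    have "FN (\<lambda>e. pair (of_nat c) (pair (e 0) (encf k (\<lambda>i. e (Suc i)))))"
      by (intro fn FN_ren[OF FN_encf, of _ Suc])
    from Gap_FN[OF tw_Gap[OF \<open>?u < hs L\<close>] nst_le[OF nst_hs hsN] this, of ?e]
    have "(\<forall>i. ?e i \<le> ?N) \<Longrightarrow> pair (of_nat c) (pair (?e 0) (encf k (\<lambda>i. ?e (Suc i)))) < tw L (?u + 1)" by blast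
    moreover have "?e i \<le> ?N" for i
      using cut_less_tw[OF y nst_ht u_le] P(1)[OF pn] by (cases i) (auto simp: less_imp_le simp del: of_nat_Suc)
    ultimately show ?thesis unfolding q_def pc_def by simp
  qed
  have H: "hh (of_nat (L + 3) + of_nat t) = hs (Suc (L + t + 2))"
  proof -
    have "L + 3 + t = Suc (L + t + 2)" by simp
    then show ?thesis unfolding hs_def of_nat_add[symmetric] by (simp only:)
  qed
  have vN: "v < ?N" "P p \<le> v" using N P(1)[OF p] by (simp_all add: less_S_iff del: of_nat_Suc)
  have "ehb (hs (Suc (L + t + 2))) (hs (L + 2)) (tw L (?u + 1)) \<sigma> ?N"
    using Om_step(2)[OF ta(2), of L] unfolding H \<sigma>_def by (simp add: add.commute)
  then have "Ev (hs (Suc (L + t + 2))) (fstp q) (pair (sndp q) (pair (rsb (hs (L + 2)) \<sigma> (P p)) (app \<sigma> (P p)))) \<longleftrightarrow>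
     Ev (hs (Suc (L + t + 2))) (fstp q) (pair (sndp q) (pair (rsb (hs (L + 2)) \<sigma> (P p)) (app \<sigma> v)))"
    unfolding ehb_def using P(1)[OF p] vN qb less_imp_le order_refl by blast
  moreover have "rsb (hs (L + 2)) \<sigma> (P p) = X" unfolding X_def by (rule rsb_eq[OF Xc(2)])
  ultimately have E: "Ev (hs (Suc (L + t + 2))) (of_nat c) (pair (pair y pc) (pair X (D L p))) \<longleftrightarrow>
     Ev (hs (Suc (L + t + 2))) (of_nat c) (pair (pair y pc) (pair X (app \<sigma> v)))"
    unfolding q_def P(2)[OF p] by (simp only: fstp_pair sndp_pair)
  have sub: "cut L \<subseteq> cut (L + t + 2)" "cut (Suc L) \<subseteq> cut (L + t + 2)" by (rule cut_mono; simp)+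
  have small: "x \<in> cut (L + t + 2)" if "x < hs (Suc L)" for x
    using sub(2) cut_down[OF hs_cut less_imp_le[OF that]] by blast
  have k1: "pc \<in> cut (L + t + 2)" unfolding pc_def
  proof (rule KelD[OF cutI_Kel[OF cutI_cut] FN_encf])
    show "(if j < k then P (ps j) else 0) \<in> cut (L + t + 2)" for j
    proof (cases "j < k")
      case True
      then show ?thesis using small[OF less_trans[OF P(1)[OF pn[OF True]] tw_hs]] by (simp only: if_True)
    next
      case False
      then show ?thesis using cutI_simps(1)[OF cutI_cut] by (simp only: if_False)
    qed
  qed
  have k2: "app \<sigma> v \<in> cut (L + t + 2)"
    unfolding \<sigma>_def using Om_val[OF ta(1) vN(1)] tw_hs less_trans by (intro small) blast
  have k3: "D L p \<in> cut (L + t + 2)" by (rule small[OF D_bnd[OF p]])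
  have k4: "X \<in> cut (L + t + 2)" unfolding X_def by (rule subsetD[OF sub(2) Xc(1)])
  have k5: "y \<in> cut (L + t + 2)" by (rule subsetD[OF sub(1) y])
  note I = cutI_simps(5)[OF cutI_cut]
  note c = I[OF I[OF k5 k1] I[OF k4 k3]] I[OF I[OF k5 k1] I[OF k4 k2]]
  show ?thesis
  proof (rule exI[of _ pc], rule exI[of _ X], intro conjI allI impI)
    show "B (pair (hs (L + t + 2)) (pair (pair y pc) (pair X (D L p)))) \<longleftrightarrow>
      B (pair (hs (L + t + 2)) (pair (pair y pc) (pair X (app (app (Om L) (of_nat (Suc t))) v))))"
      using E Ev_iff[OF coded c(1)] Ev_iff[OF coded c(2)] by (simp only: \<sigma>_def[symmetric])
  qed (rule X)
qed

lemma elim_step: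
  assumes A: "BD A"
  shows "\<exists>i' A'. BD A' \<and> (\<forall>p ps w. p < nD L \<longrightarrow> (\<forall>x\<in>set ps. x < p) \<longrightarrow> length ps = k \<longrightarrow> (\<forall>j. w j \<in> cut L) \<longrightarrow>
    (A (hs i ## D L p ## apps (map (D L) ps) w) \<longleftrightarrow> A' (hs i' ## apps (map (D L) ps) w)))"
proof -
  \<comment> \<open>Round t + 1 gives homogeneity for truth at the state of index L + t + 2. With t
    = i this index is at least i, so \<open>hs i\<close> is an iterated predecessor of that state,
    \<open>r\<close> steps back.\<close>
  define t where "t = i"
  define r where "r = L + t + 2 - i"
  define B where "B v = A ((fstp ^^ r) (fstp v) ## sndp (sndp (sndp v)) ##
    (\<lambda>j. if j < k then app (fstp (sndp (sndp v))) (dec (sndp (fstp (sndp v))) j) else dec (fstp (fstp (sndp v))) (j - k)))" for v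
  have "BD (\<lambda>e. B (e 0))" unfolding B_def
  proof (rule BD_subst[OF A, where t = "\<lambda>j e. ((fstp ^^ r) (fstp (e 0)) ## sndp (sndp (sndp (e 0))) ##
    (\<lambda>j. if j < k then app (fstp (sndp (sndp (e 0)))) (dec (sndp (fstp (sndp (e 0)))) j) else dec (fstp (fstp (sndp (e 0)))) (j - k))) j"])
    fix j
    have "FN (\<lambda>e::nat \<Rightarrow> 'a. if j < k then app (fstp (sndp (sndp (e 0)))) (dec (sndp (fstp (sndp (e 0)))) j) else dec (fstp (fstp (sndp (e 0)))) (j - k))" for j
      by (cases "j < k") (simp_all add: fn FN_dec)
    then show "FN (\<lambda>e::nat \<Rightarrow> 'a. ((fstp ^^ r) (fstp (e 0)) ## sndp (sndp (sndp (e 0))) ##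
    (\<lambda>j. if j < k then app (fstp (sndp (sndp (e 0)))) (dec (sndp (fstp (sndp (e 0)))) j) else dec (fstp (fstp (sndp (e 0)))) (j - k))) j)"
      by (intro FN_scons FN_funpow_fstp fn)
  qed
  then obtain c where c: "coded c (\<lambda>y. tv (B (fstp y)))" using coded_BD1[where 'a = 'a] by blast
  obtain v where v: "tw L (ht L (of_nat (Suc t))) = v + 1" "dfn (L + t + 3) (app (app (Om L) (of_nat (Suc t))) v)"
    using dfn_last by blast
  define \<tau> where "\<tau> = app (app (Om L) (of_nat (Suc t))) v"
  obtain f where f: "FN (\<lambda>e. f (e 0))" "\<tau> = f (hs (L + t + 3))" using v(2) unfolding dfn_def \<tau>_def by blast
  \<comment> \<open>From the state of index L + t + 3 both the stand-in for the largest
    indiscernible and the old state \<open>hs i\<close> are computed, one predecessor further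
    back.\<close>
  define A' where "A' e = A ((fstp ^^ Suc r) (e 0) ## f (e 0) ## (\<lambda>j. e (Suc j)))" for e
  have "BD A'" unfolding A'_def
    by (rule BD_subst[OF A, where t = "\<lambda>j e. ((fstp ^^ Suc r) (e 0) ## f (e 0) ## (\<lambda>j. e (Suc j))) j"])
      (intro FN_scons FN_funpow_fstp f(1) fn)
  moreover have "A (hs i ## D L p ## apps (map (D L) ps) w) \<longleftrightarrow> A' (hs (L + t + 3) ## apps (map (D L) ps) w)"
    if p: "p < nD L" and ps: "\<forall>x\<in>set ps. x < p" and k: "length ps = k" and w: "\<forall>j. w j \<in> cut L" for p ps w
  proof -
    obtain M where M: "\<And>e e'. (\<forall>i<M. e i = e' i) \<Longrightarrow> A e = A e'" using BD_supp[OF A] by blast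
    have y: "encf M w \<in> cut L" by (rule KelD[OF cutI_Kel[OF cutI_cut] FN_encf]) (use w in blast)
    have ps': "ps ! j < p" if "j < k" for j using ps that k by auto
    obtain pc X where X: "\<And>j. j < k \<Longrightarrow> app X (dec pc j) = D L (ps ! j)"
      and iff: "B (pair (hs (L + t + 2)) (pair (pair (encf M w) pc) (pair X (D L p)))) \<longleftrightarrow>
       B (pair (hs (L + t + 2)) (pair (pair (encf M w) pc) (pair X \<tau>)))"
      using D_last[where ps = "\<lambda>j. ps ! j", OF c p ps' y v(1)] unfolding \<tau>_def by blast
    have r: "(fstp ^^ r) (hs (L + t + 2)) = hs i" 
    proof -
      have "i + r = L + t + 2" unfolding r_def t_def by simp
      then show ?thesis using hs_funpow[of r i] by simp
    qed
    have B: "B (pair (hs (L + t + 2)) (pair (pair (encf M w) pc) (pair X x))) = A (hs i ## x ## apps (map (D L) ps) w)" for x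
      unfolding B_def
    proof (rule M, intro allI impI)
      fix j assume j: "j < M"
      show "((fstp ^^ r) (fstp (pair (hs (L + t + 2)) (pair (pair (encf M w) pc) (pair X x)))) ##
         sndp (sndp (sndp (pair (hs (L + t + 2)) (pair (pair (encf M w) pc) (pair X x))))) ##
         (\<lambda>j. if j < k then app (fstp (sndp (sndp (pair (hs (L + t + 2)) (pair (pair (encf M w) pc) (pair X x))))))
              (dec (sndp (fstp (sndp (pair (hs (L + t + 2)) (pair (pair (encf M w) pc) (pair X x)))))) j)
            else dec (fstp (fstp (sndp (pair (hs (L + t + 2)) (pair (pair (encf M w) pc) (pair X x)))))) (j - k))) j =
         (hs i ## x ## apps (map (D L) ps) w) j"
        using j r X by (auto simp: scons_def apps_def k dec_encf split: nat.splits)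
    qed
    have "(fstp ^^ Suc r) (hs (L + t + 3)) = hs i"
      using r fstp_hs[of "L + t + 2"] by (simp add: funpow_Suc_right eval_nat_numeral del: funpow.simps(2))
    then show ?thesis using iff f(2) unfolding B A'_def by simp
  qed
  ultimately show ?thesis by blast
qed

text \<open>The order of elimination: indiscernibles are listed from the largest downwards, higher
  levels first and larger positions first within a level.\<close>

definition before :: "nat \<times> 'a \<Rightarrow> nat \<times> 'a \<Rightarrow> bool" where
  "before g g' \<longleftrightarrow> fst g' < fst g \<or> fst g' = fst g \<and> snd g' < snd g"

definition okl :: "nat \<Rightarrow> (nat \<times> 'a) list \<Rightarrow> bool" where
  "okl l gs \<longleftrightarrow> sorted_wrt before gs \<and> (\<forall>g\<in>set gs. l \<le> fst g \<and> snd g < nD (fst g))"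

lemma okl_split:
  "okl l gs \<Longrightarrow> \<forall>g\<in>set gs. fst g \<le> L \<Longrightarrow>
   \<exists>xs ys. gs = xs @ ys \<and> (\<forall>g\<in>set xs. fst g = L) \<and> (\<forall>g\<in>set ys. fst g < L) \<and> okl l ys"
proof (induction gs)
  case Nil
  then show ?case by (simp add: okl_def)
next
  case (Cons g gs)
  show ?case
  proof (cases "fst g = L")
    case True
    have "okl l gs" using Cons.prems(1) by (auto simp: okl_def)
    then obtain xs ys where x: "gs = xs @ ys" "\<forall>g\<in>set xs. fst g = L" "\<forall>g\<in>set ys. fst g < L" "okl l ys"
      using Cons.IH Cons.prems(2) by auto
    show ?thesis by (rule exI[of _ "g # xs"], rule exI[of _ ys]) (use x True in auto)
  next
    case False
    then have "\<forall>g'\<in>set (g # gs). fst g' < L"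
      using Cons.prems by (fastforce simp: okl_def before_def)
    then show ?thesis using Cons.prems(1) by (intro exI[of _ "[]"] exI[of _ "g # gs"]) simp
  qed
qed

definition Dv :: "nat \<times> 'a \<Rightarrow> 'a" where "Dv g = D (fst g) (snd g)"

text \<open>The resulting predicate and state depend on the list of levels alone and not on the
  positions. This uniformity is indiscernibility, and the form of the result shows at the same time
  that the indiscernibles can be dispensed with over parameters from the cut.\<close>

lemma elim:
  assumes A: "BD A"
  shows "\<exists>i' A'. BD A' \<and> (\<forall>gs w. map fst gs = ls \<longrightarrow> okl l gs \<longrightarrow> (\<forall>j. w j \<in> cut l) \<longrightarrow>
    (A (hs i ## apps (map Dv gs) w) \<longleftrightarrow> A' (hs i' ## w)))"
  using A
proof (induction ls arbitrary: A i)
  case Nil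
  then show ?case by auto
next
  case (Cons L ls)
  define k where "k = length (filter (\<lambda>x. x = L) ls)"
  obtain i1 A1 where A1: "BD A1" "\<And>p ps w. p < nD L \<Longrightarrow> \<forall>x\<in>set ps. x < p \<Longrightarrow> length ps = k \<Longrightarrow> \<forall>j. w j \<in> cut L \<Longrightarrow>
    A (hs i ## D L p ## apps (map (D L) ps) w) \<longleftrightarrow> A1 (hs i1 ## apps (map (D L) ps) w)"
    using elim_step[OF Cons.prems, of L k i] by blast
  obtain i' A' where A': "BD A'" "\<And>gs w. map fst gs = ls \<Longrightarrow> okl l gs \<Longrightarrow> \<forall>j. w j \<in> cut l \<Longrightarrow>
    A1 (hs i1 ## apps (map Dv gs) w) \<longleftrightarrow> A' (hs i' ## w)" using Cons.IH[OF A1(1), of i1] by blast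
  have "A (hs i ## apps (map Dv gs) w) \<longleftrightarrow> A' (hs i' ## w)"
    if gs: "map fst gs = L # ls" and ok: "okl l gs" and w: "\<forall>j. w j \<in> cut l" for gs w
  proof -
    obtain p gs' where g: "gs = (L, p) # gs'" "map fst gs' = ls" using gs by (cases gs) auto
    have p: "p < nD L" "l \<le> L" and ok': "okl l gs'" and bef: "\<forall>g\<in>set gs'. before (L, p) g"
      using ok unfolding g(1) okl_def by auto
    have "\<forall>g\<in>set gs'. fst g \<le> L" using bef unfolding before_def by auto
    from okl_split[OF ok' this] obtain xs ys where xy: "gs' = xs @ ys" "\<forall>g\<in>set xs. fst g = L" "\<forall>g\<in>set ys. fst g < L" "okl l ys"
      by blast
    define ps where "ps = map snd xs"
    have mD: "map Dv xs = map (D L) ps" using xy(2) unfolding ps_def by (auto simp: Dv_def)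
    have ps: "\<forall>x\<in>set ps. x < p" using bef xy(1,2) unfolding ps_def before_def by auto
    have fx: "filter (\<lambda>x. x = L) (map fst xs) = map fst xs" using xy(2) by (auto simp: filter_id_conv)
    have fy: "filter (\<lambda>x. x = L) (map fst ys) = []" using xy(3) by (auto simp: filter_empty_conv)
    have len: "length ps = k" unfolding k_def g(2)[symmetric] xy(1) map_append filter_append fx fy ps_def by simp
    have lc: "cut l \<subseteq> cut L" by (rule cut_mono[OF p(2)])
    \<comment> \<open>Indiscernibles of lower levels lie below \<open>hs L\<close> and count as
      parameters from the cut while level L is treated.\<close>
    have small: "Dv g \<in> cut L" if g: "g \<in> set ys" for g
    proof -
      have "Dv g < hs (Suc (fst g))" unfolding Dv_def by (rule D_bnd) (use g xy(4) in \<open>auto simp: okl_def\<close>)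
      also have "\<dots> \<le> hs L" by (rule hs_mono) (use g xy(3) in auto)
      finally show ?thesis using cut_down[OF hs_cut] less_imp_le by blast
    qed
    have W: "\<forall>j. apps (map Dv ys) w j \<in> cut L"
      using w lc small by (auto simp: apps_def)
    have "A (hs i ## apps (map Dv gs) w) = A (hs i ## D L p ## apps (map (D L) ps) (apps (map Dv ys) w))"
      unfolding g(1) xy(1) by (simp add: apps_append mD Dv_def[of "(L, p)"])
    also have "\<dots> = A1 (hs i1 ## apps (map (D L) ps) (apps (map Dv ys) w))" by (rule A1(2)[OF p(1) ps len W])
    also have "\<dots> = A1 (hs i1 ## apps (map Dv gs') w)" unfolding xy(1) by (simp add: apps_append mD)
    also have "\<dots> = A' (hs i' ## w)" by (rule A'(2)[OF g(2) ok' w])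
    finally show ?thesis .
  qed
  then show ?case using A'(1) by blast
qed

end

section \<open>The submodel\<close>

lemma sorted_list_ex:
  assumes "finite S" "\<And>x y. x \<noteq> y \<Longrightarrow> R x y \<or> R y x" "\<And>x y z. R x y \<Longrightarrow> R y z \<Longrightarrow> R x z"
  shows "\<exists>xs. set xs = S \<and> sorted_wrt R xs"
  using assms(1)
proof induction
  case (insert x S)
  then obtain xs where xs: "set xs = S" "sorted_wrt R xs" by blast
  let ?ys = "filter (\<lambda>y. R y x) xs @ x # filter (\<lambda>y. \<not> R y x) xs"
  have "R x y" if "y \<in> S" "\<not> R y x" for y using assms(2)[of x y] that insert.hyps(2) by auto
  then have "sorted_wrt R ?ys"
    using xs assms(3) by (auto simp: sorted_wrt_append sorted_wrt_filter)
  moreover have "set ?ys = insert x S" using xs(1) by auto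
  ultimately show ?case by blast
qed simp

lemma sat_pinst2: "sat D (v ## u ## E) (pinst 2 p (Var 0) (Var 1)) = sat D (v ## u ## E) p"
  unfolding pinst_def sat_fsubst by (rule arg_cong[of _ _ "\<lambda>e. sat D e p"], rule ext) (auto simp: scons_def split: nat.splits)

lemma sat_pinst3: "sat D (x ## v ## u ## E) (pinst 3 p (Var 1) (Var 2)) = sat D (v ## u ## E) p"
  "sat D (x ## v ## u ## E) (pinst 3 p (Var 0) (Var 2)) = sat D (x ## u ## E) p"
  "sat D (x ## v ## u ## E) (pinst 3 p (Var 0) (Var 1)) = sat D (x ## v ## E) p"
proof -
  have "(\<lambda>i. tval (x ## v ## u ## E) (if i = 0 then Var 1 else if i = 1 then Var 2 else Var (i + 3 - 2))) = v ## u ## E"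
    "(\<lambda>i. tval (x ## v ## u ## E) (if i = 0 then Var 0 else if i = 1 then Var 2 else Var (i + 3 - 2))) = x ## u ## E"
    "(\<lambda>i. tval (x ## v ## u ## E) (if i = 0 then Var 0 else if i = 1 then Var 1 else Var (i + 3 - 2))) = x ## v ## E"
    by (rule ext, auto simp: scons_def numeral_2_eq_2 numeral_3_eq_3 split: nat.splits)+
  then show "sat D (x ## v ## u ## E) (pinst 3 p (Var 1) (Var 2)) = sat D (v ## u ## E) p"
    "sat D (x ## v ## u ## E) (pinst 3 p (Var 0) (Var 2)) = sat D (x ## u ## E) p"
    "sat D (x ## v ## u ## E) (pinst 3 p (Var 0) (Var 1)) = sat D (x ## v ## E) p"
    unfolding pinst_def sat_fsubst by simp_all
qed

lemma sat_graph_inj: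
  "sat D E (graph_inj p b a) \<longleftrightarrow>
     (\<forall>u\<in>D. \<forall>v\<in>D. sat D (v ## u ## E) p \<longrightarrow> u < E b \<and> v < E a) \<and>
     (\<forall>u\<in>D. u < E b \<longrightarrow> (\<exists>v\<in>D. sat D (v ## u ## E) p)) \<and>
     (\<forall>u\<in>D. \<forall>v\<in>D. \<forall>v'\<in>D. sat D (v ## u ## E) p \<and> sat D (v' ## u ## E) p \<longrightarrow> v = v') \<and>
     (\<forall>u\<in>D. \<forall>u'\<in>D. \<forall>v\<in>D. sat D (v ## u ## E) p \<and> sat D (v ## u' ## E) p \<longrightarrow> u = u')"
  unfolding graph_inj_def by (simp add: sat_pinst2 sat_pinst3 sat_pinst2[unfolded One_nat_def] numeral_2_eq_2[symmetric] sat_pinst3[unfolded One_nat_def])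
    (simp add: numeral_2_eq_2)

lemma sat_Alls: "sat D E (Alls m p) \<longleftrightarrow> (\<forall>zs. length zs = m \<longrightarrow> set zs \<subseteq> D \<longrightarrow> sat D (apps zs E) p)"
proof (induction m arbitrary: E)
  case (Suc m)
  have "sat D E (Alls (Suc m) p) \<longleftrightarrow> (\<forall>z\<in>D. \<forall>zs. length zs = m \<longrightarrow> set zs \<subseteq> D \<longrightarrow> sat D (apps (zs @ [z]) E) p)"
    using Suc.IH by (simp add: Alls_def apps_append)
  also have "\<dots> \<longleftrightarrow> (\<forall>zs. length zs = Suc m \<longrightarrow> set zs \<subseteq> D \<longrightarrow> sat D (apps zs E) p)"
  proof
    assume a: "\<forall>z\<in>D. \<forall>zs. length zs = m \<longrightarrow> set zs \<subseteq> D \<longrightarrow> sat D (apps (zs @ [z]) E) p"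
    show "\<forall>zs. length zs = Suc m \<longrightarrow> set zs \<subseteq> D \<longrightarrow> sat D (apps zs E) p"
    proof (intro allI impI)
      fix zs assume "length zs = Suc m" "set zs \<subseteq> D"
      moreover from this(1) obtain ys y where "zs = ys @ [y]" by (metis append_butlast_last_id length_0_conv nat.simps(3))
      ultimately show "sat D (apps zs E) p" using a by simp
    qed
  qed simp
  finally show ?case .
qed (simp add: Alls_def)

type_synonym 'b gen = "nat + nat \<times> 'b"

context ladder
begin

primrec gv :: "'a gen \<Rightarrow> 'a" where
  "gv (Inl i) = hs i"
| "gv (Inr g) = Dv g"

primrec okg :: "'a gen \<Rightarrow> bool" where
  "okg (Inl i) = True"
| "okg (Inr g) = (snd g < nD (fst g))"

primrec act :: "(nat \<Rightarrow> 'a \<Rightarrow> 'a) \<Rightarrow> 'a gen \<Rightarrow> 'a gen" where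
  "act \<gamma> (Inl i) = Inl i"
| "act \<gamma> (Inr g) = Inr (fst g, \<gamma> (fst g) (snd g))"

text \<open>Strictly increasing maps of positions, level by level. Levels below \<open>l\<close> are
  fixed because their indiscernibles may occur among the parameters below the cut at
  \<open>l\<close>.\<close>

definition emb :: "nat \<Rightarrow> (nat \<Rightarrow> 'a \<Rightarrow> 'a) \<Rightarrow> bool" where
  "emb l \<gamma> \<longleftrightarrow> (\<forall>L. \<forall>p<nD L. \<gamma> L p < nD L \<and> (\<forall>q<p. \<gamma> L q < \<gamma> L p) \<and> (L < l \<longrightarrow> \<gamma> L p = p))"

lemma emb_id: "emb l (\<lambda>L p. p)"
  by (simp add: emb_def)

lemma okg_act: "emb l \<gamma> \<Longrightarrow> okg g \<Longrightarrow> okg (act \<gamma> g)"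
  by (cases g) (auto simp: emb_def)

lemma hs_cut_le: "i \<le> l \<Longrightarrow> x \<le> hs i \<Longrightarrow> x \<in> cut l"
  using cut_down[OF hs_cut[of l]] hs_mono order_trans by blast

lemma Dv_cut: "snd g < nD (fst g) \<Longrightarrow> fst g < l \<Longrightarrow> Dv g \<in> cut l"
  unfolding Dv_def by (rule hs_cut_le[of "Suc (fst g)"]) (simp_all add: D_bnd less_imp_le)

lemma cut_0: "0 \<in> cut l"
  by (rule cutI_simps(1)[OF cutI_cut])

text \<open>A bounded predicate sees only finitely many generators. Those indiscernibles of level at
  least \<open>l\<close> are sorted and eliminated, the lower ones become parameters
  \<open>W\<close>, and states become iterated predecessors of one state. At \<open>l = 0\<close>
  nothing is lower, so no parameter survives.\<close>

lemma elim_gen: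
  assumes A: "BD A" and g: "\<And>j. okg (g j)"
  shows "\<exists>i A' W. BD A' \<and> (\<forall>j. W j \<in> cut l) \<and> (l = 0 \<longrightarrow> W = (\<lambda>_. 0)) \<and>
    (\<forall>\<gamma>. emb l \<gamma> \<longrightarrow> (\<forall>w\<in>cut l. A (w ## (\<lambda>j. gv (act \<gamma> (g j)))) \<longleftrightarrow> A' (hs i ## w ## W)))"
proof -
  obtain N where N: "\<And>e e'. (\<forall>i<N. e i = e' i) \<Longrightarrow> A e = A e'" using BD_supp[OF A] by blast
  define S where "S = {h. \<exists>j<N. g j = Inr h \<and> l \<le> fst h}"
  have "S \<subseteq> (\<lambda>j. projr (g j)) ` {..<N}" unfolding S_def by (force simp: image_iff)
  then have "finite S" by (rule finite_subset) simp
  moreover have "before x y \<or> before y x" if "x \<noteq> y" for x y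
    using that unfolding before_def by (auto simp: prod_eq_iff)
  moreover have "before x z" if "before x y" "before y z" for x y z using that unfolding before_def by auto
  ultimately obtain gs where gs: "set gs = S" "sorted_wrt before gs" using sorted_list_ex[of S before] by blast
  have ok: "okl l gs" unfolding okl_def
  proof (intro conjI ballI gs(2))
    fix h assume "h \<in> set gs"
    then obtain j where "g j = Inr h" "l \<le> fst h" unfolding gs(1) S_def by blast
    then show "l \<le> fst h" "snd h < nD (fst h)" using g[of j] by simp_all
  qed
  define m where "m = length gs"
  \<comment> \<open>The largest state index that occurs; all other states in use are iterated
    predecessors of \<open>hs i\<close>.\<close>
  define i where "i = Max (insert 0 ((\<lambda>j. case g j of Inl i \<Rightarrow> i | _ \<Rightarrow> 0) ` {..<N}))"
  have i: "i' \<le> i" if "j < N" "g j = Inl i'" for i' j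
  proof -
    have "i' \<in> (\<lambda>j. case g j of Inl i \<Rightarrow> i | _ \<Rightarrow> 0) ` {..<N}" using that by (force simp: image_iff)
    then show ?thesis unfolding i_def by (intro Max_ge) auto
  qed
  define W where "W j = (case g j of Inr h \<Rightarrow> if fst h < l then Dv h else 0 | _ \<Rightarrow> 0)" for j
  define ix where "ix h = (SOME k. k < m \<and> gs ! k = h)" for h
  have ix: "ix h < m \<and> gs ! ix h = h" if "h \<in> S" for h
  proof -
    have "\<exists>k. k < m \<and> gs ! k = h" using that unfolding gs(1)[symmetric] m_def in_set_conv_nth .
    from someI_ex[OF this] show ?thesis unfolding ix_def .
  qed
  define T where "T j e = (case j of 0 \<Rightarrow> e (Suc m) | Suc j \<Rightarrow> (case g j of Inl i' \<Rightarrow> (fstp ^^ (i - i')) (e 0)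
     | Inr h \<Rightarrow> if l \<le> fst h then e (Suc (ix h)) else e (Suc (Suc (m + j)))))" for j and e :: "nat \<Rightarrow> 'a"
  have FT: "FN (T j)" for j
  proof (cases j)
    case (Suc j')
    have "FN (\<lambda>e::nat \<Rightarrow> 'a. if b then e x else e y)" for b x y by (cases b) (simp_all add: FN_var)
    then show ?thesis using Suc by (cases "g j'") (auto simp: T_def[abs_def] intro: FN_funpow_fstp fn)
  qed (simp add: T_def[abs_def] FN_var)
  define A1 where "A1 e = A (\<lambda>j. T j e)" for e
  have "BD A1" unfolding A1_def by (rule BD_subst[OF A FT])
  from elim[OF this, of "map fst gs" l i] obtain i' A' where A': "BD A'"
    "\<And>gs' w. map fst gs' = map fst gs \<Longrightarrow> okl l gs' \<Longrightarrow> \<forall>j. w j \<in> cut l \<Longrightarrow>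
      A1 (hs i ## apps (map Dv gs') w) \<longleftrightarrow> A' (hs i' ## w)" by blast
  have W: "W j \<in> cut l" for j
    using g[of j] Dv_cut cut_0 unfolding W_def by (auto split: sum.splits)
  have "A (w ## (\<lambda>j. gv (act \<gamma> (g j)))) \<longleftrightarrow> A' (hs i' ## w ## W)" if \<gamma>: "emb l \<gamma>" and w: "w \<in> cut l" for \<gamma> w
  proof -
    define gs' where "gs' = map (\<lambda>h. (fst h, \<gamma> (fst h) (snd h))) gs"
    have 1: "map fst gs' = map fst gs" unfolding gs'_def by simp
    have bef: "before (fst x, \<gamma> (fst x) (snd x)) (fst y, \<gamma> (fst y) (snd y))"
      if "before x y" "x \<in> set gs" for x y
      using that \<gamma> ok unfolding before_def emb_def okl_def by auto
    have "sorted_wrt before gs'" unfolding gs'_def sorted_wrt_map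
      by (rule sorted_wrt_mono_rel[OF bef gs(2)])
    then have 2: "okl l gs'" using ok \<gamma> unfolding okl_def gs'_def emb_def by auto
    have 3: "\<forall>j. (w ## W) j \<in> cut l" using w W by (auto simp: scons_def split: nat.splits)
    have "A1 (hs i ## apps (map Dv gs') (w ## W)) \<longleftrightarrow> A (w ## (\<lambda>j. gv (act \<gamma> (g j))))"
      unfolding A1_def
    proof (rule N, intro allI impI)
      fix j assume j: "j < N"
      have len: "length gs' = m" unfolding gs'_def m_def by simp
      show "T j (hs i ## apps (map Dv gs') (w ## W)) = (w ## (\<lambda>j. gv (act \<gamma> (g j)))) j"
      proof (cases j)
        case 0
        then show ?thesis by (simp add: T_def apps_def len)
      next
        case (Suc j')
        then have j': "j' < N" using j by simp
        show ?thesis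
        proof (cases "g j'")
          case (Inl i')
          then show ?thesis using hs_funpow[of "i - i'" i'] i[OF j' Inl] Suc by (simp add: T_def)
        next
          case (Inr h)
          show ?thesis
          proof (cases "l \<le> fst h")
            case True
            then have "h \<in> S" using Inr j' unfolding S_def by blast
            then show ?thesis using ix[of h] Suc Inr True by (simp add: T_def apps_def len) (simp add: gs'_def m_def)
          next
            case False
            have "okg (g j')" by (rule g)
            then show ?thesis using Suc Inr False \<gamma> by (simp add: T_def apps_def len W_def emb_def)
          qed
        qed
      qed
    qed
    then show ?thesis using A'(2)[OF 1 2 3] by blast
  qed
  moreover have "W = (\<lambda>_. 0)" if "l = 0" unfolding W_def[abs_def] using that by (auto split: sum.splits intro!: ext)
  ultimately show ?thesis
    by (intro exI[of _ i'] exI[of _ A'] exI[of _ W] conjI allI impI ballI A'(1) W)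
qed

lemma indis:
  assumes "BD A" "\<And>j. okg (g j)" "emb l \<gamma>" "w \<in> cut l"
  shows "A (w ## (\<lambda>j. gv (act \<gamma> (g j)))) \<longleftrightarrow> A (w ## (\<lambda>j. gv (g j)))"
proof -
  have "act (\<lambda>L p. p) h = h" for h by (cases h) auto
  moreover obtain i A' W where "\<And>\<gamma> w. emb l \<gamma> \<Longrightarrow> w \<in> cut l \<Longrightarrow> A (w ## (\<lambda>j. gv (act \<gamma> (g j)))) \<longleftrightarrow> A' (hs i ## w ## W)"
    using elim_gen[where A = A and g = g and l = l, OF assms(1,2)] by blast
  note this[OF assms(3,4)] this[OF emb_id assms(4)]
  ultimately show ?thesis by simp
qed

lemma indis0:
  assumes "BD A" "\<And>j. okg (g j)" "emb l \<gamma>"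
  shows "A (\<lambda>j. gv (act \<gamma> (g j))) \<longleftrightarrow> A (\<lambda>j. gv (g j))"
  using indis[OF BD_ren[OF assms(1), of Suc] assms(2,3) cut_0] by simp

definition K :: "'a set" where
  "K = {t (\<lambda>j. gv (g j)) | t g. FN t \<and> (\<forall>j. okg (g j))}"

text \<open>Countably many elements of the submodel, each with its own sequence of generators, are
  rewritten over one common sequence by splitting indices into pairs. This turns an environment over
  \<open>K\<close> into functions of one sequence of generators, on which \<open>act\<close>
  operates at once.\<close>

lemma merge:
  fixes T :: "nat \<Rightarrow> (nat \<Rightarrow> 'a) \<Rightarrow> 'a" and g :: "nat \<Rightarrow> nat \<Rightarrow> 'a gen"
  assumes T: "\<And>j. FN (T j)" and g: "\<And>i j. okg (g i j)"
  shows "\<exists>T' g'. (\<forall>j. FN (T' j)) \<and> (\<forall>j. okg (g' j)) \<and>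
    (\<forall>\<gamma> j. T' j (\<lambda>i. gv (act \<gamma> (g' i))) = T j (\<lambda>i. gv (act \<gamma> (g j i)))) \<and>
    (\<forall>j. T' j (\<lambda>i. gv (g' i)) = T j (\<lambda>i. gv (g j i)))"
proof -
  define g' where "g' k = g (fst (prod_decode k)) (snd (prod_decode k))" for k
  define T' where "T' j e = T j (\<lambda>i. e (prod_encode (j, i)))" for j e
  have "FN (T' j)" for j unfolding T'_def[abs_def] by (rule FN_ren[OF T])
  then show ?thesis using g by (intro exI[of _ T'] exI[of _ g']) (simp add: T'_def g'_def)
qed

lemma K_merge:
  fixes e :: "nat \<Rightarrow> 'a"
  assumes "\<And>j. e j \<in> K"
  shows "\<exists>T g. (\<forall>j. FN (T j)) \<and> (\<forall>j. okg (g j)) \<and> e = (\<lambda>j. T j (\<lambda>i. gv (g i)))"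
proof -
  have "\<forall>j. \<exists>t g. FN t \<and> (\<forall>i. okg (g i)) \<and> e j = t (\<lambda>i. gv (g i))" using assms unfolding K_def by blast
  then obtain T g where T: "\<And>j. FN (T j)" "\<And>j i. okg (g j i)" "\<And>j. e j = T j (\<lambda>i. gv (g j i))" by metis
  from merge[of T g, OF T(1,2)] T(3) show ?thesis by (metis (no_types, lifting) ext)
qed

lemma K_I: "FN t \<Longrightarrow> (\<And>j. okg (g j)) \<Longrightarrow> t (\<lambda>j. gv (g j)) \<in> K"
  unfolding K_def by blast

lemma Kel_K: "Kel K"
  unfolding Kel_def
proof (intro conjI allI impI)
  fix t :: "(nat \<Rightarrow> 'a) \<Rightarrow> 'a" and e :: "nat \<Rightarrow> 'a" assume t: "FN t" and "\<forall>i. e i \<in> K"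
  then obtain T g where T: "\<forall>j. FN (T j)" "\<forall>j. okg (g j)" "e = (\<lambda>j. T j (\<lambda>i. gv (g i)))" using K_merge[of e] by blast
  have "FN (\<lambda>e. t (\<lambda>j. T j e))" using FN_comp[OF t] T(1) by blast
  from K_I[OF this] T(2,3) show "t e \<in> K" by blast
next
  have "FN (\<lambda>e::nat \<Rightarrow> 'a. 0)" by (rule FN_0)
  from K_I[OF this, of "\<lambda>_. Inl 0"] show "K \<noteq> {}" by auto
qed

lemma gv_K: "okg h \<Longrightarrow> gv h \<in> K"
  using K_I[OF FN_var[of 0], of "\<lambda>_. h"] by simp

lemma hs_K: "hs i \<in> K"
  using gv_K[of "Inl i"] by simp

lemma dfn_K: "dfn i x \<Longrightarrow> x \<in> K"
  unfolding dfn_def using KelD[OF Kel_K, of "\<lambda>e. _ (e 0)" "\<lambda>_. hs i"] hs_K by blast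

lemma K_cofinal:
  assumes "u \<in> K" shows "\<exists>i. u < hs i"
proof -
  obtain t g where t: "FN t" "\<And>j. okg (g j)" "u = t (\<lambda>j. gv (g j))" using assms unfolding K_def by blast
  obtain N where N: "\<And>e e'. (\<forall>i<N. e i = e' i) \<Longrightarrow> t e = t e'" using FN_supp[OF t(1)] by blast
  define lv where "lv h = (case h of Inl i \<Rightarrow> i | Inr h \<Rightarrow> Suc (fst h))" for h :: "'a gen"
  define i where "i = Max (insert 0 ((\<lambda>j. lv (g j)) ` {..<N}))"
  have "gv (g j) \<in> cut i" if "j < N" for j
  proof (rule hs_cut_le)
    show "lv (g j) \<le> i" unfolding i_def by (rule Max_ge) (use that in auto)
    show "gv (g j) \<le> hs (lv (g j))" using t(2)[of j] D_bnd less_imp_le unfolding lv_def by (cases "g j") (auto simp: Dv_def)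
  qed
  then have "t (\<lambda>j. if j < N then gv (g j) else 0) \<in> cut i"
    by (intro KelD[OF cutI_Kel[OF cutI_cut] t(1)]) (simp add: cut_0)
  moreover have "t (\<lambda>j. if j < N then gv (g j) else 0) = u" unfolding t(3) by (rule N) simp
  ultimately have "u < bnd (hs (Suc i))" using cut_less by blast
  then show ?thesis using bnd_le less_le_trans by blast
qed

text \<open>For y < hs i the bound of the next state was chosen so that a value z and the number
  recording its correctness lie below it. Correctness is read off from the truth code of that state,
  so z is found by a bounded search over elements of \<open>K\<close>.\<close>

theorem Kcl_K: "Kcl n {r. mem r \<epsilon>} K"
  unfolding Kcl_def
proof (intro conjI ballI Kel_K)
  fix r y assume r: "r \<in> {r. mem r \<epsilon>}" and y: "y \<in> K"
  then obtain i where i: "y < hs i" using K_cofinal by blast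
  have rK: "r \<in> K" using eps_def[of r] r dfn_K[of 0 r] unfolding dfn_def hs_0 by blast
  obtain z where z: "z < bnd (hs (Suc i))" "pair r (pair z y) < bnd (hs (Suc i))" "Th n (pair r (pair z y))"
  proof -
    have "r < \<epsilon>" "mem r \<epsilon>" "y \<le> hs i" using r i mem_less[of r \<epsilon>] by simp_all
    then show ?thesis using hs_BT[of i] that unfolding BT_def by blast
  qed
  define z' where "z' = (\<lambda>r y h. lst (\<lambda>z. z < h \<and> mem (pair r (pair z y)) (tru h))) r y (hs (Suc i))"
  have "FN (\<lambda>e::nat \<Rightarrow> 'a. (\<lambda>r y h. lst (\<lambda>z. z < h \<and> mem (pair r (pair z y)) (tru h))) (e 0) (e 1) (e 2))" by (intro fn bd)
  from KelD[OF Kel_K this, of "args [r, y, hs (Suc i)]"] have "z' \<in> K"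
    unfolding z'_def using args_all[of "[r, y, hs (Suc i)]" "\<lambda>x. x \<in> K"] rK y hs_K by simp
  moreover have "DF (\<lambda>e. e 0 < hs (Suc i) \<and> mem (pair r (pair (e 0) y)) (tru (hs (Suc i))))" by (intro df fd)
  note lst_works(1)[OF this, of z]
  then have "mem (pair r (pair z' y)) (tru (hs (Suc i)))"
    using z bnd_le[of "hs (Suc i)"] unfolding z'_def hs_tru by auto
  ultimately show "\<exists>z\<in>K. Th n (pair r (pair z y))" unfolding hs_tru by blast
qed

text \<open>Elimination at level 0 is applied to the graph w = t (generators). Numbers below
  \<open>h0\<close> belong to \<open>cut 0\<close>, and there the graph becomes a bounded condition
  on w and a single state, which only u satisfies.\<close>

theorem K_initial:
  assumes u: "u \<in> K" "u < h0"
  shows "\<exists>i B. BD (\<lambda>e. B (e 0)) \<and> B (pair (hs i) u) \<and> (\<forall>u'<u. \<not> B (pair (hs i) u')) \<and> u \<in> cut i \<and>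
    (\<forall>u'\<in>K. u' < h0 \<longrightarrow> B (pair (hs i) u') \<longrightarrow> u' = u)"
proof -
  obtain t g where t: "FN t" "\<And>j. okg (g j)" "u = t (\<lambda>j. gv (g j))" using u(1) unfolding K_def by blast
  have "BD (\<lambda>e. e 0 = t (\<lambda>i. e (Suc i)))" using t(1) by (simp add: FN_def)
  from elim_gen[where l = 0, OF this t(2)] obtain i A' where A': "BD A'"
    "\<And>\<gamma> w. emb 0 \<gamma> \<Longrightarrow> w \<in> cut 0 \<Longrightarrow> w = t (\<lambda>j. gv (act \<gamma> (g j))) \<longleftrightarrow> A' (hs i ## w ## (\<lambda>_. 0))" by fastforce
  have "act (\<lambda>L p. p) h = h" for h by (cases h) auto
  then have A'': "w = u \<longleftrightarrow> A' (hs i ## w ## (\<lambda>_. 0))" if "w \<in> cut 0" for w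
    using A'(2)[OF emb_id that] t(3) by simp
  have c: "w \<in> cut j" if "w < h0" for w j using hs_cut_le[of 0 j w] that hs_0 by simp
  define B where "B v = A' (fstp v ## sndp v ## (\<lambda>_. 0))" for v
  have "BD (\<lambda>e. B (e 0))" unfolding B_def
    by (rule BD_subst[OF A'(1), where t = "\<lambda>j e. (fstp (e 0) ## sndp (e 0) ## (\<lambda>_. 0)) j"]) (intro FN_scons fn)
  moreover have "B (pair (hs i) w) \<longleftrightarrow> w = u" if "w < h0" for w using A''[OF c[OF that]] unfolding B_def by simp
  ultimately show ?thesis using u(2) c[OF u(2)] less_trans by (intro exI[of _ i] exI[of _ B]) blast
qed

text \<open>The map induced on \<open>K\<close> is handled through representations by generators:
  atomic formulas are invariant by indiscernibility, and the right inverse \<open>\<gamma>'\<close>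
  supplies preimages in the quantifier step, so the map acts as an automorphism for all
  formulas.\<close>

lemma transfer:
  assumes \<gamma>: "emb l \<gamma>" "emb l \<gamma>'" "\<And>L p. p < nD L \<Longrightarrow> \<gamma> L (\<gamma>' L p) = p"
    and T: "\<And>j. FN (T j)" and g: "\<And>j. okg (g j)"
  shows "sat K (\<lambda>j. T j (\<lambda>i. gv (act \<gamma> (g i)))) p \<longleftrightarrow> sat K (\<lambda>j. T j (\<lambda>i. gv (g i))) p"
  using T g
proof (induction p arbitrary: T g)
  case (Eq t u)
  have F: "FN (\<lambda>e. tval (\<lambda>j. T j e) t)" for t :: tm
    by (rule FN_comp[where f = "\<lambda>e. tval e t" and t = T, OF TM_FN Eq(1)]) (auto simp: TM_def)
  show ?case using indis0[OF BD_eq[OF F[of t] F[of u]] Eq(2) \<gamma>(1)] by simp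
next
  case (Lt t u)
  have F: "FN (\<lambda>e. tval (\<lambda>j. T j e) t)" for t :: tm
    by (rule FN_comp[where f = "\<lambda>e. tval e t" and t = T, OF TM_FN Lt(1)]) (auto simp: TM_def)
  show ?case using indis0[OF BD_less[OF F[of t] F[of u]] Lt(2) \<gamma>(1)] by simp
next
  case (All p)
  have step: "sat K (t (\<lambda>i. gv (act \<gamma> (h i))) ## (\<lambda>j. T j (\<lambda>i. gv (act \<gamma> (g i))))) p \<longleftrightarrow>
     sat K (t (\<lambda>i. gv (h i)) ## (\<lambda>j. T j (\<lambda>i. gv (g i)))) p" if t: "FN t" "\<And>j. okg (h j)" for t h
  proof -
    have 1: "FN ((t ## T) j)" for j using t(1) All.prems(1) by (cases j) auto
    have 2: "okg ((h ## (\<lambda>_. g)) j i)" for i j using t(2) All.prems(2) by (cases j) auto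
    obtain T' g' where T': "\<And>j. FN (T' j)" "\<And>j. okg (g' j)"
      "\<And>\<gamma> j. T' j (\<lambda>i. gv (act \<gamma> (g' i))) = (t ## T) j (\<lambda>i. gv (act \<gamma> ((h ## (\<lambda>_. g)) j i)))"
      "\<And>j. T' j (\<lambda>i. gv (g' i)) = (t ## T) j (\<lambda>i. gv ((h ## (\<lambda>_. g)) j i))"
      using merge[of "t ## T" "h ## (\<lambda>_. g)", OF 1 2] by blast
    have "(\<lambda>j. T' j (\<lambda>i. gv (act \<gamma> (g' i)))) = t (\<lambda>i. gv (act \<gamma> (h i))) ## (\<lambda>j. T j (\<lambda>i. gv (act \<gamma> (g i))))"
      unfolding T'(3) by (rule ext) (simp add: scons_def split: nat.splits)
    moreover have "(\<lambda>j. T' j (\<lambda>i. gv (g' i))) = t (\<lambda>i. gv (h i)) ## (\<lambda>j. T j (\<lambda>i. gv (g i)))"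
      unfolding T'(4) by (rule ext) (simp add: scons_def split: nat.splits)
    ultimately show ?thesis using All.IH[where T = T' and g = g', OF T'(1,2)] by simp
  qed
  show ?case
  proof
    assume L: "sat K (\<lambda>j. T j (\<lambda>i. gv (act \<gamma> (g i)))) (All p)"
    show "sat K (\<lambda>j. T j (\<lambda>i. gv (g i))) (All p)"
      unfolding sat.simps
    proof
      fix x assume "x \<in> K"
      then obtain t h where t: "FN t" "\<And>j. okg (h j)" "x = t (\<lambda>i. gv (h i))" unfolding K_def by blast
      have "t (\<lambda>i. gv (act \<gamma> (h i))) \<in> K" by (rule K_I[OF t(1) okg_act[OF \<gamma>(1) t(2)]])
      then show "sat K (x ## (\<lambda>j. T j (\<lambda>i. gv (g i)))) p" using L step[where t = t and h = h, OF t(1,2)] t(3) by simp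
    qed
  next
    assume R: "sat K (\<lambda>j. T j (\<lambda>i. gv (g i))) (All p)"
    show "sat K (\<lambda>j. T j (\<lambda>i. gv (act \<gamma> (g i)))) (All p)"
      unfolding sat.simps
    proof
      fix x assume "x \<in> K"
      then obtain t h where t: "FN t" "\<And>j. okg (h j)" "x = t (\<lambda>i. gv (h i))" unfolding K_def by blast
      have k: "okg (act \<gamma>' (h j))" for j by (rule okg_act[OF \<gamma>(2) t(2)])
      have "act \<gamma> (act \<gamma>' (h j)) = h j" for j using t(2)[of j] \<gamma>(3) by (cases "h j") auto
      then have "x = t (\<lambda>i. gv (act \<gamma> (act \<gamma>' (h i))))" using t(3) by simp
      moreover have "t (\<lambda>i. gv (act \<gamma>' (h i))) \<in> K" by (rule K_I[OF t(1) k])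
      ultimately show "sat K (x ## (\<lambda>j. T j (\<lambda>i. gv (act \<gamma> (g i))))) p"
        using R step[where t = t and h = "\<lambda>i. act \<gamma>' (h i)", OF t(1) k] by simp
    qed
  qed
qed simp_all

section \<open>Galaxies and the shift automorphism\<close>

definition gal :: "'a \<Rightarrow> 'a \<Rightarrow> bool" where
  "gal p q \<longleftrightarrow> (\<exists>k. q \<le> p + of_nat k \<and> p \<le> q + of_nat k)"

lemma gal_sym: "gal p q \<Longrightarrow> gal q p"
  unfolding gal_def by blast

lemma gal_trans: "gal p q \<Longrightarrow> gal q r \<Longrightarrow> gal p r"
proof -
  assume "gal p q" "gal q r"
  then obtain k j where k: "q \<le> p + of_nat k" "p \<le> q + of_nat k" "r \<le> q + of_nat j" "q \<le> r + of_nat j"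
    unfolding gal_def by blast
  have "r \<le> p + of_nat k + of_nat j" by (rule order_trans[OF k(3) add_right_mono[OF k(1)]])
  moreover have "p \<le> r + of_nat j + of_nat k" by (rule order_trans[OF k(2) add_right_mono[OF k(4)]])
  ultimately show ?thesis unfolding gal_def by (intro exI[of _ "k + j"]) (simp add: ac_simps)
qed

lemma gal_Suc: "gal p q \<Longrightarrow> gal p (q + 1)" and gal_pred: "gal p (q + 1) \<Longrightarrow> gal p q"
proof -
  have "gal q (q + 1)" unfolding gal_def by (rule exI[of _ 1]) (simp add: add.assoc)
  then show "gal p q \<Longrightarrow> gal p (q + 1)" "gal p (q + 1) \<Longrightarrow> gal p q" using gal_trans gal_sym by blast+
qed

text \<open>A galaxy of nonstandard numbers has neither a first nor a last member, so adding one
  maps it onto itself; the map is the identity elsewhere, and still increasing. The assumptions on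
  \<open>p0\<close> below keep the whole galaxy nonstandard and within the sequence.\<close>

definition up1 :: "nat \<Rightarrow> 'a \<Rightarrow> nat \<Rightarrow> 'a \<Rightarrow> 'a" where
  "up1 l p0 L p = (if L = l \<and> gal p0 p then p + 1 else p)"
definition dn1 :: "nat \<Rightarrow> 'a \<Rightarrow> nat \<Rightarrow> 'a \<Rightarrow> 'a" where
  "dn1 l p0 L p = (if L = l \<and> gal p0 p then p - 1 else p)"

context
  fixes p0 :: 'a and l :: nat
  assumes lo: "nst p0" and hi: "\<And>k. p0 + of_nat k < nD l"
begin

lemma gal_minus: "gal p0 p \<Longrightarrow> (p - 1) + 1 = p"
proof -
  assume "gal p0 p"
  then obtain k where "p0 \<le> p + of_nat k" unfolding gal_def by blast
  then have "p \<noteq> 0" using lo unfolding nst_def by (auto dest: leD)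
  then show ?thesis by (simp add: pa_pos_ge1)
qed

lemma emb_up1: "emb l (up1 l p0)"
  unfolding emb_def
proof (intro allI impI conjI)
  fix L p assume p: "p < nD L"
  have "p + 1 < nD l" if "gal p0 p"
  proof -
    obtain k where "p \<le> p0 + of_nat k" using \<open>gal p0 p\<close> unfolding gal_def by blast
    then have "p + 1 \<le> p0 + of_nat k + 1" by (rule add_right_mono)
    also have "\<dots> = p0 + of_nat (Suc k)" by (simp add: ac_simps)
    finally show ?thesis using hi[of "Suc k"] by (rule le_less_trans)
  qed
  then show "up1 l p0 L p < nD L" using p by (simp add: up1_def)
  fix q assume q: "q < p"
  have s: "q + 1 \<le> p" using q by (simp add: less_iff_succ_less_eq)
  have "q + 1 \<noteq> p" if "gal p0 q" "\<not> gal p0 p" using gal_Suc that by blast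
  moreover have "q < p + 1" using q by (simp add: less_S_iff)
  ultimately show "up1 l p0 L q < up1 l p0 L p" using q s by (auto simp: up1_def le_less)
next
  fix L p assume "L < l"
  then show "up1 l p0 L p = p" by (simp add: up1_def)
qed

lemma emb_dn1: "emb l (dn1 l p0)"
  unfolding emb_def
proof (intro allI impI conjI)
  fix L p assume p: "p < nD L"
  have m: "p - 1 < p" if "gal p0 p" using gal_minus[OF that] less_S_iff[of "p - 1" "p - 1"] by simp
  then show "dn1 l p0 L p < nD L" using p by (auto simp: dn1_def intro: less_trans)
  fix q assume q: "q < p"
  have "q - 1 < p - 1" if "gal p0 p" "gal p0 q"
  proof -
    have "(q - 1) + 1 < (p - 1) + 1" unfolding gal_minus[OF that(1)] gal_minus[OF that(2)] by (rule q)
    then show ?thesis by simp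
  qed
  moreover have "q - 1 < p" if "gal p0 q"
    using gal_minus[OF that] less_S_iff[of "q - 1" "q - 1"] q by simp
  moreover have "q < p - 1" if "gal p0 p" "\<not> gal p0 q"
  proof -
    have "q \<le> p - 1" using q gal_minus[OF that(1)] less_S_iff[of q "p - 1"] by simp
    moreover have "q \<noteq> p - 1" using gal_pred[of p0 "p - 1"] gal_minus[OF that(1)] that by auto
    ultimately show ?thesis by simp
  qed
  ultimately show "dn1 l p0 L q < dn1 l p0 L p" using q by (auto simp: dn1_def)
next
  fix L p assume "L < l"
  then show "dn1 l p0 L p = p" by (simp add: dn1_def)
qed

lemma up1_dn1: "up1 l p0 L (dn1 l p0 L p) = p"
proof (cases "L = l \<and> gal p0 p")
  case True
  then have "gal p0 (p - 1)" using gal_pred[of p0 "p - 1"] gal_minus by simp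
  then show ?thesis using True gal_minus by (simp add: up1_def dn1_def)
qed (auto simp: up1_def dn1_def)

text \<open>Apply indiscernibility to the graph of \<open>t\<close> with its value as the parameter
  w: a value up to \<open>hs l\<close> lies in the cut at \<open>l\<close>, over which the shift at
  level \<open>l\<close> changes no truth.\<close>

lemma shift_fixes:
  assumes "FN t" "\<And>j. okg (g j)" "t (\<lambda>j. gv (g j)) \<le> hs l"
  shows "t (\<lambda>j. gv (act (up1 l p0) (g j))) = t (\<lambda>j. gv (g j))"
proof -
  have "BD (\<lambda>e. e 0 = t (\<lambda>i. e (Suc i)))" using assms(1) by (simp add: FN_def)
  from indis[where g = g, OF this assms(2) emb_up1 hs_cut_le[OF order_refl assms(3)]] show ?thesis by simp
qed

end

text \<open>The multiples a0 * (k + 1) lie in different galaxies as \<open>a0\<close> is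
  nonstandard, and below the length of the sequence since a0 * a0 \<le> h0. A finite set meets only
  finitely many of these galaxies.\<close>

lemma gal_avoid:
  assumes "finite F"
  shows "\<exists>p0. nst p0 \<and> (\<forall>k. p0 + of_nat k < nD l) \<and> (\<forall>p\<in>F. \<not> gal p0 p)"
proof -
  let ?q = "\<lambda>k. a0 * of_nat (Suc k)"
  have q1: "?q k + of_nat j < nD l" for k j
  proof -
    have "?q k + of_nat j < ?q k + a0" using of_nat_a0 by (rule add_strict_left_mono)
    also have "\<dots> = a0 * of_nat (Suc (Suc k))" by (simp add: algebra_simps)
    also have "\<dots> \<le> a0 * a0" by (intro mult_left_mono less_imp_le[OF of_nat_a0] zero_le)
    also have "\<dots> \<le> h0" by (rule a0(3))
    also have "\<dots> \<le> hs l" using hs_mono[of 0 l] by (simp add: hs_0)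
    also have "\<dots> \<le> nD l" by (rule nD)
    finally show ?thesis .
  qed
  have q2: "nst (?q k)" for k
    by (rule nst_le[OF a0(1)]) (use le_mult_self[of "of_nat (Suc k)" a0] in \<open>simp only: of_nat_Suc\<close>, metis add_eq_0_iff_both_eq_0 le_mult_self zero_neq_one)
  have q3: "\<not> gal (?q k) (?q j)" if "k < j" for k j
  proof
    assume "gal (?q k) (?q j)"
    then obtain i where i: "?q j \<le> ?q k + of_nat i" unfolding gal_def by blast
    have "?q k + of_nat i < ?q k + a0" using of_nat_a0 by (rule add_strict_left_mono)
    also have "\<dots> = a0 * of_nat (Suc (Suc k))" by (simp add: algebra_simps)
    also have "\<dots> \<le> ?q j" by (rule mult_left_mono, rule of_nat_mono) (use that in simp_all)
    finally show False using i by (simp add: not_less[symmetric])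
  qed
  have "\<exists>k. \<forall>p\<in>F. \<not> gal (?q k) p"
  proof (rule ccontr)
    assume "\<not> (\<exists>k. \<forall>p\<in>F. \<not> gal (?q k) p)"
    then have "\<forall>k. \<exists>p. p \<in> F \<and> gal (?q k) p" by blast
    then obtain P where P: "\<And>k. P k \<in> F" "\<And>k. gal (?q k) (P k)" by metis
    have "inj P"
    proof (rule linorder_injI)
      fix k j :: nat assume "k < j"
      then have "\<not> gal (?q k) (?q j)" by (rule q3)
      then show "P k \<noteq> P j" using gal_trans[of "?q k" "P j" "?q j"] P(2)[of k] gal_sym[OF P(2)[of j]] by metis
    qed
    moreover have "range P \<subseteq> F" using P(1) by blast
    ultimately show False using assms finite_subset finite_imageD infinite_UNIV_nat by blast
  qed
  then show ?thesis using q1 q2 by blast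
qed

text \<open>For \<open>a\<close> below \<open>hs l\<close> the next state serves as
  \<open>b\<close>. An indiscernible d of level l is below it, and its supposed image v < a is fixed
  by a shift that also fixes the parameters but moves d to d'. So v is the image of d' as
  well.\<close>

theorem K_php: "(\<And>j. e j \<in> K) \<Longrightarrow> sat K e (php_fin p m)"
  unfolding php_fin_def sat.simps sat_defs sat_Alls
proof (intro ballI)
  fix a assume e: "\<And>j. e j \<in> K" and a: "a \<in> K"
  obtain l where l: "a < hs l" using K_cofinal[OF a] by blast
  show "\<exists>b\<in>K. \<forall>zs. length zs = m \<longrightarrow> set zs \<subseteq> K \<longrightarrow> \<not> sat K (apps zs (b ## a ## e)) (graph_inj p m (Suc m))"
  proof (intro bexI[of _ "hs (Suc l)"] allI impI notI)
    fix zs assume zs: "length zs = m" "set zs \<subseteq> K"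
    define E where "E = apps zs (hs (Suc l) ## a ## e)"
    have Em: "E m = hs (Suc l)" "E (Suc m) = a" using zs(1) by (simp_all add: E_def apps_def)
    assume "sat K (apps zs (hs (Suc l) ## a ## e)) (graph_inj p m (Suc m))"
    note G = this[folded E_def, unfolded sat_graph_inj Em]
    from G have ran: "\<And>u v. u \<in> K \<Longrightarrow> v \<in> K \<Longrightarrow> sat K (v ## u ## E) p \<Longrightarrow> v < a"
      and tot: "\<And>u. u \<in> K \<Longrightarrow> u < hs (Suc l) \<Longrightarrow> \<exists>v\<in>K. sat K (v ## u ## E) p"
      and inj: "\<And>u u' v. u \<in> K \<Longrightarrow> u' \<in> K \<Longrightarrow> v \<in> K \<Longrightarrow> sat K (v ## u ## E) p \<Longrightarrow> sat K (v ## u' ## E) p \<Longrightarrow> u = u'"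
      by meson+
    have EK: "E j \<in> K" for j
      using zs e a hs_K unfolding E_def apps_def by (auto simp: scons_def split: nat.splits)
    obtain M where M: "\<forall>i\<in>fvars p. i < M" using fvars_bounded by blast
    obtain T g where T: "\<And>j. FN (T j)" "\<And>j. okg (g j)" "E = (\<lambda>j. T j (\<lambda>i. gv (g i)))" using K_merge[of E, OF EK] by auto
    have "\<forall>j. \<exists>N. \<forall>e e'. (\<forall>i<N. e i = e' i) \<longrightarrow> T j e = T j e'" using FN_supp[OF T(1)] by blast
    then obtain N where N: "\<And>j e e'. (\<forall>i<N j. e i = e' i) \<Longrightarrow> T j e = T j e'" by metis
    \<comment> \<open>The formula reads finitely many parameters and each of them finitely many
      generators; \<open>F\<close> collects the positions involved, whatever their level, and the
      shifted galaxy has to avoid them.\<close>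
    define F where "F = (\<Union>j<M. (\<lambda>i. snd (projr (g i))) ` {..<N j})"
    have "finite F" unfolding F_def by blast
    from gal_avoid[OF this, of l] obtain p0 where p0: "nst p0" "\<And>k. p0 + of_nat k < nD l" "\<And>p. p \<in> F \<Longrightarrow> \<not> gal p0 p" by blast
    let ?\<gamma> = "up1 l p0"
    have fixE: "T j (\<lambda>i. gv (act ?\<gamma> (g i))) = E j" if j: "j < M" for j
      unfolding T(3)
    proof (rule N, intro allI impI)
      fix i assume i: "i < N j"
      show "gv (act ?\<gamma> (g i)) = gv (g i)"
      proof (cases "g i")
        case (Inr h)
        have "snd (projr (g i)) \<in> F" unfolding F_def using i j by blast
        then have "\<not> gal p0 (snd h)" using p0(3) Inr by simp
        then show ?thesis using Inr by (simp add: up1_def)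
      qed simp
    qed
    have p0n: "p0 < nD l" "p0 + 1 < nD l" using p0(2)[of 0] p0(2)[of 1] by simp_all
    define d where "d = gv (Inr (l, p0))"
    define d' where "d' = gv (Inr (l, p0 + 1))"
    have dK: "d \<in> K" "d' \<in> K" unfolding d_def d'_def using gv_K[of "Inr (l, p0)"] gv_K[of "Inr (l, p0 + 1)"] p0n by simp_all
    have "d < d'" unfolding d_def d'_def Dv_def gv.simps using D_less[OF p0n(2), of p0] by (simp add: Dv_def less_S_iff)
    have dh: "d < hs (Suc l)" unfolding d_def using D_bnd[OF p0n(1)] by (simp add: Dv_def)
    obtain v where v: "v \<in> K" "sat K (v ## d ## E) p" using tot[OF dK(1) dh] by blast
    have va: "v \<le> hs l" using ran[OF dK(1) v] l by simp
    obtain t h where t: "FN t" "\<And>j. okg (h j)" "v = t (\<lambda>i. gv (h i))" using v(1) unfolding K_def by blast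
    have gp: "gal p0 p0" unfolding gal_def by (rule exI[of _ 0]) simp
    \<comment> \<open>The image v, the moving indiscernible d and the parameters are put over one
      sequence of generators, so that \<open>transfer\<close> moves the three together.\<close>
    define TT where "TT = t ## (\<lambda>e. e 0) ## T"
    define gg where "gg = h ## (\<lambda>_. Inr (l, p0)) ## (\<lambda>_. g)"
    have 1: "FN (TT j)" for j unfolding TT_def using t(1) T(1) FN_var by (auto simp: scons_def split: nat.splits)
    have 2: "okg (gg i j)" for i j unfolding gg_def using t(2) T(2) p0n by (auto simp: scons_def split: nat.splits)
    obtain T' g' where T': "\<And>j. FN (T' j)" "\<And>j. okg (g' j)"
      "\<And>\<gamma> j. T' j (\<lambda>i. gv (act \<gamma> (g' i))) = TT j (\<lambda>i. gv (act \<gamma> (gg j i)))"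
      "\<And>j. T' j (\<lambda>i. gv (g' i)) = TT j (\<lambda>i. gv (gg j i))"
      using merge[of TT gg, OF 1 2] by blast
    have e1: "(\<lambda>j. T' j (\<lambda>i. gv (g' i))) = v ## d ## E"
      unfolding T'(4) TT_def gg_def T(3) t(3) d_def by (rule ext) (simp add: scons_def split: nat.splits)
    have e2: "T' j (\<lambda>i. gv (act ?\<gamma> (g' i))) = (v ## d' ## E) j" if "j < M" for j
      unfolding T'(3) TT_def gg_def using that shift_fixes[OF p0(1,2) t(1,2)] t(3) va fixE gp
      by (auto simp: scons_def d'_def up1_def split: nat.splits)
    have "sat K (\<lambda>j. T' j (\<lambda>i. gv (act ?\<gamma> (g' i)))) p"
      using transfer[where T = T' and g = g', OF emb_up1[OF p0(1,2)] emb_dn1[OF p0(1,2)] up1_dn1[OF p0(1,2)] T'(1,2)] v(2)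
      unfolding e1 by blast
    then have "sat K (v ## d' ## E) p"
      using sat_cong[of p "\<lambda>j. T' j (\<lambda>i. gv (act ?\<gamma> (g' i)))" "v ## d' ## E"] e2 M by simp
    then show False using inj[OF dK v(1) v(2)] \<open>d < d'\<close> by simp
  qed (rule hs_K)
qed

end

section \<open>Failure of the pigeonhole principle\<close>

text \<open>The code \<open>v\<close> pairs the index of a state with the code of a formula; it
  defines \<open>u\<close> as the least solution at the predecessor of that state. Recording the
  index inside \<open>v\<close> is what makes the assignment injective.\<close>

definition En :: "'a::pa \<Rightarrow> 'a \<Rightarrow> 'a \<Rightarrow> bool" where
  "En h v u \<longleftrightarrow> fstp v = idx h \<and> Ev h (sndp v) u \<and> (\<forall>u'<u. \<not> Ev h (sndp v) u')"

lemma BD_En [bd]: "FN t \<Longrightarrow> FN u \<Longrightarrow> FN v \<Longrightarrow> BD (\<lambda>e. En (t e) (u e) (v e))"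
proof (rule BD3[where P = En])
  show "BD (\<lambda>e. En (e 0) (e 1) (e 2))" unfolding En_def by (intro bd fn)
qed

lemma DF_En [df]: "FD t \<Longrightarrow> FD u \<Longrightarrow> FD v \<Longrightarrow> DF (\<lambda>e. En (t e) (u e) (v e))"
  by (rule DF3[where P = En]) (rule BD_DF, intro bd fn)

text \<open>The parameter \<open>c\<close> is the initial state of the chain; \<open>pE\<close>, \<open>pA\<close> and \<open>pH\<close> are the code of
  the set of good elements, the bound on the values and the bound on the arguments.\<close>

definition pE :: "'a::pa \<Rightarrow> 'a" where "pE c = fstp (fstp c)"
definition pA :: "'a::pa \<Rightarrow> 'a" where "pA c = fstp (sndp (fstp c))"
definition pH :: "'a::pa \<Rightarrow> 'a" where "pH c = sndp (sndp (fstp c))"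

lemma FN_ps [fn]: "FN t \<Longrightarrow> FN (\<lambda>e. pE (t e))" "FN t \<Longrightarrow> FN (\<lambda>e. pA (t e))" "FN t \<Longrightarrow> FN (\<lambda>e. pH (t e))"
  unfolding pE_def pA_def pH_def by (intro fn; assumption)+

lemma BD_Stp' [bd]: "FN t \<Longrightarrow> FN u \<Longrightarrow> FN v \<Longrightarrow> FN w \<Longrightarrow> BD (\<lambda>e. Stp (\<lambda>q. mem q (t e)) (u e) (v e) (w e))"
  by (rule BD4[where P = "\<lambda>t. Stp (\<lambda>q. mem q t)", OF BD_Stp])

text \<open>Among all definitions of \<open>u\<close> with a code below the bound, the one at the
  earliest state and there the least code is selected, which makes \<open>v\<close> a function of
  \<open>u\<close>.\<close>

definition sel :: "'a::pa \<Rightarrow> 'a \<Rightarrow> 'a \<Rightarrow> 'a \<Rightarrow> 'a \<Rightarrow> bool" where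
  "sel O' h v u c \<longleftrightarrow> u < pH c \<and> v < pA c \<and> En h v u \<and>
     (\<forall>h'<O'. mem h' O' \<longrightarrow> idx h' < idx h \<longrightarrow> (\<forall>v'<pA c. \<not> En h' v' u)) \<and> (\<forall>v'<v. \<not> En h v' u)"

lemma BD_sel [bd]: "FN t \<Longrightarrow> FN u \<Longrightarrow> FN v \<Longrightarrow> FN w \<Longrightarrow> FN x \<Longrightarrow> BD (\<lambda>e. sel (t e) (u e) (v e) (w e) (x e))"
proof (rule BD5[where P = sel])
  show "BD (\<lambda>e. sel (e 0) (e 1) (e 2) (e 3) (e 4))" unfolding sel_def by (intro bd fn)
qed

text \<open>The bounded counterpart of \<open>valid\<close>: each step is checked with the truth
  code \<open>T\<close>, and the condition on \<open>bnd g\<close> ensures that \<open>T\<close>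
  reaches far enough to decide it.\<close>

definition lnk :: "'a::pa \<Rightarrow> 'a \<Rightarrow> 'a \<Rightarrow> 'a \<Rightarrow> bool" where
  "lnk T O' w c \<longleftrightarrow> (\<forall>g<O'. mem g O' \<longrightarrow> g = c \<or> bnd g \<le> w \<and> (\<exists>g'<O'. mem g' O' \<and> Stp (\<lambda>q. mem q T) (pE c) g' g))"

lemma BD_lnk [bd]: "FN t \<Longrightarrow> FN u \<Longrightarrow> FN v \<Longrightarrow> FN w \<Longrightarrow> BD (\<lambda>e. lnk (t e) (u e) (v e) (w e))"
proof (rule BD4[where P = lnk])
  show "BD (\<lambda>e. lnk (e 0) (e 1) (e 2) (e 3))" unfolding lnk_def by (intro bd fn)
qed

text \<open>\<open>X\<close> packs an initial part of the chain, its member at which \<open>u\<close> is defined, a bound on the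
  states and a code of the truth values below that bound which verifies the steps of the chain.\<close>

definition PM :: "nat \<Rightarrow> 'a::pa \<Rightarrow> 'a \<Rightarrow> 'a \<Rightarrow> 'a \<Rightarrow> bool" where
  "PM n X v u c \<longleftrightarrow> TV n (fstp (sndp (sndp X))) (sndp (sndp (sndp X))) \<and> mem (fstp (sndp X)) (fstp X) \<and>
     lnk (fstp (sndp (sndp (sndp X)))) (fstp X) (fstp (sndp (sndp X))) c \<and> sel (fstp X) (fstp (sndp X)) v u c"

lemma PM_G: "G n False (\<lambda>Y::'a::pa. PM n (fstp Y) (fstp (sndp Y)) (fstp (sndp (sndp Y))) (sndp (sndp (sndp Y))))"
proof -
  have f: "FN (\<lambda>e::nat \<Rightarrow> 'a. (\<lambda>Y. sndp (sndp (fstp Y))) (e 0))" by (intro fn)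
  have "G n False (\<lambda>Y::'a. TV n (fstp (sndp (sndp (fstp Y)))) (sndp (sndp (sndp (fstp Y)))))"
    using G_sub[OF TV_G[of n] f] by simp
  moreover have "G n False (\<lambda>Y::'a. mem (fstp (sndp (fstp Y))) (fstp (fstp Y)) \<and>
     lnk (fstp (sndp (sndp (sndp (fstp Y))))) (fstp (fstp Y)) (fstp (sndp (sndp (fstp Y)))) (sndp (sndp (sndp Y))) \<and>
     sel (fstp (fstp Y)) (fstp (sndp (fstp Y))) (fstp (sndp Y)) (fstp (sndp (sndp Y))) (sndp (sndp (sndp Y))))"
    by (rule G_BD) (intro bd fn)
  ultimately show ?thesis unfolding PM_def by (rule G_and)
qed

lemma fclosed_fsubst: "(\<And>i. tclosed k (s i)) \<Longrightarrow> fclosed k (fsubst s p)"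
proof (induction p arbitrary: k s)
  have t: "tclosed k (tsubst s t)" if "\<And>i. tclosed k (s i)" for k s t using that by (induction t) auto
  { case (Eq x y) then show ?case using t by simp }
  { case (Lt x y) then show ?case using t by simp }
  { case (All p)
    have l: "tclosed (Suc k) (tlift x)" if "tclosed k x" for x unfolding tlift_def using that by (induction x) auto
    have "tclosed (Suc k) (up s i)" for i using All.prems l unfolding up_def by (cases i) auto
    then show ?case using All.IH by simp }
qed simp_all

lemma sigma_pi_fsubst: "sigma k p \<Longrightarrow> sigma k (fsubst s p)" "pi k p \<Longrightarrow> pi k (fsubst s p)"
proof (induction arbitrary: s and s rule: sigma_pi.inducts)
  case (5 k p)
  then show ?case using sigma_pi.intros(5)[of k "fsubst (up s) p"] by (simp add: Ex_def Neg_def)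
next
  case (6 k p)
  then show ?case using sigma_pi.intros(6)[of k "fsubst (up s) p"] by simp
qed (auto intro: sigma_pi.intros bounded_fsubst)

lemma php_formula:
  obtains q where "pi n q" "fclosed 4 q"
    "\<And>e::nat \<Rightarrow> 'a::pa. sat UNIV e q \<longleftrightarrow> PM n (e 0) (e 1) (e 2) (e 3)"
proof -
  have "TM (\<lambda>e::nat \<Rightarrow> 'a. pair (e 0) (pair (e 1) (pair (e 2) (e 3))))" by (intro TM_pair TM_var)
  from G_fm[OF PM_G[of n] this] obtain q where q: "pi n q"
    "\<And>e::nat \<Rightarrow> 'a. sat UNIV e q \<longleftrightarrow> PM n (e 0) (e 1) (e 2) (e 3)" by auto
  let ?s = "\<lambda>i. if i < 4 then Var i else Var 0"
  show ?thesis
  proof (rule that)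
    show "pi n (fsubst ?s q)" by (rule sigma_pi_fsubst(2)[OF q(1)])
    show "fclosed 4 (fsubst ?s q)" by (rule fclosed_fsubst) simp
    show "sat UNIV e (fsubst ?s q) \<longleftrightarrow> PM n (e 0) (e 1) (e 2) (e 3)" for e :: "nat \<Rightarrow> 'a"
      unfolding sat_fsubst q(2) by simp
  qed
qed

lemma BD_exn: "(\<And>j::nat. BD (A j)) \<Longrightarrow> BD (\<lambda>e. \<exists>j<k. A j e)"
proof (induction k)
  case (Suc k)
  have "(\<lambda>e. \<exists>j<Suc k. A j e) = (\<lambda>e. (\<exists>j<k. A j e) \<or> A k e)" by (auto simp: less_Suc_eq)
  then show ?case using Suc by (simp add: BD_Or)
qed (simp add: BD_False)

locale php_ladder = ladder +
  fixes rv a Hv :: 'a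
  assumes rv: "mem rv \<epsilon>" "Th n (pair rv (pair z y)) \<Longrightarrow> TV n y (zt n z)"
    and par: "pE h0 = \<epsilon>" "pA h0 = a" "pH h0 = Hv" and Hv: "Hv < h0" and a: "nst a"
begin

text \<open>A witness X is judged in the big model, where the truth code is correct by
  \<open>TV_Th\<close>. So X contains a real initial part of the chain with all earlier states, and
  the selection made in X is independent of X.\<close>

lemma PM_Ch:
  assumes "PM n X v u h0"
  defines "h \<equiv> fstp (sndp X)"
  shows "Ch h" "u < Hv" "v < a" "En h v u" "Ch h' \<Longrightarrow> idx h' < idx h \<Longrightarrow> v' < a \<Longrightarrow> \<not> En h' v' u"
    "v' < v \<Longrightarrow> \<not> En h v' u"
proof -
  let ?O = "fstp X" let ?w = "fstp (sndp (sndp X))" let ?z = "sndp (sndp (sndp X))"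
  have P: "TV n ?w ?z" "mem h ?O" "lnk (fstp ?z) ?O ?w h0" "sel ?O h v u h0"
    using assms(1) unfolding PM_def h_def by blast+
  have T: "Stp (\<lambda>q. mem q (fstp ?z)) \<epsilon> g' g \<longleftrightarrow> St g' g" if "bnd g \<le> ?w" for g' g
    by (rule Stp_cong[OF _ that]) (simp add: TV_Th[OF P(1)])
  have V: "valid ?O" unfolding valid_def
  proof (intro allI impI)
    fix g assume g: "mem g ?O"
    then show "g = h0 \<or> (\<exists>g'. mem g' ?O \<and> St g' g)"
      using P(3) mem_less[OF g] T unfolding lnk_def par by blast
  qed
  show "Ch h" by (rule valid_Ch[OF V P(2)])
  show "u < Hv" "v < a" "En h v u" using P(4) unfolding sel_def par by blast+
  show "\<not> En h v' u" if "v' < v" using P(4) that unfolding sel_def by blast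
  assume h': "Ch h'" "idx h' < idx h" "v' < a"
  have "mem h' ?O" by (rule valid_initial[OF V P(2) h'(1)]) (use h'(2) in simp)
  then show "\<not> En h' v' u" using P(4) h'(2,3) mem_less unfolding sel_def par by blast
qed

lemma PM_functional:
  assumes "PM n X v u h0" "PM n X' v' u h0" shows "v = v'"
proof -
  let ?h = "fstp (sndp X)" let ?h' = "fstp (sndp X')"
  note P = PM_Ch[OF assms(1)] and P' = PM_Ch[OF assms(2)]
  have "\<not> idx ?h' < idx ?h" using P(5)[OF P'(1) _ P'(3)] P'(4) by blast
  moreover have "\<not> idx ?h < idx ?h'" using P'(5)[OF P(1) _ P(3)] P(4) by blast
  ultimately have "idx ?h = idx ?h'" by simp
  then have e: "?h = ?h'" by (rule Ch_idx_unique[OF P(1) P'(1)])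
  have "\<not> v' < v" using P(6) P'(4) e by auto
  moreover have "\<not> v < v'" using P'(6) P(4) e by auto
  ultimately show ?thesis by simp
qed

lemma PM_injective:
  assumes "PM n X v u h0" "PM n X' v u' h0" shows "u = u'"
proof -
  note P = PM_Ch[OF assms(1)] and P' = PM_Ch[OF assms(2)]
  have "idx (fstp (sndp X)) = idx (fstp (sndp X'))" using P(4) P'(4) unfolding En_def by simp
  then have e: "fstp (sndp X) = fstp (sndp X')" by (rule Ch_idx_unique[OF P(1) P'(1)])
  have "\<not> u' < u" "\<not> u < u'" using P(4) P'(4) unfolding e En_def by blast+
  then show ?thesis by simp
qed

lemma idx_hs: "idx (hs i) = of_nat i"
  unfolding hs_def by (rule hh(2))

text \<open>The states up to index i are the iterated predecessors of the next state, a disjunction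
  of standard length. As the cut is closed under \<open>Sub\<close>, a code of this set exists below
  that state and is found by bounded search, hence within \<open>K\<close>.\<close>

lemma initial_chain:
  obtains O' where "O' \<in> K" "\<And>g. mem g O' \<longleftrightarrow> (\<exists>j\<le>i. g = hs j)"
proof -
  define A where "A H g \<longleftrightarrow> (\<exists>j<Suc i. g = (fstp ^^ Suc j) H)" for H g :: 'a
  have A_hs: "A (hs (Suc i)) g \<longleftrightarrow> (\<exists>j\<le>i. g = hs j)" for g
  proof -
    have e: "(fstp ^^ Suc j) (hs (Suc i)) = hs (i - j)" if "j < Suc i" for j
      using hs_funpow[of "Suc j" "i - j"] that by simp
    show ?thesis unfolding A_def
    proof
      assume "\<exists>j<Suc i. g = (fstp ^^ Suc j) (hs (Suc i))"
      then show "\<exists>j\<le>i. g = hs j" using e by (metis diff_le_self)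
    next
      assume "\<exists>j\<le>i. g = hs j"
      then obtain j where "j \<le> i" "g = hs j" by blast
      then show "\<exists>j<Suc i. g = (fstp ^^ Suc j) (hs (Suc i))" using e[of "i - j"] by (intro exI[of _ "i - j"]) simp
    qed
  qed
  have BA: "BD (\<lambda>e. A (t e) (u e))" if "FN t" "FN u" for t u :: "(nat \<Rightarrow> 'a) \<Rightarrow> 'a"
    unfolding A_def by (intro BD_exn BD_eq FN_funpow_fstp that)
  have DA: "DF (\<lambda>e. A (hs (Suc i)) (e 0))"
    by (rule DF2[where P = A, OF BD_DF[OF BA]]) (intro fn fd)+
  have "hs i + 1 \<in> cut i" by (intro cutI_intros[OF cutI_cut] hs_cut)
  then obtain d where d: "d \<in> cut i" "Sub (hs i + 1) d" using cutI_cut[of i] unfolding cutI_def by blast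
  from Sub_compr[OF d(2) DA] obtain s where s: "s < d" "\<And>x. mem x s \<longleftrightarrow> x < hs i + 1 \<and> A (hs (Suc i)) x" by blast
  have sH: "s < hs (Suc i)" using less_trans[OF s(1) cut_less[OF d(1)]] bnd_le[of "hs (Suc i)"] by simp
  have ms: "mem x s \<longleftrightarrow> A (hs (Suc i)) x" for x
    unfolding s(2) A_hs less_S_iff using hs_mono by blast
  have AH: "x < hs (Suc i)" if "A (hs (Suc i)) x" for x
    using mem_less[of x s] that sH ms by simp
  define f where "f H = lst (\<lambda>O'. O' < H \<and> (\<forall>g<H. mem g O' \<longleftrightarrow> A H g))" for H
  have "FN (\<lambda>e. f (e 0))" unfolding f_def by (intro fn bd BA)
  then have "f (hs (Suc i)) \<in> K" using KelD[OF Kel_K, of "\<lambda>e. f (e 0)" "\<lambda>_. hs (Suc i)"] hs_K by simp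
  moreover have "mem g (f (hs (Suc i))) \<longleftrightarrow> (\<exists>j\<le>i. g = hs j)" for g
  proof -
    have D: "DF (\<lambda>e. e 0 < hs (Suc i) \<and> (\<forall>g<hs (Suc i). mem g (e 0) \<longleftrightarrow> A (hs (Suc i)) g))"
      by (intro df fd DF1[OF DA])
    have "f (hs (Suc i)) < hs (Suc i) \<and> (\<forall>g<hs (Suc i). mem g (f (hs (Suc i))) \<longleftrightarrow> A (hs (Suc i)) g)"
      unfolding f_def by (rule lst_works(1)[OF D, of s]) (use sH ms in blast)
    then have "mem g (f (hs (Suc i))) \<longleftrightarrow> A (hs (Suc i)) g" using AH[of g] mem_less[of g "f (hs (Suc i))"] less_trans by blast
    then show ?thesis unfolding A_hs .
  qed
  ultimately show ?thesis by (rule that)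
qed

text \<open>The definition from \<open>K_initial\<close> has a standard code and a standard state
  index, so its pair is below the nonstandard \<open>a\<close>. Hence the least standard index with
  any code below \<open>a\<close> exists, and the earliest definition, the initial chain and the
  truth code are all in \<open>K\<close>.\<close>

lemma PM_total:
  assumes u: "u \<in> K" "u < Hv"
  shows "\<exists>v\<in>K. \<exists>X\<in>K. PM n X v u h0"
proof -
  have uh: "u < h0" using u(2) Hv by simp
  obtain i0 B where B: "BD (\<lambda>e. B (e 0))" "B (pair (hs i0) u)" "\<forall>u'<u. \<not> B (pair (hs i0) u')" "u \<in> cut i0"
    using K_initial[OF u(1) uh] by blast
  obtain k where k: "coded k (\<lambda>y. tv (B (fstp y)))" using coded_BD1[OF B(1)] by blast
  have "En (hs (Suc i0)) (pair (of_nat (Suc i0)) (of_nat k)) u"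
    unfolding En_def using Ev_iff[OF k B(4)] Ev_iff[OF k cut_down[OF B(4) less_imp_le]] B(2,3) by (simp add: idx_hs)
  moreover have "pair (of_nat (Suc i0)) (of_nat k) < a"
    using of_nat_pair[of "Suc i0" k] a unfolding nst_def by metis
  ultimately have ex: "\<exists>i. \<exists>v<a. En (hs i) v u" by blast
  define i where "i = (LEAST i. \<exists>v<a. En (hs i) v u)"
  obtain v0 where v0: "v0 < a" "En (hs i) v0 u" using LeastI_ex[OF ex] unfolding i_def by blast
  have less_i: "\<not> En (hs j) v' u" if "j < i" "v' < a" for j v' using not_less_Least that unfolding i_def by blast
  define v where "v = (\<lambda>a h u. lst (\<lambda>v. v < a \<and> En h v u)) a (hs i) u"
  have D: "DF (\<lambda>e. e 0 < a \<and> En (hs i) (e 0) u)" by (intro df fd)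
  have v: "v < a" "En (hs i) v u" "\<And>v'. v' < v \<Longrightarrow> \<not> En (hs i) v' u"
    using lst_works(1)[OF D, of v0] lst_works(2)[OF D, of v0] v0 unfolding v_def by (blast, blast, meson less_trans)
  have aK: "a \<in> K" unfolding par(2)[symmetric] pA_def using hs_K[of 0] Kel_fstp[OF Kel_K] Kel_sndp[OF Kel_K] by (simp add: hs_0)
  have "FN (\<lambda>e::nat \<Rightarrow> 'a. (\<lambda>a h u. lst (\<lambda>v. v < a \<and> En h v u)) (e 0) (e 1) (e 2))" by (intro fn bd)
  from KelD[OF Kel_K this, of "args [a, hs i, u]"] have vK: "v \<in> K"
    unfolding v_def using args_all[of "[a, hs i, u]" "\<lambda>x. x \<in> K"] aK u(1) hs_K by simp
  obtain O' where O': "O' \<in> K" "\<And>g. mem g O' \<longleftrightarrow> (\<exists>j\<le>i. g = hs j)" using initial_chain by blast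
  obtain z0 where z0: "z0 \<in> K" "Th n (pair rv (pair z0 (hs i)))"
    using Kcl_K rv(1) hs_K[of i] unfolding Kcl_def by blast
  define z where "z = zt n z0"
  have z: "TV n (hs i) z" "z \<in> K" unfolding z_def using rv(2)[OF z0(2)] Kel_zt[OF Kel_K z0(1)] by blast+
  have T: "Stp (\<lambda>q. mem q (fstp z)) \<epsilon> g' g \<longleftrightarrow> St g' g" if "bnd g \<le> hs i" for g' g
    by (rule Stp_cong[OF _ that]) (simp add: TV_Th[OF z(1)])
  define X where "X = pair O' (pair (hs i) (pair (hs i) z))"
  have "X \<in> K" unfolding X_def using O'(1) hs_K z(2) by (intro Kel_pair[OF Kel_K])
  moreover have "PM n X v u h0"
    unfolding PM_def X_def fstp_pair sndp_pair
  proof (intro conjI)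
    show "TV n (hs i) z" by (rule z(1))
    show "mem (hs i) O'" using O'(2) by blast
    show "lnk (fstp z) O' (hs i) h0"
      unfolding lnk_def par
    proof (intro allI impI)
      fix g assume "mem g O'"
      then obtain j where j: "j \<le> i" "g = hs j" using O'(2) by blast
      show "g = h0 \<or> bnd g \<le> hs i \<and> (\<exists>g'<O'. mem g' O' \<and> Stp (\<lambda>q. mem q (fstp z)) \<epsilon> g' g)"
      proof (cases j)
        case 0
        then show ?thesis using j hs_0 by simp
      next
        case (Suc j')
        have b: "bnd g \<le> hs i" using bnd_le[of g] hs_mono[OF j(1)] j(2) by simp
        have m: "mem (hs j') O'" using O'(2) Suc j(1) by (metis Suc_leD)
        have "Stp (\<lambda>q. mem q (fstp z)) \<epsilon> (hs j') g" using T[OF b, of "hs j'"] St_hs[of j'] j(2) Suc by simp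
        then show ?thesis using b m mem_less[OF m] by blast
      qed
    qed
    show "sel O' (hs i) v u h0"
      unfolding sel_def par
    proof (intro conjI allI impI)
      fix h' v' assume h': "mem h' O'" "idx h' < idx (hs i)" "v' < a"
      obtain j where j: "j \<le> i" "h' = hs j" using h'(1) O'(2) by blast
      then have "j < i" using h'(2) by (cases "j = i") auto
      then show "\<not> En h' v' u" using less_i h'(3) j(2) by simp
    qed (use u(2) v in simp_all)
  qed
  ultimately show ?thesis using vK by blast
qed

text \<open>In the environment \<open>h0\<close> is the single parameter of the formula, followed by
  the value \<open>Hv\<close> of the function and by \<open>a\<close>, as \<open>php_H\<close> with
  one parameter has it. The defining conditions are checked for \<open>PM\<close> in the big model,
  which is possible because its matrix is absolute.\<close>

theorem K_not_php:
  assumes q: "\<And>e::nat \<Rightarrow> 'a. (\<And>j. e j \<in> K) \<Longrightarrow> sat K e q \<longleftrightarrow> PM n (e 0) (e 1) (e 2) (e 3)"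
    and e: "\<And>j. e j \<in> K"
  shows "sat K (h0 ## Hv ## a ## e) (graph_inj (Ex q) 1 2)"
proof -
  have h0: "h0 \<in> K" using hs_K[of 0] hs_0 by simp
  have "a = fstp (sndp (fstp h0))" "Hv = sndp (sndp (fstp h0))" using par by (simp_all add: pA_def pH_def)
  then have aH: "a \<in> K" "Hv \<in> K" using h0 Kel_fstp[OF Kel_K] Kel_sndp[OF Kel_K] by simp_all
  have P: "sat K (v ## u ## h0 ## Hv ## a ## e) (Ex q) \<longleftrightarrow> (\<exists>X\<in>K. PM n X v u h0)" if "u \<in> K" "v \<in> K" for u v
  proof -
    have "(X ## v ## u ## h0 ## Hv ## a ## e) j \<in> K" if "X \<in> K" for X j
      using that \<open>u \<in> K\<close> \<open>v \<in> K\<close> h0 aH e by (intro scons_in)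
    then show ?thesis using q by (simp add: numeral_2_eq_2 numeral_3_eq_3)
  qed
  show ?thesis
    unfolding sat_graph_inj
  proof (intro conjI ballI impI)
    fix u v assume uv: "u \<in> K" "v \<in> K" "sat K (v ## u ## h0 ## Hv ## a ## e) (Ex q)"
    then obtain X where "PM n X v u h0" using P by blast
    from PM_Ch(2,3)[OF this] show "u < (h0 ## Hv ## a ## e) 1" "v < (h0 ## Hv ## a ## e) 2"
      by (simp_all add: numeral_2_eq_2)
  next
    fix u assume "u \<in> K" "u < (h0 ## Hv ## a ## e) 1"
    then show "\<exists>v\<in>K. sat K (v ## u ## h0 ## Hv ## a ## e) (Ex q)" using PM_total[of u] P by simp
  next
    fix u v v' assume K: "u \<in> K" "v \<in> K" "v' \<in> K" and S: "sat K (v ## u ## h0 ## Hv ## a ## e) (Ex q) \<and> sat K (v' ## u ## h0 ## Hv ## a ## e) (Ex q)"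
    from S obtain X X' where X: "PM n X v u h0" "PM n X' v' u h0" unfolding P[OF K(1,2)] P[OF K(1,3)] by (elim conjE bexE)
    show "v = v'" by (rule PM_functional[OF X])
  next
    fix u u' v assume K: "u \<in> K" "u' \<in> K" "v \<in> K" and S: "sat K (v ## u ## h0 ## Hv ## a ## e) (Ex q) \<and> sat K (v ## u' ## h0 ## Hv ## a ## e) (Ex q)"
    from S obtain X X' where X: "PM n X v u h0" "PM n X' v u' h0" unfolding P[OF K(1,3)] P[OF K(2,3)] by (elim conjE bexE)
    show "u = u'" by (rule PM_injective[OF X])
  qed
qed

end

lemma finite_code: "finite F \<Longrightarrow> \<exists>s. \<forall>x. mem x s \<longleftrightarrow> x \<in> F" for F :: "'a::pa set"
proof (induction rule: finite_induct)
  case empty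
  show ?case by (rule exI[of _ 0]) (auto dest: mem_less)
next
  case (insert y F)
  then obtain s where s: "\<And>x. mem x s \<longleftrightarrow> x \<in> F" by blast
  have "DF (\<lambda>e. mem (e 0) s \<or> e 0 = y)" by (intro df fd)
  from compr[OF this, of "s + (y + 1)"] obtain s' where s': "\<And>x. mem x s' \<longleftrightarrow> x < s + (y + 1) \<and> (mem x s \<or> x = y)" by blast
  have "x < s + (y + 1)" if "mem x s \<or> x = y" for x
    using that
  proof
    assume "mem x s"
    then show ?thesis using mem_less less_le_trans by (metis le_add_same_cancel1 zero_le)
  next
    assume "x = y"
    then show ?thesis using less_le_trans[of y "y + 1" "s + (y + 1)"] by (simp add: less_S_iff)
  qed
  then show ?case using s s' by blast
qed

theorem main_model:
  fixes a :: "'a::pa"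
  assumes q: "\<And>e::nat \<Rightarrow> 'a. sat UNIV e q \<longleftrightarrow> PM n (e 0) (e 1) (e 2) (e 3)" "pi n q"
    and a: "nst a" and S: "finite S" "\<And>s. s \<in> S \<Longrightarrow> sentence s" "\<And>s. s \<in> S \<Longrightarrow> sigma (n + 3) s"
    "\<And>s e. s \<in> S \<Longrightarrow> sat UNIV (e::nat \<Rightarrow> 'a) s" and f: "sigma (Suc n) f" "fclosed 2 f" "prv S (total_fn f)"
  shows "\<exists>K::'a set. closed_dom K \<and> (\<forall>s\<in>S. \<forall>e. sat K e s) \<and>
    (\<forall>p m e. (\<forall>j. e j \<in> K) \<longrightarrow> sat K e (php_fin p m)) \<and> (\<forall>e. (\<forall>j. e j \<in> K) \<longrightarrow> \<not> sat K e (php_H f (Ex q) 1))"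
proof -
  have "\<forall>s\<in>S. \<exists>(E::'a set) c'. finite E \<and> (\<forall>r\<in>E. good n r) \<and> (\<forall>K. Kcl n E K \<longrightarrow> c' \<in> K \<longrightarrow> sat K (dec 0) s)"
    using sigma3_reflect[of n _ "0::'a"] S(3,4) by (simp add: eval_nat_numeral)
  then obtain ES :: "fm \<Rightarrow> 'a set" and cS where ES: "\<And>s. s \<in> S \<Longrightarrow> finite (ES s)" "\<And>s r. s \<in> S \<Longrightarrow> r \<in> ES s \<Longrightarrow> good n r"
    "\<And>s K. s \<in> S \<Longrightarrow> Kcl n (ES s) K \<Longrightarrow> cS s \<in> K \<Longrightarrow> sat K (dec 0) s" by metis
  have "sat UNIV (\<lambda>_. 0 :: 'a) (total_fn f)" by (rule soundness[OF f(3)]) (use S(4) in auto)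
  then obtain Hv where Hv: "sat UNIV (Hv ## a ## (\<lambda>_. 0)) f" unfolding total_fn_def by auto
  obtain EF :: "'a set" and D where EF: "finite EF" "\<forall>r\<in>EF. good n r"
    "\<And>y. sat UNIV (dec y) f \<longleftrightarrow> (\<exists>u. D (pair u y))"
    "\<And>K y u. Kcl n EF K \<Longrightarrow> y \<in> K \<Longrightarrow> u \<in> K \<Longrightarrow> D (pair u y) \<Longrightarrow> sat K (dec y) f"
    using sigma_witness[OF f(1)] by blast
  define y where "y = pair Hv (pair a 0)"
  have f2: "e i = e' i" if "e 0 = e' 0" "e 1 = e' 1" "i \<in> fvars f" for e e' :: "nat \<Rightarrow> 'a" and i
  proof -
    have "i < 2" using that(3) f(2) fclosed_fvars by blast
    then show ?thesis using that(1,2) by (auto simp: less_2_cases_iff)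
  qed
  have "sat UNIV (dec y) f" using Hv sat_cong[of f "dec y" "Hv ## a ## (\<lambda>_. 0)"] f2[of "dec y" "Hv ## a ## (\<lambda>_. 0)"] by (simp add: y_def)
  \<comment> \<open>With this witness and \<open>y\<close> in the submodel, the value
    \<open>Hv\<close> of the function at \<open>a\<close> remains its value there.\<close>
  then obtain u where u: "D (pair u y)" using EF(3) by blast
  obtain EQ :: "'a set" where EQ: "absol n EQ q" using absoluteness(2)[OF q(2) order_refl] by blast
  obtain rt :: 'a where rt: "good n rt" "\<And>z y. Th n (pair rt (pair z y)) \<Longrightarrow> tower y (zt n z)" using good_tower[where n = n and 'a = 'a] by blast
  obtain rv :: 'a where rv: "good n rv" "\<And>z y. Th n (pair rv (pair z y)) \<Longrightarrow> TV n y (zt n z)" using good_TV[where n = n and 'a = 'a] by blast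
  define F where "F = (\<Union>s\<in>S. ES s) \<union> EF \<union> EQ \<union> {rt, rv}"
  have F: "finite F" "\<And>r. r \<in> F \<Longrightarrow> good n r"
    using S(1) ES(1,2) EF(1,2) EQ rt(1) rv(1) unfolding F_def absol_def by auto
  obtain \<epsilon> where eF: "\<And>x. mem x \<epsilon> \<longleftrightarrow> x \<in> F" using finite_code[OF F(1)] by blast
  have "finite (F \<union> cS ` S \<union> {u, y})" using F(1) S(1) by simp
  from finite_list[OF this] obtain xs where xs: "set xs = F \<union> cS ` S \<union> {u, y}" by blast
  define big where "big = pair (a * a) (pair (a + a + a) (Hv + 1))"
  \<comment> \<open>The slot of the predecessor carries \<open>\<epsilon>\<close>, \<open>a\<close>
    and \<open>Hv\<close>, that of the bound carries \<open>big\<close>, which forces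
    \<open>h0\<close> above the required sizes, and the list of all elements to be contained in the
    submodel; truth code and index are 0.\<close>
  define h0 where "h0 = pair (pair \<epsilon> (pair a Hv)) (pair (pair big (encf (length xs) (\<lambda>i. xs ! i))) (pair 0 0))"
  have bh: "big \<le> h0" unfolding h0_def by (rule order_trans[OF le_pair1 order_trans[OF le_pair1 le_pair2]])
  have b1: "a * a \<le> h0" using bh unfolding big_def by (rule order_trans[OF le_pair1])
  have b2: "a + a + a \<le> h0" using bh unfolding big_def by (rule order_trans[OF order_trans[OF le_pair1 le_pair2]])
  have b3: "Hv + 1 \<le> h0" using bh unfolding big_def by (rule order_trans[OF order_trans[OF le_pair2 le_pair2]])
  have xd: "\<exists>g. FN (\<lambda>e::nat \<Rightarrow> 'a. g (e 0)) \<and> x = g h0" if "x \<in> set xs" for x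
  proof -
    obtain j where j: "j < length xs" "x = xs ! j" using \<open>x \<in> set xs\<close> unfolding in_set_conv_nth by blast
    have "FN (\<lambda>e::nat \<Rightarrow> 'a. dec (sndp (fstp (sndp (e 0)))) j)" by (intro FN_dec fn)
    moreover have "dec (sndp (fstp (sndp h0))) j = x" using j by (simp add: h0_def dec_encf)
    ultimately show ?thesis by (intro exI[of _ "\<lambda>h. dec (sndp (fstp (sndp h))) j"]) simp
  qed
  interpret php_ladder n \<epsilon> h0 rt a rv a Hv
  proof
    show "good n r" if "mem r \<epsilon>" for r using that eF F(2) by blast
    show "idx h0 = 0" by (simp add: h0_def idx_def)
    show "mem rt \<epsilon>" unfolding eF F_def by simp
    show "mem rv \<epsilon>" unfolding eF F_def by simp
    show "tower y (zt n z)" if "Th n (pair rt (pair z y))" for y z by (rule rt(2)[OF that])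
    show "TV n y (zt n z)" if "Th n (pair rv (pair z y))" for y z by (rule rv(2)[OF that])
    show "a + a + a \<le> h0" by (fact b2)
    show "a * a \<le> h0" by (fact b1)
    show "\<exists>f. FN (\<lambda>e::nat \<Rightarrow> 'a. f (e 0)) \<and> r = f h0" if "mem r \<epsilon>" for r using xd[of r] that xs eF by blast
    show "pE h0 = \<epsilon>" by (simp add: h0_def pE_def)
    show "pA h0 = a" by (simp add: h0_def pA_def)
    show "pH h0 = Hv" by (simp add: h0_def pH_def)
    show "Hv < h0" using b3 by (simp add: less_iff_succ_less_eq)
  qed (rule a)+
  have xK: "x \<in> K" if "x \<in> set xs" for x
    using xd[OF that] dfn_K[of 0 x] unfolding dfn_def hs_0 by blast
  have KF: "Kcl n E K" if "E \<subseteq> F" for E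
    using Kcl_subset[OF Kcl_K] that eF by auto
  show ?thesis
  proof (intro exI[of _ K] conjI ballI allI impI notI)
    show "closed_dom K" by (rule Kel_closed_dom[OF Kel_K])
  next
    fix s e assume s: "s \<in> S"
    have "sat K (dec 0) s" by (rule ES(3)[OF s KF xK]) (use s xs in \<open>auto simp: F_def\<close>)
    then show "sat K e s" using sat_sentence[OF S(2)[OF s]] by blast
  next
    fix p m and e :: "nat \<Rightarrow> 'a" assume "\<forall>j. e j \<in> K"
    then show "sat K e (php_fin p m)" using K_php by blast
  next
    fix e :: "nat \<Rightarrow> 'a" assume e: "\<forall>j. e j \<in> K" and P: "sat K e (php_H f (Ex q) 1)"
    have h0: "h0 \<in> K" using hs_K[of 0] hs_0 by simp
    have yK: "y \<in> K" "u \<in> K" using xK xs by auto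
    have aH: "a \<in> K" "Hv \<in> K" using Kel_fstp[OF Kel_K yK(1)] Kel_fstp[OF Kel_K Kel_sndp[OF Kel_K yK(1)]] by (simp_all add: y_def)
    have "sat K (dec y) f" by (rule EF(4)[OF KF yK u]) (auto simp: F_def)
    then have "sat K (Hv ## a ## e) f" using sat_cong[of f "dec y" "Hv ## a ## e"] f2[of "dec y" "Hv ## a ## e"] by (simp add: y_def)
    then have "sat K (Hv ## a ## e) (Alls 1 (Neg (graph_inj (Ex q) 1 2)))"
      using P aH unfolding php_H_def by (simp add: numeral_2_eq_2)
    then have "\<not> sat K (h0 ## Hv ## a ## e) (graph_inj (Ex q) 1 2)"
      using h0 unfolding sat_Alls by (auto dest: spec[of _ "[h0]"])
    moreover have "sat K e' q \<longleftrightarrow> PM n (e' 0) (e' 1) (e' 2) (e' 3)" if "\<And>j. e' j \<in> K" for e' :: "nat \<Rightarrow> 'a"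
    proof -
      have "Kcl n EQ K" by (rule KF) (auto simp: F_def)
      then have "sat K e' q = sat UNIV e' q" using EQ that unfolding absol_def by blast
      then show ?thesis using q(1) by simp
    qed
    ultimately show False using K_not_php[of q e] e by blast
  qed
qed

section \<open>The term model\<close>

lemma tclosed_tsubst: "tclosed k t \<Longrightarrow> (\<And>i. i < k \<Longrightarrow> tclosed j (s i)) \<Longrightarrow> tclosed j (tsubst s t)"
  by (induction t) auto

lemma fclosed_fsubst_le: "fclosed k p \<Longrightarrow> (\<And>i. i < k \<Longrightarrow> tclosed j (s i)) \<Longrightarrow> fclosed j (fsubst s p)"
proof (induction p arbitrary: k j s)
  case (All p)
  have "tclosed (Suc j) (up s i)" if "i < Suc k" for i
    using that All.prems(2) unfolding up_def tlift_def by (cases i) (auto intro!: tclosed_tsubst[of j])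
  then show ?case using All.IH[of "Suc k" "Suc j" "up s"] All.prems(1) by simp
qed (simp_all, (meson tclosed_tsubst)+)

lemma fclosed_Alls: "fclosed (k + m) p \<Longrightarrow> fclosed k (Alls m p)"
proof (induction m arbitrary: k)
  case (Suc m)
  then show ?case using Suc.IH[of "Suc k"] by (simp add: Alls_def)
qed (simp add: Alls_def)

lemma PA_sentence: "q \<in> PA \<Longrightarrow> sentence q"
proof -
  have "sentence (Alls m (ind p))" if p: "fclosed (Suc m) p" for m p
  proof -
    have "fclosed m (inst0 Zero p)" unfolding inst0_def by (rule fclosed_fsubst_le[OF p]) auto
    moreover have "fclosed (Suc m) (fsubst (\<lambda>i. if i = 0 then Sc (Var 0) else Var i) p)"
      by (rule fclosed_fsubst_le[OF p]) auto
    ultimately have "fclosed m (ind p)" using p unfolding ind_def by simp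
    then show ?thesis unfolding sentence_def by (intro fclosed_Alls) simp
  qed
  then show "q \<in> PA \<Longrightarrow> sentence q"
    unfolding PA_def Q_axioms_def by (auto simp: sentence_def Neg_def Iff_def And_def Ex_def)
qed

lemma sat_ind: "sat UNIV e (ind p) \<longleftrightarrow> (sat UNIV (0 ## e) p \<longrightarrow>
  (\<forall>x. sat UNIV (x ## e) p \<longrightarrow> sat UNIV ((x + 1) ## e) p) \<longrightarrow> (\<forall>x. sat UNIV (x ## e) p))"
proof -
  have "(\<lambda>i. tval (x ## e) (if i = 0 then Sc (Var 0) else Var i)) = (x + 1) ## e" for x
    by (rule ext) (simp add: scons_def split: nat.splits)
  then show ?thesis unfolding ind_def by (simp add: sat_fsubst)
qed

instance nat :: arith ..

text \<open>The term model has to exist as a type even if no counterexample to the theorem exists.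
  The theory is then plain arithmetic, whose consistency comes from the natural numbers.\<close>

lemma consistent_PA: "consistent PA"
  unfolding consistent_def
proof
  assume "prv PA Fls"
  then have "sat UNIV (\<lambda>_. 0 :: nat) Fls"
  proof (rule soundness)
    fix q and e :: "nat \<Rightarrow> nat" assume "q \<in> PA"
    then consider "q \<in> Q_axioms" | m p where "q = Alls m (ind p)" unfolding PA_def by blast
    then show "sat UNIV e q"
    proof cases
      case 1
      then show ?thesis unfolding Q_axioms_def by (auto simp: numeral_2_eq_2 less_iff_Suc_add)
    next
      case 2
      have "sat UNIV e' (ind p)" for e' :: "nat \<Rightarrow> nat"
      proof -
        have "sat UNIV (x ## e') p" if "sat UNIV (0 ## e') p" "\<forall>x. sat UNIV (x ## e') p \<longrightarrow> sat UNIV ((x + 1) ## e') p" for x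
          using that by (induction x) auto
        then show ?thesis unfolding sat_ind by blast
      qed
      then show ?thesis unfolding 2 sat_Alls by blast
    qed
  qed simp_all
  then show False by simp
qed

section \<open>Numerals and a Henkin set with a nonstandard element\<close>

primrec num :: "nat \<Rightarrow> tm" where
  "num 0 = Zero"
| "num (Suc k) = Sc (num k)"

context
  fixes T H
  assumes H: "henkin T H" and T: "PA \<subseteq> T"
begin

lemma hk_PA: "q \<in> Q_axioms \<Longrightarrow> q \<in> H"
  by (rule hk_prv[OF H prv.hyp]) (use T in \<open>auto simp: PA_def\<close>)

lemma hk_inst2: "All (All p) \<in> H \<Longrightarrow> fsubst (u ## t ## Var) p \<in> H"
proof -
  assume "All (All p) \<in> H"
  then have "inst0 u (fsubst (up (t ## Var)) p) \<in> H" unfolding hk_All[OF H] by (simp add: inst0_scons hk_All[OF H])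
  moreover have "(\<lambda>i. tsubst (u ## Var) (up (t ## Var) i)) = u ## t ## Var"
    by (rule ext) (auto simp: up_def scons_def tlift_def tsubst_tsubst tsubst_Var split: nat.splits)
  ultimately show ?thesis by (simp add: inst0_scons fsubst_fsubst)
qed

lemma hk_add0: "Eq (Pl t Zero) t \<in> H"
proof -
  have "All (Eq (Pl (Var 0) Zero) (Var 0)) \<in> H" by (rule hk_PA) (simp add: Q_axioms_def)
  then show ?thesis unfolding hk_All[OF H] by (simp add: inst0_scons)
qed

lemma hk_addS: "Eq (Pl t (Sc u)) (Sc (Pl t u)) \<in> H"
proof -
  have "All (All (Eq (Pl (Var 1) (Sc (Var 0))) (Sc (Pl (Var 1) (Var 0))))) \<in> H" by (rule hk_PA) (simp add: Q_axioms_def)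
  from hk_inst2[OF this, of u t] show ?thesis by simp
qed

lemma hk_LtI: "Eq (Pl t (Sc v)) u \<in> H \<Longrightarrow> Lt t u \<in> H"
proof -
  assume a: "Eq (Pl t (Sc v)) u \<in> H"
  have "All (All (Iff (Lt (Var 1) (Var 0)) (Ex (Eq (Pl (Var 2) (Sc (Var 0))) (Var 1))))) \<in> H"
    by (rule hk_PA) (simp add: Q_axioms_def)
  from hk_inst2[OF this, of u t]
  have "Iff (Lt t u) (Ex (Eq (Pl (tlift t) (Sc (Var 0))) (tlift u))) \<in> H"
    by (simp add: Iff_def And_def Neg_def Ex_def up_def numeral_2_eq_2)
  moreover have "Ex (Eq (Pl (tlift t) (Sc (Var 0))) (tlift u)) \<in> H"
    unfolding hk_Ex[OF H] by (rule exI[of _ v]) (simp add: inst0_scons tsubst_lift_inst[OF H] tsubst_Var a)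
  ultimately show ?thesis unfolding hk_Iff[OF H] by blast
qed

lemma hk_num_less: "k < m \<Longrightarrow> Lt (num k) (num m) \<in> H"
proof -
  have "Eq (Pl (num k) (num j)) (num (k + j)) \<in> H" for j
  proof (induction j)
    case (Suc j)
    have "Eq (Sc (Pl (num k) (num j))) (Sc (num (k + j))) \<in> H" by (rule hk_Sc[OF H Suc.IH])
    then show ?case using hk_trans[OF H hk_addS] by simp
  qed (simp add: hk_add0)
  moreover assume "k < m"
  then obtain j where "m = k + Suc j" using less_imp_Suc_add by auto
  ultimately have "Eq (Pl (num k) (Sc (num j))) (num m) \<in> H" by (metis num.simps(2))
  then show ?thesis by (rule hk_LtI)
qed

end

lemma der_finite: "der T A p \<Longrightarrow> \<exists>F. finite F \<and> F \<subseteq> A \<and> der T F p"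
proof (induction rule: der.induct)
  case (mp p q)
  then obtain F F' where F: "finite F" "F \<subseteq> A" "der T F (Imp p q)" "finite F'" "F' \<subseteq> A" "der T F' p" by blast
  have "der T (F \<union> F') q" by (rule der.mp[OF der_mono[OF F(3)] der_mono[OF F(6)]]) auto
  then show ?case using F by (intro exI[of _ "F \<union> F'"]) auto
qed (auto intro: der.prv der.hyp exI[of _ "{}"] exI[of _ "{_}"])

text \<open>\<open>Var 0\<close> acts as a constant above all numerals. A contradiction would use
  finitely many of these hypotheses, and substituting a large enough numeral for all variables turns
  them into members of any Henkin set over the theory.\<close>

lemma nonstandard_henkin:
  assumes T: "PA \<subseteq> T" and sent: "\<And>q. q \<in> T \<Longrightarrow> sentence q" and con: "consistent T"
  obtains H where "henkin T H" "\<And>k. Lt (num k) (Var 0) \<in> H"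
proof -
  have "con T {}" using con der_empty unfolding con_def consistent_def by blast
  \<comment> \<open>An auxiliary Henkin set in which the substituted hypotheses are true; it need
    not contain anything about \<open>Var 0\<close>.\<close>
  then obtain H1 where H1: "henkin T H1" by (rule henkin_exists[OF _ sent]) auto
  have tv: "tvars (num k) = {}" for k by (induction k) auto
  let ?G = "range (\<lambda>k. Lt (num k) (Var 0))"
  have cg: "con T ?G" unfolding con_def
  proof
    assume "der T ?G Fls"
    from der_finite[OF this] obtain F where F: "finite F" "F \<subseteq> ?G" "der T F Fls" by (elim exE conjE)
    from finite_subset_image[OF F(1,2)] obtain I where I: "finite I" "F = (\<lambda>k. Lt (num k) (Var 0)) ` I"
      by (elim exE conjE)
    from finite_nat_set_iff_bounded[THEN iffD1, OF I(1)] obtain N where N: "\<forall>k\<in>I. k < N" ..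
    let ?s = "\<lambda>_. num N"
    have "fsubst ?s (Lt (num k) (Var 0)) = Lt (num k) (num N)" for k
    proof -
      have "tsubst ?s (num k) = num k" for k by (induction k) auto
      then show ?thesis by simp
    qed
    then have "fsubst ?s ` F \<subseteq> H1" using hk_num_less[OF H1 T] N unfolding I(2) by auto
    moreover have "der T (fsubst ?s ` F) (fsubst ?s Fls)" by (rule der_fsubst[OF F(3) sent])
    ultimately have "der T H1 (fsubst ?s Fls)" by (rule der_mono[rotated])
    then show False using H1 unfolding henkin_def con_def by simp
  qed
  have "\<Union>(fvars ` ?G) \<subseteq> {0}" using tv by auto
  then have fin: "finite (\<Union>(fvars ` ?G))" by (rule finite_subset) simp
  obtain H where H: "henkin T H" "?G \<subseteq> H" by (rule henkin_exists[OF cg]) (use sent fin in \<open>blast | assumption\<close>)+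
  show ?thesis by (rule that[OF H(1)]) (use H(2) in auto)
qed

definition bad :: "fm set \<Rightarrow> bool" where
  "bad S \<longleftrightarrow> (\<exists>n f. (\<forall>s\<in>S. sentence s \<and> sigma (n + 3) s) \<and> consistent (PA \<union> S) \<and> sigma (n + 1) f \<and> fclosed 2 f \<and>
     prv S (total_fn f) \<and> (\<forall>p m. sigma (n + 1) p \<and> fclosed (m + 2) p \<longrightarrow> prv (S \<union> PHP_fin_all) (php_H f p m)))"

text \<open>The carrier of a model is a type, so the theory whose term model is formed has to be a closed
  term: it is a counterexample to the theorem if there is one, and empty otherwise.\<close>

definition TT :: "fm set" where "TT = (if \<exists>S. bad S then SOME S. bad S else {})"

lemma TT: "\<exists>S. bad S \<Longrightarrow> bad TT" "q \<in> PA \<union> TT \<Longrightarrow> sentence q" "consistent (PA \<union> TT)"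
proof -
  show b: "bad TT" if "\<exists>S. bad S" using someI_ex[OF that] that by (simp add: TT_def)
  have "(\<forall>q\<in>TT. sentence q) \<and> consistent (PA \<union> TT)"
  proof (cases "\<exists>S. bad S")
    case True
    show ?thesis using b[OF True] unfolding bad_def by blast
  next
    case False
    then show ?thesis unfolding TT_def if_not_P[OF False] using consistent_PA by simp
  qed
  then show "q \<in> PA \<union> TT \<Longrightarrow> sentence q" "consistent (PA \<union> TT)" using PA_sentence by blast+
qed

definition HH :: "fm set" where
  "HH = (SOME H. henkin (PA \<union> TT) H \<and> (\<forall>k. Lt (num k) (Var 0) \<in> H))"

lemma HH: "henkin (PA \<union> TT) HH" "Lt (num k) (Var 0) \<in> HH"
proof -
  have "\<exists>H. henkin (PA \<union> TT) H \<and> (\<forall>k. Lt (num k) (Var 0) \<in> H)"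
    using nonstandard_henkin[of "PA \<union> TT"] TT(2,3) by (metis Un_upper1)
  from someI_ex[OF this] show "henkin (PA \<union> TT) HH" "Lt (num k) (Var 0) \<in> HH" unfolding HH_def by blast+
qed

definition eqH :: "tm \<Rightarrow> tm \<Rightarrow> bool" where "eqH t u \<longleftrightarrow> Eq t u \<in> HH"

quotient_type mm = tm / eqH
  unfolding eqH_def
  by (rule equivpI) (auto intro!: reflpI sympI transpI intro: hk_refl[OF HH(1)] hk_sym[OF HH(1)] hk_trans[OF HH(1)])

lemma eqH_cong: "eqH t t' \<Longrightarrow> eqH u u' \<Longrightarrow> eqH (Pl t u) (Pl t' u')" "eqH t t' \<Longrightarrow> eqH u u' \<Longrightarrow> eqH (Tm t u) (Tm t' u')"
  "eqH t t' \<Longrightarrow> eqH u u' \<Longrightarrow> Lt t u \<in> HH \<longleftrightarrow> Lt t' u' \<in> HH"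
  unfolding eqH_def
  by (meson HH(1) hk_trans hk_Pl1 hk_Pl2, meson HH(1) hk_trans hk_Tm1 hk_Tm2, meson HH(1) hk_sym hk_Lt1 hk_Lt2)

instantiation mm :: arith
begin

lift_definition zero_mm :: mm is Zero .
lift_definition one_mm :: mm is "Sc Zero" .
lift_definition plus_mm :: "mm \<Rightarrow> mm \<Rightarrow> mm" is Pl by (rule eqH_cong(1))
lift_definition times_mm :: "mm \<Rightarrow> mm \<Rightarrow> mm" is Tm by (rule eqH_cong(2))
lift_definition less_mm :: "mm \<Rightarrow> mm \<Rightarrow> bool" is "\<lambda>t u. Lt t u \<in> HH" by (rule eqH_cong(3))
definition less_eq_mm :: "mm \<Rightarrow> mm \<Rightarrow> bool" where "x \<le> y \<longleftrightarrow> x < y \<or> (x :: mm) = y"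

instance ..

end

instantiation mm :: minus
begin

definition minus_mm :: "mm \<Rightarrow> mm \<Rightarrow> mm" where
  "(x :: mm) - y = (if \<exists>z. x = y + z then THE z. x = y + z else 0)"

instance ..

end

lemma abs_Sc: "abs_mm (Sc t) = abs_mm t + 1"
proof -
  have "Eq (Pl t (Sc Zero)) (Sc t) \<in> HH"
    by (rule hk_trans[OF HH(1) hk_addS[OF HH(1)] hk_Sc[OF HH(1) hk_add0[OF HH(1)]]]) simp_all
  then have "abs_mm (Pl t (Sc Zero)) = abs_mm (Sc t)" using mm.abs_eq_iff eqH_def by blast
  then show ?thesis by (simp add: one_mm.abs_eq plus_mm.abs_eq)
qed

lemma tval_abs: "tval (\<lambda>i. abs_mm (s i)) t = abs_mm (tsubst s t)"
  by (induction t) (simp_all add: abs_Sc zero_mm.abs_eq plus_mm.abs_eq times_mm.abs_eq)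

lemma inst0_up: "inst0 u (fsubst (up s) p) = fsubst (u ## s) p"
proof -
  have "(\<lambda>i. tsubst (u ## Var) (up s i)) = u ## s"
    by (rule ext) (auto simp: up_def scons_def tlift_def tsubst_tsubst tsubst_Var split: nat.splits)
  then show ?thesis by (simp add: inst0_scons fsubst_fsubst)
qed

text \<open>The quantifier case ranges over classes of terms because the Henkin property provides
  term witnesses; the statement carries a substitution \<open>s\<close> since environments are
  represented by it.\<close>

lemma truth: "sat UNIV (\<lambda>i. abs_mm (s i)) p \<longleftrightarrow> fsubst s p \<in> HH"
proof (induction p arbitrary: s)
  case Fls
  then show ?case using hk_Fls[OF HH(1)] by simp
next
  case (Eq t u)
  then show ?case by (simp add: tval_abs mm.abs_eq_iff eqH_def)
next
  case (Lt t u)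
  then show ?case by (simp add: tval_abs less_mm.abs_eq)
next
  case (Imp p q)
  then show ?case by (simp add: hk_Imp[OF HH(1)])
next
  case (All p)
  have "(abs_mm u ## (\<lambda>i. abs_mm (s i))) = (\<lambda>i. abs_mm ((u ## s) i))" for u
    by (rule ext) (simp add: scons_def split: nat.splits)
  then have "sat UNIV (abs_mm u ## (\<lambda>i. abs_mm (s i))) p \<longleftrightarrow> fsubst (u ## s) p \<in> HH" for u
    using All.IH by simp
  moreover have "(\<forall>x. P x) \<longleftrightarrow> (\<forall>u. P (abs_mm u))" for P by (metis Quotient_abs_rep[OF Quotient_mm])
  ultimately show ?case by (simp add: hk_All[OF HH(1)] inst0_up)
qed

lemma mm_T: "q \<in> PA \<union> TT \<Longrightarrow> sat UNIV (e :: nat \<Rightarrow> mm) q"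
proof -
  assume q: "q \<in> PA \<union> TT"
  have "fsubst Var q \<in> HH" using hk_prv[OF HH(1) prv.hyp[OF q]] fsubst_sentence[OF TT(2)[OF q]] by simp
  then have "sat UNIV (\<lambda>i. abs_mm (Var i)) q" by (simp only: truth)
  then show ?thesis using sat_sentence[OF TT(2)[OF q]] by blast
qed

lemma mm_Q: "q \<in> Q_axioms \<Longrightarrow> sat UNIV (e :: nat \<Rightarrow> mm) q"
  by (rule mm_T) (simp add: PA_def)

instance mm :: pa
proof
  fix x y z :: mm
  let ?e = "\<lambda>_. x"
  show "x + 1 \<noteq> 0" using mm_Q[of "All (Neg (Eq (Sc (Var 0)) Zero))" ?e] by (simp add: Q_axioms_def)
  show "x + 1 = y + 1 \<Longrightarrow> x = y"
    using mm_Q[of "All (All (Imp (Eq (Sc (Var 1)) (Sc (Var 0))) (Eq (Var 1) (Var 0))))" ?e] by (simp add: Q_axioms_def)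
  show "x + 0 = x" using mm_Q[of "All (Eq (Pl (Var 0) Zero) (Var 0))" ?e] by (simp add: Q_axioms_def)
  show "x + (y + 1) = (x + y) + 1"
    using mm_Q[of "All (All (Eq (Pl (Var 1) (Sc (Var 0))) (Sc (Pl (Var 1) (Var 0)))))" ?e] by (simp add: Q_axioms_def)
  show "x * 0 = 0" using mm_Q[of "All (Eq (Tm (Var 0) Zero) Zero)" ?e] by (simp add: Q_axioms_def)
  show "x * (y + 1) = x * y + x"
    using mm_Q[of "All (All (Eq (Tm (Var 1) (Sc (Var 0))) (Pl (Tm (Var 1) (Var 0)) (Var 1))))" ?e] by (simp add: Q_axioms_def)
  show "x < y \<longleftrightarrow> (\<exists>z. x + (z + 1) = y)"
    using mm_Q[of "All (All (Iff (Lt (Var 1) (Var 0)) (Ex (Eq (Pl (Var 2) (Sc (Var 0))) (Var 1)))))" ?e]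
    by (simp add: Q_axioms_def numeral_2_eq_2)
  show "x \<le> y \<longleftrightarrow> x < y \<or> x = y" by (rule less_eq_mm_def)
  show "x - y = (if \<exists>z. x = y + z then THE z. x = y + z else 0)" by (rule minus_mm_def)
next
  fix e :: "nat \<Rightarrow> mm" and p x
  assume a: "sat UNIV (0 ## e) p" "\<And>x. sat UNIV (x ## e) p \<Longrightarrow> sat UNIV ((x + 1) ## e) p"
  \<comment> \<open>The axiom is a closed formula with N outer quantifiers; instantiating them with
    the first N entries of \<open>e\<close> recovers induction for the given environment.\<close>
  obtain N where N: "\<forall>i\<in>fvars p. i < N" using fvars_bounded by blast
  have "fclosed (Suc N) p" unfolding fclosed_fvars using N by auto
  then have "Alls N (ind p) \<in> PA" unfolding PA_def by blast
  then have "sat UNIV e (Alls N (ind p))" using mm_T by blast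
  then have "sat UNIV (apps (map e [0..<N]) e) (ind p)" unfolding sat_Alls by simp
  then have i: "sat UNIV (0 ## apps (map e [0..<N]) e) p \<Longrightarrow>
    (\<And>x. sat UNIV (x ## apps (map e [0..<N]) e) p \<Longrightarrow> sat UNIV ((x + 1) ## apps (map e [0..<N]) e) p) \<Longrightarrow>
    sat UNIV (x ## apps (map e [0..<N]) e) p" for x unfolding sat_ind by blast
  have "sat UNIV (y ## apps (map e [0..<N]) e) p = sat UNIV (y ## e) p" for y
    by (rule sat_cong) (use N in \<open>auto simp: scons_def apps_def split: nat.splits\<close>)
  then show "sat UNIV (x ## e) p" using i a by simp
qed

lemma nst_mm: "nst (abs_mm (Var 0))"
proof -
  have "(of_nat k :: mm) = abs_mm (num k)" for k
  proof (induction k)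
    case (Suc k)
    then show ?case by (simp add: abs_Sc add.commute)
  qed (simp add: zero_mm.abs_eq)
  then show ?thesis unfolding nst_def using HH(2) by (simp add: less_mm.abs_eq)
qed

lemma not_bad: "\<not> bad TT"
proof
  assume "bad TT"
  then obtain n f where TT: "\<forall>s\<in>TT. sentence s \<and> sigma (n + 3) s" and f: "sigma (n + 1) f" "fclosed 2 f" "prv TT (total_fn f)"
    and php: "\<And>p m. sigma (n + 1) p \<Longrightarrow> fclosed (m + 2) p \<Longrightarrow> prv (TT \<union> PHP_fin_all) (php_H f p m)"
    unfolding bad_def by blast
  obtain q where q: "pi n q" "fclosed 4 q" "\<And>e::nat \<Rightarrow> mm. sat UNIV e q \<longleftrightarrow> PM n (e 0) (e 1) (e 2) (e 3)"
    using php_formula[where 'a = mm] by blast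
  have "sigma (n + 1) (Ex q)" using q(1) by (auto intro: sigma_pi.intros)
  moreover have "fclosed (1 + 2) (Ex q)" using q(2) by (simp add: Ex_def Neg_def numeral_eq_Suc)
  ultimately obtain F where F: "finite F" "F \<subseteq> TT \<union> PHP_fin_all" "prv F (php_H f (Ex q) 1)"
    \<comment> \<open>Compactness: the derivation uses finitely many axioms, so only finitely many
      members of the theory have to hold in the submodel. The pigeonhole instances hold there all at
      once.\<close>
    using prv_finite[OF php[of "Ex q" 1]] by blast
  obtain F' where F': "finite F'" "F' \<subseteq> TT" "prv F' (total_fn f)" using prv_finite[OF f(3)] by blast
  define S where "S = (F \<inter> TT) \<union> F'"
  have S: "finite S" "S \<subseteq> TT" using F(1) F'(1,2) unfolding S_def by auto
  have "prv S (total_fn f)" by (rule prv_mono[OF F'(3)]) (simp add: S_def)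
  moreover have "sat UNIV e s" if "s \<in> S" for s and e :: "nat \<Rightarrow> mm" using mm_T that S(2) by blast
  moreover have "sentence s" "sigma (n + 3) s" if "s \<in> S" for s using TT S(2) that by blast+
  moreover have "sigma (Suc n) f" using f(1) by simp
  ultimately have "\<exists>K::mm set. closed_dom K \<and> (\<forall>s\<in>S. \<forall>e. sat K e s) \<and>
    (\<forall>p m e. (\<forall>j. e j \<in> K) \<longrightarrow> sat K e (php_fin p m)) \<and> (\<forall>e. (\<forall>j. e j \<in> K) \<longrightarrow> \<not> sat K e (php_H f (Ex q) 1))"
    by (intro main_model[OF q(3,1) nst_mm S(1) _ _ _ _ f(2)])
  then obtain K :: "mm set" where K: "closed_dom K" "\<And>s e. s \<in> S \<Longrightarrow> sat K e s"
    "\<And>p m e. (\<And>j. e j \<in> K) \<Longrightarrow> sat K e (php_fin p m)" "\<And>e. (\<And>j. e j \<in> K) \<Longrightarrow> \<not> sat K e (php_H f (Ex q) 1)"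
    by blast
  have z: "0 \<in> K" using K(1) by (simp add: closed_dom_def)
  have "sat K (\<lambda>_. 0) (php_H f (Ex q) 1)"
  proof (rule soundness[OF F(3) K(1)])
    fix s and e :: "nat \<Rightarrow> mm" assume s: "s \<in> F" and e: "\<And>i. e i \<in> K"
    show "sat K e s"
    proof (cases "s \<in> TT")
      case True
      then show ?thesis using K(2) s unfolding S_def by blast
    next
      case False
      then obtain p m where "s = php_fin p m" using s F(2) unfolding PHP_fin_all_def by blast
      then show ?thesis using K(3) e by blast
    qed
  qed (rule z)
  moreover have "\<not> sat K (\<lambda>_. 0) (php_H f (Ex q) 1)" by (rule K(4)) (rule z)
  ultimately show False by blast
qed

theorem theorem6p1:
  fixes n :: nat and S :: "fm set" and f :: fm
  assumes "\<forall>s\<in>S. sentence s \<and> sigma (n + 3) s"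
    and "consistent (PA \<union> S)"
    and "sigma (n + 1) f" and "fclosed 2 f"
    and "prv S (total_fn f)"
  shows "\<not> (\<forall>p m. sigma (n + 1) p \<and> fclosed (m + 2) p \<longrightarrow> prv (S \<union> PHP_fin_all) (php_H f p m))"
proof
  assume "\<forall>p m. sigma (n + 1) p \<and> fclosed (m + 2) p \<longrightarrow> prv (S \<union> PHP_fin_all) (php_H f p m)"
  then have "bad S" unfolding bad_def using assms by blast
  then show False using TT(1) not_bad by blast
qed

end
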